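(* Let $M$ be a Hausdorff manifold and $\pi:E\to M$ a sheaf on $M$. There is a natural (in $E$) isomorphism of sheaves on $M$ $$\Phi_{E}:E\to\mathcal{E}_{sp}(\mathcal{C}^{\infty}_{c}(E))$$ defined for any $y\in E$ by $$\Phi_{E}(y)=(f\circ\pi|_{U})_{\pi(y)},$$ where $U$ is any $\pi$-elementary subset of $E$ with $y\in U$ and $f$ is any function in $\mathcal{C}^{\infty}_{c}(\pi(U))$ which satisfies $f_{\pi(y)}=1$.
   Context: All manifolds and maps are smooth; $\mathbb{F}\in\{\mathbb{R},\mathbb{C}\}$ is fixed; $R=\mathcal{C}^{\infty}_{c}(M)$ is the ring of $\mathbb{F}$-valued smooth functions with compact support; "$f_{x}=1$" means that the germ of $f$ at $x$ is that of the constant $1$. Coalgebras. A left $R$-module $C$ is locally unitary if for all $c_{1},\dots,c_{k}\in C$ there is $r\in R$ with $rc_{i}=c_{i}$ for all $i$. A coalgebra over $R$ is a locally unitary $R$-module $C$ with $R$-linear maps $\Delta:C\to C\otimes_{R}C$ and $\epsilon:C\to R$ with $(\mathrm{id}\otimes\epsilon)\circ\Delta=\mathrm{id}=(\epsilon\otimes\mathrm{id})\circ\Delta$. An element $c$ is weakly grouplike if $\Delta(c)=c\otimes c'$ for some $c'\in C$. Sheaves. A sheaf on $M$ is a local diffeomorphism $\pi:E\to M$ with $E$ a manifold, not necessarily Hausdorff (no second countability required); morphisms are smooth maps over $M$. An open $U\subset E$ is $\pi$-elementary if $\pi|_{U}$ is injective. With $\mathcal{C}^{\infty}_{E}$ the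 sheaf of germs of smooth $\mathbb{F}$-valued functions, $\mathcal{C}^{\infty}_{c}(E)$ is the subspace of the space of all (not necessarily continuous) global sections of $\mathcal{C}^{\infty}_{E}$ spanned by the extensions by zero of functions in $\mathcal{C}^{\infty}_{c}(U)$, $U\subset E$ Hausdorff open; it consists of sums of elements $f\circ\pi|_{U}$ (extended by zero), $U$ $\pi$-elementary, $f\in\mathcal{C}^{\infty}_{c}(\pi(U))$. Module structure: $p(f\circ\pi|_{U})=pf\circ\pi|_{U}$. Coalgebra structure: $\Delta(f\circ\pi|_{U})=(f\circ\pi|_{U})\otimes(\eta\circ\pi|_{U})$ for any $\eta\in\mathcal{C}^{\infty}_{c}(\pi(U))$ with $\eta f=f$, and $\epsilon(f\circ\pi|_{U})=f$. A morphism $\phi:E\to F$ to $\xi:F\to M$ induces the coalgebra homomorphism $\phi_{+}$ with $\phi_{+}(f\circ\pi|_{U})=f\circ\xi|_{\phi(U)}$. Spectral sheaf. For a coalgebra $C$ over $R$ and $x\in M$, put $N_{x}(C)=\{c\in C: fc=0$ for some $f\in\mathcal{C}^{\infty}_{c}(M)$ with $f_{x}=1\}$, $C_{x}=C/N_{x}(C)$, $c_{x}=c+N_{x}(C)$. With the induced maps $\Delta_{x},\epsilon_{x}$ (using $(C\otimes_{R}C)_{x}=C_{x}\otimes_{R_{x}}C_{x}$) $C_{x}$ is a coalgebra over the ring of germs $R_{x}=(\mathcal{C}^{\infty}_{M})_{x}$; $G(C_{x})=\{\zeta:\Delta_{x}(\zeta)=\zeta\otimes\zeta,\ \epsilon_{x}(\zeta)=1\}$.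 $c$ is normalized on $W\subset M$ if $\epsilon(c)_{x}=1$ for all $x\in W$. $\mathcal{E}_{sp}(C)$ is the sheaf on $M$ with stalks $G(C_{x})$ and topology with basis the sets $c_{W}=\{c_{x}:x\in W\}$, $W\subset M$ open, $c$ weakly grouplike and normalized on $W$ (each projecting diffeomorphically to $W$). For a homomorphism $\alpha:C\to D$, $\mathcal{E}_{sp}(\alpha)(c_{x})=\alpha(c)_{x}$. Naturality of $\Phi$ means $\mathcal{E}_{sp}(\phi_{+})\circ\Phi_{E}=\Phi_{F}\circ\phi$ for every morphism of sheaves $\phi:E\to F$ on $M$. *)

theory Defs
  imports
    "HOL-Analysis.Analysis"
    "HOL-Algebra.Free_Abelian_Groups"
    "HOL-Algebra.Module"
    "HOL-Algebra.AbelCoset"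
begin

section \<open>Manifolds\<close>

text \<open>
  The model space is a linear subspace \<open>V\<close> of a Euclidean space, so that every dimension
  \<open>dim V \<ge> 0\<close> occurs (a type of class \<open>euclidean_space\<close> has positive dimension).
  In \<open>Ck_on k V U f\<close> the set \<open>U\<close> is open in \<open>V\<close>; the derivative of \<open>f\<close> within \<open>U\<close> is then
  determined on the directions \<open>v \<in> V\<close>, and only these are used.
\<close>

primrec Ck_on ::
  "nat \<Rightarrow> 'b::euclidean_space set \<Rightarrow> 'b set \<Rightarrow> ('b \<Rightarrow> 'c::real_normed_vector) \<Rightarrow> bool" where
  "Ck_on 0 V U f \<longleftrightarrow> continuous_on U f"
| "Ck_on (Suc k) V U f \<longleftrightarrow>
     (\<exists>f'. (\<forall>x\<in>U. (f has_derivative f' x) (at x within U)) \<and>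
           (\<forall>v\<in>V. Ck_on k V U (\<lambda>x. f' x v)))"

definition smooth_on ::
  "'b::euclidean_space set \<Rightarrow> 'b set \<Rightarrow> ('b \<Rightarrow> 'c::real_normed_vector) \<Rightarrow> bool" where
  "smooth_on V U f \<longleftrightarrow> (\<forall>k. Ck_on k V U f)"

record ('a, 'b) manifold =
  points :: "'a set"
  mtop :: "'a topology"
  model :: "'b set"
  atlas :: "('a set \<times> ('a \<Rightarrow> 'b)) set"

text \<open>Neither the Hausdorff property nor second countability is part of the notion.\<close>

definition is_manifold :: "('a, 'b::euclidean_space) manifold \<Rightarrow> bool" where
  "is_manifold X \<longleftrightarrow>
     topspace (mtop X) = points X \<and>
     subspace (model X) \<and>
     (\<Union>(U, \<phi>)\<in>atlas X. U) = points X \<and>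
     (\<forall>(U, \<phi>)\<in>atlas X.
        openin (mtop X) U \<and> openin (top_of_set (model X)) (\<phi> ` U) \<and>
        homeomorphic_map (subtopology (mtop X) U) (top_of_set (\<phi> ` U)) \<phi>) \<and>
     (\<forall>(U, \<phi>)\<in>atlas X. \<forall>(W, \<psi>)\<in>atlas X.
        smooth_on (model X) (\<phi> ` (U \<inter> W)) (\<psi> \<circ> inv_into U \<phi>))"

text \<open>Open submanifolds, for \<open>U\<close> open in \<open>X\<close>.\<close>

definition submanifold :: "('a, 'b) manifold \<Rightarrow> 'a set \<Rightarrow> ('a, 'b) manifold" where
  "submanifold X U =
     \<lparr>points = points X \<inter> U, mtop = subtopology (mtop X) U, model = model X,
      atlas = {(W \<inter> U, \<phi>) | W \<phi>. (W, \<phi>) \<in> atlas X}\<rparr>"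

definition smooth_fun ::
  "('a, 'b::euclidean_space) manifold \<Rightarrow> ('a \<Rightarrow> 'k::real_normed_vector) \<Rightarrow> bool" where
  "smooth_fun X f \<longleftrightarrow>
     (\<forall>(U, \<phi>)\<in>atlas X. smooth_on (model X) (\<phi> ` U) (f \<circ> inv_into U \<phi>))"

definition smooth_map ::
  "('a, 'b::euclidean_space) manifold \<Rightarrow> ('c, 'd::euclidean_space) manifold \<Rightarrow> ('a \<Rightarrow> 'c) \<Rightarrow> bool"
  where
  "smooth_map X Y h \<longleftrightarrow>
     continuous_map (mtop X) (mtop Y) h \<and>
     (\<forall>(U, \<phi>)\<in>atlas X. \<forall>(W, \<psi>)\<in>atlas Y.
        smooth_on (model X) (\<phi> ` (U \<inter> h -` W)) (\<psi> \<circ> h \<circ> inv_into U \<phi>))"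

definition diffeo ::
  "('a, 'b::euclidean_space) manifold \<Rightarrow> ('c, 'd::euclidean_space) manifold \<Rightarrow> ('a \<Rightarrow> 'c) \<Rightarrow> bool"
  where
  "diffeo X Y h \<longleftrightarrow>
     smooth_map X Y h \<and>
     (\<exists>g. smooth_map Y X g \<and> (\<forall>x\<in>points X. g (h x) = x) \<and> (\<forall>y\<in>points Y. h (g y) = y))"

definition local_diffeo ::
  "('a, 'b::euclidean_space) manifold \<Rightarrow> ('c, 'd::euclidean_space) manifold \<Rightarrow> ('a \<Rightarrow> 'c) \<Rightarrow> bool"
  where
  "local_diffeo X Y h \<longleftrightarrow>
     (\<forall>x\<in>points X. \<exists>U. x \<in> U \<and> openin (mtop X) U \<and> openin (mtop Y) (h ` U) \<and>
        diffeo (submanifold X U) (submanifold Y (h ` U)) h)"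


section \<open>Sheaves as local diffeomorphisms\<close>

definition sheaf ::
  "('m, 'b::euclidean_space) manifold \<Rightarrow> ('e, 'c::euclidean_space) manifold \<Rightarrow> ('e \<Rightarrow> 'm) \<Rightarrow> bool"
  where
  "sheaf M E \<pi> \<longleftrightarrow> is_manifold E \<and> local_diffeo E M \<pi>"

definition sheaf_morphism ::
  "('e, 'c::euclidean_space) manifold \<Rightarrow> ('e \<Rightarrow> 'm) \<Rightarrow>
   ('f, 'd::euclidean_space) manifold \<Rightarrow> ('f \<Rightarrow> 'm) \<Rightarrow> ('e \<Rightarrow> 'f) \<Rightarrow> bool" where
  "sheaf_morphism E \<pi> F \<xi> \<phi> \<longleftrightarrow> smooth_map E F \<phi> \<and> (\<forall>y\<in>points E. \<xi> (\<phi> y) = \<pi> y)"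

definition sheaf_isomorphism ::
  "('e, 'c::euclidean_space) manifold \<Rightarrow> ('e \<Rightarrow> 'm) \<Rightarrow>
   ('f, 'd::euclidean_space) manifold \<Rightarrow> ('f \<Rightarrow> 'm) \<Rightarrow> ('e \<Rightarrow> 'f) \<Rightarrow> bool" where
  "sheaf_isomorphism E \<pi> F \<xi> \<phi> \<longleftrightarrow>
     sheaf_morphism E \<pi> F \<xi> \<phi> \<and>
     (\<exists>\<psi>. sheaf_morphism F \<xi> E \<pi> \<psi> \<and>
          (\<forall>y\<in>points E. \<psi> (\<phi> y) = y) \<and> (\<forall>z\<in>points F. \<phi> (\<psi> z) = z))"

definition elementary :: "('e, 'c) manifold \<Rightarrow> ('e \<Rightarrow> 'm) \<Rightarrow> 'e set \<Rightarrow> bool" where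
  "elementary E \<pi> U \<longleftrightarrow> openin (mtop E) U \<and> inj_on \<pi> U"


section \<open>Compactly supported functions and germs\<close>

text \<open>
  The scalar field is a type \<open>'k\<close> of class \<open>real_normed_field\<close>: by the Gelfand--Mazur theorem
  these are exactly the real and the complex numbers. Functions in \<open>Cc X\<close> are extended by \<open>0\<close>
  outside \<open>X\<close>; hence, for \<open>U\<close> open in a Hausdorff manifold \<open>M\<close>, \<open>Cc (submanifold M U)\<close> is
  literally a subset of \<open>Cc M\<close>.
\<close>

definition Cc :: "('a, 'b::euclidean_space) manifold \<Rightarrow> ('a \<Rightarrow> 'k::real_normed_field) set" where
  "Cc X = {f. smooth_fun X f \<and> (\<forall>x. x \<notin> points X \<longrightarrow> f x = 0) \<and>
              compactin (mtop X) (mtop X closure_of {x \<in> points X. f x \<noteq> 0})}"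

text \<open>The structure \<open>Cc_ring M\<close> is a ring without unit in general; its field \<open>one\<close> is junk.\<close>

definition Cc_ring ::
  "('a, 'b::euclidean_space) manifold \<Rightarrow> ('a \<Rightarrow> 'k::real_normed_field) ring" where
  "Cc_ring M = \<lparr>carrier = Cc M, monoid.mult = (\<lambda>f g x. f x * g x), one = undefined,
                zero = (\<lambda>_. 0), add = (\<lambda>f g x. f x + g x)\<rparr>"

text \<open>
  A germ at \<open>x\<close> is the set of all functions that agree near \<open>x\<close> with a given one. Note that
  \<open>germ X x f = {}\<close> for \<open>x\<close> outside \<open>X\<close>. Sums and products of representatives again form full
  germs, since representatives are arbitrary away from \<open>x\<close>.
\<close>

definition germ :: "('a, 'b) manifold \<Rightarrow> 'a \<Rightarrow> ('a \<Rightarrow> 'k) \<Rightarrow> ('a \<Rightarrow> 'k) set" where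
  "germ X x f = {g. \<exists>W. openin (mtop X) W \<and> x \<in> W \<and> (\<forall>z\<in>W. g z = f z)}"

definition germ_add :: "('a \<Rightarrow> 'k::real_normed_field) set \<Rightarrow> ('a \<Rightarrow> 'k) set \<Rightarrow> ('a \<Rightarrow> 'k) set" where
  "germ_add a b = {\<lambda>z. f z + g z | f g. f \<in> a \<and> g \<in> b}"

definition germ_mult :: "('a \<Rightarrow> 'k::real_normed_field) set \<Rightarrow> ('a \<Rightarrow> 'k) set \<Rightarrow> ('a \<Rightarrow> 'k) set" where
  "germ_mult a b = {\<lambda>z. f z * g z | f g. f \<in> a \<and> g \<in> b}"

definition germ_ring ::
  "('a, 'b::euclidean_space) manifold \<Rightarrow> 'a \<Rightarrow> ('a \<Rightarrow> 'k::real_normed_field) set ring" where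
  "germ_ring M x =
     \<lparr>carrier = {germ M x f | f W. openin (mtop M) W \<and> x \<in> W \<and> smooth_fun (submanifold M W) f},
      monoid.mult = germ_mult, one = germ M x (\<lambda>_. 1),
      zero = germ M x (\<lambda>_. 0), add = germ_add\<rparr>"


section \<open>Modules, tensor products and coalgebras\<close>

text \<open>
  The records of HOL-Algebra are used for modules over rings that need not have a unit. The
  fields \<open>mult\<close> and \<open>one\<close> of a module record are junk.
\<close>

definition nonunital_module :: "('r, 'x) ring_scheme \<Rightarrow> ('r, 'c, 'y) module_scheme \<Rightarrow> bool" where
  "nonunital_module R C \<longleftrightarrow>
     abelian_group C \<and>
     (\<forall>r\<in>carrier R. \<forall>c\<in>carrier C. r \<odot>\<^bsub>C\<^esub> c \<in> carrier C) \<and>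
     (\<forall>r\<in>carrier R. \<forall>c\<in>carrier C. \<forall>d\<in>carrier C.
        r \<odot>\<^bsub>C\<^esub> (c \<oplus>\<^bsub>C\<^esub> d) = (r \<odot>\<^bsub>C\<^esub> c) \<oplus>\<^bsub>C\<^esub> (r \<odot>\<^bsub>C\<^esub> d)) \<and>
     (\<forall>r\<in>carrier R. \<forall>s\<in>carrier R. \<forall>c\<in>carrier C.
        (r \<oplus>\<^bsub>R\<^esub> s) \<odot>\<^bsub>C\<^esub> c = (r \<odot>\<^bsub>C\<^esub> c) \<oplus>\<^bsub>C\<^esub> (s \<odot>\<^bsub>C\<^esub> c) \<and>
        (r \<otimes>\<^bsub>R\<^esub> s) \<odot>\<^bsub>C\<^esub> c = r \<odot>\<^bsub>C\<^esub> (s \<odot>\<^bsub>C\<^esub> c))"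

definition locally_unitary :: "('r, 'x) ring_scheme \<Rightarrow> ('r, 'c, 'y) module_scheme \<Rightarrow> bool" where
  "locally_unitary R C \<longleftrightarrow>
     (\<forall>S. finite S \<and> S \<subseteq> carrier C \<longrightarrow> (\<exists>r\<in>carrier R. \<forall>c\<in>S. r \<odot>\<^bsub>C\<^esub> c = c))"

definition linear_map ::
  "('r, 'x) ring_scheme \<Rightarrow> ('r, 'c, 'y) module_scheme \<Rightarrow> ('r, 'd, 'z) module_scheme \<Rightarrow> ('c \<Rightarrow> 'd) \<Rightarrow> bool"
  where
  "linear_map R C D \<alpha> \<longleftrightarrow>
     \<alpha> \<in> carrier C \<rightarrow> carrier D \<and>
     (\<forall>c\<in>carrier C. \<forall>d\<in>carrier C. \<alpha> (c \<oplus>\<^bsub>C\<^esub> d) = \<alpha> c \<oplus>\<^bsub>D\<^esub> \<alpha> d) \<and>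
     (\<forall>r\<in>carrier R. \<forall>c\<in>carrier C. \<alpha> (r \<odot>\<^bsub>C\<^esub> c) = r \<odot>\<^bsub>D\<^esub> \<alpha> c)"

definition regular_module :: "('r, 'x) ring_scheme \<Rightarrow> ('r, 'r) module" where
  "regular_module R =
     \<lparr>carrier = carrier R, monoid.mult = undefined, one = undefined,
      zero = \<zero>\<^bsub>R\<^esub>, add = add R, smult = monoid.mult R\<rparr>"

text \<open>
  The tensor product is the quotient of the free abelian group on \<open>carrier C \<times> carrier D\<close> by the
  subgroup generated by the usual relations; its elements are cosets. The functions
  \<open>tensor_map\<close> and \<open>tensor_lift\<close> are the maps out of the tensor product induced by
  \<open>(c, d) \<mapsto> \<alpha> c \<otimes> \<beta> d\<close> and by a balanced biadditive map \<open>b\<close> with values in an abelian group \<open>A\<close>.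
\<close>

definition tensor_gens ::
  "('r, 'c, 'y) module_scheme \<Rightarrow> ('r, 'd, 'z) module_scheme \<Rightarrow> ('c \<times> 'd \<Rightarrow>\<^sub>0 int) monoid" where
  "tensor_gens C D = free_Abelian_group (carrier C \<times> carrier D)"

definition tensor_null ::
  "('r, 'x) ring_scheme \<Rightarrow> ('r, 'c, 'y) module_scheme \<Rightarrow> ('r, 'd, 'z) module_scheme \<Rightarrow>
   ('c \<times> 'd \<Rightarrow>\<^sub>0 int) set" where
  "tensor_null R C D = generate (tensor_gens C D)
     ({frag_of (c \<oplus>\<^bsub>C\<^esub> c', d) - frag_of (c, d) - frag_of (c', d) | c c' d.
         c \<in> carrier C \<and> c' \<in> carrier C \<and> d \<in> carrier D} \<union>
      {frag_of (c, d \<oplus>\<^bsub>D\<^esub> d') - frag_of (c, d) - frag_of (c, d') | c d d'.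
         c \<in> carrier C \<and> d \<in> carrier D \<and> d' \<in> carrier D} \<union>
      {frag_of (r \<odot>\<^bsub>C\<^esub> c, d) - frag_of (c, r \<odot>\<^bsub>D\<^esub> d) | r c d.
         r \<in> carrier R \<and> c \<in> carrier C \<and> d \<in> carrier D})"

definition tensor_class ::
  "('r, 'x) ring_scheme \<Rightarrow> ('r, 'c, 'y) module_scheme \<Rightarrow> ('r, 'd, 'z) module_scheme \<Rightarrow>
   ('c \<times> 'd \<Rightarrow>\<^sub>0 int) \<Rightarrow> ('c \<times> 'd \<Rightarrow>\<^sub>0 int) set" where
  "tensor_class R C D t = tensor_null R C D #>\<^bsub>tensor_gens C D\<^esub> t"

definition pure_tensor ::
  "('r, 'x) ring_scheme \<Rightarrow> ('r, 'c, 'y) module_scheme \<Rightarrow> ('r, 'd, 'z) module_scheme \<Rightarrow>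
   'c \<Rightarrow> 'd \<Rightarrow> ('c \<times> 'd \<Rightarrow>\<^sub>0 int) set" where
  "pure_tensor R C D c d = tensor_class R C D (frag_of (c, d))"

definition tensor_map ::
  "('s, 'x) ring_scheme \<Rightarrow> ('s, 'c2, 'y) module_scheme \<Rightarrow> ('s, 'd2, 'z) module_scheme \<Rightarrow>
   ('c \<Rightarrow> 'c2) \<Rightarrow> ('d \<Rightarrow> 'd2) \<Rightarrow> ('c \<times> 'd \<Rightarrow>\<^sub>0 int) set \<Rightarrow> ('c2 \<times> 'd2 \<Rightarrow>\<^sub>0 int) set" where
  "tensor_map S C' D' \<alpha> \<beta> T =
     the_elem ((\<lambda>t. tensor_class S C' D' (frag_extend (\<lambda>(c, d). frag_of (\<alpha> c, \<beta> d)) t)) ` T)"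

definition tensor_lift ::
  "('r, 'a, 'z) module_scheme \<Rightarrow> ('c \<Rightarrow> 'd \<Rightarrow> 'a) \<Rightarrow> ('c \<times> 'd \<Rightarrow>\<^sub>0 int) set \<Rightarrow> 'a" where
  "tensor_lift A b T =
     the_elem ((\<lambda>t. \<Oplus>\<^bsub>A\<^esub>p\<in>Poly_Mapping.keys t.
                  [Poly_Mapping.lookup t p] \<cdot>\<^bsub>A\<^esub> b (fst p) (snd p)) ` T)"

definition tensor ::
  "('r, 'x) ring_scheme \<Rightarrow> ('r, 'c, 'y) module_scheme \<Rightarrow> ('r, 'd, 'z) module_scheme \<Rightarrow>
   ('r, ('c \<times> 'd \<Rightarrow>\<^sub>0 int) set) module" where
  "tensor R C D =
     \<lparr>carrier = carrier (tensor_gens C D Mod tensor_null R C D),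
      monoid.mult = undefined, one = undefined,
      zero = one (tensor_gens C D Mod tensor_null R C D),
      add = monoid.mult (tensor_gens C D Mod tensor_null R C D),
      smult = (\<lambda>r. tensor_map R C D (smult C r) (\<lambda>d. d))\<rparr>"

record ('r, 'c) coalgebra = "('r, 'c) module" +
  comult :: "'c \<Rightarrow> ('c \<times> 'c \<Rightarrow>\<^sub>0 int) set"
  counit :: "'c \<Rightarrow> 'r"

text \<open>
  The identities \<open>(id \<otimes> \<epsilon>) \<circ> \<Delta> = id = (\<epsilon> \<otimes> id) \<circ> \<Delta>\<close> are stated with the identifications
  \<open>c \<otimes> r \<mapsto> r c\<close> and \<open>r \<otimes> c \<mapsto> r c\<close> of \<open>C \<otimes> R\<close> and \<open>R \<otimes> C\<close> with \<open>C\<close>. Coassociativity is not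
  required.
\<close>

definition is_coalgebra :: "('r, 'x) ring_scheme \<Rightarrow> ('r, 'c, 'y) coalgebra_scheme \<Rightarrow> bool" where
  "is_coalgebra R C \<longleftrightarrow>
     nonunital_module R C \<and> locally_unitary R C \<and>
     linear_map R C (tensor R C C) (comult C) \<and>
     linear_map R C (regular_module R) (counit C) \<and>
     (\<forall>c\<in>carrier C.
        tensor_lift C (\<lambda>c1 c2. counit C c2 \<odot>\<^bsub>C\<^esub> c1) (comult C c) = c \<and>
        tensor_lift C (\<lambda>c1 c2. counit C c1 \<odot>\<^bsub>C\<^esub> c2) (comult C c) = c)"

definition weakly_grouplike ::
  "('r, 'x) ring_scheme \<Rightarrow> ('r, 'c, 'y) coalgebra_scheme \<Rightarrow> 'c \<Rightarrow> bool" where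
  "weakly_grouplike R C c \<longleftrightarrow>
     c \<in> carrier C \<and> (\<exists>c'\<in>carrier C. comult C c = pure_tensor R C C c c')"


section \<open>The coalgebra of compactly supported functions on a sheaf\<close>

text \<open>
  Elements are global sections of the sheaf of germs of smooth functions on \<open>E\<close>. These are not
  determined by their values when \<open>E\<close> is not Hausdorff, so germs cannot be replaced by values.
\<close>

type_synonym ('e, 'k) germ_section = "'e \<Rightarrow> ('e \<Rightarrow> 'k) set"

definition zero_ext ::
  "('e, 'c) manifold \<Rightarrow> 'e set \<Rightarrow> ('e \<Rightarrow> 'k::real_normed_field) \<Rightarrow> ('e, 'k) germ_section" where
  "zero_ext E U f = (\<lambda>y. if y \<in> U then germ E y f else germ E y (\<lambda>_. 0))"

inductive_set Cc_sections ::
  "('e, 'c::euclidean_space) manifold \<Rightarrow> ('e, 'k::real_normed_field) germ_section set"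
  for E where
  zero: "(\<lambda>y. germ E y (\<lambda>_. 0)) \<in> Cc_sections E"
| ext: "zero_ext E U f \<in> Cc_sections E"
    if "openin (mtop E) U" "Hausdorff_space (subtopology (mtop E) U)" "f \<in> Cc (submanifold E U)"
| add: "(\<lambda>y. germ_add (s y) (t y)) \<in> Cc_sections E"
    if "s \<in> Cc_sections E" "t \<in> Cc_sections E"
| scale: "(\<lambda>y. germ_mult (germ E y (\<lambda>_. a)) (s y)) \<in> Cc_sections E"
    if "s \<in> Cc_sections E"

text \<open>The element \<open>f \<circ> \<pi>|U\<close>, for \<open>U\<close> elementary and \<open>f \<in> Cc (submanifold M (\<pi> ` U))\<close>.\<close>

definition pullback_ext ::
  "('e, 'c) manifold \<Rightarrow> ('e \<Rightarrow> 'm) \<Rightarrow> 'e set \<Rightarrow> ('m \<Rightarrow> 'k::real_normed_field) \<Rightarrow> ('e, 'k) germ_section"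
  where
  "pullback_ext E \<pi> U f = zero_ext E U (f \<circ> \<pi>)"

definition Cc_module ::
  "('e, 'c::euclidean_space) manifold \<Rightarrow> ('e \<Rightarrow> 'm) \<Rightarrow>
   ('m \<Rightarrow> 'k::real_normed_field, ('e, 'k) germ_section) module" where
  "Cc_module E \<pi> =
     \<lparr>carrier = Cc_sections E, monoid.mult = undefined, one = undefined,
      zero = (\<lambda>y. germ E y (\<lambda>_. 0)),
      add = (\<lambda>s t y. germ_add (s y) (t y)),
      smult = (\<lambda>p s y. germ_mult (germ E y (p \<circ> \<pi>)) (s y))\<rparr>"

definition Cc_comult ::
  "('m, 'b::euclidean_space) manifold \<Rightarrow> ('e, 'c::euclidean_space) manifold \<Rightarrow> ('e \<Rightarrow> 'm) \<Rightarrow>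
   ('e, 'k::real_normed_field) germ_section \<Rightarrow>
   (('e, 'k) germ_section \<times> ('e, 'k) germ_section \<Rightarrow>\<^sub>0 int) set" where
  "Cc_comult M E \<pi> = (THE \<Delta>.
     \<Delta> \<in> extensional (Cc_sections E) \<and>
     linear_map (Cc_ring M) (Cc_module E \<pi>)
       (tensor (Cc_ring M) (Cc_module E \<pi>) (Cc_module E \<pi>)) \<Delta> \<and>
     (\<forall>U. elementary E \<pi> U \<longrightarrow>
        (\<forall>f\<in>Cc (submanifold M (\<pi> ` U)). \<forall>\<eta>\<in>Cc (submanifold M (\<pi> ` U)).
           (\<forall>x. \<eta> x * f x = f x) \<longrightarrow>
           \<Delta> (pullback_ext E \<pi> U f) =
             pure_tensor (Cc_ring M) (Cc_module E \<pi>) (Cc_module E \<pi>)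
               (pullback_ext E \<pi> U f) (pullback_ext E \<pi> U \<eta>))))"

definition Cc_counit ::
  "('m, 'b::euclidean_space) manifold \<Rightarrow> ('e, 'c::euclidean_space) manifold \<Rightarrow> ('e \<Rightarrow> 'm) \<Rightarrow>
   ('e, 'k::real_normed_field) germ_section \<Rightarrow> 'm \<Rightarrow> 'k" where
  "Cc_counit M E \<pi> = (THE \<epsilon>.
     \<epsilon> \<in> extensional (Cc_sections E) \<and>
     linear_map (Cc_ring M) (Cc_module E \<pi>) (regular_module (Cc_ring M)) \<epsilon> \<and>
     (\<forall>U. elementary E \<pi> U \<longrightarrow>
        (\<forall>f\<in>Cc (submanifold M (\<pi> ` U)). \<epsilon> (pullback_ext E \<pi> U f) = f)))"

definition Cc_coalgebra ::
  "('m, 'b::euclidean_space) manifold \<Rightarrow> ('e, 'c::euclidean_space) manifold \<Rightarrow> ('e \<Rightarrow> 'm) \<Rightarrow>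
   ('m \<Rightarrow> 'k::real_normed_field, ('e, 'k) germ_section) coalgebra" where
  "Cc_coalgebra M E \<pi> =
     module.extend (Cc_module E \<pi>)
       (coalgebra.fields (Cc_comult M E \<pi>) (Cc_counit M E \<pi>))"

definition Cc_push ::
  "('m, 'b::euclidean_space) manifold \<Rightarrow> ('e, 'c::euclidean_space) manifold \<Rightarrow> ('e \<Rightarrow> 'm) \<Rightarrow>
   ('f, 'd::euclidean_space) manifold \<Rightarrow> ('f \<Rightarrow> 'm) \<Rightarrow> ('e \<Rightarrow> 'f) \<Rightarrow>
   ('e, 'k::real_normed_field) germ_section \<Rightarrow> ('f, 'k) germ_section" where
  "Cc_push M E \<pi> F \<xi> \<phi> = (THE \<alpha>.
     \<alpha> \<in> extensional (Cc_sections E) \<and>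
     linear_map (Cc_ring M) (Cc_module E \<pi>) (Cc_module F \<xi>) \<alpha> \<and>
     (\<forall>U. elementary E \<pi> U \<longrightarrow>
        (\<forall>f\<in>Cc (submanifold M (\<pi> ` U)).
           \<alpha> (pullback_ext E \<pi> U f) = pullback_ext F \<xi> (\<phi> ` U) f)))"


section \<open>The spectral sheaf of a coalgebra over \<open>Cc_ring M\<close>\<close>

definition null_at ::
  "('m, 'b::euclidean_space) manifold \<Rightarrow> ('m \<Rightarrow> 'k::real_normed_field, 'c, 'y) module_scheme \<Rightarrow>
   'm \<Rightarrow> 'c set" where
  "null_at M C x =
     {c \<in> carrier C. \<exists>f\<in>Cc M. germ M x f = germ M x (\<lambda>_. 1) \<and> f \<odot>\<^bsub>C\<^esub> c = \<zero>\<^bsub>C\<^esub>}"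

definition stalk_class ::
  "('m, 'b::euclidean_space) manifold \<Rightarrow> ('m \<Rightarrow> 'k::real_normed_field, 'c, 'y) module_scheme \<Rightarrow>
   'm \<Rightarrow> 'c \<Rightarrow> 'c set" where
  "stalk_class M C x c = null_at M C x +>\<^bsub>C\<^esub> c"

text \<open>Every germ at \<open>x\<close> has a representative in \<open>Cc M\<close>; it acts by \<open>f\<^sub>x c\<^sub>x = (f c)\<^sub>x\<close>.\<close>

definition stalk ::
  "('m, 'b::euclidean_space) manifold \<Rightarrow> ('m \<Rightarrow> 'k::real_normed_field, 'c, 'y) module_scheme \<Rightarrow>
   'm \<Rightarrow> (('m \<Rightarrow> 'k) set, 'c set) module" where
  "stalk M C x =
     \<lparr>carrier = carrier (C A_Mod null_at M C x), monoid.mult = undefined, one = undefined,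
      zero = one (C A_Mod null_at M C x), add = monoid.mult (C A_Mod null_at M C x),
      smult = (\<lambda>g \<zeta>. the_elem {stalk_class M C x (f \<odot>\<^bsub>C\<^esub> c) | f c.
                              f \<in> Cc M \<and> germ M x f = g \<and> c \<in> \<zeta>})\<rparr>"

text \<open>
  \<open>\<Delta>\<^sub>x\<close> sends \<open>c\<^sub>x\<close> to the image of \<open>\<Delta> c\<close> under the map
  \<open>C \<otimes>\<^sub>R C \<rightarrow> C\<^sub>x \<otimes> C\<^sub>x, c \<otimes> d \<mapsto> c\<^sub>x \<otimes> d\<^sub>x\<close>, the target being a tensor product over germs.
\<close>

definition stalk_comult ::
  "('m, 'b::euclidean_space) manifold \<Rightarrow> ('m \<Rightarrow> 'k::real_normed_field, 'c, 'y) coalgebra_scheme \<Rightarrow>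
   'm \<Rightarrow> 'c set \<Rightarrow> ('c set \<times> 'c set \<Rightarrow>\<^sub>0 int) set" where
  "stalk_comult M C x \<zeta> =
     the_elem ((\<lambda>c. tensor_map (germ_ring M x) (stalk M C x) (stalk M C x)
                      (stalk_class M C x) (stalk_class M C x) (comult C c)) ` \<zeta>)"

definition stalk_counit ::
  "('m, 'b::euclidean_space) manifold \<Rightarrow> ('m \<Rightarrow> 'k::real_normed_field, 'c, 'y) coalgebra_scheme \<Rightarrow>
   'm \<Rightarrow> 'c set \<Rightarrow> ('m \<Rightarrow> 'k) set" where
  "stalk_counit M C x \<zeta> = the_elem ((\<lambda>c. germ M x (counit C c)) ` \<zeta>)"

definition grouplikes ::
  "('m, 'b::euclidean_space) manifold \<Rightarrow> ('m \<Rightarrow> 'k::real_normed_field, 'c, 'y) coalgebra_scheme \<Rightarrow>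
   'm \<Rightarrow> 'c set set" where
  "grouplikes M C x =
     {\<zeta> \<in> carrier (stalk M C x).
        stalk_comult M C x \<zeta> = pure_tensor (germ_ring M x) (stalk M C x) (stalk M C x) \<zeta> \<zeta> \<and>
        stalk_counit M C x \<zeta> = \<one>\<^bsub>germ_ring M x\<^esub>}"

definition normalized_on ::
  "('m, 'b::euclidean_space) manifold \<Rightarrow> ('m \<Rightarrow> 'k::real_normed_field, 'c, 'y) coalgebra_scheme \<Rightarrow>
   'm set \<Rightarrow> 'c \<Rightarrow> bool" where
  "normalized_on M C W c \<longleftrightarrow> (\<forall>x\<in>W. germ M x (counit C c) = germ M x (\<lambda>_. 1))"

definition basic_section ::
  "('m, 'b::euclidean_space) manifold \<Rightarrow> ('m \<Rightarrow> 'k::real_normed_field, 'c, 'y) coalgebra_scheme \<Rightarrow>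
   'c \<Rightarrow> 'm set \<Rightarrow> ('m \<times> 'c set) set" where
  "basic_section M C c W = (\<lambda>x. (x, stalk_class M C x c)) ` W"

definition basic_pair ::
  "('m, 'b::euclidean_space) manifold \<Rightarrow> ('m \<Rightarrow> 'k::real_normed_field, 'c, 'y) coalgebra_scheme \<Rightarrow>
   'c \<Rightarrow> 'm set \<Rightarrow> bool" where
  "basic_pair M C c W \<longleftrightarrow>
     openin (mtop M) W \<and> weakly_grouplike (Cc_ring M) C c \<and> normalized_on M C W c"

text \<open>
  The projection of the spectral sheaf is \<open>fst\<close>. The charts are those for which \<open>fst\<close> maps each
  basic set \<open>c\<^sub>W\<close> diffeomorphically to \<open>W\<close>.
\<close>

definition spectral_sheaf ::
  "('m, 'b::euclidean_space) manifold \<Rightarrow> ('m \<Rightarrow> 'k::real_normed_field, 'c, 'y) coalgebra_scheme \<Rightarrow>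
   ('m \<times> 'c set, 'b) manifold" where
  "spectral_sheaf M C =
     \<lparr>points = (SIGMA x:points M. grouplikes M C x),
      mtop = topology (arbitrary union_of (\<lambda>S. \<exists>c W. basic_pair M C c W \<and> S = basic_section M C c W)),
      model = model M,
      atlas = {(basic_section M C c W, \<phi> \<circ> fst) | c W U \<phi>.
                 basic_pair M C c W \<and> (U, \<phi>) \<in> atlas M \<and> W \<subseteq> U}\<rparr>"

definition spectral_map ::
  "('m, 'b::euclidean_space) manifold \<Rightarrow> ('m \<Rightarrow> 'k::real_normed_field, 'd, 'z) module_scheme \<Rightarrow>
   ('c \<Rightarrow> 'd) \<Rightarrow> 'm \<times> 'c set \<Rightarrow> 'm \<times> 'd set" where
  "spectral_map M D \<alpha> = (\<lambda>(x, \<zeta>). (x, the_elem ((\<lambda>c. stalk_class M D x (\<alpha> c)) ` \<zeta>)))"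

definition admissible ::
  "('m, 'b::euclidean_space) manifold \<Rightarrow> ('e, 'c::euclidean_space) manifold \<Rightarrow> ('e \<Rightarrow> 'm) \<Rightarrow>
   'e \<Rightarrow> 'e set \<Rightarrow> ('m \<Rightarrow> 'k::real_normed_field) \<Rightarrow> bool" where
  "admissible M E \<pi> y U f \<longleftrightarrow>
     elementary E \<pi> U \<and> y \<in> U \<and> f \<in> Cc (submanifold M (\<pi> ` U)) \<and>
     germ M (\<pi> y) f = germ M (\<pi> y) (\<lambda>_. 1)"

definition Phi ::
  "('m, 'b::euclidean_space) manifold \<Rightarrow> ('e, 'c::euclidean_space) manifold \<Rightarrow> ('e \<Rightarrow> 'm) \<Rightarrow>
   'e \<Rightarrow> 'm \<times> ('e, 'k::real_normed_field) germ_section set" where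
  "Phi M E \<pi> y = (THE p. \<exists>U f. admissible M E \<pi> y U f \<and>
     p = (\<pi> y, stalk_class M (Cc_coalgebra M E \<pi>) (\<pi> y) (pullback_ext E \<pi> U f)))"

end

theory Submission
  imports Defs
begin

text \<open>
  Bump functions reduce every statement to a neighbourhood of a point \<open>x\<close> of \<open>M\<close>. Over a small neighbourhood a
  finite sum \<open>\<Sum>\<^sub>i f\<^sub>i \<circ> \<pi>|U\<^sub>i\<close> splits into independent contributions of the points of the fibre over \<open>x\<close>. This
  gives a universal property of \<open>C\<^sub>c(E)\<close>, from which \<open>\<Delta>\<close>, \<open>\<epsilon>\<close> and \<open>\<phi>\<^sub>+\<close> are obtained, and it shows that \<open>c\<^sub>x = d\<^sub>x\<close>
  exactly when \<open>c\<close> and \<open>d\<close> have the same germs along the fibre. Evaluating \<open>\<Delta>\<^sub>x c\<^sub>x = c\<^sub>x \<otimes> c\<^sub>x\<close> by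
  \<open>c \<otimes> d \<mapsto> c(y) d(y)\<close> makes the germs of a grouplike element idempotent, hence \<open>0\<close> or \<open>1\<close>; by \<open>\<epsilon>(c\<^sub>x) = 1\<close> exactly
  one of them is \<open>1\<close>, so the grouplike elements over \<open>x\<close> are the elements \<open>\<Phi>(y)\<close> with \<open>\<pi>(y) = x\<close>. Finally \<open>\<Phi>\<close> is a
  homeomorphism over \<open>M\<close>, and continuous maps over \<open>M\<close> between sheaves are smooth.
\<close>

section \<open>Calculus of smooth functions on open subsets of a subspace\<close>

text \<open>What shapes the proof is that \<open>E\<close> need not be Hausdorff: an element of
  \<open>Cc_sections E\<close> is not determined by its values, and it has many presentations as a
  sum of pullbacks. Relations between presentations are never solved globally. A relation is
  multiplied by a function supported near one point of \<open>M\<close>, where the elementary sets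
  through a given point of the fibre shrink to a common one and the terms add up to a single
  function. Local unitarity of the target then turns local vanishing into vanishing, because an
  element \<open>a = r a\<close> can be tested on the pieces of \<open>r\<close>. Hence additivity,
  linearity and compatibility with enlarging an elementary set are all that a map out of the module
  has to respect. This is applied with four targets: the module itself, its tensor square, the ring,
  and the sections over a second sheaf. Many objects are given by definite descriptions or by
  \<open>the_elem\<close>, so a good part of the work is to show that they exist and do not depend
  on choices.\<close>

lemma at_within_relative_open:
  assumes "openin (top_of_set V) N" "x \<in> N" "N \<subseteq> U" "U \<subseteq> V"
  shows "at x within N = at x within U"
proof -
  obtain O' where O': "open O'" "N = V \<inter> O'" using assms(1) by (auto simp: openin_open)
  show ?thesis by (rule at_within_nhd[where S = O']) (use assms O' in auto)
qed

text \<open>For \<open>v\<close> in \<open>V\<close> the line through \<open>x\<close> in direction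
  \<open>v\<close> stays in \<open>U\<close> for small times; along it the difference of the two
  derivatives is a derivative of the constant 0 at an interior time. In directions outside
  \<open>V\<close> a derivative within \<open>U\<close> is arbitrary, hence uniqueness is stated
  direction by direction.\<close>

lemma has_derivative_within_unique_direction:
  assumes V: "subspace V" "openin (top_of_set V) U" "x \<in> U" "v \<in> V"
    and D: "(f has_derivative D) (at x within U)" "(f has_derivative D') (at x within U)"
  shows "D v = D' v"
proof -
  obtain O' where O': "open O'" "U = V \<inter> O'" using V(2) by (auto simp: openin_open)
  define T where "T = (\<lambda>t::real. x + t *\<^sub>R v) -` O'"
  have "open T" unfolding T_def using O'(1) by (rule open_vimage) (intro continuous_intros)
  have xV: "x \<in> V" and xO: "x \<in> O'" using V(3) O' by auto
  have sub: "(\<lambda>t. x + t *\<^sub>R v) ` T \<subseteq> U"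
    using xV V(1,4) O'(2) by (auto simp: T_def subspace_add subspace_mul)
  have "((\<lambda>y. f y - f y) has_derivative (\<lambda>w. D w - D' w)) (at x within U)"
    by (intro derivative_intros D)
  then have 1: "((\<lambda>y. 0) has_derivative (\<lambda>w. D w - D' w)) (at (x + 0 *\<^sub>R v) within (\<lambda>t. x + t *\<^sub>R v) ` T)"
    by (auto intro: has_derivative_subset[OF _ sub])
  have "((\<lambda>t::real. x + t *\<^sub>R v) has_derivative (\<lambda>t. t *\<^sub>R v)) (at 0 within T)"
    by (auto intro!: derivative_eq_intros)
  from has_derivative_in_compose[OF this 1]
  have "((\<lambda>t::real. 0) has_derivative (\<lambda>t. D (t *\<^sub>R v) - D' (t *\<^sub>R v))) (at 0 within T)"
    by simp
  then have "((\<lambda>t::real. 0) has_derivative (\<lambda>t. D (t *\<^sub>R v) - D' (t *\<^sub>R v))) (at 0)"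
    using \<open>open T\<close> xO by (subst (asm) at_within_open) (auto simp: T_def)
  from has_derivative_unique[OF this has_derivative_const]
  have "D (1 *\<^sub>R v) - D' (1 *\<^sub>R v) = 0" by metis
  then show ?thesis by simp
qed

lemma Ck_on_cong:
  assumes "\<And>x. x \<in> U \<Longrightarrow> f x = g x"
  shows "Ck_on k V U f \<longleftrightarrow> Ck_on k V U g"
proof (cases k)
  case 0
  then show ?thesis using assms by (auto cong: continuous_on_cong)
next
  case (Suc n)
  have "(f has_derivative D) (at x within U) \<longleftrightarrow> (g has_derivative D) (at x within U)" if "x \<in> U" for x D
    using has_derivative_transform[OF that, of f g D] has_derivative_transform[OF that, of g f D] assms by auto
  then show ?thesis using Suc by simp
qed

lemma Ck_on_subset: "Ck_on k V U f \<Longrightarrow> U' \<subseteq> U \<Longrightarrow> Ck_on k V U' f"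
proof (induction k arbitrary: f)
  case 0
  then show ?case by (auto intro: continuous_on_subset)
next
  case (Suc k)
  then obtain f' where "\<forall>x\<in>U. (f has_derivative f' x) (at x within U)" "\<forall>v\<in>V. Ck_on k V U (\<lambda>x. f' x v)"
    by auto
  with Suc show ?case by (auto intro!: exI[of _ f'] intro: has_derivative_subset)
qed

lemma Ck_on_Suc_continuous: "Ck_on (Suc k) V U f \<Longrightarrow> continuous_on U f"
  by (auto simp: continuous_on_eq_continuous_within intro: has_derivative_continuous)

lemma Ck_on_Suc_imp: "Ck_on (Suc k) V U f \<Longrightarrow> Ck_on k V U f"
proof (induction k arbitrary: f)
  case 0
  then show ?case using Ck_on_Suc_continuous[OF 0] by simp
next
  case (Suc k)
  then obtain f' where "\<forall>x\<in>U. (f has_derivative f' x) (at x within U)"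
      "\<forall>v\<in>V. Ck_on (Suc k) V U (\<lambda>x. f' x v)"
    by (metis Ck_on.simps(2))
  with Suc.IH show ?case unfolding Ck_on.simps(2)[of k] by blast
qed

text \<open>\<open>Ck_on (Suc k)\<close> asks for one derivative on all of \<open>U\<close>, while
  each neighbourhood supplies its own. In the directions of \<open>V\<close> these agree on
  overlaps, so one may use at every \<open>x\<close> the derivative that was chosen for the
  neighbourhood of \<open>x\<close>.\<close>

lemma Ck_on_local:
  assumes V: "subspace V"
    and loc: "\<And>x. x \<in> U \<Longrightarrow> \<exists>N. openin (top_of_set V) N \<and> x \<in> N \<and> N \<subseteq> U \<and> Ck_on k V N f"
  shows "Ck_on k V U f"
  using loc
proof (induction k arbitrary: f)
  case 0
  then have UV: "U \<subseteq> V" by (meson openin_imp_subset subset_iff)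
  show ?case unfolding Ck_on.simps continuous_on_eq_continuous_within
  proof
    fix x assume "x \<in> U"
    then obtain N where N: "openin (top_of_set V) N" "x \<in> N" "N \<subseteq> U" "continuous_on N f"
      using 0 by auto
    then show "continuous (at x within U) f"
      using at_within_relative_open[OF N(1-3) UV]
      by (auto simp: continuous_on_eq_continuous_within continuous_within)
  qed
next
  case (Suc k)
  then have UV: "U \<subseteq> V" by (meson openin_imp_subset subset_iff)
  from Suc.prems obtain N where N: "\<And>x. x \<in> U \<Longrightarrow> openin (top_of_set V) (N x) \<and> x \<in> N x \<and> N x \<subseteq> U \<and> Ck_on (Suc k) V (N x) f"
    by metis
  then have "\<forall>x\<in>U. \<exists>F. (\<forall>z\<in>N x. (f has_derivative F z) (at z within N x)) \<and> (\<forall>v\<in>V. Ck_on k V (N x) (\<lambda>z. F z v))"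
    by simp
  then obtain F where F: "\<And>x z. x \<in> U \<Longrightarrow> z \<in> N x \<Longrightarrow> (f has_derivative F x z) (at z within N x)"
    "\<And>x v. x \<in> U \<Longrightarrow> v \<in> V \<Longrightarrow> Ck_on k V (N x) (\<lambda>z. F x z v)"
    by metis
  have FU: "(f has_derivative F x z) (at z within U)" if "x \<in> U" "z \<in> N x" for x z
    using F(1)[OF that] at_within_relative_open[of V "N x" z U] N[OF that(1)] that UV by metis
  have "U = \<Union> (N ` U)" using N by blast
  then have oU: "openin (top_of_set V) U" using N by (metis (no_types, lifting) imageE openin_Union)
  show ?case unfolding Ck_on.simps
  proof (intro exI[of _ "\<lambda>x. F x x"] conjI ballI)
    fix x assume "x \<in> U" then show "(f has_derivative F x x) (at x within U)" using FU N by blast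
  next
    fix v assume v: "v \<in> V"
    show "Ck_on k V U (\<lambda>x. F x x v)"
    proof (rule Suc.IH)
      fix x assume x: "x \<in> U"
      have "F z z v = F x z v" if "z \<in> N x" for z
      proof -
        have "z \<in> U" using that N x by blast
        then show ?thesis
          by (intro has_derivative_within_unique_direction[OF V oU _ v FU FU]) (use that x N in auto)
      qed
      then have "Ck_on k V (N x) (\<lambda>z. F z z v)" using F(2)[OF x v] Ck_on_cong[of "N x" "\<lambda>z. F z z v" "\<lambda>z. F x z v"] by blast
      then show "\<exists>N. openin (top_of_set V) N \<and> x \<in> N \<and> N \<subseteq> U \<and> Ck_on k V N (\<lambda>z. F z z v)"
        using N[OF x] by blast
    qed
  qed
qed

section \<open>Closure of the classes C^k under algebraic operations and composition\<close>

lemma Ck_on_const: "Ck_on k V U (\<lambda>x. c)"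
proof (induction k arbitrary: c)
  case (Suc k)
  show ?case unfolding Ck_on.simps
    by (intro exI[of _ "\<lambda>_ _. 0"] conjI ballI Suc) auto
qed simp

lemma Ck_on_add: "Ck_on k V U f \<Longrightarrow> Ck_on k V U g \<Longrightarrow> Ck_on k V U (\<lambda>x. f x + g x)"
proof (induction k arbitrary: f g)
  case 0
  then show ?case by (auto intro: continuous_on_add)
next
  case (Suc k)
  then obtain f' g' where
    "\<forall>x\<in>U. (f has_derivative f' x) (at x within U)" "\<forall>v\<in>V. Ck_on k V U (\<lambda>x. f' x v)"
    "\<forall>x\<in>U. (g has_derivative g' x) (at x within U)" "\<forall>v\<in>V. Ck_on k V U (\<lambda>x. g' x v)"
    by auto
  then show ?case unfolding Ck_on.simps
    by (intro exI[of _ "\<lambda>x v. f' x v + g' x v"] conjI ballI Suc.IH) (auto intro!: has_derivative_add)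
qed

lemma Ck_on_bilinear:
  fixes B :: "'c::real_normed_vector \<Rightarrow> 'd::real_normed_vector \<Rightarrow> 'e::real_normed_vector"
  assumes "bounded_bilinear B"
  shows "Ck_on k V U f \<Longrightarrow> Ck_on k V U g \<Longrightarrow> Ck_on k V U (\<lambda>x. B (f x) (g x))"
proof (induction k arbitrary: f g)
  case 0
  then show ?case using bounded_bilinear.continuous_on[OF assms] by auto
next
  case (Suc k)
  then obtain f' g' where
    "\<forall>x\<in>U. (f has_derivative f' x) (at x within U)" "\<forall>v\<in>V. Ck_on k V U (\<lambda>x. f' x v)"
    "\<forall>x\<in>U. (g has_derivative g' x) (at x within U)" "\<forall>v\<in>V. Ck_on k V U (\<lambda>x. g' x v)"
    by auto
  then show ?case unfolding Ck_on.simps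
    by (intro exI[of _ "\<lambda>x v. B (f x) (g' x v) + B (f' x v) (g x)"] conjI ballI Ck_on_add Suc.IH)
      (auto intro!: bounded_bilinear.FDERIV[OF assms] Ck_on_Suc_imp[OF Suc.prems(1)] Ck_on_Suc_imp[OF Suc.prems(2)])
qed

lemma Ck_on_bounded_linear:
  assumes "bounded_linear L"
  shows "Ck_on k V U f \<Longrightarrow> Ck_on k V U (\<lambda>x. L (f x))"
proof (induction k arbitrary: f)
  case 0
  then show ?case using bounded_linear.continuous_on[OF assms] by auto
next
  case (Suc k)
  then obtain f' where
    "\<forall>x\<in>U. (f has_derivative f' x) (at x within U)" "\<forall>v\<in>V. Ck_on k V U (\<lambda>x. f' x v)"
    by auto
  then show ?case unfolding Ck_on.simps
    by (intro exI[of _ "\<lambda>x v. L (f' x v)"] conjI ballI Suc.IH) (auto intro!: bounded_linear.has_derivative[OF assms])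
qed

lemma Ck_on_sum: "finite B \<Longrightarrow> (\<And>b. b \<in> B \<Longrightarrow> Ck_on k V U (f b)) \<Longrightarrow> Ck_on k V U (\<lambda>x. \<Sum>b\<in>B. f b x)"
  by (induction B rule: finite_induct) (auto intro: Ck_on_const Ck_on_add)

lemma Ck_on_ident: "Ck_on k V U (\<lambda>x. x)"
proof (cases k)
  case (Suc n)
  show ?thesis unfolding Suc Ck_on.simps
    by (intro exI[of _ "\<lambda>x v. v"] conjI ballI Ck_on_const) (auto intro!: derivative_eq_intros)
qed auto

lemma Ck_on_inverse:
  fixes f :: "'b::euclidean_space \<Rightarrow> real"
  assumes "\<And>x. x \<in> U \<Longrightarrow> f x \<noteq> 0"
  shows "Ck_on k V U f \<Longrightarrow> Ck_on k V U (\<lambda>x. inverse (f x))"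
proof (induction k)
  case 0
  then show ?case using assms by (auto intro: continuous_on_inverse)
next
  case (Suc k)
  then obtain f' where f':
    "\<forall>x\<in>U. (f has_derivative f' x) (at x within U)" "\<forall>v\<in>V. Ck_on k V U (\<lambda>x. f' x v)"
    by auto
  have i: "Ck_on k V U (\<lambda>x. inverse (f x))" using Suc Ck_on_Suc_imp by blast
  show ?case unfolding Ck_on.simps
  \<comment> \<open>The minus sign is a multiplication by the constant -1, so that the product rule
    together with the inductive hypothesis for \<open>inverse (f x)\<close> covers the whole
    expression.\<close>
  proof (intro exI[of _ "\<lambda>x v. -1 * (inverse (f x) * f' x v * inverse (f x))"] conjI ballI)
    fix x assume "x \<in> U"
    then show "((\<lambda>x. inverse (f x)) has_derivative (\<lambda>v. - 1 * (inverse (f x) * f' x v * inverse (f x)))) (at x within U)"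
      using Deriv.has_derivative_inverse[of f x "f' x" U] f'(1) assms by simp
  next
    fix v assume "v \<in> V"
    with i f'(2) show "Ck_on k V U (\<lambda>x. - 1 * (inverse (f x) * f' x v * inverse (f x)))"
      by (intro Ck_on_bilinear[OF bounded_bilinear_mult] Ck_on_const) auto
  qed
qed

text \<open>Orthogonality is preserved by derivatives, and \<open>V'\<close> is its own double orthogonal complement.\<close>

lemma has_derivative_within_range_subspace:
  fixes h :: "'a::euclidean_space \<Rightarrow> 'b::euclidean_space"
  assumes V: "subspace V" "openin (top_of_set V) U" "x \<in> U" "v \<in> V"
    and V': "subspace V'" "h ` U \<subseteq> V'" and D: "(h has_derivative D) (at x within U)"
  shows "D v \<in> V'"
proof -
  have "orthogonal w (D v)" if w: "w \<in> orthogonal_comp V'" for w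
  proof -
    have "((\<lambda>x. w \<bullet> h x) has_derivative (\<lambda>u. w \<bullet> D u)) (at x within U)"
      by (intro derivative_intros D)
    moreover have "w \<bullet> h z = 0" if "z \<in> U" for z
      using that w V'(2) by (simp add: orthogonal_comp_def orthogonal_def image_subset_iff) (metis inner_commute)
    ultimately have "((\<lambda>x. 0) has_derivative (\<lambda>u. w \<bullet> D u)) (at x within U)"
      using has_derivative_transform[OF V(3), of "\<lambda>_. 0" "\<lambda>x. w \<bullet> h x" "\<lambda>u. w \<bullet> D u"] by simp
    from has_derivative_within_unique_direction[OF V this has_derivative_const]
    show ?thesis by (simp add: orthogonal_def)
  qed
  then have "D v \<in> orthogonal_comp (orthogonal_comp V')"
    by (simp add: orthogonal_comp_def)
  then show ?thesis using V'(1) by (simp add: orthogonal_comp_self)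
qed

text \<open>In the chain rule the direction \<open>h' x v\<close> varies with \<open>x\<close>, but
  the regularity of \<open>g'\<close> is known only for fixed directions. Expanding
  \<open>h' x v\<close> in an orthonormal basis of \<open>V'\<close> separates the two dependences
  and leaves a finite sum of products. The expansion is legitimate because \<open>h\<close> maps
  into \<open>V'\<close> and so does its derivative.\<close>

lemma Ck_on_compose:
  assumes V: "subspace V" "openin (top_of_set V) U" and V': "subspace V'" "U' \<subseteq> V'" and sub: "h ` U \<subseteq> U'"
  shows "Ck_on k V U h \<Longrightarrow> Ck_on k V' U' g \<Longrightarrow> Ck_on k V U (\<lambda>x. g (h x))"
proof (induction k arbitrary: g)
  case 0
  then show ?case using sub by (auto intro: continuous_on_compose2)
next
  case (Suc k)
  then obtain h' g' where h': "\<forall>x\<in>U. (h has_derivative h' x) (at x within U)" "\<forall>v\<in>V. Ck_on k V U (\<lambda>x. h' x v)"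
    and g': "\<forall>x\<in>U'. (g has_derivative g' x) (at x within U')" "\<forall>v\<in>V'. Ck_on k V' U' (\<lambda>x. g' x v)"
    by auto
  obtain B where B: "B \<subseteq> V'" "pairwise orthogonal B" "\<And>b. b \<in> B \<Longrightarrow> norm b = 1" "independent B" "span B = V'"
    using orthonormal_basis_subspace[OF V'(1)] by metis
  then have finB: "finite B" using independent_imp_finite by blast
  have expand: "g' (h x) (h' x v) = (\<Sum>b\<in>B. (h' x v \<bullet> b) *\<^sub>R g' (h x) b)" if "x \<in> U" "v \<in> V" for x v
  proof -
    have "h' x v \<in> V'"
      by (rule has_derivative_within_range_subspace[OF V that V'(1), where h = h and D = "h' x"]) (use h' that V' sub in auto)
    then have "(\<Sum>b\<in>B. (h' x v \<bullet> b) *\<^sub>R b) = h' x v"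
      using orthonormal_basis_expand[OF B(2,3) _ finB] B(5) by blast
    moreover have "linear (g' (h x))" using g'(1) that sub has_derivative_linear by blast
    then have "g' (h x) (\<Sum>b\<in>B. (h' x v \<bullet> b) *\<^sub>R b) = (\<Sum>b\<in>B. (h' x v \<bullet> b) *\<^sub>R g' (h x) b)"
      by (simp add: linear_sum linear_cmul)
    ultimately show ?thesis by simp
  qed
  show ?case unfolding Ck_on.simps
  proof (intro exI[of _ "\<lambda>x v. g' (h x) (h' x v)"] conjI ballI)
    fix x assume "x \<in> U"
    then have "(h has_derivative h' x) (at x within U)" "(g has_derivative g' (h x)) (at (h x) within U')"
      using h'(1) g'(1) sub by auto
    then have "(h has_derivative h' x) (at x within U)" "(g has_derivative g' (h x)) (at (h x) within h ` U)"
      using has_derivative_subset[OF _ sub] by blast+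
    then show "((\<lambda>x. g (h x)) has_derivative (\<lambda>v. g' (h x) (h' x v))) (at x within U)"
      by (rule has_derivative_in_compose)
  next
    fix v assume v: "v \<in> V"
    have "Ck_on k V U (\<lambda>x. \<Sum>b\<in>B. (h' x v \<bullet> b) *\<^sub>R g' (h x) b)"
    proof (intro Ck_on_sum finB Ck_on_bilinear[OF bounded_bilinear_scaleR])
      fix b assume "b \<in> B"
      show "Ck_on k V U (\<lambda>x. h' x v \<bullet> b)"
        using h'(2) v by (intro Ck_on_bounded_linear[OF bounded_linear_inner_left]) auto
      show "Ck_on k V U (\<lambda>x. g' (h x) b)"
        using Suc.IH[OF Ck_on_Suc_imp[OF Suc.prems(1)]] g'(2) \<open>b \<in> B\<close> B(1) by auto
    qed
    then show "Ck_on k V U (\<lambda>x. g' (h x) (h' x v))"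
      using Ck_on_cong[of U "\<lambda>x. g' (h x) (h' x v)" "\<lambda>x. \<Sum>b\<in>B. (h' x v \<bullet> b) *\<^sub>R g' (h x) b"] expand[OF _ v] by blast
  qed
qed

section \<open>Smooth functions on relatively open sets\<close>

lemma smooth_on_cong:
  assumes "\<And>x. x \<in> U \<Longrightarrow> f x = g x"
  shows "smooth_on V U f \<longleftrightarrow> smooth_on V U g"
  by (simp add: smooth_on_def Ck_on_cong[of U f g] assms)

lemma smooth_on_subset: "smooth_on V U f \<Longrightarrow> U' \<subseteq> U \<Longrightarrow> smooth_on V U' f"
  by (auto simp: smooth_on_def intro: Ck_on_subset)

lemma smooth_on_continuous: "smooth_on V U f \<Longrightarrow> continuous_on U f"
  unfolding smooth_on_def using Ck_on.simps(1) by blast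

lemma smooth_on_local:
  assumes V: "subspace V"
    and loc: "\<And>x. x \<in> U \<Longrightarrow> \<exists>N. openin (top_of_set V) N \<and> x \<in> N \<and> N \<subseteq> U \<and> smooth_on V N f"
  shows "smooth_on V U f"
  unfolding smooth_on_def
proof
  fix k show "Ck_on k V U f"
  proof (rule Ck_on_local[OF V])
    fix x assume "x \<in> U"
    then show "\<exists>N. openin (top_of_set V) N \<and> x \<in> N \<and> N \<subseteq> U \<and> Ck_on k V N f"
      using loc[of x] by (auto simp: smooth_on_def)
  qed
qed

lemma smooth_on_const: "smooth_on V U (\<lambda>x. c)"
  and smooth_on_ident: "smooth_on V U (\<lambda>x. x)"
  and smooth_on_add: "smooth_on V U f \<Longrightarrow> smooth_on V U g \<Longrightarrow> smooth_on V U (\<lambda>x. f x + g x)"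
  and smooth_on_bilinear: "bounded_bilinear B \<Longrightarrow> smooth_on V U f' \<Longrightarrow> smooth_on V U g' \<Longrightarrow>
    smooth_on V U (\<lambda>x. B (f' x) (g' x))"
  and smooth_on_bounded_linear: "bounded_linear L \<Longrightarrow> smooth_on V U f'' \<Longrightarrow> smooth_on V U (\<lambda>x. L (f'' x))"
  by (auto simp: smooth_on_def intro: Ck_on_const Ck_on_ident Ck_on_add Ck_on_bilinear Ck_on_bounded_linear)

lemma smooth_on_compose:
  assumes "subspace V" "openin (top_of_set V) U" "subspace V'" "U' \<subseteq> V'" "h ` U \<subseteq> U'"
    and "smooth_on V U h" "smooth_on V' U' g"
  shows "smooth_on V U (\<lambda>x. g (h x))"
  unfolding smooth_on_def
proof
  fix k show "Ck_on k V U (\<lambda>x. g (h x))"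
    by (rule Ck_on_compose[OF assms(1-5)]) (use assms(6,7) in \<open>simp_all add: smooth_on_def\<close>)
qed

subsection \<open>Bump functions\<close>

text \<open>The function p(1/t) exp(-1/t), continued by 0. The polynomial parameter makes the family
  closed under differentiation, so that smoothness follows by one induction over all
  members.\<close>

definition flat_fun :: "real poly \<Rightarrow> real \<Rightarrow> real" where
  "flat_fun p t = (if t \<le> 0 then 0 else poly p (inverse t) * exp (- inverse t))"

lemma poly_times_exp_minus_tendsto_0:
  fixes p :: "real poly"
  shows "((\<lambda>u. poly p u * exp (- u)) \<longlongrightarrow> 0) at_top"
proof -
  have "((\<lambda>u. \<Sum>i\<le>degree p. coeff p i * (u ^ i / exp u)) \<longlongrightarrow> (\<Sum>i\<le>degree p. coeff p i * 0)) at_top"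
    by (intro tendsto_intros tendsto_power_div_exp_0)
  moreover have "(\<Sum>i\<le>degree p. coeff p i * (u ^ i / exp u)) = poly p u * exp (- u)" for u
    by (simp add: poly_altdef sum_distrib_right exp_minus divide_inverse mult.assoc)
  ultimately show ?thesis by simp
qed

lemma flat_fun_tendsto_0: "(flat_fun p \<longlongrightarrow> 0) (at 0)"
proof -
  have "((\<lambda>t. poly p (inverse t) * exp (- inverse t)) \<longlongrightarrow> 0) (at_right 0)"
    using filterlim_compose[OF poly_times_exp_minus_tendsto_0 filterlim_inverse_at_top_right] .
  then have "(flat_fun p \<longlongrightarrow> 0) (at_right 0)"
    by (rule Lim_transform_eventually) (auto simp: eventually_at_right_field flat_fun_def intro!: exI[of _ 1])
  moreover have "(flat_fun p \<longlongrightarrow> 0) (at_left 0)"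
    by (rule Lim_transform_eventually[OF tendsto_const]) (auto simp: eventually_at_left_field flat_fun_def intro!: exI[of _ "-1"])
  ultimately show ?thesis by (simp add: filterlim_at_split)
qed

text \<open>With u = 1/t one has du/dt = -u^2, so the derivative of p(u) exp(-u) is u^2 (p(u) -
  p'(u)) exp(-u); the factor \<open>[:0, 0, 1:]\<close> is u^2. At \<open>t = 0\<close> the
  difference quotient is itself a member of the family, with polynomial u p(u), and tends to
  0.\<close>

lemma flat_fun_deriv:
  "(flat_fun p has_real_derivative flat_fun ([:0, 0, 1:] * (p - pderiv p)) t) (at t)"
proof -
  consider "t < 0" | "t > 0" | "t = 0" by linarith
  then show ?thesis
  proof cases
    case 1
    have "((\<lambda>_. 0) has_real_derivative 0) (at t)" by simp
    then have "(flat_fun p has_real_derivative 0) (at t)"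
      by (rule has_field_derivative_transform_within_open[where S = "{..<0}"]) (use 1 in \<open>auto simp: flat_fun_def\<close>)
    then show ?thesis using 1 by (simp add: flat_fun_def)
  next
    case 2
    have "((\<lambda>t. poly p (inverse t) * exp (- inverse t)) has_real_derivative
        flat_fun ([:0, 0, 1:] * (p - pderiv p)) t) (at t)"
      using 2 by (auto intro!: derivative_eq_intros simp: flat_fun_def algebra_simps power2_eq_square)
    then show ?thesis
      by (rule has_field_derivative_transform_within_open[where S = "{0<..}"]) (use 2 in \<open>auto simp: flat_fun_def\<close>)
  next
    case 3
    have "((\<lambda>h. (flat_fun p (0 + h) - flat_fun p 0) / h) \<longlongrightarrow> 0) (at 0)"
      by (rule Lim_transform_eventually[OF flat_fun_tendsto_0[of "[:0, 1:] * p"]])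
        (auto simp: flat_fun_def field_simps eventually_at_filter)
    then show ?thesis using 3 by (simp add: DERIV_def flat_fun_def)
  qed
qed

lemma Ck_on_flat_fun: "Ck_on k UNIV UNIV (flat_fun p)"
proof (induction k arbitrary: p)
  case 0
  show ?case using flat_fun_deriv by (auto intro: DERIV_continuous_on)
next
  case (Suc k)
  show ?case unfolding Ck_on.simps
  proof (intro exI[of _ "\<lambda>t v. flat_fun ([:0, 0, 1:] * (p - pderiv p)) t * v"] conjI ballI)
    show "(flat_fun p has_derivative (*) (flat_fun ([:0, 0, 1:] * (p - pderiv p)) x)) (at x)" for x
      using flat_fun_deriv by (simp add: has_field_derivative_def)
  qed (intro Ck_on_bilinear[OF bounded_bilinear_mult] Ck_on_const Suc)
qed

text \<open>The usual smooth transition from 0 to 1. The denominator never vanishes, since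
  \<open>t\<close> or \<open>1 - t\<close> is positive.\<close>

definition step_fun :: "real \<Rightarrow> real" where
  "step_fun t = flat_fun 1 t * inverse (flat_fun 1 t + flat_fun 1 (1 - t))"

lemma step_fun_0: "t \<le> 0 \<Longrightarrow> step_fun t = 0"
  and step_fun_1: "t \<ge> 1 \<Longrightarrow> step_fun t = 1"
  by (auto simp: step_fun_def flat_fun_def)

lemma smooth_on_step_fun: "smooth_on UNIV UNIV step_fun"
  unfolding smooth_on_def step_fun_def
proof (intro allI Ck_on_bilinear[OF bounded_bilinear_mult] Ck_on_inverse Ck_on_add Ck_on_flat_fun)
  fix k
  have "Ck_on k UNIV UNIV (\<lambda>t::real. 1 + -1 * t)"
    by (intro Ck_on_add Ck_on_const Ck_on_bilinear[OF bounded_bilinear_mult] Ck_on_ident)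
  then have "Ck_on k UNIV UNIV (\<lambda>t. flat_fun 1 (1 + -1 * t))"
    by (rule Ck_on_compose[where g = "flat_fun 1" and V' = UNIV and U' = UNIV, rotated 5]) (auto intro: Ck_on_flat_fun)
  then show "Ck_on k UNIV UNIV (\<lambda>t. flat_fun 1 (1 - t))" by simp
next
  fix t :: real
  have "flat_fun 1 t \<ge> 0" "flat_fun 1 (1 - t) \<ge> 0" "flat_fun 1 t > 0 \<or> flat_fun 1 (1 - t) > 0"
    by (auto simp: flat_fun_def)
  then show "flat_fun 1 t + flat_fun 1 (1 - t) \<noteq> 0" by linarith
qed

lemma bump_arg: "2 + (-2 / r\<^sup>2) * ((x + - p) \<bullet> (x + - p)) = 2 - 2 * (dist p x / r)\<^sup>2"
  by (simp add: dist_norm norm_minus_commute power2_norm_eq_inner[symmetric] power_divide)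

lemma smooth_bump_exists:
  fixes p :: "'b::euclidean_space" and r :: real
  assumes "r > 0"
  obtains \<beta> :: "'b \<Rightarrow> real" where
    "\<And>V U. subspace V \<Longrightarrow> openin (top_of_set V) U \<Longrightarrow> smooth_on V U \<beta>"
    "\<And>x. x \<in> ball p (r / 2) \<Longrightarrow> \<beta> x = 1" "\<And>x. x \<notin> cball p r \<Longrightarrow> \<beta> x = 0"
proof
  \<comment> \<open>The quantity is 2 - 2 (d/r)^2 for the distance d to \<open>p\<close>: at least
    3/2 on the half ball, where the step function is already 1, and at most 0 outside the ball. It
    is spelled as a polynomial in \<open>x\<close> so that the sum and product rules apply.\<close>
  let ?q = "\<lambda>x. 2 + (-2 / r\<^sup>2) * ((x + - p) \<bullet> (x + - p))"
  fix V U :: "'b set" assume V: "subspace V" "openin (top_of_set V) U"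
  have "smooth_on V U ?q"
    by (intro smooth_on_add smooth_on_const smooth_on_ident
        smooth_on_bilinear[OF bounded_bilinear_mult] smooth_on_bilinear[OF bounded_bilinear_inner])
  then show "smooth_on V U (\<lambda>x. step_fun (?q x))"
    by (rule smooth_on_compose[where g = step_fun and V' = UNIV and U' = UNIV, rotated 5]) (use V smooth_on_step_fun in auto)
next
  fix x assume "x \<in> ball p (r / 2)"
  then have "(dist p x / r)\<^sup>2 \<le> (1 / 2)\<^sup>2"
    using assms by (intro power_mono) (auto simp: field_simps)
  also have "(1 / 2)\<^sup>2 = (1 / 4 :: real)" by (simp add: power2_eq_square)
  finally have "1 \<le> 2 - 2 * (dist p x / r)\<^sup>2" by linarith
  then show "step_fun (2 + (-2 / r\<^sup>2) * ((x + - p) \<bullet> (x + - p))) = 1"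
    unfolding bump_arg by (rule step_fun_1)
next
  fix x assume "x \<notin> cball p r"
  then have "1\<^sup>2 \<le> (dist p x / r)\<^sup>2"
    using assms by (intro power_mono) (auto simp: field_simps)
  then show "step_fun (2 + (-2 / r\<^sup>2) * ((x + - p) \<bullet> (x + - p))) = 0"
    unfolding bump_arg by (intro step_fun_0) simp
qed

section \<open>Smooth functions and maps on manifolds\<close>

text \<open>Smoothness is tested in the charts of \<open>X\<close> itself rather than in those of
  \<open>submanifold X N\<close>. Passing to a smaller \<open>N\<close> is then a mere inclusion,
  and \<open>smooth_fun_submanifold\<close> translates back.\<close>

definition smooth_fun_on ::
  "('a, 'b::euclidean_space) manifold \<Rightarrow> 'a set \<Rightarrow> ('a \<Rightarrow> 'z::real_normed_vector) \<Rightarrow> bool" where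
  "smooth_fun_on X N f \<longleftrightarrow>
     (\<forall>(U, \<phi>)\<in>atlas X. smooth_on (model X) (\<phi> ` (U \<inter> N)) (f \<circ> inv_into U \<phi>))"

lemma manifoldD:
  assumes "is_manifold X"
  shows "topspace (mtop X) = points X" "subspace (model X)" "(\<Union>(U, \<phi>)\<in>atlas X. U) = points X"
  using assms by (auto simp: is_manifold_def)

lemma manifold_chart_exists:
  assumes "is_manifold X" "x \<in> points X"
  obtains U \<phi> where "(U, \<phi>) \<in> atlas X" "x \<in> U"
proof -
  have "x \<in> (\<Union>(U, \<phi>)\<in>atlas X. U)" using manifoldD(3)[OF assms(1)] assms(2) by simp
  then show ?thesis by (auto intro: that)
qed

lemma manifold_chartD:
  assumes X: "is_manifold X" and c: "(U, \<phi>) \<in> atlas X"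
  shows "openin (mtop X) U" "U \<subseteq> points X" "openin (top_of_set (model X)) (\<phi> ` U)"
    "homeomorphic_map (subtopology (mtop X) U) (top_of_set (\<phi> ` U)) \<phi>" "inj_on \<phi> U"
proof -
  show 1: "openin (mtop X) U" "openin (top_of_set (model X)) (\<phi> ` U)"
    and 2: "homeomorphic_map (subtopology (mtop X) U) (top_of_set (\<phi> ` U)) \<phi>"
    using assms by (auto simp: is_manifold_def)
  show 3: "U \<subseteq> points X" using openin_subset[OF 1(1)] manifoldD(1)[OF X] by simp
  then have "topspace (subtopology (mtop X) U) = U" using manifoldD(1)[OF X] by auto
  then show "inj_on \<phi> U" using 2 by (metis homeomorphic_imp_injective_map)
qed

lemma manifold_transition_smooth:
  assumes "is_manifold X" "(U, \<phi>) \<in> atlas X" "(W, \<psi>) \<in> atlas X"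
  shows "smooth_on (model X) (\<phi> ` (U \<inter> W)) (\<psi> \<circ> inv_into U \<phi>)"
  using assms by (auto simp: is_manifold_def)

lemma chart_open_image:
  assumes X: "is_manifold X" and c: "(U, \<phi>) \<in> atlas X" and N: "openin (mtop X) N" "N \<subseteq> U"
  shows "openin (top_of_set (model X)) (\<phi> ` N)"
proof -
  have "openin (subtopology (mtop X) U) N" using N by (simp add: openin_subset_topspace_eq openin_open_subtopology manifold_chartD(1)[OF X c])
  then have "openin (top_of_set (\<phi> ` U)) (\<phi> ` N)"
    using homeomorphic_imp_open_map[OF manifold_chartD(4)[OF X c]] by (simp add: open_map_def)
  then show ?thesis using openin_trans manifold_chartD(3)[OF X c] by blast
qed

lemma chart_open_vimage:
  assumes X: "is_manifold X" and c: "(U, \<phi>) \<in> atlas X" and Q: "openin (top_of_set (model X)) Q"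
  shows "openin (mtop X) {x \<in> U. \<phi> x \<in> Q}"
proof -
  have "Q \<subseteq> model X" using openin_imp_subset[OF Q] .
  have "openin (top_of_set (\<phi> ` U)) (\<phi> ` U \<inter> Q)"
    using Q manifold_chartD(3)[OF X c] by (metis inf.cobounded1 openin_Int openin_subset_trans openin_imp_subset)
  then have "openin (subtopology (mtop X) U) {x \<in> topspace (subtopology (mtop X) U). \<phi> x \<in> \<phi> ` U \<inter> Q}"
    by (rule openin_continuous_map_preimage[OF homeomorphic_imp_continuous_map[OF manifold_chartD(4)[OF X c]]])
  moreover have "{x \<in> topspace (subtopology (mtop X) U). \<phi> x \<in> \<phi> ` U \<inter> Q} = {x \<in> U. \<phi> x \<in> Q}"
    using manifold_chartD(2)[OF X c] manifoldD(1)[OF X] by auto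
  ultimately show ?thesis using manifold_chartD(1)[OF X c] openin_trans_full by metis
qed

text \<open>The smooth transition maps carry the representation in one chart to all others. A
  function built inside a chart, such as a bump function, thus has to be examined only
  there.\<close>

lemma smooth_fun_on_chartI:
  assumes X: "is_manifold X" and c: "(U, \<phi>) \<in> atlas X" and N: "openin (mtop X) N" "N \<subseteq> U"
    and f: "smooth_on (model X) (\<phi> ` N) (f \<circ> inv_into U \<phi>)"
  shows "smooth_fun_on X N f"
  unfolding smooth_fun_on_def
proof clarify
  fix U' \<phi>' assume c': "(U', \<phi>') \<in> atlas X"
  note inj = manifold_chartD(5)[OF X c] and inj' = manifold_chartD(5)[OF X c']
  let ?D = "\<phi>' ` (U' \<inter> N)"
  have D: "openin (top_of_set (model X)) ?D"
    by (rule chart_open_image[OF X c']) (use N manifold_chartD(1)[OF X c'] in auto)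
  have "\<phi> ` N \<subseteq> model X" using chart_open_image[OF X c N] openin_imp_subset by blast
  moreover have "smooth_on (model X) ?D (\<phi> \<circ> inv_into U' \<phi>')"
    by (rule smooth_on_subset[OF manifold_transition_smooth[OF X c' c]]) (use N in auto)
  moreover have "(\<phi> \<circ> inv_into U' \<phi>') ` ?D \<subseteq> \<phi> ` N"
    using inj' by auto
  ultimately have "smooth_on (model X) ?D (\<lambda>w. (f \<circ> inv_into U \<phi>) ((\<phi> \<circ> inv_into U' \<phi>') w))"
    by (intro smooth_on_compose[OF manifoldD(2)[OF X] D manifoldD(2)[OF X] _ _ _ f])
  then show "smooth_on (model X) ?D (f \<circ> inv_into U' \<phi>')"
    by (rule smooth_on_cong[THEN iffD1, rotated]) (use inj inj' N in auto)
qed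

lemma smooth_fun_on_subset: "smooth_fun_on X N f \<Longrightarrow> N' \<subseteq> N \<Longrightarrow> smooth_fun_on X N' f"
  unfolding smooth_fun_on_def by (auto elim!: smooth_on_subset ballE)

lemma smooth_fun_on_local:
  assumes X: "is_manifold X"
    and loc: "\<And>x. x \<in> N \<Longrightarrow> x \<in> points X \<Longrightarrow>
      \<exists>N'. openin (mtop X) N' \<and> x \<in> N' \<and> N' \<subseteq> N \<and> smooth_fun_on X N' f"
  shows "smooth_fun_on X N f"
  unfolding smooth_fun_on_def
proof clarify
  fix U \<phi> assume c: "(U, \<phi>) \<in> atlas X"
  show "smooth_on (model X) (\<phi> ` (U \<inter> N)) (f \<circ> inv_into U \<phi>)"
  proof (rule smooth_on_local[OF manifoldD(2)[OF X]])
    fix w assume "w \<in> \<phi> ` (U \<inter> N)"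
    then obtain z where z: "z \<in> U" "z \<in> N" "w = \<phi> z" by auto
    then obtain N' where N': "openin (mtop X) N'" "z \<in> N'" "N' \<subseteq> N" "smooth_fun_on X N' f"
      using loc[of z] manifold_chartD(2)[OF X c] by blast
    have "openin (top_of_set (model X)) (\<phi> ` (U \<inter> N'))"
      by (rule chart_open_image[OF X c]) (use N' manifold_chartD(1)[OF X c] in auto)
    with N' c z show "\<exists>Q. openin (top_of_set (model X)) Q \<and> w \<in> Q \<and> Q \<subseteq> \<phi> ` (U \<inter> N) \<and>
        smooth_on (model X) Q (f \<circ> inv_into U \<phi>)"
      by (intro exI[of _ "\<phi> ` (U \<inter> N')"]) (auto simp: smooth_fun_on_def)
  qed
qed

lemma smooth_fun_on_cong:
  assumes X: "is_manifold X" and "\<And>x. x \<in> N \<Longrightarrow> x \<in> points X \<Longrightarrow> f x = g x"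
  shows "smooth_fun_on X N f \<longleftrightarrow> smooth_fun_on X N g"
proof -
  have "smooth_on (model X) (\<phi> ` (U \<inter> N)) (f \<circ> inv_into U \<phi>) \<longleftrightarrow> smooth_on (model X) (\<phi> ` (U \<inter> N)) (g \<circ> inv_into U \<phi>)"
    if c: "(U, \<phi>) \<in> atlas X" for U \<phi>
    by (rule smooth_on_cong) (use assms(2) manifold_chartD(2,5)[OF X c] in auto)
  then show ?thesis by (auto simp: smooth_fun_on_def)
qed

lemma smooth_fun_on_Int_points:
  assumes "is_manifold X"
  shows "smooth_fun_on X (points X \<inter> N) f \<longleftrightarrow> smooth_fun_on X N f"
proof -
  have "U \<inter> (points X \<inter> N) = U \<inter> N" if "(U, \<phi>) \<in> atlas X" for U \<phi>
    using manifold_chartD(2)[OF assms that] by auto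
  then show ?thesis by (auto simp: smooth_fun_on_def)
qed

lemma smooth_fun_on_const: "smooth_fun_on X N (\<lambda>x. c)"
  by (auto simp: smooth_fun_on_def o_def intro: smooth_on_const)

lemma smooth_fun_on_add:
  "smooth_fun_on X N f \<Longrightarrow> smooth_fun_on X N g \<Longrightarrow> smooth_fun_on X N (\<lambda>x. f x + g x)"
  unfolding smooth_fun_on_def o_def by (auto intro!: smooth_on_add elim!: ballE)

lemma smooth_fun_on_mult:
  fixes f g :: "'a \<Rightarrow> 'k::real_normed_algebra"
  shows "smooth_fun_on X N f \<Longrightarrow> smooth_fun_on X N g \<Longrightarrow> smooth_fun_on X N (\<lambda>x. f x * g x)"
  unfolding smooth_fun_on_def o_def by (auto intro!: smooth_on_bilinear[OF bounded_bilinear_mult] elim!: ballE)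

lemma smooth_fun_on_continuous:
  assumes X: "is_manifold X" and f: "smooth_fun_on X N f" and N: "openin (mtop X) N" and "open Q"
  shows "openin (mtop X) {x \<in> N. f x \<in> Q}"
proof (subst openin_subopen, clarify)
  fix x assume x: "x \<in> N" "f x \<in> Q"
  then have "x \<in> points X" using openin_subset[OF N] manifoldD(1)[OF X] by auto
  then obtain U \<phi> where c: "(U, \<phi>) \<in> atlas X" "x \<in> U" using manifold_chart_exists[OF X] by metis
  note inj = manifold_chartD(5)[OF X c(1)]
  let ?D = "\<phi> ` (U \<inter> N)"
  have D: "openin (top_of_set (model X)) ?D"
    by (rule chart_open_image[OF X c(1)]) (use N manifold_chartD(1)[OF X c(1)] in auto)
  have "continuous_on ?D (f \<circ> inv_into U \<phi>)"
    using f c(1) smooth_on_continuous by (fastforce simp: smooth_fun_on_def)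
  then have "openin (top_of_set ?D) (?D \<inter> (f \<circ> inv_into U \<phi>) -` Q)"
    using \<open>open Q\<close> by (rule continuous_openin_preimage_gen)
  then have "openin (top_of_set (model X)) (?D \<inter> (f \<circ> inv_into U \<phi>) -` Q)"
    using D openin_trans by blast
  from chart_open_vimage[OF X c(1) this]
  have "openin (mtop X) {z \<in> U. \<phi> z \<in> ?D \<inter> (f \<circ> inv_into U \<phi>) -` Q}" .
  moreover have "{z \<in> U. \<phi> z \<in> ?D \<inter> (f \<circ> inv_into U \<phi>) -` Q} = {z \<in> U \<inter> N. f z \<in> Q}"
    using inj by (auto dest: inj_onD[OF inj])
  ultimately show "\<exists>T. openin (mtop X) T \<and> x \<in> T \<and> T \<subseteq> {x \<in> N. f x \<in> Q}"
    using x c by (intro exI[of _ "{z \<in> U \<inter> N. f z \<in> Q}"]) auto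
qed

lemma smooth_fun_on_chart: "is_manifold Y \<Longrightarrow> (W, \<psi>) \<in> atlas Y \<Longrightarrow> smooth_fun_on Y W \<psi>"
  using manifold_transition_smooth by (fastforce simp: smooth_fun_on_def)

text \<open>Smoothness of a map becomes smoothness of the functions obtained by pulling back charts,
  which makes the calculus of functions available for maps.\<close>

lemma smooth_map_iff:
  "smooth_map X Y h \<longleftrightarrow> continuous_map (mtop X) (mtop Y) h \<and>
     (\<forall>(W, \<psi>)\<in>atlas Y. smooth_fun_on X (h -` W) (\<psi> \<circ> h))"
  by (auto simp: smooth_map_def smooth_fun_on_def o_assoc)

text \<open>On the open set where \<open>h\<close> lands in one chart of \<open>Y\<close>, the
  composite factors through that chart, and \<open>smooth_on_compose\<close> applies to the two
  coordinate representations.\<close>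

lemma smooth_fun_on_comp:
  assumes X: "is_manifold X" and Y: "is_manifold Y" and h: "smooth_map X Y h"
    and N: "openin (mtop Y) N" and f: "smooth_fun_on Y N f"
  shows "smooth_fun_on X (h -` N) (f \<circ> h)"
proof (rule smooth_fun_on_local[OF X])
  fix x assume x: "x \<in> h -` N" "x \<in> points X"
  have cont: "continuous_map (mtop X) (mtop Y) h" using h by (simp add: smooth_map_iff)
  have "h x \<in> points Y" using x openin_subset[OF N] manifoldD(1)[OF Y] by auto
  then obtain W \<psi> where c: "(W, \<psi>) \<in> atlas Y" "h x \<in> W" using manifold_chart_exists[OF Y] by metis
  let ?N = "{z \<in> points X. h z \<in> W \<inter> N}"
  have oWN: "openin (mtop Y) (W \<inter> N)" using N manifold_chartD(1)[OF Y c(1)] by auto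
  have oN: "openin (mtop X) ?N"
    using openin_continuous_map_preimage[OF cont oWN] manifoldD(1)[OF X] by simp
  have "smooth_fun_on X ?N (f \<circ> h)" unfolding smooth_fun_on_def
  proof clarify
    fix U \<phi> assume u: "(U, \<phi>) \<in> atlas X"
    note inj = manifold_chartD(5)[OF X u] and inj' = manifold_chartD(5)[OF Y c(1)]
    let ?D = "\<phi> ` (U \<inter> ?N)"
    have D: "openin (top_of_set (model X)) ?D"
      by (rule chart_open_image[OF X u]) (use oN manifold_chartD(1)[OF X u] in auto)
    have "smooth_fun_on X (h -` W) (\<psi> \<circ> h)" using h c(1) by (auto simp: smooth_map_iff)
    then have "smooth_on (model X) (\<phi> ` (U \<inter> h -` W)) (\<psi> \<circ> h \<circ> inv_into U \<phi>)"
      using u by (auto simp: smooth_fun_on_def)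
    then have 1: "smooth_on (model X) ?D (\<psi> \<circ> h \<circ> inv_into U \<phi>)"
      by (rule smooth_on_subset) auto
    have 2: "smooth_on (model Y) (\<psi> ` (W \<inter> N)) (f \<circ> inv_into W \<psi>)"
      using f c(1) by (auto simp: smooth_fun_on_def)
    have 3: "\<psi> ` (W \<inter> N) \<subseteq> model Y"
      using chart_open_image[OF Y c(1) oWN] openin_imp_subset by blast
    have 4: "(\<psi> \<circ> h \<circ> inv_into U \<phi>) ` ?D \<subseteq> \<psi> ` (W \<inter> N)" using inj by auto
    have "smooth_on (model X) ?D (\<lambda>w. (f \<circ> inv_into W \<psi>) ((\<psi> \<circ> h \<circ> inv_into U \<phi>) w))"
      by (rule smooth_on_compose[OF manifoldD(2)[OF X] D manifoldD(2)[OF Y] 3 4 1 2])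
    then show "smooth_on (model X) ?D (f \<circ> h \<circ> inv_into U \<phi>)"
      by (rule smooth_on_cong[THEN iffD1, rotated]) (use inj inj' in auto)
  qed
  then show "\<exists>N'. openin (mtop X) N' \<and> x \<in> N' \<and> N' \<subseteq> h -` N \<and> smooth_fun_on X N' (f \<circ> h)"
    using x c oN by (intro exI[of _ ?N]) auto
qed

subsection \<open>Open submanifolds\<close>

lemma submanifold_simps [simp]:
  "points (submanifold X N) = points X \<inter> N" "mtop (submanifold X N) = subtopology (mtop X) N"
  "model (submanifold X N) = model X" "atlas (submanifold X N) = {(W \<inter> N, \<phi>) | W \<phi>. (W, \<phi>) \<in> atlas X}"
  by (auto simp: submanifold_def)

text \<open>The two conditions differ only in the inverses
  \<open>inv_into (W \<inter> N) \<phi>\<close> and \<open>inv_into W \<phi>\<close>, which agree on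
  the image of the smaller set because \<open>\<phi>\<close> is injective on
  \<open>W\<close>.\<close>

lemma smooth_fun_on_submanifold:
  assumes X: "is_manifold X"
  shows "smooth_fun_on (submanifold X N) K f \<longleftrightarrow> smooth_fun_on X (N \<inter> K) f"
proof -
  have "smooth_on (model X) (\<phi> ` (W \<inter> N \<inter> K)) (f \<circ> inv_into (W \<inter> N) \<phi>) \<longleftrightarrow>
      smooth_on (model X) (\<phi> ` (W \<inter> (N \<inter> K))) (f \<circ> inv_into W \<phi>)" if c: "(W, \<phi>) \<in> atlas X" for W \<phi>
    unfolding Int_assoc
  proof (rule smooth_on_cong, clarify)
    fix z assume z: "z \<in> W" "z \<in> N" "z \<in> K"
    have "inj_on \<phi> (W \<inter> N)" using manifold_chartD(5)[OF X c] by (auto simp: inj_on_def)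
    with z show "(f \<circ> inv_into (W \<inter> N) \<phi>) (\<phi> z) = (f \<circ> inv_into W \<phi>) (\<phi> z)"
      using manifold_chartD(5)[OF X c] by simp
  qed
  moreover have "smooth_fun_on (submanifold X N) K f \<longleftrightarrow> (\<forall>W \<phi>. (W, \<phi>) \<in> atlas X \<longrightarrow>
      smooth_on (model X) (\<phi> ` (W \<inter> N \<inter> K)) (f \<circ> inv_into (W \<inter> N) \<phi>))"
    by (auto simp: smooth_fun_on_def)
  moreover have "smooth_fun_on X (N \<inter> K) f \<longleftrightarrow> (\<forall>W \<phi>. (W, \<phi>) \<in> atlas X \<longrightarrow>
      smooth_on (model X) (\<phi> ` (W \<inter> (N \<inter> K))) (f \<circ> inv_into W \<phi>))"
    by (auto simp: smooth_fun_on_def)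
  ultimately show ?thesis by simp
qed

lemma smooth_fun_submanifold:
  assumes X: "is_manifold X"
  shows "smooth_fun (submanifold X N) f \<longleftrightarrow> smooth_fun_on X N f"
proof -
  have "smooth_fun (submanifold X N) f \<longleftrightarrow> smooth_fun_on (submanifold X N) UNIV f"
    by (simp add: smooth_fun_def smooth_fun_on_def)
  then show ?thesis by (simp add: smooth_fun_on_submanifold[OF X])
qed

lemma smooth_fun_eq: "is_manifold X \<Longrightarrow> smooth_fun X f \<longleftrightarrow> smooth_fun_on X (points X) f"
  using smooth_fun_on_Int_points[of X UNIV f] by (simp add: smooth_fun_def smooth_fun_on_def)

lemma is_manifold_submanifold:
  assumes X: "is_manifold X" and N: "openin (mtop X) N"
  shows "is_manifold (submanifold X N)"
proof -
  have N': "N \<subseteq> points X" using openin_subset[OF N] manifoldD(1)[OF X] by simp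
  have cov: "(\<Union>(U, \<phi>)\<in>atlas (submanifold X N). U) = points X \<inter> N"
    unfolding manifoldD(3)[OF X, symmetric] by auto
  have 1: "openin (subtopology (mtop X) N) (W \<inter> N)" "openin (top_of_set (model X)) (\<phi> ` (W \<inter> N))"
      "homeomorphic_map (subtopology (subtopology (mtop X) N) (W \<inter> N)) (top_of_set (\<phi> ` (W \<inter> N))) \<phi>"
    if c: "(W, \<phi>) \<in> atlas X" for W \<phi>
  proof -
    have o: "openin (mtop X) (W \<inter> N)" using N manifold_chartD(1)[OF X c] by auto
    show "openin (subtopology (mtop X) N) (W \<inter> N)" "openin (top_of_set (model X)) (\<phi> ` (W \<inter> N))"
      using o N by (auto simp: openin_open_subtopology intro: chart_open_image[OF X c])
    have "homeomorphic_map (subtopology (subtopology (mtop X) W) (W \<inter> N)) (subtopology (top_of_set (\<phi> ` W)) (\<phi> ` (W \<inter> N))) \<phi>"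
    proof (rule homeomorphic_map_subtopologies[OF manifold_chartD(4)[OF X c]])
      show "\<phi> ` (topspace (subtopology (mtop X) W) \<inter> (W \<inter> N)) = topspace (top_of_set (\<phi> ` W)) \<inter> \<phi> ` (W \<inter> N)"
        using manifold_chartD(2)[OF X c] manifoldD(1)[OF X] by auto
    qed
    moreover have "W \<inter> (W \<inter> N) = N \<inter> (W \<inter> N)" "\<phi> ` W \<inter> \<phi> ` (W \<inter> N) = \<phi> ` (W \<inter> N)" by auto
    ultimately show "homeomorphic_map (subtopology (subtopology (mtop X) N) (W \<inter> N)) (top_of_set (\<phi> ` (W \<inter> N))) \<phi>"
      by (simp only: subtopology_subtopology)
  qed
  have 2: "smooth_on (model X) (\<phi> ` (W \<inter> N \<inter> (W' \<inter> N))) (\<psi> \<circ> inv_into (W \<inter> N) \<phi>)"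
    if c: "(W, \<phi>) \<in> atlas X" "(W', \<psi>) \<in> atlas X" for W \<phi> W' \<psi>
  proof -
    have "smooth_fun_on (submanifold X N) (W' \<inter> N) \<psi>"
      unfolding smooth_fun_on_submanifold[OF X]
      by (rule smooth_fun_on_subset[OF smooth_fun_on_chart[OF X c(2)]]) auto
    moreover have "(W \<inter> N, \<phi>) \<in> atlas (submanifold X N)" using c(1) by auto
    ultimately show ?thesis by (auto simp: smooth_fun_on_def dest: bspec[rotated])
  qed
  show ?thesis unfolding is_manifold_def cov
  proof (intro conjI)
    show "topspace (mtop (submanifold X N)) = points (submanifold X N)" "subspace (model (submanifold X N))"
      using manifoldD(1,2)[OF X] by auto
    show "points X \<inter> N = points (submanifold X N)" by simp
  qed (use 1 2 in auto)
qed

subsection \<open>Sheaves\<close>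

lemma sheaf_manifold: "sheaf M E \<pi> \<Longrightarrow> is_manifold E"
  by (simp add: sheaf_def)

lemma sheaf_local_inverse:
  assumes "sheaf M E \<pi>" "y \<in> points E"
  obtains U g where "y \<in> U" "openin (mtop E) U" "openin (mtop M) (\<pi> ` U)"
    "smooth_map (submanifold E U) (submanifold M (\<pi> ` U)) \<pi>"
    "smooth_map (submanifold M (\<pi> ` U)) (submanifold E U) g" "\<And>x. x \<in> U \<Longrightarrow> g (\<pi> x) = x"
proof -
  from assms obtain U where U: "y \<in> U" "openin (mtop E) U" "openin (mtop M) (\<pi> ` U)"
    "diffeo (submanifold E U) (submanifold M (\<pi> ` U)) \<pi>" unfolding sheaf_def local_diffeo_def by blast
  then obtain g where "smooth_map (submanifold E U) (submanifold M (\<pi> ` U)) \<pi>"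
    "smooth_map (submanifold M (\<pi> ` U)) (submanifold E U) g" "\<forall>x\<in>points (submanifold E U). g (\<pi> x) = x"
    unfolding diffeo_def by blast
  moreover have "U \<subseteq> points E"
    using openin_subset[OF U(2)] manifoldD(1)[OF sheaf_manifold[OF assms(1)]] by simp
  ultimately show ?thesis by (intro that[of U g] U) auto
qed

lemma elementary_subset: "elementary E \<pi> U \<Longrightarrow> openin (mtop E) N \<Longrightarrow> N \<subseteq> U \<Longrightarrow> elementary E \<pi> N"
  by (auto simp: elementary_def inj_on_def)

lemma sheaf_elementary_nbhd:
  assumes "sheaf M E \<pi>" "y \<in> points E"
  obtains U where "elementary E \<pi> U" "y \<in> U"
proof -
  obtain U g where "y \<in> U" "openin (mtop E) U" "\<And>x. x \<in> U \<Longrightarrow> g (\<pi> x) = x"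
    using sheaf_local_inverse[OF assms] by metis
  then show ?thesis using that by (auto simp: elementary_def inj_on_def) metis
qed

lemma sheaf_continuous_map:
  assumes "is_manifold M" and E: "sheaf M E \<pi>"
  shows "continuous_map (mtop E) (mtop M) \<pi>"
proof -
  note TE = manifoldD(1)[OF sheaf_manifold[OF E]] and TM = manifoldD(1)[OF assms(1)]
  have "openin (mtop E) {y \<in> points E. \<pi> y \<in> Q}" if Q: "openin (mtop M) Q" for Q
  proof (subst openin_subopen, clarify)
    fix y assume y: "y \<in> points E" "\<pi> y \<in> Q"
    from sheaf_local_inverse[OF E y(1)] obtain U where U: "y \<in> U" "openin (mtop E) U" "openin (mtop M) (\<pi> ` U)"
      "smooth_map (submanifold E U) (submanifold M (\<pi> ` U)) \<pi>" by metis
    have "U \<subseteq> points E" using openin_subset[OF U(2)] TE by simp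
    have "continuous_map (subtopology (mtop E) U) (subtopology (mtop M) (\<pi> ` U)) \<pi>"
      using U(4) by (simp add: smooth_map_iff)
    then have "openin (subtopology (mtop E) U) {z \<in> topspace (subtopology (mtop E) U). \<pi> z \<in> Q \<inter> \<pi> ` U}"
      by (rule openin_continuous_map_preimage) (use Q in \<open>auto simp: openin_subtopology\<close>)
    then have "openin (mtop E) {z \<in> topspace (subtopology (mtop E) U). \<pi> z \<in> Q \<inter> \<pi> ` U}"
      using U(2) openin_trans_full by blast
    then show "\<exists>T. openin (mtop E) T \<and> y \<in> T \<and> T \<subseteq> {y \<in> points E. \<pi> y \<in> Q}"
      using y U(1) TE by (intro exI[of _ "{z \<in> topspace (subtopology (mtop E) U). \<pi> z \<in> Q \<inter> \<pi> ` U}"]) auto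
  qed
  moreover have "\<pi> y \<in> points M" if "y \<in> points E" for y
    using sheaf_local_inverse[OF E that] openin_subset TM by (metis imageI subsetD)
  ultimately show ?thesis using TE TM by (auto simp: continuous_map_def)
qed

text \<open>Near a point of \<open>N\<close> the image is the preimage of \<open>N\<close> under a
  continuous local inverse \<open>g\<close>.\<close>

lemma sheaf_open_map:
  assumes M: "is_manifold M" and E: "sheaf M E \<pi>" and N: "openin (mtop E) N"
  shows "openin (mtop M) (\<pi> ` N)"
proof (subst openin_subopen, clarify)
  note TE = manifoldD(1)[OF sheaf_manifold[OF E]] and TM = manifoldD(1)[OF M]
  fix y assume y: "y \<in> N"
  then have "y \<in> points E" using openin_subset[OF N] TE by auto
  from sheaf_local_inverse[OF E this] obtain U g where U: "y \<in> U" "openin (mtop E) U" "openin (mtop M) (\<pi> ` U)"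
    "smooth_map (submanifold M (\<pi> ` U)) (submanifold E U) g" "\<And>x. x \<in> U \<Longrightarrow> g (\<pi> x) = x" by metis
  have "continuous_map (subtopology (mtop M) (\<pi> ` U)) (subtopology (mtop E) U) g"
    using U(4) by (simp add: smooth_map_iff)
  then have "openin (subtopology (mtop M) (\<pi> ` U)) {z \<in> topspace (subtopology (mtop M) (\<pi> ` U)). g z \<in> N \<inter> U}"
    by (rule openin_continuous_map_preimage) (use N in \<open>auto simp: openin_subtopology\<close>)
  then have "openin (mtop M) {z \<in> topspace (subtopology (mtop M) (\<pi> ` U)). g z \<in> N \<inter> U}"
    using U(3) openin_trans_full by blast
  moreover have "\<pi> ` U \<subseteq> topspace (mtop M)" using U(3) openin_subset by blast
  then have "{z \<in> topspace (subtopology (mtop M) (\<pi> ` U)). g z \<in> N \<inter> U} = \<pi> ` (N \<inter> U)"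
    using U(5) by auto
  ultimately show "\<exists>T. openin (mtop M) T \<and> \<pi> y \<in> T \<and> T \<subseteq> \<pi> ` N"
    using y U(1) by (intro exI[of _ "\<pi> ` (N \<inter> U)"]) auto
qed

lemma sheaf_smooth_map:
  assumes M: "is_manifold M" and E: "sheaf M E \<pi>"
  shows "smooth_map E M \<pi>"
  unfolding smooth_map_iff
proof (intro conjI sheaf_continuous_map[OF M E], clarify)
  note ME = sheaf_manifold[OF E]
  fix W \<psi> assume c: "(W, \<psi>) \<in> atlas M"
  show "smooth_fun_on E (\<pi> -` W) (\<psi> \<circ> \<pi>)"
  proof (rule smooth_fun_on_local[OF ME])
    fix y assume y: "y \<in> \<pi> -` W" "y \<in> points E"
    from sheaf_local_inverse[OF E y(2)] obtain U where U: "y \<in> U" "openin (mtop E) U" "openin (mtop M) (\<pi> ` U)"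
      "smooth_map (submanifold E U) (submanifold M (\<pi> ` U)) \<pi>" by metis
    let ?N = "U \<inter> {z \<in> topspace (mtop E). \<pi> z \<in> W}"
    have oN: "openin (mtop E) ?N"
      using U(2) openin_continuous_map_preimage[OF sheaf_continuous_map[OF M E] manifold_chartD(1)[OF M c]] by blast
    have "smooth_fun_on (submanifold E U) (\<pi> -` (W \<inter> \<pi> ` U)) (\<psi> \<circ> \<pi>)"
      using U(4) c unfolding smooth_map_iff submanifold_simps by blast
    then have "smooth_fun_on E (U \<inter> \<pi> -` (W \<inter> \<pi> ` U)) (\<psi> \<circ> \<pi>)"
      by (simp add: smooth_fun_on_submanifold[OF ME])
    then have "smooth_fun_on E ?N (\<psi> \<circ> \<pi>)" by (rule smooth_fun_on_subset) auto
    then show "\<exists>N'. openin (mtop E) N' \<and> y \<in> N' \<and> N' \<subseteq> \<pi> -` W \<and> smooth_fun_on E N' (\<psi> \<circ> \<pi>)"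
      using oN y U(1) manifoldD(1)[OF ME] by (intro exI[of _ ?N]) auto
  qed
qed

text \<open>An elementary set is merely open with \<open>\<pi>\<close> injective on it; it need not
  be one of the sets on which a smooth inverse is provided. Near each point the provided inverse
  \<open>g\<close> must still coincide with \<open>inv_into U \<pi>\<close>, so the latter is smooth
  as well.\<close>

lemma smooth_fun_on_comp_sheaf_inverse:
  assumes M: "is_manifold M" and E: "sheaf M E \<pi>" and U: "elementary E \<pi> U"
    and N: "openin (mtop E) N" "N \<subseteq> U" and f: "smooth_fun_on E N f"
  shows "smooth_fun_on M (\<pi> ` N) (f \<circ> inv_into U \<pi>)"
proof (rule smooth_fun_on_local[OF M], clarify)
  note ME = sheaf_manifold[OF E]
  fix y assume y: "y \<in> N"
  then have "y \<in> points E" using openin_subset[OF N(1)] manifoldD(1)[OF ME] by auto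
  from sheaf_local_inverse[OF E this] obtain U0 g where U0: "y \<in> U0" "openin (mtop E) U0" "openin (mtop M) (\<pi> ` U0)"
    "smooth_map (submanifold M (\<pi> ` U0)) (submanifold E U0) g" "\<And>x. x \<in> U0 \<Longrightarrow> g (\<pi> x) = x" by metis
  have "smooth_fun_on (submanifold M (\<pi> ` U0)) (g -` (N \<inter> U0)) (f \<circ> g)"
  proof (rule smooth_fun_on_comp[OF _ _ U0(4)])
    show "openin (mtop (submanifold E U0)) (N \<inter> U0)" using N by (auto simp: openin_subtopology)
    show "smooth_fun_on (submanifold E U0) (N \<inter> U0) f"
      unfolding smooth_fun_on_submanifold[OF ME] by (rule smooth_fun_on_subset[OF f]) auto
  qed (simp_all add: is_manifold_submanifold M ME U0)
  then have "smooth_fun_on M (\<pi> ` U0 \<inter> g -` (N \<inter> U0)) (f \<circ> g)"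
    by (simp add: smooth_fun_on_submanifold[OF M])
  moreover have "\<pi> ` U0 \<inter> g -` (N \<inter> U0) = \<pi> ` (N \<inter> U0)" using U0(5) by auto
  ultimately have "smooth_fun_on M (\<pi> ` (N \<inter> U0)) (f \<circ> g)" by simp
  moreover have "(f \<circ> g) x = (f \<circ> inv_into U \<pi>) x" if "x \<in> \<pi> ` (N \<inter> U0)" for x
  proof -
    from that obtain z where "z \<in> N" "z \<in> U0" "x = \<pi> z" by auto
    moreover have "inv_into U \<pi> (\<pi> z) = z" using U N(2) \<open>z \<in> N\<close> by (auto simp: elementary_def)
    ultimately show ?thesis using U0(5) by simp
  qed
  ultimately have "smooth_fun_on M (\<pi> ` (N \<inter> U0)) (f \<circ> inv_into U \<pi>)"
    using smooth_fun_on_cong[OF M] by blast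
  moreover have "openin (mtop M) (\<pi> ` (N \<inter> U0))"
    by (rule sheaf_open_map[OF M E]) (use N U0 in auto)
  ultimately show "\<exists>N'. openin (mtop M) N' \<and> \<pi> y \<in> N' \<and> N' \<subseteq> \<pi> ` N \<and> smooth_fun_on M N' (f \<circ> inv_into U \<pi>)"
    using y U0(1) by (intro exI[of _ "\<pi> ` (N \<inter> U0)"]) auto
qed

text \<open>By continuity a neighbourhood of \<open>y\<close> is mapped into an elementary set
  \<open>V\<close>, and there \<open>h\<close> can only be \<open>\<pi>\<close> followed by the
  smooth inverse of \<open>\<xi>\<close> on \<open>V\<close>.\<close>

lemma continuous_map_over_smooth:
  assumes M: "is_manifold M" and E: "sheaf M E \<pi>" and F: "sheaf M F \<xi>"
    and h: "continuous_map (mtop E) (mtop F) h" "\<And>y. y \<in> points E \<Longrightarrow> \<xi> (h y) = \<pi> y"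
  shows "smooth_map E F h"
  unfolding smooth_map_iff
proof (intro conjI h(1), clarify)
  note ME = sheaf_manifold[OF E] and MF = sheaf_manifold[OF F]
  fix U \<phi> assume c: "(U, \<phi>) \<in> atlas F"
  show "smooth_fun_on E (h -` U) (\<phi> \<circ> h)"
  proof (rule smooth_fun_on_local[OF ME])
    fix y assume y: "y \<in> h -` U" "y \<in> points E"
    then have "h y \<in> points F" using manifold_chartD(2)[OF MF c] by auto
    then obtain V where V: "elementary F \<xi> V" "h y \<in> V" using sheaf_elementary_nbhd[OF F] by metis
    let ?N = "V \<inter> U"
    have N: "openin (mtop F) ?N" using V(1) manifold_chartD(1)[OF MF c] by (auto simp: elementary_def)
    have "smooth_fun_on F ?N \<phi>" by (rule smooth_fun_on_subset[OF smooth_fun_on_chart[OF MF c]]) auto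
    then have "smooth_fun_on M (\<xi> ` ?N) (\<phi> \<circ> inv_into V \<xi>)"
      using smooth_fun_on_comp_sheaf_inverse[OF M F V(1) N] by auto
    then have 1: "smooth_fun_on E (\<pi> -` (\<xi> ` ?N)) (\<phi> \<circ> inv_into V \<xi> \<circ> \<pi>)"
      by (rule smooth_fun_on_comp[OF ME M sheaf_smooth_map[OF M E] sheaf_open_map[OF M F N]])
    let ?N' = "{z \<in> topspace (mtop E). h z \<in> ?N}"
    have "smooth_fun_on E ?N' (\<phi> \<circ> inv_into V \<xi> \<circ> \<pi>)"
    proof (rule smooth_fun_on_subset[OF 1], rule subsetI)
      fix z assume "z \<in> ?N'"
      then show "z \<in> \<pi> -` (\<xi> ` ?N)" using h(2)[of z] manifoldD(1)[OF ME] by (auto intro!: image_eqI[of _ \<xi> "h z"])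
    qed
    moreover have "(\<phi> \<circ> inv_into V \<xi> \<circ> \<pi>) z = (\<phi> \<circ> h) z" if "z \<in> ?N'" for z
    proof -
      have "inv_into V \<xi> (\<xi> (h z)) = h z" using V(1) that by (intro inv_into_f_f) (auto simp: elementary_def)
      then show ?thesis using h(2)[of z] that manifoldD(1)[OF ME] by auto
    qed
    ultimately have "smooth_fun_on E ?N' (\<phi> \<circ> h)" using smooth_fun_on_cong[OF ME] by blast
    moreover have "openin (mtop E) ?N'" by (rule openin_continuous_map_preimage[OF h(1) N])
    ultimately show "\<exists>N'. openin (mtop E) N' \<and> y \<in> N' \<and> N' \<subseteq> h -` U \<and> smooth_fun_on E N' (\<phi> \<circ> h)"
      using y V(2) manifoldD(1)[OF ME] by (intro exI[of _ ?N']) auto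
  qed
qed

section \<open>Compactly supported functions\<close>

definition supp :: "('a, 'b) manifold \<Rightarrow> ('a \<Rightarrow> 'k::zero) \<Rightarrow> 'a set" where
  "supp X f = mtop X closure_of {x \<in> points X. f x \<noteq> 0}"

lemma closedin_supp: "closedin (mtop X) (supp X f)"
  by (simp add: supp_def)

lemma supp_mono: "(\<And>x. f x \<noteq> 0 \<Longrightarrow> g x \<noteq> 0) \<Longrightarrow> supp X f \<subseteq> supp X g"
  unfolding supp_def by (rule closure_of_mono) auto

lemma supp_minimal:
  "closedin (mtop X) K \<Longrightarrow> (\<And>x. x \<in> points X \<Longrightarrow> f x \<noteq> 0 \<Longrightarrow> x \<in> K) \<Longrightarrow> supp X f \<subseteq> K"
  unfolding supp_def by (rule closure_of_minimal) auto

lemma Cc_iff: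
  assumes "is_manifold X"
  shows "f \<in> Cc X \<longleftrightarrow> smooth_fun_on X (points X) f \<and> (\<forall>x. x \<notin> points X \<longrightarrow> f x = 0) \<and> compactin (mtop X) (supp X f)"
  by (simp add: Cc_def supp_def smooth_fun_eq[OF assms])

lemma Cc_nonzero_in_supp:
  assumes "is_manifold X" "f \<in> Cc X" "f x \<noteq> 0"
  shows "x \<in> supp X f"
proof -
  have "x \<in> points X" using assms by (auto simp: Cc_iff)
  moreover have "{x \<in> points X. f x \<noteq> 0} \<subseteq> supp X f"
    unfolding supp_def by (rule closure_of_subset) (use manifoldD(1)[OF assms(1)] in auto)
  ultimately show ?thesis using assms(3) by blast
qed

lemma supp_subset_points: "is_manifold X \<Longrightarrow> supp X f \<subseteq> points X"
  using closedin_subset[OF closedin_supp] manifoldD(1) by metis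

text \<open>Instantiated not only with the base but also with Hausdorff open submanifolds of
  \<open>E\<close>, on which the generating functions of \<open>Cc_sections E\<close> live.\<close>

locale hausdorff_manifold =
  fixes M :: "('m, 'b::euclidean_space) manifold"
  assumes M: "is_manifold M" and H: "Hausdorff_space (mtop M)"
begin

lemmas TM = manifoldD(1)[OF M]

lemma openin_points: "openin (mtop M) (points M)"
  using TM by (metis openin_topspace)

lemma open_subset_points: "openin (mtop M) N \<Longrightarrow> N \<subseteq> points M"
  using openin_subset[of "mtop M" N] TM by simp

lemma submanifold: "openin (mtop M) U \<Longrightarrow> hausdorff_manifold (submanifold M U)"
  by (simp add: hausdorff_manifold_def is_manifold_submanifold M H Hausdorff_space_subtopology)

lemma openin_compl_supp: "openin (mtop M) (points M - supp M f)"
  using closedin_supp[of M f] TM by (simp add: closedin_def)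

text \<open>The Hausdorff property makes the compact set \<open>K\<close> closed. Hence the
  complement of \<open>K\<close>, where \<open>f\<close> is 0, is open and together with
  \<open>N\<close> covers \<open>M\<close>, and smoothness can be checked on the two pieces.\<close>

lemma CcI:
  assumes K: "compactin (mtop M) K" "K \<subseteq> N" and N: "openin (mtop M) N" "smooth_fun_on M N f"
    and f: "\<And>x. f x \<noteq> 0 \<Longrightarrow> x \<in> K"
  shows "f \<in> Cc M" "supp M f \<subseteq> K"
proof -
  have clK: "closedin (mtop M) K" using compactin_imp_closedin[OF H K(1)] .
  then have KM: "K \<subseteq> points M" using closedin_subset TM by metis
  show sK: "supp M f \<subseteq> K" using supp_minimal[OF clK] f by blast
  have "smooth_fun_on M (points M) f"
  proof (rule smooth_fun_on_local[OF M])
    fix x assume x: "x \<in> points M"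
    show "\<exists>N'. openin (mtop M) N' \<and> x \<in> N' \<and> N' \<subseteq> points M \<and> smooth_fun_on M N' f"
    proof (cases "x \<in> N")
      case True
      then show ?thesis using N open_subset_points by blast
    next
      case False
      have "smooth_fun_on M (points M - K) f"
        by (rule smooth_fun_on_cong[OF M, THEN iffD1, rotated], rule smooth_fun_on_const[of _ _ 0]) (use f in auto)
      moreover have "openin (mtop M) (points M - K)" using clK TM by (simp add: closedin_def)
      ultimately show ?thesis using False x K by (intro exI[of _ "points M - K"]) auto
    qed
  qed
  moreover have "compactin (mtop M) (supp M f)"
    using closed_compactin[OF K(1) sK closedin_supp] .
  ultimately show "f \<in> Cc M" using f KM by (auto simp: Cc_iff[OF M])
qed

lemma CcD:
  assumes "f \<in> Cc M"
  shows "smooth_fun_on M (points M) f" "x \<notin> points M \<Longrightarrow> f x = 0" "compactin (mtop M) (supp M f)"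
  using assms by (auto simp: Cc_iff[OF M])

lemma Cc_zero: "(\<lambda>_. 0) \<in> Cc M"
  by (rule CcI(1)[of "{}" "{}"]) (auto intro: smooth_fun_on_const)

lemma Cc_mult_smooth:
  assumes "f \<in> Cc M" "smooth_fun_on M (points M) g"
  shows "(\<lambda>x. f x * g x) \<in> Cc M"
  by (rule CcI(1)[of "supp M f" "points M"])
    (use assms CcD[OF assms(1)] openin_points supp_subset_points[OF M] Cc_nonzero_in_supp[OF M] in
      \<open>auto intro: smooth_fun_on_mult\<close>)

lemma Cc_mult: "f \<in> Cc M \<Longrightarrow> g \<in> Cc M \<Longrightarrow> (\<lambda>x. f x * g x) \<in> Cc M"
  by (rule Cc_mult_smooth) (use CcD in auto)

lemma Cc_cmult: "f \<in> Cc M \<Longrightarrow> (\<lambda>x. a * f x) \<in> Cc M"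
  using Cc_mult_smooth[OF _ smooth_fun_on_const, of f a] by (simp add: mult.commute[of a])

lemma Cc_add:
  assumes "f \<in> Cc M" "g \<in> Cc M"
  shows "(\<lambda>x. f x + g x) \<in> Cc M" and supp_add: "supp M (\<lambda>x. f x + g x) \<subseteq> supp M f \<union> supp M g"
proof -
  have nz: "x \<in> supp M f \<union> supp M g" if "f x + g x \<noteq> 0" for x
    using that Cc_nonzero_in_supp[OF M] assms by (cases "f x = 0") auto
  have "compactin (mtop M) (supp M f \<union> supp M g)" using CcD(3) assms by (blast intro: compactin_Un)
  moreover have "supp M f \<union> supp M g \<subseteq> points M" using supp_subset_points[OF M] by blast
  moreover have "smooth_fun_on M (points M) (\<lambda>x. f x + g x)"
    by (intro smooth_fun_on_add CcD(1) assms)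
  ultimately show "(\<lambda>x. f x + g x) \<in> Cc M" "supp M (\<lambda>x. f x + g x) \<subseteq> supp M f \<union> supp M g"
    using CcI[OF _ _ openin_points _ nz] by auto
qed

lemma Cc_uminus: "f \<in> Cc M \<Longrightarrow> (\<lambda>x. - f x) \<in> Cc M"
  using Cc_cmult[of f "-1"] by simp

lemma Cc_diff: "f \<in> Cc M \<Longrightarrow> g \<in> Cc M \<Longrightarrow> (\<lambda>x. f x - g x) \<in> Cc M"
  using Cc_add(1)[OF _ Cc_uminus, of f g] by simp

text \<open>A support that is compact in \<open>U\<close> is compact in \<open>M\<close>, so
  extension by 0 is smooth by \<open>CcI\<close>, and closing up in \<open>U\<close> or in
  \<open>M\<close> gives the same set. From here on elements of \<open>Cc (submanifold M U)\<close>
  are treated as elements of \<open>Cc M\<close> with support in \<open>U\<close>.\<close>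

lemma Cc_submanifold_iff:
  assumes U: "openin (mtop M) U"
  shows "f \<in> Cc (submanifold M U) \<longleftrightarrow> f \<in> Cc M \<and> supp M f \<subseteq> U"
    and "f \<in> Cc (submanifold M U) \<Longrightarrow> supp (submanifold M U) f = supp M f"
proof -
  let ?S = "submanifold M U"
  interpret S: hausdorff_manifold ?S by (rule submanifold[OF U])
  have UM: "U \<subseteq> points M" using open_subset_points[OF U] .
  have 1: "f \<in> Cc M" "supp M f \<subseteq> supp ?S f" "supp ?S f \<subseteq> U" if f: "f \<in> Cc ?S"
  proof -
    have K: "compactin (mtop M) (supp ?S f)" and KU: "supp ?S f \<subseteq> U"
      using S.CcD(3)[OF f] by (auto simp: compactin_subtopology)
    show "f \<in> Cc M" "supp M f \<subseteq> supp ?S f"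
      by (rule CcI[OF K KU U]; use f Cc_nonzero_in_supp[OF S.M f] S.CcD(1)[OF f] UM in
          \<open>auto simp: smooth_fun_on_submanifold[OF M] Int_absorb1 Int_absorb2\<close>)+
    show "supp ?S f \<subseteq> U" by fact
  qed
  have eq: "supp ?S f = supp M f" if "supp M f \<subseteq> U" "f \<in> Cc M"
  proof -
    have "{x \<in> points M. f x \<noteq> 0} \<subseteq> U" using that Cc_nonzero_in_supp[OF M] by blast
    then have "{x \<in> points M \<inter> U. f x \<noteq> 0} = U \<inter> {x \<in> points M. f x \<noteq> 0}" "U \<inter> {x \<in> points M. f x \<noteq> 0} = {x \<in> points M. f x \<noteq> 0}" by auto
    then show ?thesis using that
      by (auto simp: supp_def closure_of_subtopology)
  qed
  have 2: "f \<in> Cc ?S" if f: "f \<in> Cc M" "supp M f \<subseteq> U"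
    unfolding Cc_iff[OF S.M] eq[OF f(2,1)]
  proof (intro conjI)
    show "smooth_fun_on ?S (points ?S) f"
      unfolding smooth_fun_on_submanifold[OF M] by (rule smooth_fun_on_subset[OF CcD(1)[OF f(1)]]) auto
    show "\<forall>x. x \<notin> points ?S \<longrightarrow> f x = 0" using Cc_nonzero_in_supp[OF M f(1)] f(2) UM by auto
    show "compactin (mtop ?S) (supp M f)" using CcD(3)[OF f(1)] f(2) by (simp add: compactin_subtopology)
  qed
  show "f \<in> Cc ?S \<longleftrightarrow> f \<in> Cc M \<and> supp M f \<subseteq> U" using 1 2 by blast
  show "supp ?S f = supp M f" if "f \<in> Cc ?S" using 1[OF that] eq by blast
qed

text \<open>A bump of the model space is transported by a chart. The radius is such that the closed
  ball meets the model inside the chart image; the preimage \<open>K\<close> of this compact set is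
  then compact, and it contains the support.\<close>

lemma Cc_bump:
  assumes x: "x \<in> W" and W: "openin (mtop M) W"
  obtains \<rho> :: "'m \<Rightarrow> 'k::real_normed_field" and N where "\<rho> \<in> Cc M" "supp M \<rho> \<subseteq> W"
    "openin (mtop M) N" "x \<in> N" "N \<subseteq> W" "\<And>z. z \<in> N \<Longrightarrow> \<rho> z = 1"
proof -
  have "x \<in> points M" using x open_subset_points[OF W] by auto
  then obtain U \<phi> where c: "(U, \<phi>) \<in> atlas M" "x \<in> U" using manifold_chart_exists[OF M] by metis
  note cD = manifold_chartD[OF M c(1)]
  have oUW: "openin (mtop M) (U \<inter> W)" using cD(1) W by blast
  let ?D = "\<phi> ` (U \<inter> W)"
  have D: "openin (top_of_set (model M)) ?D" by (rule chart_open_image[OF M c(1) oUW]) auto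
  then obtain r where r: "r > 0" "cball (\<phi> x) r \<inter> model M \<subseteq> ?D"
    unfolding openin_contains_cball using x c(2) by blast
  have DV: "?D \<subseteq> model M" using openin_imp_subset[OF D] .
  obtain \<beta> :: "'b \<Rightarrow> real" where \<beta>:
    "\<And>V U. subspace V \<Longrightarrow> openin (top_of_set V) U \<Longrightarrow> smooth_on V U \<beta>"
    "\<And>w. w \<in> ball (\<phi> x) (r / 2) \<Longrightarrow> \<beta> w = 1" "\<And>w. w \<notin> cball (\<phi> x) r \<Longrightarrow> \<beta> w = 0"
    using smooth_bump_exists[OF r(1)] by metis
  define \<rho> :: "'m \<Rightarrow> 'k" where "\<rho> z = (if z \<in> U \<inter> W then of_real (\<beta> (\<phi> z)) else 0)" for z
  define K where "K = {z \<in> U \<inter> W. \<phi> z \<in> cball (\<phi> x) r}"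
  have "\<phi> ` K = cball (\<phi> x) r \<inter> model M" using r(2) DV by (auto simp: K_def)
  then have "compact (\<phi> ` K)"
    using compact_Int_closed[OF compact_cball closed_subspace[OF manifoldD(2)[OF M]]] by simp
  then have "compactin (top_of_set (\<phi> ` U)) (\<phi> ` K)" by (auto simp: compactin_subtopology K_def)
  moreover have "K \<subseteq> topspace (subtopology (mtop M) U)" using cD(2) TM by (auto simp: K_def)
  ultimately have "compactin (subtopology (mtop M) U) K"
    using homeomorphic_map_compactness[OF cD(4)] by blast
  then have K: "compactin (mtop M) K" by (simp add: compactin_subtopology)
  have "smooth_on (model M) ?D (\<lambda>w. of_real (\<beta> w) :: 'k)"
    by (rule smooth_on_bounded_linear[OF bounded_linear_of_real \<beta>(1)[OF manifoldD(2)[OF M] D]])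
  then have "smooth_on (model M) ?D (\<rho> \<circ> inv_into U \<phi>)"
    by (rule smooth_on_cong[THEN iffD1, rotated]) (use cD(5) in \<open>auto simp: \<rho>_def\<close>)
  then have "smooth_fun_on M (U \<inter> W) \<rho>" by (intro smooth_fun_on_chartI[OF M c(1) oUW]) auto
  moreover have "\<And>z. \<rho> z \<noteq> 0 \<Longrightarrow> z \<in> K" using \<beta>(3) by (auto simp: \<rho>_def K_def split: if_splits)
  moreover have "K \<subseteq> U \<inter> W" by (auto simp: K_def)
  ultimately have \<rho>: "\<rho> \<in> Cc M" "supp M \<rho> \<subseteq> K" using CcI[OF K _ oUW, of \<rho>] by auto
  let ?N = "{z \<in> U. \<phi> z \<in> model M \<inter> ball (\<phi> x) (r / 2)} \<inter> W"
  have "openin (top_of_set (model M)) (model M \<inter> ball (\<phi> x) (r / 2))" by (simp add: openin_open_Int)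
  from chart_open_vimage[OF M c(1) this] have "openin (mtop M) ?N" using W by blast
  moreover have "x \<in> ?N" using x c(2) r(1) DV by auto
  moreover have "\<rho> z = 1" if "z \<in> ?N" for z using that \<beta>(2) by (auto simp: \<rho>_def)
  ultimately show thesis using that[OF \<rho>(1), of ?N] \<rho>(2) by (auto simp: K_def)
qed

text \<open>
  This replaces partitions of unity: with bump functions \<open>\<rho>\<^sub>i\<close> around finitely many points, a function
  is peeled off as \<open>f = f \<rho>\<^sub>1 + f (1 - \<rho>\<^sub>1)\<close>, where \<open>f (1 - \<rho>\<^sub>1)\<close> vanishes wherever \<open>\<rho>\<^sub>1 = 1\<close>.
\<close>

lemma Cc_induct_local:
  fixes f :: "'m \<Rightarrow> 'k::real_normed_field"
  assumes f: "f \<in> Cc M" and zero: "P (\<lambda>_. 0)"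
    and add: "\<And>f g. f \<in> Cc M \<Longrightarrow> g \<in> Cc M \<Longrightarrow> P f \<Longrightarrow> P g \<Longrightarrow> P (\<lambda>x. f x + g x)"
    and loc: "\<And>x. x \<in> points M \<Longrightarrow>
      \<exists>W. openin (mtop M) W \<and> x \<in> W \<and> (\<forall>f\<in>Cc M. supp M f \<subseteq> W \<longrightarrow> P f)"
  shows "P f"
proof -
  have "\<exists>\<rho> N. \<rho> \<in> Cc M \<and> openin (mtop M) N \<and> x \<in> N \<and> (\<forall>z\<in>N. \<rho> z = (1::'k)) \<and>
      (\<forall>f\<in>Cc M. supp M f \<subseteq> supp M \<rho> \<longrightarrow> P f)" if x: "x \<in> points M" for x
  proof -
    obtain W where W: "openin (mtop M) W" "x \<in> W" "\<And>f. f \<in> Cc M \<Longrightarrow> supp M f \<subseteq> W \<Longrightarrow> P f"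
      using loc[OF x] by blast
    obtain \<rho> :: "'m \<Rightarrow> 'k" and N where "\<rho> \<in> Cc M" "supp M \<rho> \<subseteq> W"
      "openin (mtop M) N" "x \<in> N" "N \<subseteq> W" "\<And>z. z \<in> N \<Longrightarrow> \<rho> z = 1" using Cc_bump[OF W(2,1)] by metis
    then show ?thesis using W(3) by (intro exI[of _ \<rho>] exI[of _ N]) blast
  qed
  then obtain \<rho> N where *: "\<And>x. x \<in> points M \<Longrightarrow> \<rho> x \<in> Cc M \<and> openin (mtop M) (N x) \<and> x \<in> N x \<and>
      (\<forall>z\<in>N x. \<rho> x z = (1::'k)) \<and> (\<forall>f\<in>Cc M. supp M f \<subseteq> supp M (\<rho> x) \<longrightarrow> P f)" by metis
  have sM: "supp M f \<subseteq> points M" by (rule supp_subset_points[OF M])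
  obtain \<F> where \<F>: "finite \<F>" "\<F> \<subseteq> N ` supp M f" "supp M f \<subseteq> \<Union>\<F>"
    using compactinD[OF CcD(3)[OF f], of "N ` supp M f"] * sM by blast
  then obtain A where A: "finite A" "A \<subseteq> supp M f" "\<F> = N ` A" using finite_subset_image by metis
  have "P g" if "g \<in> Cc M" "\<And>x. g x \<noteq> 0 \<Longrightarrow> x \<in> \<Union>(N ` A)" for g
    using A(1) order_trans[OF A(2) sM] that
  proof (induction A arbitrary: g rule: finite_induct)
    case empty
    then have "g = (\<lambda>_. 0)" by auto
    then show ?case using zero by simp
  next
    case (insert a A)
    then have a: "\<rho> a \<in> Cc M" "\<And>z. z \<in> N a \<Longrightarrow> \<rho> a z = 1" "\<And>f. f \<in> Cc M \<Longrightarrow> supp M f \<subseteq> supp M (\<rho> a) \<Longrightarrow> P f"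
      using *[of a] by auto
    let ?g1 = "\<lambda>x. g x * \<rho> a x" and ?g2 = "\<lambda>x. g x - g x * \<rho> a x"
    have g1: "?g1 \<in> Cc M" and g2: "?g2 \<in> Cc M" using Cc_mult[OF insert.prems(2) a(1)] Cc_diff[OF insert.prems(2)] by auto
    have "P ?g1" by (rule a(3)[OF g1]) (rule supp_mono, auto)
    moreover have "P ?g2"
    proof (rule insert.IH[OF _ g2])
      show "A \<subseteq> points M" using insert.prems(1) by auto
      fix x assume "?g2 x \<noteq> 0"
      then have "g x \<noteq> 0" "x \<notin> N a" using a(2) by auto
      then show "x \<in> \<Union>(N ` A)" using insert.prems(3) by auto
    qed
    ultimately have "P (\<lambda>x. ?g1 x + ?g2 x)" using add g1 g2 by blast
    then show ?case by simp
  qed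
  moreover have "x \<in> \<Union>(N ` A)" if "f x \<noteq> 0" for x
    using Cc_nonzero_in_supp[OF M f that] \<F>(3) A(3) by auto
  ultimately show ?thesis using f by blast
qed

text \<open>The witness is 1 - (1 - \<eta>)(1 - \<theta>), multiplied out so that the constant 1,
  which need not have compact support, disappears.\<close>

lemma Cc_unit_pair:
  fixes \<eta> \<theta> :: "'m \<Rightarrow> 'k::real_normed_field"
  assumes "\<eta> \<in> Cc M" "\<theta> \<in> Cc M"
  obtains \<kappa> :: "'m \<Rightarrow> 'k" where "\<kappa> \<in> Cc M" "\<And>x. \<eta> x = 1 \<Longrightarrow> \<kappa> x = 1" "\<And>x. \<theta> x = 1 \<Longrightarrow> \<kappa> x = 1"
proof
  show "(\<lambda>x. \<eta> x + \<theta> x - \<eta> x * \<theta> x) \<in> Cc M"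
    by (intro Cc_diff Cc_add Cc_mult assms)
qed auto

lemma mult_left_eq_self_iff: "a * b = b \<longleftrightarrow> b = 0 \<or> a = (1::'k::real_normed_field)"
  by auto

lemma Cc_unit:
  fixes f :: "'m \<Rightarrow> 'k::real_normed_field"
  assumes f: "f \<in> Cc M"
  obtains \<eta> :: "'m \<Rightarrow> 'k" where "\<eta> \<in> Cc M" "\<And>x. \<eta> x * f x = f x"
proof -
  \<comment> \<open>Over a field \<open>\<eta> x * f x = f x\<close> means \<open>f x = 0\<close> or
    \<open>\<eta> x = 1\<close>. The second form passes to sums by \<open>Cc_unit_pair\<close>, and
    for \<open>f\<close> supported where a bump function is 1 that bump function is a unit.\<close>
  have "\<exists>\<eta>\<in>(Cc M :: ('m \<Rightarrow> 'k) set). \<forall>x. f x = 0 \<or> \<eta> x = 1" using f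
  proof (rule Cc_induct_local[where P = "\<lambda>f. \<exists>\<eta>\<in>(Cc M :: ('m \<Rightarrow> 'k) set). \<forall>x. f x = 0 \<or> \<eta> x = 1"])
    show "\<exists>\<eta>\<in>(Cc M :: ('m \<Rightarrow> 'k) set). \<forall>x. (0::'k) = 0 \<or> \<eta> x = (1::'k)" using Cc_zero by auto
  next
    fix f g :: "'m \<Rightarrow> 'k" assume "\<exists>\<eta>\<in>(Cc M :: ('m \<Rightarrow> 'k) set). \<forall>x. f x = 0 \<or> \<eta> x = 1" "\<exists>\<eta>\<in>(Cc M :: ('m \<Rightarrow> 'k) set). \<forall>x. g x = 0 \<or> \<eta> x = 1"
    then obtain \<eta> \<theta> :: "'m \<Rightarrow> 'k" where e: "\<eta> \<in> Cc M" "\<forall>x. f x = 0 \<or> \<eta> x = 1" "\<theta> \<in> Cc M" "\<forall>x. g x = 0 \<or> \<theta> x = 1" by blast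
    obtain \<kappa> :: "'m \<Rightarrow> 'k" where "\<kappa> \<in> Cc M" "\<And>x. \<eta> x = 1 \<Longrightarrow> \<kappa> x = 1" "\<And>x. \<theta> x = 1 \<Longrightarrow> \<kappa> x = 1"
      using Cc_unit_pair[OF e(1,3)] by metis
    then show "\<exists>\<eta>\<in>(Cc M :: ('m \<Rightarrow> 'k) set). \<forall>x. f x + g x = 0 \<or> \<eta> x = 1" using e by (metis add_0)
  next
    fix x assume "x \<in> points M"
    then obtain \<rho> :: "'m \<Rightarrow> 'k" and N where "\<rho> \<in> Cc M" "openin (mtop M) N" "x \<in> N" "\<And>z. z \<in> N \<Longrightarrow> \<rho> z = 1"
      using Cc_bump[OF _ openin_points] by metis
    then show "\<exists>W. openin (mtop M) W \<and> x \<in> W \<and>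
        (\<forall>f\<in>Cc M. supp M f \<subseteq> W \<longrightarrow> (\<exists>\<eta>\<in>(Cc M :: ('m \<Rightarrow> 'k) set). \<forall>x. f x = 0 \<or> \<eta> x = (1::'k)))"
      using Cc_nonzero_in_supp[OF M] by (intro exI[of _ N]) blast
  qed
  then show ?thesis using that by (metis mult_1 mult_zero_right)
qed

lemma Cc_common_unit:
  fixes f g :: "'m \<Rightarrow> 'k::real_normed_field"
  assumes f: "f \<in> Cc M" and g: "g \<in> Cc M"
  obtains \<eta> :: "'m \<Rightarrow> 'k" where "\<eta> \<in> Cc M" "\<And>x. \<eta> x * f x = f x" "\<And>x. \<eta> x * g x = g x"
proof -
  obtain \<eta> :: "'m \<Rightarrow> 'k" where \<eta>: "\<eta> \<in> Cc M" "\<And>x. \<eta> x * f x = f x" using Cc_unit[OF f] by metis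
  obtain \<theta> :: "'m \<Rightarrow> 'k" where \<theta>: "\<theta> \<in> Cc M" "\<And>x. \<theta> x * g x = g x" using Cc_unit[OF g] by metis
  obtain \<kappa> :: "'m \<Rightarrow> 'k" where "\<kappa> \<in> Cc M" "\<And>x. \<eta> x = 1 \<Longrightarrow> \<kappa> x = 1" "\<And>x. \<theta> x = 1 \<Longrightarrow> \<kappa> x = 1"
    using Cc_unit_pair[OF \<eta>(1) \<theta>(1)] by blast
  with \<eta>(2) \<theta>(2) show ?thesis by (intro that[of \<kappa>]) (simp_all add: mult_left_eq_self_iff, blast+)
qed

end

section \<open>Germs\<close>

lemma germ_eqI:
  assumes "openin (mtop X) W" "y \<in> W" "\<And>z. z \<in> W \<Longrightarrow> f z = g z"
  shows "germ X y f = germ X y g"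
proof -
  have "germ X y f \<subseteq> germ X y g" if "\<And>z. z \<in> W \<Longrightarrow> f z = g z" for f g :: "'a \<Rightarrow> 'c"
  proof
    fix h assume "h \<in> germ X y f"
    then obtain W' where "openin (mtop X) W'" "y \<in> W'" "\<forall>z\<in>W'. h z = f z" by (auto simp: germ_def)
    then show "h \<in> germ X y g"
      unfolding germ_def using assms(1,2) that by (intro CollectI exI[of _ "W' \<inter> W"]) auto
  qed
  then show ?thesis using assms(3) by (metis subset_antisym)
qed

lemma germ_eqD:
  assumes "germ X y f = germ X y g" "y \<in> topspace (mtop X)"
  obtains W where "openin (mtop X) W" "y \<in> W" "\<And>z. z \<in> W \<Longrightarrow> f z = g z"
proof -
  have "f \<in> germ X y f" unfolding germ_def using assms(2) by (intro CollectI exI[of _ "topspace (mtop X)"]) auto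
  then have "f \<in> germ X y g" using assms(1) by simp
  then show ?thesis using that by (auto simp: germ_def)
qed

lemma germ_value: "germ X y f = germ X y g \<Longrightarrow> y \<in> topspace (mtop X) \<Longrightarrow> f y = g y"
  by (metis germ_eqD)

lemma germ_add_germ: "germ_add (germ X y f) (germ X y g) = germ X y (\<lambda>z. f z + g z)"
proof
  show "germ_add (germ X y f) (germ X y g) \<subseteq> germ X y (\<lambda>z. f z + g z)"
  proof
    fix h assume "h \<in> germ_add (germ X y f) (germ X y g)"
    then obtain f' g' W W' where "h = (\<lambda>z. f' z + g' z)" "openin (mtop X) W" "y \<in> W" "\<forall>z\<in>W. f' z = f z"
      "openin (mtop X) W'" "y \<in> W'" "\<forall>z\<in>W'. g' z = g z" by (auto simp: germ_add_def germ_def)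
    then show "h \<in> germ X y (\<lambda>z. f z + g z)"
      unfolding germ_def by (intro CollectI exI[of _ "W \<inter> W'"]) auto
  qed
  show "germ X y (\<lambda>z. f z + g z) \<subseteq> germ_add (germ X y f) (germ X y g)"
  proof
    fix h assume "h \<in> germ X y (\<lambda>z. f z + g z)"
    then obtain W where W: "openin (mtop X) W" "y \<in> W" "\<forall>z\<in>W. h z = f z + g z" by (auto simp: germ_def)
    then have "f \<in> germ X y f" "(\<lambda>z. h z - f z) \<in> germ X y g" "h = (\<lambda>z. f z + (h z - f z))"
      by (auto simp: germ_def)
    then show "h \<in> germ_add (germ X y f) (germ X y g)" unfolding germ_add_def
      by (intro CollectI exI[of _ f] exI[of _ "\<lambda>z. h z - f z"]) simp
  qed
qed

lemma germ_mult_germ: "germ_mult (germ X y f) (germ X y g) = germ X y (\<lambda>z. f z * g z)"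
proof
  show "germ_mult (germ X y f) (germ X y g) \<subseteq> germ X y (\<lambda>z. f z * g z)"
  proof
    fix h assume "h \<in> germ_mult (germ X y f) (germ X y g)"
    then obtain f' g' W W' where "h = (\<lambda>z. f' z * g' z)" "openin (mtop X) W" "y \<in> W" "\<forall>z\<in>W. f' z = f z"
      "openin (mtop X) W'" "y \<in> W'" "\<forall>z\<in>W'. g' z = g z" by (auto simp: germ_mult_def germ_def)
    then show "h \<in> germ X y (\<lambda>z. f z * g z)"
      unfolding germ_def by (intro CollectI exI[of _ "W \<inter> W'"]) auto
  qed
  show "germ X y (\<lambda>z. f z * g z) \<subseteq> germ_mult (germ X y f) (germ X y g)"
  proof
    fix h assume "h \<in> germ X y (\<lambda>z. f z * g z)"
    then obtain W where W: "openin (mtop X) W" "y \<in> W" "\<forall>z\<in>W. h z = f z * g z" by (auto simp: germ_def)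
    \<comment> \<open>Unlike for sums, \<open>h\<close> cannot be divided by \<open>f\<close>. Away
      from \<open>W\<close> the factors are free, and \<open>h\<close> times 1 is a factorization
      there.\<close>
    let ?f = "\<lambda>z. if z \<in> W then f z else h z" and ?g = "\<lambda>z. if z \<in> W then g z else 1"
    have "?f \<in> germ X y f" "?g \<in> germ X y g" "h = (\<lambda>z. ?f z * ?g z)"
      using W by (auto simp: germ_def fun_eq_iff intro!: exI[of _ W])
    then show "h \<in> germ_mult (germ X y f) (germ X y g)" unfolding germ_mult_def
      by (intro CollectI exI[of _ ?f] exI[of _ ?g]) simp
  qed
qed

text \<open>The representative \<open>H y\<close> may vary with \<open>y\<close> without any
  coherence. This suffices to reduce identities between sections to identities between functions,
  one point at a time.\<close>

definition germ_section :: "('e, 'c) manifold \<Rightarrow> ('e \<Rightarrow> ('e \<Rightarrow> 'k) set) \<Rightarrow> bool" where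
  "germ_section E s \<longleftrightarrow> (\<exists>H. s = (\<lambda>y. germ E y (H y)))"

lemma germ_sectionE:
  assumes "germ_section E s"
  obtains H where "s = (\<lambda>y. germ E y (H y))"
  using assms by (auto simp: germ_section_def)

lemma zero_ext_section: "zero_ext E U f = (\<lambda>y. germ E y (\<lambda>z. if y \<in> U then f z else 0))"
  by (rule HOL.ext) (simp add: zero_ext_def)

lemma Cc_sections_germ_section: "s \<in> Cc_sections E \<Longrightarrow> germ_section E s"
proof (induction rule: Cc_sections.induct)
  case zero
  show ?case unfolding germ_section_def by (rule exI[of _ "\<lambda>_ _. 0"]) (rule refl)
next
  case (ext U f)
  then show ?case unfolding zero_ext_section germ_section_def by (intro exI) (rule refl)
next
  case (add s t)
  then obtain H K where "s = (\<lambda>y. germ E y (H y))" "t = (\<lambda>y. germ E y (K y))" by (auto simp: germ_section_def)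
  then show ?case unfolding germ_section_def by (intro exI[of _ "\<lambda>y z. H y z + K y z"]) (simp add: germ_add_germ)
next
  case (scale s a)
  then obtain H where "s = (\<lambda>y. germ E y (H y))" by (auto simp: germ_section_def)
  then show ?case unfolding germ_section_def by (intro exI[of _ "\<lambda>y z. a * H y z"]) (simp add: germ_mult_germ)
qed

section \<open>The additive group of compactly supported sections\<close>

lemma Cc_module_simps [simp]:
  "carrier (Cc_module E \<pi>) = Cc_sections E" "zero (Cc_module E \<pi>) = (\<lambda>y. germ E y (\<lambda>_. 0))"
  "add (Cc_module E \<pi>) = (\<lambda>s t y. germ_add (s y) (t y))"
  "smult (Cc_module E \<pi>) = (\<lambda>p s y. germ_mult (germ E y (p \<circ> \<pi>)) (s y))"
  by (auto simp: Cc_module_def)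

lemma Cc_ring_simps [simp]:
  "carrier (Cc_ring M) = Cc M" "zero (Cc_ring M) = (\<lambda>_. 0)"
  "add (Cc_ring M) = (\<lambda>f g x. f x + g x)" "monoid.mult (Cc_ring M) = (\<lambda>f g x. f x * g x)"
  by (auto simp: Cc_ring_def)

lemma Cc_module_abelian_group:
  "abelian_group (Cc_module E \<pi> :: ('m \<Rightarrow> 'k::real_normed_field, ('e, 'k) germ_section) module)"
proof (rule abelian_groupI; simp)
  fix s t u :: "('e, 'k) germ_section" assume s: "s \<in> Cc_sections E" and t: "t \<in> Cc_sections E" and u: "u \<in> Cc_sections E"
  obtain H K L where [simp]: "s = (\<lambda>y. germ E y (H y))" "t = (\<lambda>y. germ E y (K y))" "u = (\<lambda>y. germ E y (L y))"
    using Cc_sections_germ_section[OF s] Cc_sections_germ_section[OF t] Cc_sections_germ_section[OF u]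
    unfolding germ_section_def by blast
  show "(\<lambda>y. germ_add (s y) (t y)) \<in> Cc_sections E" by (rule Cc_sections.add[OF s t])
  show "(\<lambda>y. germ_add (germ_add (s y) (t y)) (u y)) = (\<lambda>y. germ_add (s y) (germ_add (t y) (u y)))"
    by (simp add: germ_add_germ add.assoc)
  show "(\<lambda>y. germ_add (s y) (t y)) = (\<lambda>y. germ_add (t y) (s y))"
    by (simp add: germ_add_germ add.commute)
  show "(\<lambda>y. germ_add (germ E y (\<lambda>_. 0)) (s y)) = s" by (simp add: germ_add_germ)
  have "(\<lambda>y. germ_mult (germ E y (\<lambda>_. -1)) (s y)) \<in> Cc_sections E" by (rule Cc_sections.scale[OF s])
  then show "\<exists>t\<in>Cc_sections E. (\<lambda>y. germ_add (t y) (s y)) = (\<lambda>y. germ E y (\<lambda>_. 0))"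
    by (rule bexI[rotated]) (simp add: germ_mult_germ germ_add_germ)
qed (rule Cc_sections.zero)

section \<open>Modules without unit\<close>

lemma nonunital_moduleD:
  assumes "nonunital_module R A"
  shows "abelian_group A"
    "r \<in> carrier R \<Longrightarrow> a \<in> carrier A \<Longrightarrow> r \<odot>\<^bsub>A\<^esub> a \<in> carrier A"
    "r \<in> carrier R \<Longrightarrow> a \<in> carrier A \<Longrightarrow> b \<in> carrier A \<Longrightarrow> r \<odot>\<^bsub>A\<^esub> (a \<oplus>\<^bsub>A\<^esub> b) = (r \<odot>\<^bsub>A\<^esub> a) \<oplus>\<^bsub>A\<^esub> (r \<odot>\<^bsub>A\<^esub> b)"
    "r \<in> carrier R \<Longrightarrow> s \<in> carrier R \<Longrightarrow> a \<in> carrier A \<Longrightarrow> (r \<oplus>\<^bsub>R\<^esub> s) \<odot>\<^bsub>A\<^esub> a = (r \<odot>\<^bsub>A\<^esub> a) \<oplus>\<^bsub>A\<^esub> (s \<odot>\<^bsub>A\<^esub> a)"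
    "r \<in> carrier R \<Longrightarrow> s \<in> carrier R \<Longrightarrow> a \<in> carrier A \<Longrightarrow> (r \<otimes>\<^bsub>R\<^esub> s) \<odot>\<^bsub>A\<^esub> a = r \<odot>\<^bsub>A\<^esub> (s \<odot>\<^bsub>A\<^esub> a)"
  using assms by (auto simp: nonunital_module_def)

lemma (in abelian_group) add_idem_zero: "a \<in> carrier G \<Longrightarrow> a \<oplus> a = a \<Longrightarrow> a = \<zero>"
  by (metis add.l_cancel_one)

lemma nonunital_smult_zero:
  assumes "nonunital_module R A" "r \<in> carrier R"
  shows "r \<odot>\<^bsub>A\<^esub> \<zero>\<^bsub>A\<^esub> = \<zero>\<^bsub>A\<^esub>"
proof -
  interpret abelian_group A using nonunital_moduleD(1)[OF assms(1)] .
  show ?thesis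
    using nonunital_moduleD(2,3)[OF assms, of "\<zero>\<^bsub>A\<^esub>"] add_idem_zero by (metis zero_closed l_zero)
qed

lemma nonunital_smult_minus:
  assumes "nonunital_module R A" "r \<in> carrier R" "a \<in> carrier A"
  shows "r \<odot>\<^bsub>A\<^esub> (\<ominus>\<^bsub>A\<^esub> a) = \<ominus>\<^bsub>A\<^esub> (r \<odot>\<^bsub>A\<^esub> a)"
proof -
  interpret abelian_group A using nonunital_moduleD(1)[OF assms(1)] .
  have "(r \<odot>\<^bsub>A\<^esub> (\<ominus>\<^bsub>A\<^esub> a)) \<oplus>\<^bsub>A\<^esub> (r \<odot>\<^bsub>A\<^esub> a) = \<zero>\<^bsub>A\<^esub>"
    using nonunital_moduleD(3)[OF assms(1,2), of "\<ominus>\<^bsub>A\<^esub> a" a] assms(3) nonunital_smult_zero[OF assms(1,2)] l_neg by auto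
  then show ?thesis using nonunital_moduleD(2)[OF assms(1,2)] assms(3) minus_equality by (metis a_inv_closed)
qed

lemma linear_map_zero:
  assumes "abelian_group A" "abelian_group B" "linear_map R A B \<alpha>"
  shows "\<alpha> \<zero>\<^bsub>A\<^esub> = \<zero>\<^bsub>B\<^esub>"
proof -
  interpret A: abelian_group A by fact
  interpret B: abelian_group B by fact
  have "\<alpha> \<zero>\<^bsub>A\<^esub> \<in> carrier B" "\<alpha> \<zero>\<^bsub>A\<^esub> \<oplus>\<^bsub>B\<^esub> \<alpha> \<zero>\<^bsub>A\<^esub> = \<alpha> \<zero>\<^bsub>A\<^esub>"
    using assms(3) unfolding linear_map_def by (auto) (metis A.l_zero A.zero_closed)
  then show ?thesis using B.add_idem_zero by blast
qed

text \<open>Sums over lists, because the same generator may occur several times in a presentation,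
  and because presentations are to be concatenated, filtered and compared by length.\<close>

primrec gsum :: "('a, 'x) ring_scheme \<Rightarrow> ('p \<Rightarrow> 'a) \<Rightarrow> 'p list \<Rightarrow> 'a" where
  "gsum A \<beta> [] = \<zero>\<^bsub>A\<^esub>"
| "gsum A \<beta> (p # ps) = \<beta> p \<oplus>\<^bsub>A\<^esub> gsum A \<beta> ps"

context abelian_group
begin

lemma gsum_closed: "(\<And>p. p \<in> set ps \<Longrightarrow> \<beta> p \<in> carrier G) \<Longrightarrow> gsum G \<beta> ps \<in> carrier G"
  by (induction ps) auto

lemma gsum_append:
  "(\<And>p. p \<in> set ps \<union> set qs \<Longrightarrow> \<beta> p \<in> carrier G) \<Longrightarrow> gsum G \<beta> (ps @ qs) = gsum G \<beta> ps \<oplus> gsum G \<beta> qs"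
  by (induction ps) (auto simp: gsum_closed a_assoc)

lemma gsum_filter:
  "(\<And>p. p \<in> set ps \<Longrightarrow> \<beta> p \<in> carrier G) \<Longrightarrow>
    gsum G \<beta> ps = gsum G \<beta> (filter P ps) \<oplus> gsum G \<beta> (filter (\<lambda>p. \<not> P p) ps)"
proof (induction ps)
  case (Cons q ps)
  then have "\<beta> q \<in> carrier G" "gsum G \<beta> (filter P ps) \<in> carrier G" "gsum G \<beta> (filter (\<lambda>p. \<not> P p) ps) \<in> carrier G"
    by (auto intro!: gsum_closed)
  with Cons show ?case by (simp add: a_assoc a_lcomm)
qed simp

end

context hausdorff_manifold
begin

text \<open>If \<open>\<eta>\<close> is a unit for both \<open>r\<close> and \<open>s\<close>, then
  \<open>r a = a\<close> gives \<eta> a = (\<eta> r) a = a, and likewise for \<open>s\<close>. Thus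
  units of single elements combine to a unit of a finite set.\<close>

lemma locally_unitaryI:
  fixes A :: "('m \<Rightarrow> 'k::real_normed_field, 'a, 'z) module_scheme"
  assumes A: "nonunital_module (Cc_ring M) A"
    and un: "\<And>a. a \<in> carrier A \<Longrightarrow> \<exists>r\<in>Cc M. r \<odot>\<^bsub>A\<^esub> a = a"
  shows "locally_unitary (Cc_ring M) A"
  unfolding locally_unitary_def
proof (intro allI impI, elim conjE)
  fix S assume "finite S" "S \<subseteq> carrier A"
  then show "\<exists>r\<in>carrier (Cc_ring M). \<forall>a\<in>S. r \<odot>\<^bsub>A\<^esub> a = a"
  proof (induction S rule: finite_induct)
    case empty
    then show ?case using Cc_zero by auto
  next
    case (insert a S)
    then obtain r s where r: "r \<in> Cc M" "\<forall>b\<in>S. r \<odot>\<^bsub>A\<^esub> b = b" and s: "s \<in> Cc M" "s \<odot>\<^bsub>A\<^esub> a = a"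
      using un[of a] by auto
    obtain \<eta> where \<eta>: "\<eta> \<in> Cc M" "\<And>x. \<eta> x * r x = r x" "\<And>x. \<eta> x * s x = s x"
      using Cc_common_unit[OF r(1) s(1)] by metis
    have "\<eta> \<odot>\<^bsub>A\<^esub> b = b" if "t \<in> Cc M" "t \<odot>\<^bsub>A\<^esub> b = b" "b \<in> carrier A" "\<And>x. \<eta> x * t x = t x" for t b
      using nonunital_moduleD(5)[OF A, of \<eta> t b] that \<eta>(1) by simp
    then show ?case using r s \<eta> insert.prems by (intro bexI[of _ \<eta>]) auto
  qed
qed

lemma unitary_add:
  fixes A :: "('m \<Rightarrow> 'k::real_normed_field, 'a, 'z) module_scheme"
  assumes A: "nonunital_module (Cc_ring M) A" and ab: "a \<in> carrier A" "b \<in> carrier A"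
    and r: "r \<in> Cc M" "r \<odot>\<^bsub>A\<^esub> a = a" and s: "s \<in> Cc M" "s \<odot>\<^bsub>A\<^esub> b = b"
  shows "\<exists>t\<in>Cc M. t \<odot>\<^bsub>A\<^esub> (a \<oplus>\<^bsub>A\<^esub> b) = a \<oplus>\<^bsub>A\<^esub> b"
proof -
  obtain \<eta> where \<eta>: "\<eta> \<in> Cc M" "\<And>x. \<eta> x * r x = r x" "\<And>x. \<eta> x * s x = s x"
    using Cc_common_unit[OF r(1) s(1)] by metis
  have "\<eta> \<odot>\<^bsub>A\<^esub> c = c" if "t \<in> Cc M" "t \<odot>\<^bsub>A\<^esub> c = c" "c \<in> carrier A" "\<And>x. \<eta> x * t x = t x" for t c
    using nonunital_moduleD(5)[OF A, of \<eta> t c] that \<eta>(1) by simp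
  then have "\<eta> \<odot>\<^bsub>A\<^esub> a = a" "\<eta> \<odot>\<^bsub>A\<^esub> b = b" using r s \<eta> ab by auto
  then show ?thesis using nonunital_moduleD(3)[OF A, of \<eta> a b] \<eta>(1) ab by (intro bexI[of _ \<eta>]) auto
qed

end

section \<open>The module of compactly supported functions on a sheaf\<close>

locale sheaf_over = hausdorff_manifold M
  for M :: "('m, 'b::euclidean_space) manifold" +
  fixes E :: "('e, 'c::euclidean_space) manifold" and \<pi> :: "'e \<Rightarrow> 'm"
  assumes E: "sheaf M E \<pi>"
begin

lemmas ME = sheaf_manifold[OF E]
lemmas TE = manifoldD(1)[OF ME]
lemmas proj_continuous = sheaf_continuous_map[OF M E]
lemmas proj_open = sheaf_open_map[OF M E]

lemma open_subset_pointsE: "openin (mtop E) N \<Longrightarrow> N \<subseteq> points E"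
  using openin_subset[of "mtop E" N] TE by simp

lemma proj_points: "y \<in> points E \<Longrightarrow> \<pi> y \<in> points M"
  using proj_continuous TE TM by (auto simp: continuous_map_def)

lemma openin_proj_vimage: "openin (mtop M) W \<Longrightarrow> openin (mtop E) {y \<in> points E. \<pi> y \<in> W}"
  using openin_continuous_map_preimage[OF proj_continuous] TE by metis

lemma elementary_image_open: "elementary E \<pi> U \<Longrightarrow> openin (mtop M) (\<pi> ` U)"
  using proj_open by (simp add: elementary_def)

lemma elementary_points: "elementary E \<pi> U \<Longrightarrow> U \<subseteq> points E"
  using open_subset_pointsE by (auto simp: elementary_def)

text \<open>Carries the Hausdorff property of \<open>M\<close>, and compactness of supports, over to
  elementary sets of \<open>E\<close>.\<close>

lemma elementary_homeomorphic:
  assumes U: "elementary E \<pi> U"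
  shows "homeomorphic_map (subtopology (mtop E) U) (subtopology (mtop M) (\<pi> ` U)) \<pi>"
proof (rule bijective_open_imp_homeomorphic_map)
  have oU: "openin (mtop E) U" using U by (simp add: elementary_def)
  have UE: "U \<subseteq> points E" using elementary_points[OF U] .
  show "continuous_map (subtopology (mtop E) U) (subtopology (mtop M) (\<pi> ` U)) \<pi>"
    by (rule continuous_map_into_subtopology) (use proj_continuous continuous_map_from_subtopology in auto)
  show "open_map (subtopology (mtop E) U) (subtopology (mtop M) (\<pi> ` U)) \<pi>"
    unfolding open_map_def
  proof (intro allI impI)
    fix N assume "openin (subtopology (mtop E) U) N"
    then have "openin (mtop E) N" "N \<subseteq> U" using oU by (auto simp: openin_open_subtopology)
    then show "openin (subtopology (mtop M) (\<pi> ` U)) (\<pi> ` N)"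
      using proj_open by (auto simp: openin_open_subtopology[OF elementary_image_open[OF U]])
  qed
  show "\<pi> ` topspace (subtopology (mtop E) U) = topspace (subtopology (mtop M) (\<pi> ` U))"
    using UE proj_points TE TM by auto
  show "inj_on \<pi> (topspace (subtopology (mtop E) U))"
    using U by (auto simp: elementary_def inj_on_def)
qed

lemma elementary_Hausdorff: "elementary E \<pi> U \<Longrightarrow> Hausdorff_space (subtopology (mtop E) U)"
  using homeomorphic_Hausdorff_space[OF homeomorphic_map_imp_homeomorphic_space[OF elementary_homeomorphic]]
    Hausdorff_space_subtopology[OF H] by blast

text \<open>The index set of the generators. The function is kept on all of \<open>M\<close> with a
  condition on its support, so that products, sums and enlargements of \<open>U\<close> need no
  change of domain; \<open>gens_iff\<close> gives the formulation on the submanifold.\<close>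

definition gens :: "('e set \<times> ('m \<Rightarrow> 'k::real_normed_field)) set" where
  "gens = {(U, f). elementary E \<pi> U \<and> f \<in> Cc M \<and> supp M f \<subseteq> \<pi> ` U}"

abbreviation pe :: "'e set \<times> ('m \<Rightarrow> 'k::real_normed_field) \<Rightarrow> ('e, 'k) germ_section" where
  "pe \<equiv> \<lambda>(U, f). pullback_ext E \<pi> U f"

lemma gens_iff: "(U, f) \<in> gens \<longleftrightarrow> elementary E \<pi> U \<and> f \<in> Cc (submanifold M (\<pi> ` U))"
  using Cc_submanifold_iff(1)[OF elementary_image_open] by (auto simp: gens_def)

lemma gensD:
  assumes "(U, f) \<in> gens"
  shows "elementary E \<pi> U" "f \<in> Cc M" "supp M f \<subseteq> \<pi> ` U" "f x \<noteq> 0 \<Longrightarrow> x \<in> \<pi> ` U"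
  using assms Cc_nonzero_in_supp[OF M] by (auto simp: gens_def)

lemma gens_mult: "(U, f) \<in> gens \<Longrightarrow> p \<in> Cc M \<Longrightarrow> (U, \<lambda>x. p x * f x) \<in> gens"
  using supp_mono[of "\<lambda>x. p x * f x" f M] by (auto simp: gens_def Cc_mult)

lemma gens_cmult: "(U, f) \<in> gens \<Longrightarrow> (U, \<lambda>x. a * f x) \<in> gens"
  using supp_mono[of "\<lambda>x. a * f x" f M] by (auto simp: gens_def Cc_cmult)

lemma gens_uminus: "(U, f) \<in> gens \<Longrightarrow> (U, \<lambda>x. - f x) \<in> gens"
  using gens_cmult[of U f "-1"] by simp

lemma gens_add: "(U, f) \<in> gens \<Longrightarrow> (U, g) \<in> gens \<Longrightarrow> (U, \<lambda>x. f x + g x) \<in> gens"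
  unfolding gens_def using Cc_add[of f g] supp_add[of f g] by auto

lemma gens_zero: "elementary E \<pi> U \<Longrightarrow> (U, \<lambda>_. 0) \<in> gens"
  by (auto simp: gens_def Cc_zero supp_def)

lemma gens_mono: "(V, f) \<in> gens \<Longrightarrow> V \<subseteq> U \<Longrightarrow> elementary E \<pi> U \<Longrightarrow> (U, f) \<in> gens"
  unfolding gens_def using image_mono[of V U \<pi>] by auto

lemma pullback_ext_at: "pullback_ext E \<pi> U f y = germ E y (\<lambda>z. if y \<in> U then f (\<pi> z) else 0)"
  by (simp add: pullback_ext_def zero_ext_def o_def)

lemma pullback_ext_in_Cc_sections:
  assumes "(U, f) \<in> gens"
  shows "pullback_ext E \<pi> U f \<in> Cc_sections E"
proof -
  have U: "elementary E \<pi> U" "openin (mtop E) U" using assms by (auto simp: gens_def elementary_def)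
  note UE = elementary_points[OF U(1)]
  interpret S: hausdorff_manifold "submanifold E U"
    by (simp add: hausdorff_manifold_def is_manifold_submanifold ME U(2) elementary_Hausdorff U(1))
  \<comment> \<open>On other sheets over the support of \<open>f\<close> the function
    \<open>f \<circ> \<pi>\<close> does not vanish, so it has to be cut off outside \<open>U\<close>
    to be a compactly supported function on \<open>U\<close>. The cut-off leaves the germs at points
    of the open set \<open>U\<close> unchanged.\<close>
  let ?f = "\<lambda>z. if z \<in> U then f (\<pi> z) else 0"
  let ?K = "{z \<in> U. \<pi> z \<in> supp M f}"
  have "\<pi> ` ?K = supp M f" using gensD(3)[OF assms] by auto
  then have "compactin (subtopology (mtop M) (\<pi> ` U)) (\<pi> ` ?K)"
    using CcD(3)[OF gensD(2)[OF assms]] gensD(3)[OF assms] by (simp add: compactin_subtopology)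
  then have K: "compactin (mtop (submanifold E U)) ?K"
    using homeomorphic_map_compactness[OF elementary_homeomorphic[OF U(1)], of ?K] UE TE by auto
  have "smooth_fun_on E (\<pi> -` points M) (f \<circ> \<pi>)"
    by (rule smooth_fun_on_comp[OF ME M sheaf_smooth_map[OF M E] openin_points CcD(1)[OF gensD(2)[OF assms]]])
  then have "smooth_fun_on E U (f \<circ> \<pi>)"
    by (rule smooth_fun_on_subset) (use UE proj_points in auto)
  then have "smooth_fun_on E U ?f"
    by (rule smooth_fun_on_cong[OF ME, THEN iffD1, rotated]) auto
  then have sm: "smooth_fun_on (submanifold E U) U ?f" by (simp add: smooth_fun_on_submanifold[OF ME])
  have "?f \<in> Cc (submanifold E U)"
    by (rule S.CcI(1)[OF K _ _ sm])
      (use U Cc_nonzero_in_supp[OF M gensD(2)[OF assms]] in \<open>auto simp: openin_open_subtopology split: if_splits\<close>)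
  then have "zero_ext E U ?f \<in> Cc_sections E"
    using U elementary_Hausdorff by (intro Cc_sections.ext) auto
  moreover have "zero_ext E U ?f = pullback_ext E \<pi> U f"
    unfolding pullback_ext_def zero_ext_def by (rule HOL.ext) (auto intro!: germ_eqI[OF U(2)])
  ultimately show ?thesis by simp
qed

lemma pe_closed: "set ps \<subseteq> gens \<Longrightarrow> p \<in> set ps \<Longrightarrow> pe p \<in> carrier (Cc_module E \<pi>)"
  using pullback_ext_in_Cc_sections by (cases p) auto

sublocale C: abelian_group "Cc_module E \<pi> :: ('m \<Rightarrow> 'k::real_normed_field, ('e, 'k) germ_section) module"
  by (rule Cc_module_abelian_group)

lemma gsum_pe_at:
  "gsum (Cc_module E \<pi>) pe ps y = germ E y (\<lambda>z. \<Sum>(U, f)\<leftarrow>ps. if y \<in> U then f (\<pi> z) else 0)"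
  by (induction ps) (auto simp: pullback_ext_at germ_add_germ simp del: Cc_module_simps(1))

lemma gsum_pe_closed: "set ps \<subseteq> gens \<Longrightarrow> gsum (Cc_module E \<pi>) pe ps \<in> Cc_sections E"
  using C.gsum_closed[of ps pe] pe_closed[of ps] by simp

text \<open>\<open>Cc_induct_local\<close>, applied on the Hausdorff manifold \<open>U\<close>,
  splits \<open>f\<close> into functions supported in elementary sets. On such a set
  \<open>?W\<close> the function is the pullback of \<open>g\<close>, obtained by composing
  \<open>f\<close> with the inverse of \<open>\<pi>\<close> on \<open>?W\<close>.\<close>

lemma zero_ext_generated:
  fixes f :: "'e \<Rightarrow> 'k::real_normed_field"
  assumes U: "openin (mtop E) U" "Hausdorff_space (subtopology (mtop E) U)" and f: "f \<in> Cc (submanifold E U)"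
  shows "\<exists>ps. set ps \<subseteq> gens \<and> zero_ext E U f = gsum (Cc_module E \<pi>) pe ps"
proof -
  interpret S: hausdorff_manifold "submanifold E U"
    by (simp add: hausdorff_manifold_def is_manifold_submanifold ME U)
  show ?thesis using f
  proof (rule S.Cc_induct_local[where P = "\<lambda>f. \<exists>ps. set ps \<subseteq> gens \<and> zero_ext E U f = gsum (Cc_module E \<pi>) pe ps"])
    show "\<exists>ps. set ps \<subseteq> gens \<and> zero_ext E U (\<lambda>_. 0 :: 'k) = gsum (Cc_module E \<pi>) pe ps"
      by (intro exI[of _ "[]"]) (auto simp: zero_ext_def)
  next
    fix f g :: "'e \<Rightarrow> 'k" assume "\<exists>ps. set ps \<subseteq> gens \<and> zero_ext E U f = gsum (Cc_module E \<pi>) pe ps"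
      "\<exists>ps. set ps \<subseteq> gens \<and> zero_ext E U g = gsum (Cc_module E \<pi>) pe ps"
    then obtain ps qs where *: "set ps \<subseteq> gens" "zero_ext E U f = gsum (Cc_module E \<pi>) pe ps"
      "set qs \<subseteq> gens" "zero_ext E U g = gsum (Cc_module E \<pi>) pe qs" by blast
    have "zero_ext E U (\<lambda>x. f x + g x) = (\<lambda>y. germ_add (zero_ext E U f y) (zero_ext E U g y))"
      by (rule HOL.ext) (simp add: zero_ext_def germ_add_germ)
    then show "\<exists>ps. set ps \<subseteq> gens \<and> zero_ext E U (\<lambda>x. f x + g x) = gsum (Cc_module E \<pi>) pe ps"
      using * pe_closed[of "ps @ qs"] C.gsum_append[of ps qs pe] by (intro exI[of _ "ps @ qs"]) auto
  next
    fix y assume "y \<in> points (submanifold E U)"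
    then have y: "y \<in> points E" "y \<in> U" by auto
    obtain U0 where U0: "elementary E \<pi> U0" "y \<in> U0" using sheaf_elementary_nbhd[OF E y(1)] by metis
    let ?W = "U0 \<inter> U"
    have oW: "openin (mtop E) ?W" using U0 U by (auto simp: elementary_def)
    have W: "elementary E \<pi> ?W" by (rule elementary_subset[OF U0(1) oW]) auto
    have "\<exists>ps. set ps \<subseteq> gens \<and> zero_ext E U f = gsum (Cc_module E \<pi>) pe ps"
      if f: "f \<in> Cc (submanifold E U)" "supp (submanifold E U) f \<subseteq> ?W" for f :: "'e \<Rightarrow> 'k"
    proof -
      let ?K = "supp (submanifold E U) f"
      define g where "g x = (if x \<in> \<pi> ` ?W then f (inv_into ?W \<pi> x) else 0)" for x
      have inv: "inv_into ?W \<pi> (\<pi> z) = z" if "z \<in> ?W" for z using W that by (simp add: elementary_def)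
      have "compactin (mtop E) ?K" using S.CcD(3)[OF f(1)] by (auto simp: compactin_subtopology)
      then have K: "compactin (mtop M) (\<pi> ` ?K)" by (rule image_compactin[OF _ proj_continuous])
      have "smooth_fun_on E U f" using S.CcD(1)[OF f(1)] open_subset_pointsE[OF U(1)]
        by (simp add: smooth_fun_on_submanifold[OF ME] Int_absorb1)
      then have "smooth_fun_on E ?W f" by (rule smooth_fun_on_subset) auto
      then have "smooth_fun_on M (\<pi> ` ?W) (f \<circ> inv_into ?W \<pi>)"
        by (rule smooth_fun_on_comp_sheaf_inverse[OF M E W oW order_refl])
      then have sm: "smooth_fun_on M (\<pi> ` ?W) g"
        by (rule smooth_fun_on_cong[OF M, THEN iffD1, rotated]) (auto simp: g_def)
      have nz: "x \<in> \<pi> ` ?K" if "g x \<noteq> 0" for x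
        using that Cc_nonzero_in_supp[OF S.M f(1)] inv by (auto simp: g_def split: if_splits)
      have gg: "(?W, g) \<in> gens"
        using CcI[OF K image_mono[OF f(2)] elementary_image_open[OF W] sm nz] image_mono[OF f(2), of \<pi>] W
        unfolding gens_def by blast
      have eq: "zero_ext E U f = pullback_ext E \<pi> ?W g"
      proof
        fix z
        consider "z \<in> ?W" | "z \<in> U" "z \<notin> ?W" | "z \<notin> U" by auto
        then show "zero_ext E U f z = pullback_ext E \<pi> ?W g z"
        proof cases
          case 1
          then have "germ E z f = germ E z (g \<circ> \<pi>)"
            using inv by (intro germ_eqI[OF oW]) (auto simp: g_def)
          then show ?thesis using 1 by (simp add: zero_ext_def pullback_ext_def)
        next
          \<comment> \<open>On the left the germ is that of \<open>f\<close>, on the right it is 0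
            by definition. They agree because such a point lies outside the support of
            \<open>f\<close>, whose complement in \<open>U\<close> is open.\<close>
          case 2
          have "openin (mtop (submanifold E U)) (points (submanifold E U) - ?K)"
            by (rule S.openin_compl_supp)
          then have "openin (mtop E) (points (submanifold E U) - ?K)"
            using U(1) by (simp add: openin_open_subtopology)
          moreover have "z \<in> points (submanifold E U) - ?K" using 2 f(2) open_subset_pointsE[OF U(1)] by auto
          ultimately have "germ E z f = germ E z (\<lambda>_. 0)"
            by (rule germ_eqI) (use Cc_nonzero_in_supp[OF S.M f(1)] in auto)
          then show ?thesis using 2 by (auto simp: zero_ext_def pullback_ext_def)
        qed (auto simp: zero_ext_def pullback_ext_def)
      qed
      have "pullback_ext E \<pi> ?W g = gsum (Cc_module E \<pi>) pe [(?W, g)]"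
        using C.r_zero[OF pe_closed[of "[(?W, g)]"]] gg by simp
      with eq have "zero_ext E U f = gsum (Cc_module E \<pi>) pe [(?W, g)]" by (rule trans)
      moreover have "set [(?W, g)] \<subseteq> gens" using gg by simp
      ultimately show ?thesis by (intro exI conjI)
    qed
    then show "\<exists>W. openin (mtop (submanifold E U)) W \<and> y \<in> W \<and> (\<forall>f\<in>Cc (submanifold E U).
        supp (submanifold E U) f \<subseteq> W \<longrightarrow> (\<exists>ps. set ps \<subseteq> gens \<and> zero_ext E U (f::'e \<Rightarrow> 'k) = gsum (Cc_module E \<pi>) pe ps))"
      using oW openin_open_subtopology[OF U(1)] U0(2) y(2) by (intro exI[of _ ?W] conjI ballI impI) simp_all
  qed
qed

lemma Cc_sections_generated:
  fixes s :: "('e, 'k::real_normed_field) germ_section"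
  assumes "s \<in> Cc_sections E"
  shows "\<exists>ps. set ps \<subseteq> gens \<and> s = gsum (Cc_module E \<pi>) pe ps"
  using assms
proof (induction rule: Cc_sections.induct)
  case zero
  show ?case by (intro exI[of _ "[]"]) auto
next
  case (ext U f)
  then show ?case by (rule zero_ext_generated)
next
  case (add s t)
  then obtain ps qs where "set ps \<subseteq> gens" "s = gsum (Cc_module E \<pi>) pe ps"
    "set qs \<subseteq> gens" "t = gsum (Cc_module E \<pi>) pe qs" by blast
  then show ?case using pe_closed[of "ps @ qs"] C.gsum_append[of ps qs pe] by (intro exI[of _ "ps @ qs"]) auto
next
  case (scale s a)
  then obtain ps where ps: "set ps \<subseteq> gens" "s = gsum (Cc_module E \<pi>) pe ps" by blast
  have "germ_mult (germ E y (\<lambda>_. a)) (gsum (Cc_module E \<pi>) pe ps y) =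
      gsum (Cc_module E \<pi>) pe (map (\<lambda>(U, f). (U, \<lambda>x. a * f x)) ps) y" for y
    unfolding gsum_pe_at germ_mult_germ
    by (rule arg_cong[of _ _ "germ E y"]) (auto simp: fun_eq_iff sum_list_const_mult[symmetric] o_def intro!: arg_cong[of _ _ sum_list])
  then show ?case using ps by (intro exI[of _ "map (\<lambda>(U, f). (U, \<lambda>x. a * f x)) ps"]) (auto intro!: gens_cmult)
qed

lemma smult_gsum:
  "(\<lambda>y. germ_mult (germ E y (p \<circ> \<pi>)) (gsum (Cc_module E \<pi>) pe ps y)) =
      gsum (Cc_module E \<pi>) pe (map (\<lambda>(U, f). (U, \<lambda>x. p x * f x)) ps)"
  unfolding gsum_pe_at germ_mult_germ
  by (rule HOL.ext, rule arg_cong[of _ _ "germ _ _"])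
    (auto simp: fun_eq_iff sum_list_const_mult[symmetric] o_def intro!: arg_cong[of _ _ sum_list])

lemma smult_pe: "p \<odot>\<^bsub>Cc_module E \<pi>\<^esub> pullback_ext E \<pi> U f = pullback_ext E \<pi> U (\<lambda>x. p x * f x)"
  by (rule HOL.ext) (auto simp: pullback_ext_at germ_mult_germ intro!: arg_cong[of _ _ "germ E _"])

lemma Cc_module_nonunital: "nonunital_module (Cc_ring M) (Cc_module E \<pi>)"
  unfolding nonunital_module_def
proof (intro conjI ballI Cc_module_abelian_group)
  fix p q :: "'m \<Rightarrow> 'k::real_normed_field" and s t :: "('e, 'k) germ_section" assume "p \<in> carrier (Cc_ring M)" "s \<in> carrier (Cc_module E \<pi>)"
  then have p: "p \<in> Cc M" and s: "s \<in> Cc_sections E" by auto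
  from Cc_sections_generated[OF s] obtain ps where ps: "set ps \<subseteq> gens" "s = gsum (Cc_module E \<pi>) pe ps" by blast
  show "p \<odot>\<^bsub>Cc_module E \<pi>\<^esub> s \<in> carrier (Cc_module E \<pi>)"
    unfolding ps(2) Cc_module_simps smult_gsum
    by (rule gsum_pe_closed) (use ps(1) gens_mult p in auto)
  obtain H where [simp]: "s = (\<lambda>y. germ E y (H y))" using germ_sectionE[OF Cc_sections_germ_section[OF s]] .
  show "(p \<oplus>\<^bsub>Cc_ring M\<^esub> q) \<odot>\<^bsub>Cc_module E \<pi>\<^esub> s = p \<odot>\<^bsub>Cc_module E \<pi>\<^esub> s \<oplus>\<^bsub>Cc_module E \<pi>\<^esub> q \<odot>\<^bsub>Cc_module E \<pi>\<^esub> s"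
    "(p \<otimes>\<^bsub>Cc_ring M\<^esub> q) \<odot>\<^bsub>Cc_module E \<pi>\<^esub> s = p \<odot>\<^bsub>Cc_module E \<pi>\<^esub> (q \<odot>\<^bsub>Cc_module E \<pi>\<^esub> s)"
    by (auto simp: germ_mult_germ germ_add_germ algebra_simps o_def)
  assume "t \<in> carrier (Cc_module E \<pi>)"
  then have t: "t \<in> Cc_sections E" by simp
  obtain K where [simp]: "t = (\<lambda>y. germ E y (K y))" using germ_sectionE[OF Cc_sections_germ_section[OF t]] .
  show "p \<odot>\<^bsub>Cc_module E \<pi>\<^esub> (s \<oplus>\<^bsub>Cc_module E \<pi>\<^esub> t) = p \<odot>\<^bsub>Cc_module E \<pi>\<^esub> s \<oplus>\<^bsub>Cc_module E \<pi>\<^esub> p \<odot>\<^bsub>Cc_module E \<pi>\<^esub> t"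
    by (auto simp: germ_mult_germ germ_add_germ algebra_simps o_def)
qed

lemma Cc_sections_induct [consumes 1, case_names zero gen add]:
  assumes "s \<in> Cc_sections E" and "P (\<lambda>y. germ E y (\<lambda>_. 0))"
    and gen: "\<And>U f. (U, f) \<in> gens \<Longrightarrow> P (pullback_ext E \<pi> U f)"
    and add: "\<And>s t. s \<in> Cc_sections E \<Longrightarrow> t \<in> Cc_sections E \<Longrightarrow> P s \<Longrightarrow> P t \<Longrightarrow> P (\<lambda>y. germ_add (s y) (t y))"
  shows "P s"
proof -
  obtain ps where "set ps \<subseteq> gens" "s = gsum (Cc_module E \<pi>) pe ps" using Cc_sections_generated[OF assms(1)] by blast
  moreover have "set ps \<subseteq> gens \<Longrightarrow> P (gsum (Cc_module E \<pi>) pe ps)" for ps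
  proof (induction ps)
    case (Cons q ps)
    obtain U f where "q = (U, f)" by force
    with Cons have *: "(U, f) \<in> gens" "set ps \<subseteq> gens" "P (gsum (Cc_module E \<pi>) pe ps)" by auto
    show ?case
      using add[OF pullback_ext_in_Cc_sections[OF *(1)] gsum_pe_closed[OF *(2)] gen[OF *(1)] *(3)] \<open>q = (U, f)\<close> by simp
  qed (use assms(2) in auto)
  ultimately show ?thesis by simp
qed

lemma Cc_module_unitary:
  fixes s :: "('e, 'k::real_normed_field) germ_section"
  assumes "s \<in> Cc_sections E"
  shows "\<exists>r\<in>Cc M. r \<odot>\<^bsub>Cc_module E \<pi>\<^esub> s = s"
  using assms
proof (induction rule: Cc_sections_induct)
  case zero
  show ?case by (intro bexI[of _ "\<lambda>_. 0"]) (simp_all add: germ_mult_germ Cc_zero)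
next
  case (gen U f)
  obtain \<eta> where "\<eta> \<in> Cc M" "\<And>x. \<eta> x * f x = f x" using Cc_unit[OF gensD(2)[OF gen]] by metis
  then have "(\<lambda>x. \<eta> x * f x) = f" by (intro HOL.ext)
  with \<open>\<eta> \<in> Cc M\<close> show ?case unfolding smult_pe by (intro bexI[of _ \<eta>]) simp_all
next
  case (add s t)
  then obtain r r' where "r \<in> Cc M" "r \<odot>\<^bsub>Cc_module E \<pi>\<^esub> s = s" "r' \<in> Cc M" "r' \<odot>\<^bsub>Cc_module E \<pi>\<^esub> t = t" by blast
  from unitary_add[OF Cc_module_nonunital _ _ this(1,2,3,4)] add show ?case by simp
qed

lemma Cc_module_locally_unitary: "locally_unitary (Cc_ring M) (Cc_module E \<pi>)"
  by (rule locally_unitaryI[OF Cc_module_nonunital], rule Cc_module_unitary) simp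

end

section \<open>Universal property of the module of compactly supported functions\<close>

text \<open>Prospective values on generators, subject to the evident relations between them:
  additivity and linearity for fixed \<open>U\<close>, and independence of \<open>U\<close> when it
  is enlarged. The aim is that no further relation has to be imposed. Unitarity of the target is
  what allows an element to be detected locally.\<close>

locale compatible_family = sheaf_over M E \<pi>
  for M :: "('m, 'b::euclidean_space) manifold" and E :: "('e, 'c::euclidean_space) manifold" and \<pi> +
  fixes A :: "('m \<Rightarrow> 'k::real_normed_field, 'a, 'z) module_scheme" and \<beta> :: "'e set \<times> ('m \<Rightarrow> 'k) \<Rightarrow> 'a"
  assumes A: "nonunital_module (Cc_ring M) A"
    and unitary: "\<And>a. a \<in> carrier A \<Longrightarrow> \<exists>r\<in>Cc M. r \<odot>\<^bsub>A\<^esub> a = a"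
    and closed: "p \<in> gens \<Longrightarrow> \<beta> p \<in> carrier A"
    and additive: "(U, f) \<in> gens \<Longrightarrow> (U, g) \<in> gens \<Longrightarrow> \<beta> (U, \<lambda>x. f x + g x) = \<beta> (U, f) \<oplus>\<^bsub>A\<^esub> \<beta> (U, g)"
    and linear: "r \<in> Cc M \<Longrightarrow> (U, f) \<in> gens \<Longrightarrow> \<beta> (U, \<lambda>x. r x * f x) = r \<odot>\<^bsub>A\<^esub> \<beta> (U, f)"
    and mono: "(V, f) \<in> gens \<Longrightarrow> V \<subseteq> U \<Longrightarrow> elementary E \<pi> U \<Longrightarrow> \<beta> (V, f) = \<beta> (U, f)"
begin

sublocale A: abelian_group A by (rule nonunital_moduleD(1)[OF A])

lemma zero:
  assumes "elementary E \<pi> U"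
  shows "\<beta> (U, \<lambda>_. 0) = \<zero>\<^bsub>A\<^esub>"
proof (rule A.add_idem_zero[OF closed[OF gens_zero[OF assms]]])
  show "\<beta> (U, \<lambda>_. 0) \<oplus>\<^bsub>A\<^esub> \<beta> (U, \<lambda>_. 0) = \<beta> (U, \<lambda>_. 0)"
    using additive[OF gens_zero[OF assms] gens_zero[OF assms]] by (simp only: add_0)
qed

lemma uminus:
  assumes "(U, f) \<in> gens"
  shows "\<beta> (U, \<lambda>x. - f x) = \<ominus>\<^bsub>A\<^esub> \<beta> (U, f)"
proof -
  have "\<beta> (U, \<lambda>x. - f x) \<oplus>\<^bsub>A\<^esub> \<beta> (U, f) = \<zero>\<^bsub>A\<^esub>"
    using additive[OF gens_uminus[OF assms] assms] zero gensD(1)[OF assms] by simp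
  then show ?thesis using A.minus_equality closed assms gens_uminus by metis
qed

lemma sum_closed: "set ps \<subseteq> gens \<Longrightarrow> gsum A \<beta> ps \<in> carrier A"
  using closed by (intro A.gsum_closed) blast

lemma sum_filter: "set ps \<subseteq> gens \<Longrightarrow>
    gsum A \<beta> ps = gsum A \<beta> (filter P ps) \<oplus>\<^bsub>A\<^esub> gsum A \<beta> (filter (\<lambda>p. \<not> P p) ps)"
  using closed by (intro A.gsum_filter) blast

text \<open>For \<open>r\<close> supported in \<pi>(V) with \<open>V\<close> contained in all the
  sets \<open>U\<close> of the list, r \<beta>(U, f) = \<beta>(U, r f) = \<beta>(V, r f). Over the
  common domain additivity merges the whole sum into one value of \<open>\<beta>\<close>.\<close>

lemma smult_sum_common_domain:
  assumes "set ps \<subseteq> gens" "\<And>p. p \<in> set ps \<Longrightarrow> V \<subseteq> fst p" "elementary E \<pi> V" "r \<in> Cc M" "supp M r \<subseteq> \<pi> ` V"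
  shows "(V, \<lambda>x. r x * sum_list (map (\<lambda>p. snd p x) ps)) \<in> gens \<and>
    r \<odot>\<^bsub>A\<^esub> gsum A \<beta> ps = \<beta> (V, \<lambda>x. r x * sum_list (map (\<lambda>p. snd p x) ps))"
  using assms(1,2)
proof (induction ps)
  case Nil
  then show ?case using zero[OF assms(3)] gens_zero[OF assms(3)] nonunital_smult_zero[OF A] assms(4) by simp
next
  case (Cons p ps)
  obtain U f where p: "p = (U, f)" by force
  have g: "(U, f) \<in> gens" "V \<subseteq> U" "set ps \<subseteq> gens" using Cons.prems(1) Cons.prems(2)[of p] by (auto simp: p)
  have rf: "(V, \<lambda>x. r x * f x) \<in> gens"
    using assms(3,5) Cc_mult[OF assms(4) gensD(2)[OF g(1)]] supp_mono[of "\<lambda>x. r x * f x" r M]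
    by (auto simp: gens_def)
  have "r \<odot>\<^bsub>A\<^esub> gsum A \<beta> (p # ps) = r \<odot>\<^bsub>A\<^esub> \<beta> (U, f) \<oplus>\<^bsub>A\<^esub> r \<odot>\<^bsub>A\<^esub> gsum A \<beta> ps"
    using nonunital_moduleD(3)[OF A, of r "\<beta> (U, f)" "gsum A \<beta> ps"] closed[OF g(1)] sum_closed[OF g(3)] assms(4) by (simp add: p)
  also have "r \<odot>\<^bsub>A\<^esub> \<beta> (U, f) = \<beta> (V, \<lambda>x. r x * f x)"
    using linear[OF assms(4) g(1)] mono[OF rf g(2) gensD(1)[OF g(1)]] by simp
  finally show ?case
    using Cons additive[OF rf, of "\<lambda>x. r x * sum_list (map (\<lambda>p. snd p x) ps)"]
      gens_add[OF rf, of "\<lambda>x. r x * sum_list (map (\<lambda>p. snd p x) ps)"] by (simp add: p distrib_left)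
qed

text \<open>
  By induction on the length: the pairs \<open>(U, f)\<close> whose \<open>U\<close> contains a given point \<open>y\<^sub>0\<close> over \<open>x\<close> are split off;
  they do not contribute to the germs at the other points of the fibre.
\<close>

lemma sum_locally_zero:
  assumes "x \<in> points M" "set ps \<subseteq> gens"
    and "\<And>y. y \<in> points E \<Longrightarrow> \<pi> y = x \<Longrightarrow> gsum (Cc_module E \<pi>) pe ps y = germ E y (\<lambda>_. 0)"
  shows "\<exists>W. openin (mtop M) W \<and> x \<in> W \<and>
    (\<forall>r\<in>Cc M. supp M r \<subseteq> W \<longrightarrow> r \<odot>\<^bsub>A\<^esub> gsum A \<beta> ps = \<zero>\<^bsub>A\<^esub>)"
  using assms(2,3)
proof (induction ps rule: measure_induct_rule[where f = length])
  case (less ps)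
  show ?case
  proof (cases ps)
    case Nil
    then show ?thesis using nonunital_smult_zero[OF A] openin_points assms(1) by (intro exI[of _ "points M"]) auto
  next
    case (Cons p qs)
    obtain U f where p: "p = (U, f)" by force
    have g: "(U, f) \<in> gens" "set qs \<subseteq> gens" using less.prems(1) by (auto simp: Cons p)
    note eU = gensD(1)[OF g(1)]
    show ?thesis
    proof (cases "x \<in> \<pi> ` U")
      case False
      have "gsum (Cc_module E \<pi>) pe qs y = germ E y (\<lambda>_. 0)" if y: "y \<in> points E" "\<pi> y = x" for y
      proof -
        have "y \<notin> U" using False y by auto
        then have "gsum (Cc_module E \<pi>) pe ps y = gsum (Cc_module E \<pi>) pe qs y"
          unfolding gsum_pe_at by (simp add: Cons p)
        then show ?thesis using less.prems(2)[OF y] by simp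
      qed
      then obtain W where W: "openin (mtop M) W" "x \<in> W"
        "\<forall>r\<in>Cc M. supp M r \<subseteq> W \<longrightarrow> r \<odot>\<^bsub>A\<^esub> gsum A \<beta> qs = \<zero>\<^bsub>A\<^esub>"
        using less.IH[of qs] g(2) by (auto simp: Cons)
      \<comment> \<open>Since \<open>x\<close> is not in \<pi>(U), it lies outside the support of
        \<open>f\<close>. Multiplying by functions supported off this closed set kills the first
        summand.\<close>
      have "r \<odot>\<^bsub>A\<^esub> gsum A \<beta> ps = \<zero>\<^bsub>A\<^esub>" if r: "r \<in> Cc M" "supp M r \<subseteq> W \<inter> (points M - supp M f)" for r
      proof -
        have "(\<lambda>x. r x * f x) = (\<lambda>_. 0)"
        proof
          fix z show "r z * f z = 0"
            using Cc_nonzero_in_supp[OF M r(1), of z] Cc_nonzero_in_supp[OF M gensD(2)[OF g(1)], of z] r(2) by auto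
        qed
        then have "r \<odot>\<^bsub>A\<^esub> \<beta> (U, f) = \<zero>\<^bsub>A\<^esub>" using linear[OF r(1) g(1)] zero[OF eU] by simp
        moreover have "r \<odot>\<^bsub>A\<^esub> gsum A \<beta> qs = \<zero>\<^bsub>A\<^esub>" using W(3) r by auto
        ultimately show ?thesis
          using nonunital_moduleD(3)[OF A, of r "\<beta> (U, f)" "gsum A \<beta> qs"] closed[OF g(1)] sum_closed[OF g(2)] r(1)
          by (simp add: Cons p)
      qed
      moreover have "openin (mtop M) (W \<inter> (points M - supp M f))" using W(1) openin_compl_supp by blast
      moreover have "x \<in> W \<inter> (points M - supp M f)" using W(2) gensD(3)[OF g(1)] False assms(1) by auto
      ultimately show ?thesis by blast
    next
      case True
      then obtain y0 where y0: "y0 \<in> U" "x = \<pi> y0" by auto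
      then have y0E: "y0 \<in> points E" using elementary_points[OF eU] by auto
      define ps1 ps2 where "ps1 = filter (\<lambda>p. y0 \<in> fst p) ps" and "ps2 = filter (\<lambda>p. \<not> y0 \<in> fst p) ps"
      have s1: "set ps1 \<subseteq> gens" and s2: "set ps2 \<subseteq> gens" using less.prems(1) by (auto simp: ps1_def ps2_def)
      have "length ps2 < length ps" unfolding ps2_def Cons p using y0(1) by (auto simp: le_imp_less_Suc)
      have split: "(\<Sum>(U, f)\<leftarrow>ps. if y \<in> U then f (\<pi> z) else 0) =
          (\<Sum>(U, f)\<leftarrow>ps1. if y \<in> U then f (\<pi> z) else 0) + (\<Sum>(U, f)\<leftarrow>ps2. if y \<in> U then f (\<pi> z) else 0)" for y z
        unfolding ps1_def ps2_def by (induction ps) auto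
      have z2: "(\<Sum>(U, f)\<leftarrow>ps2. if y0 \<in> U then f (\<pi> z) else 0) = 0" for z
        unfolding ps2_def by (induction ps) auto
      \<comment> \<open>All elementary sets in \<open>ps1\<close> contain \<open>y0\<close>, so by
        injectivity of \<open>\<pi>\<close> none of them contains a second point of the
        fibre.\<close>
      have z1: "(\<Sum>(U, f)\<leftarrow>ps1. if y \<in> U then f (\<pi> z) else 0) = 0" if "\<pi> y = x" "y \<noteq> y0" for y z
      proof -
        have "\<forall>(U, f)\<in>set ps1. y \<notin> U"
        proof clarify
          fix U f assume "(U, f) \<in> set ps1" "y \<in> U"
          then have "elementary E \<pi> U" "y0 \<in> U" using s1 by (auto simp: gens_def ps1_def)
          then show False using \<open>y \<in> U\<close> that y0(2) by (auto simp: elementary_def inj_on_def)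
        qed
        then show ?thesis by (induction ps1) auto
      qed
      have "gsum (Cc_module E \<pi>) pe ps2 y = germ E y (\<lambda>_. 0)" if y: "y \<in> points E" "\<pi> y = x" for y
      proof (cases "y = y0")
        case True
        then show ?thesis unfolding gsum_pe_at by (simp add: z2)
      next
        case False
        then show ?thesis using less.prems(2)[OF y] unfolding gsum_pe_at split by (simp add: z1[OF y(2)])
      qed
      then obtain W2 where W2: "openin (mtop M) W2" "x \<in> W2"
        "\<forall>r\<in>Cc M. supp M r \<subseteq> W2 \<longrightarrow> r \<odot>\<^bsub>A\<^esub> gsum A \<beta> ps2 = \<zero>\<^bsub>A\<^esub>"
        using less.IH[OF \<open>length ps2 < length ps\<close> s2] by blast
      have y0T: "y0 \<in> topspace (mtop E)" using y0E TE by simp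
      have germ0: "germ E y0 (\<lambda>z. \<Sum>(U, f)\<leftarrow>ps1. if y0 \<in> U then f (\<pi> z) else 0) = germ E y0 (\<lambda>_. 0)"
        using less.prems(2)[OF y0E y0(2)[symmetric]] unfolding gsum_pe_at split by (simp add: z2)
      obtain N where N: "openin (mtop E) N" "y0 \<in> N"
        "\<And>z. z \<in> N \<Longrightarrow> (\<Sum>(U, f)\<leftarrow>ps1. if y0 \<in> U then f (\<pi> z) else 0) = 0"
        using germ_eqD[OF germ0 y0T] by blast
      have sum1: "(\<Sum>(U, f)\<leftarrow>ps1. if y0 \<in> U then f (\<pi> z) else 0) = sum_list (map (\<lambda>p. snd p (\<pi> z)) ps1)" for z
        unfolding ps1_def by (induction ps) auto
      \<comment> \<open>A common domain for the pairs in \<open>ps1\<close>, shrunk into the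
        neighbourhood \<open>N\<close> on which their functions add up to 0. Finitely many open sets
        are intersected, so \<open>V\<close> is open.\<close>
      define V where "V = N \<inter> \<Inter>(fst ` set ps1)"
      have "(U, f) \<in> set ps1" using y0(1) by (auto simp: ps1_def Cons p)
      then have VU: "V \<subseteq> U" by (auto simp: V_def)
      have "openin (mtop E) (\<Inter>(fst ` set ps1))"
        using s1 \<open>(U, f) \<in> set ps1\<close> by (intro openin_Inter) (auto simp: gens_def elementary_def)
      then have oV: "openin (mtop E) V" using N(1) by (auto simp: V_def)
      have eV: "elementary E \<pi> V" by (rule elementary_subset[OF eU oV VU])
      have y0V: "y0 \<in> V" using N(2) by (auto simp: V_def ps1_def)
      have "r \<odot>\<^bsub>A\<^esub> gsum A \<beta> ps = \<zero>\<^bsub>A\<^esub>" if r: "r \<in> Cc M" "supp M r \<subseteq> W2 \<inter> \<pi> ` V" for r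
      proof -
        have "r \<odot>\<^bsub>A\<^esub> gsum A \<beta> ps1 = \<beta> (V, \<lambda>x. r x * sum_list (map (\<lambda>p. snd p x) ps1))"
          using smult_sum_common_domain[OF s1 _ eV r(1)] r(2) by (auto simp: V_def)
        also have "(\<lambda>x. r x * sum_list (map (\<lambda>p. snd p x) ps1)) = (\<lambda>_. 0)"
        proof
          fix z
          show "r z * sum_list (map (\<lambda>p. snd p z) ps1) = 0"
          proof (cases "r z = 0")
            case False
            then obtain y where "y \<in> V" "z = \<pi> y" using Cc_nonzero_in_supp[OF M r(1)] r(2) by blast
            then show ?thesis using N(3)[of y] sum1[of y] by (simp add: V_def)
          qed simp
        qed
        finally have "r \<odot>\<^bsub>A\<^esub> gsum A \<beta> ps1 = \<zero>\<^bsub>A\<^esub>" using zero[OF eV] by simp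
        moreover have "r \<odot>\<^bsub>A\<^esub> gsum A \<beta> ps2 = \<zero>\<^bsub>A\<^esub>" using W2(3) r by auto
        moreover have "gsum A \<beta> ps = gsum A \<beta> ps1 \<oplus>\<^bsub>A\<^esub> gsum A \<beta> ps2"
          unfolding ps1_def ps2_def by (rule sum_filter[OF less.prems(1)])
        ultimately show ?thesis
          using nonunital_moduleD(3)[OF A, of r "gsum A \<beta> ps1" "gsum A \<beta> ps2"] sum_closed s1 s2 r(1) by simp
      qed
      moreover have "openin (mtop M) (W2 \<inter> \<pi> ` V)" using W2(1) proj_open[OF oV] by blast
      moreover have "x \<in> W2 \<inter> \<pi> ` V" using W2(2) y0(2) y0V by auto
      ultimately show ?thesis by blast
    qed
  qed
qed

text \<open>Write \<open>a = r a\<close> and decompose \<open>r\<close> by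
  \<open>Cc_induct_local\<close> into functions with support in the given neighbourhoods; each of
  them annihilates \<open>a\<close>.\<close>

lemma locally_zero_imp_zero:
  assumes a: "a \<in> carrier A"
    and loc: "\<And>x. x \<in> points M \<Longrightarrow>
      \<exists>W. openin (mtop M) W \<and> x \<in> W \<and> (\<forall>r\<in>Cc M. supp M r \<subseteq> W \<longrightarrow> r \<odot>\<^bsub>A\<^esub> a = \<zero>\<^bsub>A\<^esub>)"
  shows "a = \<zero>\<^bsub>A\<^esub>"
proof -
  obtain r where r: "r \<in> Cc M" "r \<odot>\<^bsub>A\<^esub> a = a" using unitary[OF a] by blast
  have "r \<odot>\<^bsub>A\<^esub> a = \<zero>\<^bsub>A\<^esub>" using r(1)
  proof (rule Cc_induct_local[where P = "\<lambda>r. r \<odot>\<^bsub>A\<^esub> a = \<zero>\<^bsub>A\<^esub>"])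
    show zero: "(\<lambda>_. 0) \<odot>\<^bsub>A\<^esub> a = \<zero>\<^bsub>A\<^esub>"
    proof (rule A.add_idem_zero)
      show "(\<lambda>_. 0) \<odot>\<^bsub>A\<^esub> a \<oplus>\<^bsub>A\<^esub> (\<lambda>_. 0) \<odot>\<^bsub>A\<^esub> a = (\<lambda>_. 0) \<odot>\<^bsub>A\<^esub> a"
        using nonunital_moduleD(4)[OF A _ _ a, of "\<lambda>_. 0" "\<lambda>_. 0"] Cc_zero
        unfolding Cc_ring_simps add_0 by metis
    qed (use nonunital_moduleD(2)[OF A] a Cc_zero in simp)
  next
    fix f g assume "f \<in> Cc M" "g \<in> Cc M" "f \<odot>\<^bsub>A\<^esub> a = \<zero>\<^bsub>A\<^esub>" "g \<odot>\<^bsub>A\<^esub> a = \<zero>\<^bsub>A\<^esub>"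
    then show "(\<lambda>x. f x + g x) \<odot>\<^bsub>A\<^esub> a = \<zero>\<^bsub>A\<^esub>"
      using nonunital_moduleD(4)[OF A, of f g a] a by simp
  qed (rule loc)
  then show ?thesis using r(2) by simp
qed

text \<open>The formal difference \<open>ps @ rs\<close> presents the zero section, so its image
  vanishes near every point and therefore vanishes.\<close>

lemma sum_well_defined:
  assumes ps: "set ps \<subseteq> gens" and qs: "set qs \<subseteq> gens"
    and eq: "gsum (Cc_module E \<pi>) pe ps = gsum (Cc_module E \<pi>) pe qs"
  shows "gsum A \<beta> ps = gsum A \<beta> qs"
proof -
  define rs where "rs = map (\<lambda>(U, f). (U, \<lambda>x. - f x)) qs"
  have rs: "set rs \<subseteq> gens" using qs gens_uminus by (auto simp: rs_def)
  have neg: "gsum A \<beta> rs = \<ominus>\<^bsub>A\<^esub> gsum A \<beta> qs" using qs unfolding rs_def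
  proof (induction qs)
    case (Cons q qs)
    obtain U f where "q = (U, f)" by force
    with Cons show ?case using uminus[of U f] closed[of "(U, f)"] sum_closed[of qs] A.minus_add by simp
  qed (simp, rule sym, rule A.minus_equality, simp_all)
  have sum_neg: "(\<Sum>(U, f)\<leftarrow>rs. if y \<in> U then f (\<pi> z) else 0) = - (\<Sum>(U, f)\<leftarrow>qs. if y \<in> U then f (\<pi> z) else 0)" for y z
    unfolding rs_def by (induction qs) auto
  have "gsum (Cc_module E \<pi>) pe (ps @ rs) y = germ E y (\<lambda>_. 0)" for y
  proof -
    have "gsum (Cc_module E \<pi>) pe ps y = gsum (Cc_module E \<pi>) pe qs y" using eq by simp
    then have "germ_add (gsum (Cc_module E \<pi>) pe ps y) (gsum (Cc_module E \<pi>) pe rs y) =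
        germ_add (gsum (Cc_module E \<pi>) pe qs y) (gsum (Cc_module E \<pi>) pe rs y)" by simp
    then show ?thesis unfolding gsum_pe_at germ_add_germ by (simp add: sum_neg)
  qed
  then have "gsum A \<beta> (ps @ rs) = \<zero>\<^bsub>A\<^esub>"
    using sum_locally_zero[of _ "ps @ rs"] ps rs sum_closed[of "ps @ rs"] by (intro locally_zero_imp_zero) auto
  then have "gsum A \<beta> ps \<oplus>\<^bsub>A\<^esub> \<ominus>\<^bsub>A\<^esub> gsum A \<beta> qs = \<zero>\<^bsub>A\<^esub>"
    using A.gsum_append[of ps rs \<beta>] closed ps rs neg by (metis Un_iff subsetD)
  then have "\<ominus>\<^bsub>A\<^esub> (\<ominus>\<^bsub>A\<^esub> gsum A \<beta> qs) = gsum A \<beta> ps"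
    using sum_closed ps qs by (intro A.minus_equality) auto
  then show ?thesis using A.minus_minus sum_closed[OF qs] by simp
qed

text \<open>A presentation is chosen for every section. Since the resulting value depends only on
  the section, concatenated and rescaled presentations may be used to check linearity. Restriction
  to \<open>Cc_sections E\<close> fixes the map as a function of the logic.\<close>

lemma extension_exists:
  obtains \<alpha> where "\<alpha> \<in> extensional (Cc_sections E)" "linear_map (Cc_ring M) (Cc_module E \<pi>) A \<alpha>"
    "\<And>U f. (U, f) \<in> gens \<Longrightarrow> \<alpha> (pullback_ext E \<pi> U f) = \<beta> (U, f)"
proof
  define rep where "rep s = (SOME ps. set ps \<subseteq> gens \<and> s = gsum (Cc_module E \<pi>) pe ps)"
    for s :: "('e, 'k) germ_section"
  define \<alpha> where "\<alpha> = restrict (\<lambda>s. gsum A \<beta> (rep s)) (Cc_sections E)"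
  have rep: "set (rep s) \<subseteq> gens" "s = gsum (Cc_module E \<pi>) pe (rep s)" if "s \<in> Cc_sections E" for s
    using someI_ex[OF Cc_sections_generated[OF that]] unfolding rep_def by auto
  have \<alpha>: "\<alpha> (gsum (Cc_module E \<pi>) pe ps) = gsum A \<beta> ps" if "set ps \<subseteq> gens" for ps
  proof -
    have s: "gsum (Cc_module E \<pi>) pe ps \<in> Cc_sections E" by (rule gsum_pe_closed[OF that])
    show ?thesis using sum_well_defined[OF rep(1)[OF s] that rep(2)[OF s, symmetric]] s by (simp add: \<alpha>_def)
  qed
  show "\<alpha> \<in> extensional (Cc_sections E)" by (simp add: \<alpha>_def)
  show "\<alpha> (pullback_ext E \<pi> U f) = \<beta> (U, f)" if g: "(U, f) \<in> gens" for U f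
    using \<alpha>[of "[(U, f)]"] g closed[OF g] C.r_zero[of "pullback_ext E \<pi> U f"] pullback_ext_in_Cc_sections[OF g] by simp
  show "linear_map (Cc_ring M) (Cc_module E \<pi>) A \<alpha>"
    unfolding linear_map_def
  proof (intro conjI ballI)
    show "\<alpha> \<in> carrier (Cc_module E \<pi>) \<rightarrow> carrier A"
    proof
      fix s :: "('e, 'k) germ_section" assume "s \<in> carrier (Cc_module E \<pi>)"
      then obtain ps where "set ps \<subseteq> gens" "s = gsum (Cc_module E \<pi>) pe ps" using Cc_sections_generated by auto
      then show "\<alpha> s \<in> carrier A" using \<alpha> sum_closed by simp
    qed
  next
    fix s t :: "('e, 'k) germ_section" assume "s \<in> carrier (Cc_module E \<pi>)" "t \<in> carrier (Cc_module E \<pi>)"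
    then obtain ps qs where *: "set ps \<subseteq> gens" "s = gsum (Cc_module E \<pi>) pe ps"
      "set qs \<subseteq> gens" "t = gsum (Cc_module E \<pi>) pe qs" using Cc_sections_generated by (metis Cc_module_simps(1))
    then have "s \<oplus>\<^bsub>Cc_module E \<pi>\<^esub> t = gsum (Cc_module E \<pi>) pe (ps @ qs)"
      using C.gsum_append[of ps qs pe] pe_closed[of "ps @ qs"] by auto
    moreover have "gsum A \<beta> (ps @ qs) = gsum A \<beta> ps \<oplus>\<^bsub>A\<^esub> gsum A \<beta> qs"
      using closed * by (intro A.gsum_append) auto
    ultimately show "\<alpha> (s \<oplus>\<^bsub>Cc_module E \<pi>\<^esub> t) = \<alpha> s \<oplus>\<^bsub>A\<^esub> \<alpha> t"
      using \<alpha>[of "ps @ qs"] \<alpha>[of ps] \<alpha>[of qs] * by simp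
  next
    fix p :: "'m \<Rightarrow> 'k" and s :: "('e, 'k) germ_section"
    assume "p \<in> carrier (Cc_ring M)" "s \<in> carrier (Cc_module E \<pi>)"
    then obtain ps where p: "p \<in> Cc M" and ps: "set ps \<subseteq> gens" "s = gsum (Cc_module E \<pi>) pe ps"
      using Cc_sections_generated by auto
    let ?ps = "\<lambda>ps. map (\<lambda>(U, f). (U, \<lambda>x. p x * f x)) ps"
    have m: "set (?ps ps) \<subseteq> gens" using ps(1) gens_mult[OF _ p] by auto
    have "gsum A \<beta> (?ps ps) = p \<odot>\<^bsub>A\<^esub> gsum A \<beta> ps" using ps(1)
    proof (induction ps)
      case Nil
      then show ?case using nonunital_smult_zero[OF A] p by simp
    next
      case (Cons q ps)
      obtain U f where "q = (U, f)" by force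
      with Cons show ?case
        using linear[OF p, of U f] closed[of "(U, f)"] sum_closed[of ps] nonunital_moduleD(3)[OF A, of p "\<beta> (U, f)" "gsum A \<beta> ps"] p
        by simp
    qed
    then show "\<alpha> (p \<odot>\<^bsub>Cc_module E \<pi>\<^esub> s) = p \<odot>\<^bsub>A\<^esub> \<alpha> s"
      using \<alpha>[OF m] \<alpha>[OF ps(1)] unfolding ps(2) Cc_module_simps smult_gsum by simp
  qed
qed

end

context sheaf_over
begin

section \<open>Uniqueness of linear extensions and the submodules of sections that vanish at a
  point\<close>

lemma linear_map_unique:
  fixes \<alpha> \<beta> :: "('e, 'k::real_normed_field) germ_section \<Rightarrow> 'a"
  assumes A: "abelian_group A"
    and "\<alpha> \<in> extensional (Cc_sections E)" "linear_map (Cc_ring M) (Cc_module E \<pi>) A \<alpha>"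
    and "\<beta> \<in> extensional (Cc_sections E)" "linear_map (Cc_ring M) (Cc_module E \<pi>) A \<beta>"
    and "\<And>U f. (U, f) \<in> gens \<Longrightarrow> \<alpha> (pullback_ext E \<pi> U f) = \<beta> (pullback_ext E \<pi> U f)"
  shows "\<alpha> = \<beta>"
proof (rule extensionalityI[OF assms(2,4)])
  fix s :: "('e, 'k) germ_section" assume "s \<in> Cc_sections E"
  then show "\<alpha> s = \<beta> s"
  proof (induction rule: Cc_sections_induct)
    case zero
    show ?case
      using linear_map_zero[OF Cc_module_abelian_group A assms(3)] linear_map_zero[OF Cc_module_abelian_group A assms(5)]
      by simp
  next
    case (add s t)
    then show ?case using assms(3,5) by (simp add: linear_map_def)
  qed (use assms(6) in auto)
qed

text \<open>The key lemma with \<open>A\<close> the module itself identifies \<open>N\<^sub>x\<close> as the sections vanishing on the fibre.\<close>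

lemma compatible_family_self:
  "compatible_family M E \<pi> (Cc_module E \<pi> :: ('m \<Rightarrow> 'k::real_normed_field, ('e, 'k) germ_section) module) pe"
proof
  show "nonunital_module (Cc_ring M) (Cc_module E \<pi>)" by (rule Cc_module_nonunital)
  show "\<exists>r\<in>Cc M. r \<odot>\<^bsub>Cc_module E \<pi>\<^esub> a = a" if "a \<in> carrier (Cc_module E \<pi>)" for a :: "('e, 'k::real_normed_field) germ_section"
    using Cc_module_unitary that by simp
next
  fix p :: "'e set \<times> ('m \<Rightarrow> 'k::real_normed_field)" assume "p \<in> gens"
  then show "pe p \<in> carrier (Cc_module E \<pi>)" using pe_closed[of "[p]"] by simp
next
  fix U and f g :: "'m \<Rightarrow> 'k::real_normed_field"
  show "pe (U, \<lambda>x. f x + g x) = pe (U, f) \<oplus>\<^bsub>Cc_module E \<pi>\<^esub> pe (U, g)"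
    by (auto simp: pullback_ext_at germ_add_germ fun_eq_iff intro!: arg_cong[of _ _ "germ E _"])
next
  fix U p and f :: "'m \<Rightarrow> 'k::real_normed_field"
  show "pe (U, \<lambda>x. p x * f x) = p \<odot>\<^bsub>Cc_module E \<pi>\<^esub> pe (U, f)"
    using smult_pe[of p U f] by simp
next
  fix V U and f :: "'m \<Rightarrow> 'k::real_normed_field" assume g: "(V, f) \<in> gens" and VU: "V \<subseteq> U" and U: "elementary E \<pi> U"
  have "germ E y (\<lambda>z. if y \<in> V then f (\<pi> z) else 0) = germ E y (\<lambda>z. if y \<in> U then f (\<pi> z) else 0)" for y
  proof (cases "y \<in> U \<and> y \<notin> V")
    case True
    \<comment> \<open>A point \<open>y\<close> of \<open>U\<close> outside \<open>V\<close> cannot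
      lie over \<pi>(V), by injectivity on \<open>U\<close>; hence \<pi>(y) is off the support of
      \<open>f\<close>, and the larger pullback has germ 0 at \<open>y\<close>.\<close>
    have "openin (mtop E) (U \<inter> {z \<in> points E. \<pi> z \<in> points M - supp M f})"
      using openin_proj_vimage[OF openin_compl_supp] U by (auto simp: elementary_def)
    moreover have "\<pi> y \<notin> \<pi> ` V" using U VU True by (auto simp: elementary_def inj_on_def)
    then have "\<pi> y \<notin> supp M f" using gensD(3)[OF g] by auto
    then have "y \<in> U \<inter> {z \<in> points E. \<pi> z \<in> points M - supp M f}"
      using True elementary_points[OF U] proj_points by auto
    ultimately show ?thesis
      by (rule germ_eqI) (use True Cc_nonzero_in_supp[OF M gensD(2)[OF g]] in auto)
  next
    case False
    then have "y \<in> V \<longleftrightarrow> y \<in> U" using VU by blast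
    then show ?thesis by simp
  qed
  then show "pe (V, f) = pe (U, f)" by (auto simp: pullback_ext_at fun_eq_iff)
qed

text \<open>A function with germ 1 at \<open>x\<close> pulls back to germ 1 along the fibre and so
  leaves the germs of \<open>s\<close> there unchanged; if it annihilates \<open>s\<close>, they are
  0. Conversely \<open>sum_locally_zero\<close> gives a neighbourhood of \<open>x\<close> such that
  all functions supported in it annihilate \<open>s\<close>, among them a bump function with germ
  1.\<close>

lemma null_at_iff:
  fixes s :: "('e, 'k::real_normed_field) germ_section"
  assumes x: "x \<in> points M"
  shows "s \<in> null_at M (Cc_module E \<pi>) x \<longleftrightarrow>
    s \<in> Cc_sections E \<and> (\<forall>y\<in>points E. \<pi> y = x \<longrightarrow> s y = germ E y (\<lambda>_. 0))"
proof
  assume "s \<in> null_at M (Cc_module E \<pi>) x"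
  then obtain f where s: "s \<in> Cc_sections E" and f: "germ M x f = germ M x (\<lambda>_. 1)"
    "(\<lambda>y. germ_mult (germ E y (f \<circ> \<pi>)) (s y)) = (\<lambda>y. germ E y (\<lambda>_. 0))" by (auto simp: null_at_def)
  obtain H where Hs: "s = (\<lambda>y. germ E y (H y))" using germ_sectionE[OF Cc_sections_germ_section[OF s]] .
  obtain W where W: "openin (mtop M) W" "x \<in> W" "\<And>z. z \<in> W \<Longrightarrow> f z = 1" using germ_eqD[OF f(1)] x TM by metis
  have "s y = germ E y (\<lambda>_. 0)" if y: "y \<in> points E" "\<pi> y = x" for y
  proof -
    have "germ E y (f \<circ> \<pi>) = germ E y (\<lambda>_. 1)"
      by (rule germ_eqI[OF openin_proj_vimage[OF W(1)]]) (use y W in auto)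
    then have "germ_mult (germ E y (f \<circ> \<pi>)) (s y) = s y" by (simp add: Hs germ_mult_germ)
    then show ?thesis using f(2) by (metis (no_types))
  qed
  with s show "s \<in> Cc_sections E \<and> (\<forall>y\<in>points E. \<pi> y = x \<longrightarrow> s y = germ E y (\<lambda>_. 0))" by blast
next
  interpret F: compatible_family M E \<pi> "Cc_module E \<pi> :: ('m \<Rightarrow> 'k, ('e, 'k) germ_section) module" pe
    by (rule compatible_family_self)
  assume s: "s \<in> Cc_sections E \<and> (\<forall>y\<in>points E. \<pi> y = x \<longrightarrow> s y = germ E y (\<lambda>_. 0))"
  then obtain ps where ps: "set ps \<subseteq> gens" "s = gsum (Cc_module E \<pi>) pe ps" using Cc_sections_generated by blast
  then obtain W where W: "openin (mtop M) W" "x \<in> W"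
    "\<And>r. r \<in> Cc M \<Longrightarrow> supp M r \<subseteq> W \<Longrightarrow> r \<odot>\<^bsub>Cc_module E \<pi>\<^esub> s = \<zero>\<^bsub>Cc_module E \<pi>\<^esub>"
    using F.sum_locally_zero[OF x ps(1)] s by blast
  obtain \<rho> :: "'m \<Rightarrow> 'k" and N where \<rho>: "\<rho> \<in> Cc M" "supp M \<rho> \<subseteq> W" "openin (mtop M) N" "x \<in> N"
    "\<And>z. z \<in> N \<Longrightarrow> \<rho> z = 1" using Cc_bump[OF W(2,1)] by metis
  have "germ M x \<rho> = germ M x (\<lambda>_. 1)" by (rule germ_eqI[OF \<rho>(3,4,5)])
  then show "s \<in> null_at M (Cc_module E \<pi>) x"
    using s W(3)[OF \<rho>(1,2)] \<rho>(1) unfolding null_at_def by auto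
qed

end

section \<open>Tensor products\<close>

text \<open>Stated for abelian groups with a closed scalar action, so that stalks over
  \<open>germ_ring\<close> qualify as soon as closedness of their action is known.\<close>

locale tensor_pair = C: abelian_group C + D: abelian_group D
  for R :: "('r, 'x) ring_scheme" and C :: "('r, 'c, 'y) module_scheme" and D :: "('r, 'd, 'z) module_scheme" +
  assumes smult_closed: "r \<in> carrier R \<Longrightarrow> c \<in> carrier C \<Longrightarrow> r \<odot>\<^bsub>C\<^esub> c \<in> carrier C"
    "r \<in> carrier R \<Longrightarrow> d \<in> carrier D \<Longrightarrow> r \<odot>\<^bsub>D\<^esub> d \<in> carrier D"
begin

abbreviation G where "G \<equiv> tensor_gens C D"
abbreviation N where "N \<equiv> tensor_null R C D"
abbreviation T where "T \<equiv> tensor R C D"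
abbreviation cls where "cls \<equiv> tensor_class R C D"
abbreviation pure where "pure \<equiv> pure_tensor R C D"

definition rels :: "('c \<times> 'd \<Rightarrow>\<^sub>0 int) set" where
  "rels = {frag_of (c \<oplus>\<^bsub>C\<^esub> c', d) - frag_of (c, d) - frag_of (c', d) | c c' d.
         c \<in> carrier C \<and> c' \<in> carrier C \<and> d \<in> carrier D} \<union>
      {frag_of (c, d \<oplus>\<^bsub>D\<^esub> d') - frag_of (c, d) - frag_of (c, d') | c d d'.
         c \<in> carrier C \<and> d \<in> carrier D \<and> d' \<in> carrier D} \<union>
      {frag_of (r \<odot>\<^bsub>C\<^esub> c, d) - frag_of (c, r \<odot>\<^bsub>D\<^esub> d) | r c d.
         r \<in> carrier R \<and> c \<in> carrier C \<and> d \<in> carrier D}"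

lemma null_eq: "N = generate G rels"
  by (simp add: tensor_null_def rels_def)

sublocale G: comm_group G
  unfolding tensor_gens_def by (rule abelian_free_Abelian_group)

lemma G_simps [simp]: "x \<in> carrier G \<longleftrightarrow> Poly_Mapping.keys x \<subseteq> carrier C \<times> carrier D"
  "x \<otimes>\<^bsub>G\<^esub> y = x + y" "\<one>\<^bsub>G\<^esub> = 0"
  by (auto simp: tensor_gens_def)

lemma inv_G: "x \<in> carrier G \<Longrightarrow> inv\<^bsub>G\<^esub> x = - x"
  by (simp add: tensor_gens_def)

lemma frag_of_G: "c \<in> carrier C \<Longrightarrow> d \<in> carrier D \<Longrightarrow> frag_of (c, d) \<in> carrier G"
  by simp

lemma G_add: "x \<in> carrier G \<Longrightarrow> y \<in> carrier G \<Longrightarrow> x + y \<in> carrier G"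
  using G.m_closed[of x y] unfolding G_simps(2) .

lemma G_uminus: "x \<in> carrier G \<Longrightarrow> - x \<in> carrier G"
  using G.inv_closed[of x] inv_G by simp

lemma G_diff: "x \<in> carrier G \<Longrightarrow> y \<in> carrier G \<Longrightarrow> x - y \<in> carrier G"
  using G_add[OF _ G_uminus, of x y] by (simp only: add_uminus_conv_diff)

lemma rels_subset: "rels \<subseteq> carrier G"
proof -
  have 1: "frag_of (c \<oplus>\<^bsub>C\<^esub> c', d) - frag_of (c, d) - frag_of (c', d) \<in> carrier G"
    if "c \<in> carrier C" "c' \<in> carrier C" "d \<in> carrier D" for c c' d
    by (intro G_diff frag_of_G that C.a_closed)
  have 2: "frag_of (c, d \<oplus>\<^bsub>D\<^esub> d') - frag_of (c, d) - frag_of (c, d') \<in> carrier G"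
    if "c \<in> carrier C" "d \<in> carrier D" "d' \<in> carrier D" for c d d'
    by (intro G_diff frag_of_G that D.a_closed)
  have 3: "frag_of (r \<odot>\<^bsub>C\<^esub> c, d) - frag_of (c, r \<odot>\<^bsub>D\<^esub> d) \<in> carrier G"
    if "r \<in> carrier R" "c \<in> carrier C" "d \<in> carrier D" for r c d
    by (intro G_diff frag_of_G that smult_closed)
  show ?thesis unfolding rels_def
    by (intro subsetI; elim UnE CollectE exE conjE; simp only: 1 2 3)
qed

lemma null_subgroup: "subgroup N G"
  unfolding null_eq by (rule G.generate_is_subgroup[OF rels_subset])

lemma null_normal: "N \<lhd> G"
  by (rule G.subgroup_imp_normal[OF null_subgroup])

lemma rels_null: "t \<in> rels \<Longrightarrow> t \<in> N"
  unfolding null_eq by (rule generate.incl)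

lemma cls_eqI:
  assumes "t \<in> carrier G" "u \<in> carrier G" "t - u \<in> N"
  shows "cls t = cls u"
proof -
  have "t \<in> N #>\<^bsub>G\<^esub> u" unfolding r_coset_def using assms(3) by (force intro!: bexI[of _ "t - u"])
  then show ?thesis unfolding tensor_class_def using G.repr_independence[OF _ assms(2) null_subgroup] by simp
qed

lemma cls_mem:
  assumes "t \<in> carrier G" "u \<in> cls t"
  shows "u \<in> carrier G" "u - t \<in> N"
proof -
  obtain n where n: "n \<in> N" "u = n + t" using assms(2) by (auto simp: tensor_class_def r_coset_def)
  then show "u - t \<in> N" by simp
  show "u \<in> carrier G" unfolding n(2) using G_add[OF _ assms(1)] n(1) subgroup.mem_carrier[OF null_subgroup] by blast
qed

lemma cls_self: "t \<in> carrier G \<Longrightarrow> t \<in> cls t"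
  unfolding tensor_class_def by (rule G.rcos_self[OF _ null_subgroup])

lemma carrier_tensor: "carrier T = cls ` carrier G"
  by (simp add: tensor_def carrier_FactGroup tensor_class_def)

lemma tensor_abelian_group: "abelian_group T"
proof -
  interpret H: comm_group "G Mod N" by (rule G.abelian_FactGroup[OF null_subgroup])
  have T: "carrier T = carrier (G Mod N)" "add T = monoid.mult (G Mod N)" "zero T = one (G Mod N)"
    by (auto simp: tensor_def)
  show ?thesis
  proof (rule abelian_groupI; unfold T)
    fix x assume "x \<in> carrier (G Mod N)"
    then show "\<exists>y\<in>carrier (G Mod N). y \<otimes>\<^bsub>G Mod N\<^esub> x = \<one>\<^bsub>G Mod N\<^esub>"
      using H.l_inv_ex by blast
  qed (assumption | rule H.m_closed H.m_assoc H.m_comm H.l_one H.one_closed)+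
qed

sublocale T: abelian_group T by (rule tensor_abelian_group)

lemma cls_closed: "t \<in> carrier G \<Longrightarrow> cls t \<in> carrier T"
  by (auto simp: carrier_tensor)

lemma cls_add: "t \<in> carrier G \<Longrightarrow> u \<in> carrier G \<Longrightarrow> cls t \<oplus>\<^bsub>T\<^esub> cls u = cls (t + u)"
  using normal.rcos_sum[OF null_normal, of t u] by (simp add: tensor_def tensor_class_def)

lemma cls_zero: "cls 0 = \<zero>\<^bsub>T\<^esub>"
  using G.coset_mult_one[OF subgroup.subset[OF null_subgroup]] by (simp add: tensor_def tensor_class_def)

lemma pure_closed: "c \<in> carrier C \<Longrightarrow> d \<in> carrier D \<Longrightarrow> pure c d \<in> carrier T"
  unfolding pure_tensor_def by (intro cls_closed frag_of_G)

lemma pure_add_left: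
  assumes "c \<in> carrier C" "c' \<in> carrier C" "d \<in> carrier D"
  shows "pure (c \<oplus>\<^bsub>C\<^esub> c') d = pure c d \<oplus>\<^bsub>T\<^esub> pure c' d"
proof -
  have "frag_of (c \<oplus>\<^bsub>C\<^esub> c', d) - (frag_of (c, d) + frag_of (c', d)) \<in> N"
    using assms by (intro rels_null) (auto simp: rels_def diff_diff_eq)
  then have "cls (frag_of (c \<oplus>\<^bsub>C\<^esub> c', d)) = cls (frag_of (c, d) + frag_of (c', d))"
    by (rule cls_eqI[rotated 2]; intro G_add frag_of_G assms C.a_closed)
  then show ?thesis unfolding pure_tensor_def
    by (simp only: cls_add[OF frag_of_G frag_of_G] assms)
qed

lemma pure_balanced:
  assumes "r \<in> carrier R" "c \<in> carrier C" "d \<in> carrier D"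
  shows "pure (r \<odot>\<^bsub>C\<^esub> c) d = pure c (r \<odot>\<^bsub>D\<^esub> d)"
proof -
  have "frag_of (r \<odot>\<^bsub>C\<^esub> c, d) - frag_of (c, r \<odot>\<^bsub>D\<^esub> d) \<in> N"
    using assms by (intro rels_null) (auto simp: rels_def)
  then show ?thesis unfolding pure_tensor_def
    by (rule cls_eqI[rotated 2]; intro frag_of_G assms smult_closed)
qed

lemma pure_zero_left: "d \<in> carrier D \<Longrightarrow> pure \<zero>\<^bsub>C\<^esub> d = \<zero>\<^bsub>T\<^esub>"
  by (rule T.add_idem_zero[OF pure_closed])
    (simp_all only: pure_add_left[symmetric] C.zero_closed C.l_zero)

lemma pure_uminus_left:
  assumes "c \<in> carrier C" "d \<in> carrier D"
  shows "pure (\<ominus>\<^bsub>C\<^esub> c) d = \<ominus>\<^bsub>T\<^esub> pure c d"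
proof -
  have "pure (\<ominus>\<^bsub>C\<^esub> c) d \<oplus>\<^bsub>T\<^esub> pure c d = \<zero>\<^bsub>T\<^esub>"
    using pure_add_left[of "\<ominus>\<^bsub>C\<^esub> c" c d] pure_zero_left assms by (simp add: C.l_neg)
  then show ?thesis using T.minus_equality pure_closed assms by (metis C.a_inv_closed)
qed

lemma cls_uminus: "t \<in> carrier G \<Longrightarrow> cls (- t) = \<ominus>\<^bsub>T\<^esub> cls t"
  using cls_add[OF G_uminus, of t t] cls_zero T.minus_equality[of "cls (- t)" "cls t"] cls_closed G_uminus
  by simp

text \<open>Induction on the free group runs through differences, so the claim is proved for the
  classes of \<open>x\<close> and of \<open>-x\<close> together. Negatives of pure tensors do no
  harm, being pure themselves: the sign moves into the first factor.\<close>

lemma tensor_induct [consumes 1, case_names zero pure add]: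
  assumes "t \<in> carrier T" and zero: "P \<zero>\<^bsub>T\<^esub>"
    and pure: "\<And>c d. c \<in> carrier C \<Longrightarrow> d \<in> carrier D \<Longrightarrow> P (pure c d)"
    and add: "\<And>t u. t \<in> carrier T \<Longrightarrow> u \<in> carrier T \<Longrightarrow> P t \<Longrightarrow> P u \<Longrightarrow> P (t \<oplus>\<^bsub>T\<^esub> u)"
  shows "P t"
proof -
  obtain x where x: "x \<in> carrier G" "t = cls x" using assms(1) by (auto simp: carrier_tensor)
  have "x \<in> carrier G \<and> P (cls x) \<and> P (cls (- x))"
    using x(1)[unfolded G_simps(1)]
  proof (induction x rule: frag_induction)
    case zero
    then show ?case using \<open>P \<zero>\<^bsub>T\<^esub>\<close> by (simp add: cls_zero)
  next
    case (diff x y)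
    then have xy: "x \<in> carrier G" "y \<in> carrier G" "P (cls x)" "P (cls (- x))" "P (cls y)" "P (cls (- y))" by blast+
    have "cls (x - y) = cls x \<oplus>\<^bsub>T\<^esub> cls (- y)" "cls (- (x - y)) = cls (- x) \<oplus>\<^bsub>T\<^esub> cls y"
      using cls_add[OF xy(1) G_uminus[OF xy(2)]] cls_add[OF G_uminus[OF xy(1)] xy(2)] by simp_all
    then show ?case using xy add cls_closed G_uminus G_diff by metis
  next
    case (one a)
    then obtain c d where a: "a = (c, d)" "c \<in> carrier C" "d \<in> carrier D" by auto
    have "cls (- frag_of (c, d)) = pure (\<ominus>\<^bsub>C\<^esub> c) d"
      using pure_uminus_left[OF a(2,3)] cls_uminus[OF frag_of_G[OF a(2,3)]] by (simp add: pure_tensor_def)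
    then show ?case using pure[OF a(2,3)] pure[OF C.a_inv_closed[OF a(2)] a(3)] a
      by (simp add: pure_tensor_def)
  qed
  then show ?thesis using x by simp
qed

section \<open>Homomorphisms out of a tensor product\<close>

definition lift_sum :: "('r, 'a, 'w) module_scheme \<Rightarrow> ('c \<Rightarrow> 'd \<Rightarrow> 'a) \<Rightarrow> ('c \<times> 'd \<Rightarrow>\<^sub>0 int) \<Rightarrow> 'a" where
  "lift_sum A b t = (\<Oplus>\<^bsub>A\<^esub>p\<in>Poly_Mapping.keys t. [Poly_Mapping.lookup t p] \<cdot>\<^bsub>A\<^esub> b (fst p) (snd p))"

context
  fixes A :: "('r, 'a, 'w) module_scheme" and b :: "'c \<Rightarrow> 'd \<Rightarrow> 'a"
  assumes A: "abelian_group A"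
    and b_closed: "\<And>c d. c \<in> carrier C \<Longrightarrow> d \<in> carrier D \<Longrightarrow> b c d \<in> carrier A"
    and b_left: "\<And>c c' d. c \<in> carrier C \<Longrightarrow> c' \<in> carrier C \<Longrightarrow> d \<in> carrier D \<Longrightarrow> b (c \<oplus>\<^bsub>C\<^esub> c') d = b c d \<oplus>\<^bsub>A\<^esub> b c' d"
    and b_right: "\<And>c d d'. c \<in> carrier C \<Longrightarrow> d \<in> carrier D \<Longrightarrow> d' \<in> carrier D \<Longrightarrow> b c (d \<oplus>\<^bsub>D\<^esub> d') = b c d \<oplus>\<^bsub>A\<^esub> b c d'"
    and b_bal: "\<And>r c d. r \<in> carrier R \<Longrightarrow> c \<in> carrier C \<Longrightarrow> d \<in> carrier D \<Longrightarrow> b (r \<odot>\<^bsub>C\<^esub> c) d = b c (r \<odot>\<^bsub>D\<^esub> d)"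
begin

interpretation A: abelian_group A by (rule A)

text \<open>In \<open>t + u\<close> coefficients may cancel, so its keys can be fewer than those of
  \<open>t\<close> and \<open>u\<close>. Summing over a finite superset gives both sides of
  additivity the same index set.\<close>

lemma lift_sum_superset:
  assumes "finite K" "Poly_Mapping.keys t \<subseteq> K" "K \<subseteq> carrier C \<times> carrier D"
  shows "lift_sum A b t = (\<Oplus>\<^bsub>A\<^esub>p\<in>K. [Poly_Mapping.lookup t p] \<cdot>\<^bsub>A\<^esub> b (fst p) (snd p))"
  unfolding lift_sum_def
proof (rule A.add.finprod_mono_neutral_cong_left[OF assms(1,2)])
  show "(\<lambda>p. [Poly_Mapping.lookup t p] \<cdot>\<^bsub>A\<^esub> b (fst p) (snd p)) \<in> K \<rightarrow> carrier A"
    using assms(3) b_closed by (auto intro!: A.add.int_pow_closed)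
  show "[Poly_Mapping.lookup t p] \<cdot>\<^bsub>A\<^esub> b (fst p) (snd p) = \<zero>\<^bsub>A\<^esub>" if "p \<in> K - Poly_Mapping.keys t" for p
    using that by (simp add: in_keys_iff add_pow_def int_pow_0)
qed auto

lemma lift_sum_closed: "t \<in> carrier G \<Longrightarrow> lift_sum A b t \<in> carrier A"
  unfolding lift_sum_def using b_closed by (intro A.add.finprod_closed) (auto intro!: A.add.int_pow_closed)

lemma lift_sum_add:
  assumes "t \<in> carrier G" "u \<in> carrier G"
  shows "lift_sum A b (t + u) = lift_sum A b t \<oplus>\<^bsub>A\<^esub> lift_sum A b u"
proof -
  let ?K = "Poly_Mapping.keys t \<union> Poly_Mapping.keys u"
  have K: "finite ?K" "?K \<subseteq> carrier C \<times> carrier D" using assms by auto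
  have bK: "b (fst p) (snd p) \<in> carrier A" if "p \<in> ?K" for p using K(2) that b_closed by auto
  have "lift_sum A b (t + u) = (\<Oplus>\<^bsub>A\<^esub>p\<in>?K. [Poly_Mapping.lookup (t + u) p] \<cdot>\<^bsub>A\<^esub> b (fst p) (snd p))"
    by (rule lift_sum_superset[OF K(1) Poly_Mapping.keys_add K(2)])
  also have "\<dots> = (\<Oplus>\<^bsub>A\<^esub>p\<in>?K. [Poly_Mapping.lookup t p] \<cdot>\<^bsub>A\<^esub> b (fst p) (snd p) \<oplus>\<^bsub>A\<^esub> [Poly_Mapping.lookup u p] \<cdot>\<^bsub>A\<^esub> b (fst p) (snd p))"
  proof (rule A.add.finprod_cong')
    fix p assume p: "p \<in> ?K"
    show "[Poly_Mapping.lookup (t + u) p] \<cdot>\<^bsub>A\<^esub> b (fst p) (snd p) =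
      [Poly_Mapping.lookup t p] \<cdot>\<^bsub>A\<^esub> b (fst p) (snd p) \<oplus>\<^bsub>A\<^esub> [Poly_Mapping.lookup u p] \<cdot>\<^bsub>A\<^esub> b (fst p) (snd p)"
      using A.add.int_pow_mult[OF bK[OF p]] by (simp add: lookup_add)
  qed (use bK in \<open>auto intro!: A.add.int_pow_closed\<close>)
  also have "\<dots> = (\<Oplus>\<^bsub>A\<^esub>p\<in>?K. [Poly_Mapping.lookup t p] \<cdot>\<^bsub>A\<^esub> b (fst p) (snd p)) \<oplus>\<^bsub>A\<^esub>
      (\<Oplus>\<^bsub>A\<^esub>p\<in>?K. [Poly_Mapping.lookup u p] \<cdot>\<^bsub>A\<^esub> b (fst p) (snd p))"
    by (rule A.finsum_addf) (use bK in \<open>auto intro!: A.add.int_pow_closed\<close>)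
  finally show ?thesis using lift_sum_superset[OF K(1) _ K(2)] by simp
qed

lemma lift_sum_frag_of: "c \<in> carrier C \<Longrightarrow> d \<in> carrier D \<Longrightarrow> lift_sum A b (frag_of (c, d)) = b c d"
  unfolding lift_sum_def using b_closed[of c d] A.add.int_pow_1[of "b c d"] by simp

lemma lift_sum_hom: "group_hom G (add_monoid A) (lift_sum A b)"
proof (rule group_hom.intro[OF G.is_group A.a_group], rule group_hom_axioms.intro)
  show "lift_sum A b \<in> hom G (add_monoid A)"
    by (rule homI) (use lift_sum_closed lift_sum_add in \<open>auto simp del: G_simps(1)\<close>)
qed

lemma lift_sum_diff:
  assumes "t \<in> carrier G" "u \<in> carrier G" "lift_sum A b t = lift_sum A b u"
  shows "lift_sum A b (t - u) = \<zero>\<^bsub>A\<^esub>"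
proof -
  have "lift_sum A b (t - u) \<oplus>\<^bsub>A\<^esub> lift_sum A b u = lift_sum A b u"
    using lift_sum_add[OF G_diff[OF assms(1,2)] assms(2)] assms(3) by simp
  then show ?thesis
    using A.add.l_cancel_one lift_sum_closed G_diff assms A.a_comm by (metis A.add.r_cancel_one')
qed

text \<open>The kernel of the additive extension is a subgroup, and the hypotheses on
  \<open>b\<close> say that it contains each of the three kinds of relations.\<close>

lemma lift_sum_null:
  assumes "n \<in> N"
  shows "lift_sum A b n = \<zero>\<^bsub>A\<^esub>"
proof -
  interpret h: group_hom G "add_monoid A" "lift_sum A b" by (rule lift_sum_hom)
  have "rels \<subseteq> kernel G (add_monoid A) (lift_sum A b)"
  proof
    fix t assume t: "t \<in> rels"
    then have tG: "t \<in> carrier G" using rels_subset by blast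
    have 1: "lift_sum A b (frag_of (c \<oplus>\<^bsub>C\<^esub> c', d) - frag_of (c, d) - frag_of (c', d)) = \<zero>\<^bsub>A\<^esub>"
      if "c \<in> carrier C" "c' \<in> carrier C" "d \<in> carrier D" for c c' d
      unfolding diff_diff_eq using that b_left[OF that]
      by (intro lift_sum_diff) (simp_all only: lift_sum_add[OF frag_of_G frag_of_G] lift_sum_frag_of C.a_closed G_add frag_of_G)
    have 2: "lift_sum A b (frag_of (c, d \<oplus>\<^bsub>D\<^esub> d') - frag_of (c, d) - frag_of (c, d')) = \<zero>\<^bsub>A\<^esub>"
      if "c \<in> carrier C" "d \<in> carrier D" "d' \<in> carrier D" for c d d'
      unfolding diff_diff_eq using that b_right[OF that]
      by (intro lift_sum_diff) (simp_all only: lift_sum_add[OF frag_of_G frag_of_G] lift_sum_frag_of D.a_closed G_add frag_of_G)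
    have 3: "lift_sum A b (frag_of (r \<odot>\<^bsub>C\<^esub> c, d) - frag_of (c, r \<odot>\<^bsub>D\<^esub> d)) = \<zero>\<^bsub>A\<^esub>"
      if "r \<in> carrier R" "c \<in> carrier C" "d \<in> carrier D" for r c d
      using that b_bal[OF that]
      by (intro lift_sum_diff) (simp_all only: lift_sum_frag_of smult_closed frag_of_G)
    have "lift_sum A b t = \<zero>\<^bsub>A\<^esub>" using t unfolding rels_def by (auto simp only: Un_iff mem_Collect_eq 1 2 3)
    then show "t \<in> kernel G (add_monoid A) (lift_sum A b)" using tG by (simp add: kernel_def)
  qed
  then have "N \<subseteq> kernel G (add_monoid A) (lift_sum A b)"
    unfolding null_eq by (rule G.generate_subgroup_incl[OF _ h.subgroup_kernel])
  then show ?thesis using assms by (auto simp: kernel_def)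
qed

text \<open>Elements of a coset differ by relations, on which the extension vanishes; hence the
  image of the coset is a singleton and \<open>the_elem\<close> picks its element.\<close>

lemma tensor_lift_cls:
  assumes "t \<in> carrier G"
  shows "tensor_lift A b (cls t) = lift_sum A b t"
proof -
  have eq: "lift_sum A b u = lift_sum A b t" if "u \<in> cls t" for u
  proof -
    have "lift_sum A b ((u - t) + t) = lift_sum A b (u - t) \<oplus>\<^bsub>A\<^esub> lift_sum A b t"
      using lift_sum_add[OF G_diff[OF cls_mem(1)[OF assms that] assms] assms] .
    then show ?thesis using lift_sum_null[OF cls_mem(2)[OF assms that]] lift_sum_closed[OF assms] by simp
  qed
  have "the_elem (lift_sum A b ` cls t) = lift_sum A b t"
    by (rule the_elem_image_unique[OF _ eq]) (use cls_self[OF assms] in blast)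
  moreover have "tensor_lift A b (cls t) = the_elem (lift_sum A b ` cls t)"
    by (simp add: tensor_lift_def lift_sum_def)
  ultimately show ?thesis by simp
qed

lemma tensor_lift_pure: "c \<in> carrier C \<Longrightarrow> d \<in> carrier D \<Longrightarrow> tensor_lift A b (pure c d) = b c d"
  unfolding pure_tensor_def by (simp only: tensor_lift_cls frag_of_G lift_sum_frag_of)

lemma tensor_lift_add:
  "t \<in> carrier T \<Longrightarrow> u \<in> carrier T \<Longrightarrow> tensor_lift A b (t \<oplus>\<^bsub>T\<^esub> u) = tensor_lift A b t \<oplus>\<^bsub>A\<^esub> tensor_lift A b u"
  unfolding carrier_tensor by (auto simp only: cls_add tensor_lift_cls G_add lift_sum_add)

lemma tensor_lift_closed: "t \<in> carrier T \<Longrightarrow> tensor_lift A b t \<in> carrier A"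
  unfolding carrier_tensor by (auto simp only: tensor_lift_cls lift_sum_closed)

lemma tensor_lift_zero: "tensor_lift A b \<zero>\<^bsub>T\<^esub> = \<zero>\<^bsub>A\<^esub>"
  by (rule A.add_idem_zero[OF tensor_lift_closed])
    (simp_all only: tensor_lift_add[symmetric] T.zero_closed T.l_zero)

end

end

lemma tensor_pairI: "nonunital_module R C \<Longrightarrow> nonunital_module R D \<Longrightarrow> tensor_pair R C D"
  by (simp add: tensor_pair_def tensor_pair_axioms_def nonunital_moduleD)

text \<open>The two sides may have different scalars. It is enough that every scalar of the source
  is matched by one scalar of the target acting compatibly on both factors. This covers passage from
  functions to germs as well as multiplication of the first factor by a fixed scalar.\<close>

locale tensor_hom = P: tensor_pair R C D + Q: tensor_pair S C' D'
  for R :: "('r, 'x) ring_scheme" and C :: "('r, 'c, 'y) module_scheme" and D :: "('r, 'd, 'z) module_scheme"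
    and S :: "('s, 'x') ring_scheme" and C' :: "('s, 'c2, 'y') module_scheme" and D' :: "('s, 'd2, 'z') module_scheme" +
  fixes \<alpha> :: "'c \<Rightarrow> 'c2" and \<beta> :: "'d \<Rightarrow> 'd2"
  assumes \<alpha>_closed: "c \<in> carrier C \<Longrightarrow> \<alpha> c \<in> carrier C'"
    and \<beta>_closed: "d \<in> carrier D \<Longrightarrow> \<beta> d \<in> carrier D'"
    and \<alpha>_add: "c \<in> carrier C \<Longrightarrow> c' \<in> carrier C \<Longrightarrow> \<alpha> (c \<oplus>\<^bsub>C\<^esub> c') = \<alpha> c \<oplus>\<^bsub>C'\<^esub> \<alpha> c'"
    and \<beta>_add: "d \<in> carrier D \<Longrightarrow> d' \<in> carrier D \<Longrightarrow> \<beta> (d \<oplus>\<^bsub>D\<^esub> d') = \<beta> d \<oplus>\<^bsub>D'\<^esub> \<beta> d'"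
    and semilinear: "r \<in> carrier R \<Longrightarrow> \<exists>s\<in>carrier S. (\<forall>c\<in>carrier C. \<alpha> (r \<odot>\<^bsub>C\<^esub> c) = s \<odot>\<^bsub>C'\<^esub> \<alpha> c) \<and>
      (\<forall>d\<in>carrier D. \<beta> (r \<odot>\<^bsub>D\<^esub> d) = s \<odot>\<^bsub>D'\<^esub> \<beta> d)"
begin

abbreviation F where "F \<equiv> frag_extend (\<lambda>(c, d). frag_of (\<alpha> c, \<beta> d))"

lemma F_closed:
  assumes "t \<in> carrier P.G"
  shows "F t \<in> carrier Q.G"
proof -
  have "Poly_Mapping.keys t \<subseteq> carrier C \<times> carrier D" using assms by simp
  then show ?thesis
  proof (induction t rule: frag_induction)
    case (diff x y)
    then show ?case unfolding frag_extend_diff by (intro Q.G_diff)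
  next
    case (one a)
    then show ?case using \<alpha>_closed \<beta>_closed by (auto split: prod.splits)
  qed simp
qed

text \<open>The elements sent into the null subgroup form a subgroup, and each defining relation
  goes to a relation of the same kind, with the scalar replaced by the one from
  \<open>semilinear\<close>.\<close>

lemma F_null:
  assumes "n \<in> P.N"
  shows "F n \<in> Q.N"
proof -
  have hom: "group_hom P.G Q.G F"
  proof (rule group_hom.intro[OF P.G.is_group Q.G.is_group], rule group_hom_axioms.intro)
    show "F \<in> hom P.G Q.G"
      by (rule homI) (use F_closed in \<open>auto simp: frag_extend_add simp del: P.G_simps(1) Q.G_simps(1)\<close>)
  qed
  interpret h: group_hom P.G Q.G F by (rule hom)
  have "subgroup {t \<in> carrier P.G. F t \<in> Q.N} P.G"
  proof
    fix x assume "x \<in> {t \<in> carrier P.G. F t \<in> Q.N}"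
    then have x: "x \<in> carrier P.G" "F x \<in> Q.N" by blast+
    then show "inv\<^bsub>P.G\<^esub> x \<in> {t \<in> carrier P.G. F t \<in> Q.N}"
      using h.hom_inv[OF x(1)] subgroup.m_inv_closed[OF Q.null_subgroup x(2)] P.G.inv_closed[OF x(1)] by simp
    fix y assume "y \<in> {t \<in> carrier P.G. F t \<in> Q.N}"
    then have y: "y \<in> carrier P.G" "F y \<in> Q.N" by blast+
    then show "x \<otimes>\<^bsub>P.G\<^esub> y \<in> {t \<in> carrier P.G. F t \<in> Q.N}"
      using h.hom_mult[OF x(1) y(1)] subgroup.m_closed[OF Q.null_subgroup x(2) y(2)] P.G.m_closed[OF x(1) y(1)] by simp
  qed (use subgroup.one_closed[OF Q.null_subgroup] in auto)
  moreover have "P.rels \<subseteq> {t \<in> carrier P.G. F t \<in> Q.N}"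
  proof
    fix t assume t: "t \<in> P.rels"
    then have tG: "t \<in> carrier P.G" using P.rels_subset by blast
    have "F t \<in> Q.rels"
    proof -
      from t consider (1) c c' d where "t = frag_of (c \<oplus>\<^bsub>C\<^esub> c', d) - frag_of (c, d) - frag_of (c', d)"
          "c \<in> carrier C" "c' \<in> carrier C" "d \<in> carrier D"
        | (2) c d d' where "t = frag_of (c, d \<oplus>\<^bsub>D\<^esub> d') - frag_of (c, d) - frag_of (c, d')"
          "c \<in> carrier C" "d \<in> carrier D" "d' \<in> carrier D"
        | (3) r c d where "t = frag_of (r \<odot>\<^bsub>C\<^esub> c, d) - frag_of (c, r \<odot>\<^bsub>D\<^esub> d)"
          "r \<in> carrier R" "c \<in> carrier C" "d \<in> carrier D"
        unfolding P.rels_def by blast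
      then show ?thesis
      proof cases
        case 1
        then have "F t = frag_of (\<alpha> c \<oplus>\<^bsub>C'\<^esub> \<alpha> c', \<beta> d) - frag_of (\<alpha> c, \<beta> d) - frag_of (\<alpha> c', \<beta> d)"
          by (simp add: frag_extend_diff \<alpha>_add)
        then show ?thesis unfolding Q.rels_def using 1 \<alpha>_closed \<beta>_closed by blast
      next
        case 2
        then have "F t = frag_of (\<alpha> c, \<beta> d \<oplus>\<^bsub>D'\<^esub> \<beta> d') - frag_of (\<alpha> c, \<beta> d) - frag_of (\<alpha> c, \<beta> d')"
          by (simp add: frag_extend_diff \<beta>_add)
        then show ?thesis unfolding Q.rels_def using 2 \<alpha>_closed \<beta>_closed by blast
      next
        case 3
        obtain s where s: "s \<in> carrier S" "\<alpha> (r \<odot>\<^bsub>C\<^esub> c) = s \<odot>\<^bsub>C'\<^esub> \<alpha> c" "\<beta> (r \<odot>\<^bsub>D\<^esub> d) = s \<odot>\<^bsub>D'\<^esub> \<beta> d"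
          using semilinear[OF 3(2)] 3(3,4) by blast
        then have "F t = frag_of (s \<odot>\<^bsub>C'\<^esub> \<alpha> c, \<beta> d) - frag_of (\<alpha> c, s \<odot>\<^bsub>D'\<^esub> \<beta> d)"
          using 3 by (simp add: frag_extend_diff)
        then show ?thesis unfolding Q.rels_def using 3 s \<alpha>_closed \<beta>_closed by blast
      qed
    qed
    then show "t \<in> {t \<in> carrier P.G. F t \<in> Q.N}" using tG Q.rels_null by blast
  qed
  ultimately have "P.N \<subseteq> {t \<in> carrier P.G. F t \<in> Q.N}"
    unfolding P.null_eq by (intro P.G.generate_subgroup_incl)
  then show ?thesis using assms by blast
qed

lemma tensor_map_cls:
  assumes "t \<in> carrier P.G"
  shows "tensor_map S C' D' \<alpha> \<beta> (P.cls t) = Q.cls (F t)"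
proof -
  have eq: "Q.cls (F u) = Q.cls (F t)" if "u \<in> P.cls t" for u
    by (rule Q.cls_eqI)
      (use F_closed P.cls_mem[OF assms that] assms F_null in \<open>auto simp: frag_extend_diff[symmetric] simp del: P.G_simps Q.G_simps\<close>)
  have "the_elem ((\<lambda>u. Q.cls (F u)) ` P.cls t) = Q.cls (F t)"
    by (rule the_elem_image_unique[OF _ eq]) (use P.cls_self[OF assms] in blast)
  then show ?thesis by (simp add: tensor_map_def)
qed

lemma tensor_map_closed: "t \<in> carrier P.T \<Longrightarrow> tensor_map S C' D' \<alpha> \<beta> t \<in> carrier Q.T"
  unfolding P.carrier_tensor Q.carrier_tensor by (auto simp: tensor_map_cls F_closed simp del: P.G_simps Q.G_simps)

lemma tensor_map_pure:
  "c \<in> carrier C \<Longrightarrow> d \<in> carrier D \<Longrightarrow> tensor_map S C' D' \<alpha> \<beta> (P.pure c d) = Q.pure (\<alpha> c) (\<beta> d)"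
  unfolding pure_tensor_def by (simp add: tensor_map_cls[OF P.frag_of_G])

lemma tensor_map_add:
  "t \<in> carrier P.T \<Longrightarrow> u \<in> carrier P.T \<Longrightarrow>
    tensor_map S C' D' \<alpha> \<beta> (t \<oplus>\<^bsub>P.T\<^esub> u) = tensor_map S C' D' \<alpha> \<beta> t \<oplus>\<^bsub>Q.T\<^esub> tensor_map S C' D' \<alpha> \<beta> u"
  unfolding P.carrier_tensor
  by (auto simp only: P.cls_add tensor_map_cls P.G_add frag_extend_add Q.cls_add F_closed)

lemma tensor_map_zero: "tensor_map S C' D' \<alpha> \<beta> \<zero>\<^bsub>P.T\<^esub> = \<zero>\<^bsub>Q.T\<^esub>"
  by (rule Q.T.add_idem_zero[OF tensor_map_closed])
    (simp_all only: tensor_map_add[symmetric] P.T.zero_closed P.T.l_zero)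

end

section \<open>The module structure of a tensor product\<close>

lemma smult_tensor: "smult (tensor R C D) r = tensor_map R C D (smult C r) (\<lambda>d. d)"
  by (simp add: tensor_def)

text \<open>Commutativity of the ring is what makes multiplication in the first factor balanced:
  each scalar is matched by itself.\<close>

lemma tensor_hom_smult:
  assumes C: "nonunital_module R C" and D: "nonunital_module R D" and r: "r \<in> carrier R"
    and comm: "\<And>r s. r \<in> carrier R \<Longrightarrow> s \<in> carrier R \<Longrightarrow> r \<otimes>\<^bsub>R\<^esub> s = s \<otimes>\<^bsub>R\<^esub> r"
  shows "tensor_hom R C D R C D (smult C r) (\<lambda>d. d)"
proof -
  interpret tensor_pair R C D by (rule tensor_pairI[OF C D])
  show ?thesis
  proof
    fix s assume s: "s \<in> carrier R"
    have "r \<odot>\<^bsub>C\<^esub> (s \<odot>\<^bsub>C\<^esub> c) = s \<odot>\<^bsub>C\<^esub> (r \<odot>\<^bsub>C\<^esub> c)" if "c \<in> carrier C" for c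
      using nonunital_moduleD(5)[OF C r s that] nonunital_moduleD(5)[OF C s r that] comm[OF r s] by simp
    then show "\<exists>s'\<in>carrier R. (\<forall>c\<in>carrier C. r \<odot>\<^bsub>C\<^esub> (s \<odot>\<^bsub>C\<^esub> c) = s' \<odot>\<^bsub>C\<^esub> (r \<odot>\<^bsub>C\<^esub> c)) \<and>
      (\<forall>d\<in>carrier D. s \<odot>\<^bsub>D\<^esub> d = s' \<odot>\<^bsub>D\<^esub> d)" using s by blast
  qed (use nonunital_moduleD(2,3)[OF C r] in auto)
qed

lemma tensor_nonunital_module:
  assumes C: "nonunital_module R C" and D: "nonunital_module R D"
    and ring: "\<And>r s. r \<in> carrier R \<Longrightarrow> s \<in> carrier R \<Longrightarrow> r \<otimes>\<^bsub>R\<^esub> s = s \<otimes>\<^bsub>R\<^esub> r"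
      "\<And>r s. r \<in> carrier R \<Longrightarrow> s \<in> carrier R \<Longrightarrow> r \<otimes>\<^bsub>R\<^esub> s \<in> carrier R"
      "\<And>r s. r \<in> carrier R \<Longrightarrow> s \<in> carrier R \<Longrightarrow> r \<oplus>\<^bsub>R\<^esub> s \<in> carrier R"
  shows "nonunital_module R (tensor R C D)"
    and "r \<in> carrier R \<Longrightarrow> c \<in> carrier C \<Longrightarrow> d \<in> carrier D \<Longrightarrow>
      r \<odot>\<^bsub>tensor R C D\<^esub> pure_tensor R C D c d = pure_tensor R C D (r \<odot>\<^bsub>C\<^esub> c) d"
proof -
  interpret tensor_pair R C D by (rule tensor_pairI[OF C D])
  note hom = tensor_hom_smult[OF C D _ ring(1)]
  note closedT = tensor_hom.tensor_map_closed[OF hom, folded smult_tensor]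
    and addT = tensor_hom.tensor_map_add[OF hom, folded smult_tensor]
    and pureT = tensor_hom.tensor_map_pure[OF hom, folded smult_tensor]
    and zeroT = tensor_hom.tensor_map_zero[OF hom, folded smult_tensor]
  show "r \<odot>\<^bsub>T\<^esub> pure c d = pure (r \<odot>\<^bsub>C\<^esub> c) d" if "r \<in> carrier R" "c \<in> carrier C" "d \<in> carrier D"
    using pureT that by simp
  have 1: "(r \<oplus>\<^bsub>R\<^esub> s) \<odot>\<^bsub>T\<^esub> t = r \<odot>\<^bsub>T\<^esub> t \<oplus>\<^bsub>T\<^esub> s \<odot>\<^bsub>T\<^esub> t"
    if rs: "r \<in> carrier R" "s \<in> carrier R" and "t \<in> carrier T" for r s t
    using that(3)
  proof (induction rule: tensor_induct)
    case zero
    then show ?case using rs ring(3) by (simp add: zeroT)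
  next
    case (pure c d)
    then show ?case using rs ring(3) smult_closed(1) nonunital_moduleD(4)[OF C rs]
      by (simp add: pureT pure_add_left)
  next
    case (add t u)
    then show ?case using rs ring(3) closedT by (simp add: addT T.a_ac)
  qed
  have 2: "(r \<otimes>\<^bsub>R\<^esub> s) \<odot>\<^bsub>T\<^esub> t = r \<odot>\<^bsub>T\<^esub> (s \<odot>\<^bsub>T\<^esub> t)"
    if rs: "r \<in> carrier R" "s \<in> carrier R" and "t \<in> carrier T" for r s t
    using that(3)
  proof (induction rule: tensor_induct)
    case zero
    then show ?case using rs ring(2) by (simp add: zeroT)
  next
    case (pure c d)
    then show ?case using rs ring(2) smult_closed(1) nonunital_moduleD(5)[OF C rs]
      by (simp add: pureT)
  next
    case (add t u)
    then show ?case using rs ring(2) closedT by (simp add: addT)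
  qed
  show "nonunital_module R T"
    unfolding nonunital_module_def using tensor_abelian_group closedT addT 1 2 by auto
qed

section \<open>Stalks of modules and coalgebras\<close>

locale module_at = hausdorff_manifold M
  for M :: "('m, 'b::euclidean_space) manifold" +
  fixes A :: "('m \<Rightarrow> 'k::real_normed_field, 'a, 'z) module_scheme" and x :: 'm
  assumes A: "nonunital_module (Cc_ring M) A" and x: "x \<in> points M"
begin

sublocale A: abelian_group A by (rule nonunital_moduleD(1)[OF A])

lemma xT: "x \<in> topspace (mtop M)"
  using x TM by simp

lemma smult_closed: "f \<in> Cc M \<Longrightarrow> a \<in> carrier A \<Longrightarrow> f \<odot>\<^bsub>A\<^esub> a \<in> carrier A"
  and smult_add: "f \<in> Cc M \<Longrightarrow> a \<in> carrier A \<Longrightarrow> b \<in> carrier A \<Longrightarrow>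
    f \<odot>\<^bsub>A\<^esub> (a \<oplus>\<^bsub>A\<^esub> b) = (f \<odot>\<^bsub>A\<^esub> a) \<oplus>\<^bsub>A\<^esub> (f \<odot>\<^bsub>A\<^esub> b)"
  and add_smult: "f \<in> Cc M \<Longrightarrow> g \<in> Cc M \<Longrightarrow> a \<in> carrier A \<Longrightarrow>
    (\<lambda>z. f z + g z) \<odot>\<^bsub>A\<^esub> a = (f \<odot>\<^bsub>A\<^esub> a) \<oplus>\<^bsub>A\<^esub> (g \<odot>\<^bsub>A\<^esub> a)"
  and mult_smult: "f \<in> Cc M \<Longrightarrow> g \<in> Cc M \<Longrightarrow> a \<in> carrier A \<Longrightarrow> (\<lambda>z. f z * g z) \<odot>\<^bsub>A\<^esub> a = f \<odot>\<^bsub>A\<^esub> (g \<odot>\<^bsub>A\<^esub> a)"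
  using nonunital_moduleD[OF A] by auto

lemma smult_zero: "f \<in> Cc M \<Longrightarrow> f \<odot>\<^bsub>A\<^esub> \<zero>\<^bsub>A\<^esub> = \<zero>\<^bsub>A\<^esub>"
  using nonunital_smult_zero[OF A] by simp

lemma smult_uminus: "f \<in> Cc M \<Longrightarrow> a \<in> carrier A \<Longrightarrow> f \<odot>\<^bsub>A\<^esub> (\<ominus>\<^bsub>A\<^esub> a) = \<ominus>\<^bsub>A\<^esub> (f \<odot>\<^bsub>A\<^esub> a)"
  using nonunital_smult_minus[OF A] by simp

lemma zero_smult:
  assumes "a \<in> carrier A"
  shows "(\<lambda>_. 0) \<odot>\<^bsub>A\<^esub> a = \<zero>\<^bsub>A\<^esub>"
proof (rule A.add_idem_zero[OF smult_closed[OF Cc_zero assms]])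
  show "(\<lambda>_. 0) \<odot>\<^bsub>A\<^esub> a \<oplus>\<^bsub>A\<^esub> (\<lambda>_. 0) \<odot>\<^bsub>A\<^esub> a = (\<lambda>_. 0) \<odot>\<^bsub>A\<^esub> a"
    using add_smult[OF Cc_zero Cc_zero assms] unfolding add_0 by (rule sym)
qed

lemma diff_smult:
  assumes "f \<in> Cc M" "g \<in> Cc M" "a \<in> carrier A"
  shows "(\<lambda>z. f z - g z) \<odot>\<^bsub>A\<^esub> a = (f \<odot>\<^bsub>A\<^esub> a) \<ominus>\<^bsub>A\<^esub> (g \<odot>\<^bsub>A\<^esub> a)"
proof -
  have "(\<lambda>z. (f z - g z) + g z) \<odot>\<^bsub>A\<^esub> a = ((\<lambda>z. f z - g z) \<odot>\<^bsub>A\<^esub> a) \<oplus>\<^bsub>A\<^esub> (g \<odot>\<^bsub>A\<^esub> a)"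
    by (rule add_smult[OF Cc_diff assms(2,3)]) (use assms in auto)
  then have "f \<odot>\<^bsub>A\<^esub> a = ((\<lambda>z. f z - g z) \<odot>\<^bsub>A\<^esub> a) \<oplus>\<^bsub>A\<^esub> (g \<odot>\<^bsub>A\<^esub> a)" by simp
  then show ?thesis
    using smult_closed[OF Cc_diff] smult_closed assms by (simp add: A.minus_eq A.a_assoc A.r_neg)
qed

abbreviation N where "N \<equiv> null_at M A x"
abbreviation cl where "cl \<equiv> stalk_class M A x"
abbreviation S where "S \<equiv> stalk M A x"

lemma null_iff: "a \<in> N \<longleftrightarrow> a \<in> carrier A \<and> (\<exists>f\<in>Cc M. germ M x f = germ M x (\<lambda>_. 1) \<and> f \<odot>\<^bsub>A\<^esub> a = \<zero>\<^bsub>A\<^esub>)"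
  by (simp add: null_at_def)

lemma unit_germ_exists:
  assumes "openin (mtop M) W" "x \<in> W"
  obtains \<rho> where "\<rho> \<in> Cc M" "supp M \<rho> \<subseteq> W" "germ M x \<rho> = germ M x (\<lambda>_. 1 :: 'k)"
proof -
  obtain \<rho> :: "'m \<Rightarrow> 'k" and N where \<rho>: "\<rho> \<in> Cc M" "supp M \<rho> \<subseteq> W" "openin (mtop M) N" "x \<in> N" "\<And>z. z \<in> N \<Longrightarrow> \<rho> z = 1"
    using Cc_bump[OF assms(2,1)] by metis
  show ?thesis by (rule that[OF \<rho>(1,2) germ_eqI[OF \<rho>(3,4,5)]])
qed

lemma null_add:
  assumes "a \<in> N" "b \<in> N"
  shows "a \<oplus>\<^bsub>A\<^esub> b \<in> N"
proof -
  obtain f g where *: "f \<in> Cc M" "germ M x f = germ M x (\<lambda>_. 1)" "f \<odot>\<^bsub>A\<^esub> a = \<zero>\<^bsub>A\<^esub>" "a \<in> carrier A"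
    "g \<in> Cc M" "germ M x g = germ M x (\<lambda>_. 1)" "g \<odot>\<^bsub>A\<^esub> b = \<zero>\<^bsub>A\<^esub>" "b \<in> carrier A"
    using assms by (auto simp: null_iff)
  have "germ M x (\<lambda>z. f z * g z) = germ M x (\<lambda>_. 1)"
    using germ_mult_germ[of M x f g] germ_mult_germ[of M x "\<lambda>_. 1::'k" "\<lambda>_. 1"] *(2,6) by simp
  moreover have "(\<lambda>z. f z * g z) \<odot>\<^bsub>A\<^esub> a = \<zero>\<^bsub>A\<^esub>"
    using mult_smult[OF *(5,1,4)] *(3) smult_zero[OF *(5)] by (simp add: mult.commute[of "f _"])
  moreover have "(\<lambda>z. f z * g z) \<odot>\<^bsub>A\<^esub> b = \<zero>\<^bsub>A\<^esub>"
    using mult_smult[OF *(1,5,8)] *(7) smult_zero[OF *(1)] by simp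
  ultimately show ?thesis
    using Cc_mult[OF *(1,5)] smult_add[OF Cc_mult[OF *(1,5)] *(4,8)] *(4,8) unfolding null_iff by auto
qed

lemma null_uminus: "a \<in> N \<Longrightarrow> \<ominus>\<^bsub>A\<^esub> a \<in> N"
  unfolding null_iff using smult_uminus A.minus_equality[of "\<zero>\<^bsub>A\<^esub>" "\<zero>\<^bsub>A\<^esub>"] by auto

lemma null_smult:
  assumes "f \<in> Cc M" "a \<in> N"
  shows "f \<odot>\<^bsub>A\<^esub> a \<in> N"
proof -
  obtain g where g: "g \<in> Cc M" "germ M x g = germ M x (\<lambda>_. 1)" "g \<odot>\<^bsub>A\<^esub> a = \<zero>\<^bsub>A\<^esub>" "a \<in> carrier A"
    using assms by (auto simp: null_iff)
  have "g \<odot>\<^bsub>A\<^esub> (f \<odot>\<^bsub>A\<^esub> a) = f \<odot>\<^bsub>A\<^esub> (g \<odot>\<^bsub>A\<^esub> a)"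
    unfolding mult_smult[OF g(1) assms(1) g(4), symmetric] mult_smult[OF assms(1) g(1,4), symmetric]
    by (simp add: mult.commute)
  then show ?thesis using g smult_zero smult_closed assms(1) unfolding null_iff by auto
qed

text \<open>A function supported where \<open>f\<close> vanishes, with germ 1 at \<open>x\<close>,
  has product 0 with \<open>f\<close> and thus annihilates \<open>f a\<close>.\<close>

lemma null_of_zero_germ:
  assumes "f \<in> Cc M" "germ M x f = germ M x (\<lambda>_. 0)" "a \<in> carrier A"
  shows "f \<odot>\<^bsub>A\<^esub> a \<in> N"
proof -
  obtain W where W: "openin (mtop M) W" "x \<in> W" "\<And>z. z \<in> W \<Longrightarrow> f z = 0"
    using germ_eqD[OF assms(2) xT] by blast
  obtain \<rho> where \<rho>: "\<rho> \<in> Cc M" "supp M \<rho> \<subseteq> W" "germ M x \<rho> = germ M x (\<lambda>_. 1 :: 'k)"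
    using unit_germ_exists[OF W(1,2)] .
  have "(\<lambda>z. \<rho> z * f z) = (\<lambda>_. 0)"
    using W(3) Cc_nonzero_in_supp[OF M \<rho>(1)] \<rho>(2) by (intro HOL.ext) auto
  then have "\<rho> \<odot>\<^bsub>A\<^esub> (f \<odot>\<^bsub>A\<^esub> a) = \<zero>\<^bsub>A\<^esub>"
    using mult_smult[OF \<rho>(1) assms(1,3)] zero_smult[OF assms(3)] by simp
  then show ?thesis using \<rho> smult_closed assms unfolding null_iff by blast
qed

lemma null_zero: "\<zero>\<^bsub>A\<^esub> \<in> N"
  using null_of_zero_germ[OF Cc_zero refl A.zero_closed] smult_zero[OF Cc_zero] by simp

lemma null_subgroup: "subgroup N (add_monoid A)"
proof (rule group.subgroupI[OF A.a_group])
  show "N \<subseteq> carrier (add_monoid A)" by (auto simp: null_iff)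
  show "N \<noteq> {}" using null_zero by blast
qed (use null_add null_uminus in \<open>auto simp: a_inv_def[symmetric]\<close>)

lemma stalk_class_iff: "b \<in> cl a \<longleftrightarrow> (\<exists>n\<in>N. b = n \<oplus>\<^bsub>A\<^esub> a)"
  by (auto simp: stalk_class_def a_r_coset_def')

lemma stalk_class_memD:
  assumes "a \<in> carrier A" "b \<in> cl a"
  shows "b \<in> carrier A" "b \<ominus>\<^bsub>A\<^esub> a \<in> N"
proof -
  obtain n where n: "n \<in> N" "b = n \<oplus>\<^bsub>A\<^esub> a" using assms(2) by (auto simp: stalk_class_iff)
  have nA: "n \<in> carrier A" using n(1) by (simp add: null_iff)
  then show "b \<in> carrier A" using n assms by simp
  have "b \<ominus>\<^bsub>A\<^esub> a = n" using nA assms(1) by (simp add: n(2) A.minus_eq A.a_assoc A.r_neg)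
  then show "b \<ominus>\<^bsub>A\<^esub> a \<in> N" using n(1) by simp
qed

lemma stalk_class_eqI:
  assumes "a \<in> carrier A" "b \<in> carrier A" "b \<ominus>\<^bsub>A\<^esub> a \<in> N"
  shows "cl b = cl a"
proof -
  have "b = (b \<ominus>\<^bsub>A\<^esub> a) \<oplus>\<^bsub>A\<^esub> a" using assms by (simp add: A.minus_eq A.a_assoc A.l_neg)
  then have "b \<in> cl a" unfolding stalk_class_iff using assms(3) by blast
  then have "b \<in> N #>\<^bsub>add_monoid A\<^esub> a" by (simp add: stalk_class_def a_r_coset_def)
  then show ?thesis
    unfolding stalk_class_def a_r_coset_def
    using group.repr_independence[OF A.a_group _ _ null_subgroup] assms(1) by simp
qed

lemma stalk_class_self: "a \<in> carrier A \<Longrightarrow> a \<in> cl a"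
  unfolding stalk_class_iff using null_zero by (intro bexI[of _ "\<zero>\<^bsub>A\<^esub>"]) auto

lemma stalk_class_eq_iff:
  assumes "a \<in> carrier A" "b \<in> carrier A"
  shows "cl b = cl a \<longleftrightarrow> b \<ominus>\<^bsub>A\<^esub> a \<in> N"
  using stalk_class_eqI[OF assms] stalk_class_memD(2)[OF assms(1)] stalk_class_self[OF assms(2)] by blast

lemma carrier_stalk: "carrier S = cl ` carrier A"
  by (auto simp: stalk_def A_FactGroup_def carrier_FactGroup stalk_class_def a_r_coset_def)

lemma stalk_class_add: "a \<in> carrier A \<Longrightarrow> b \<in> carrier A \<Longrightarrow> cl a \<oplus>\<^bsub>S\<^esub> cl b = cl (a \<oplus>\<^bsub>A\<^esub> b)"
  using normal.rcos_sum[OF comm_group.subgroup_imp_normal[OF A.a_comm_group null_subgroup], of a b]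
  by (simp add: stalk_def A_FactGroup_def stalk_class_def a_r_coset_def)

lemma stalk_abelian_group: "abelian_group S"
proof -
  interpret Q: comm_group "add_monoid A Mod N" by (rule comm_group.abelian_FactGroup[OF A.a_comm_group null_subgroup])
  have T: "carrier S = carrier (add_monoid A Mod N)" "add S = monoid.mult (add_monoid A Mod N)" "zero S = one (add_monoid A Mod N)"
    by (auto simp: stalk_def A_FactGroup_def)
  show ?thesis
  proof (rule abelian_groupI; unfold T)
    fix z assume "z \<in> carrier (add_monoid A Mod N)"
    then show "\<exists>y\<in>carrier (add_monoid A Mod N). y \<otimes>\<^bsub>add_monoid A Mod N\<^esub> z = \<one>\<^bsub>add_monoid A Mod N\<^esub>"
      using Q.l_inv_ex by blast
  qed (assumption | rule Q.m_closed Q.m_assoc Q.m_comm Q.l_one Q.one_closed)+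
qed

text \<open>From f b - g a = f (b - a) + (f - g) a: the first summand is null because
  \<open>b - a\<close> is, the second because \<open>f - g\<close> has germ 0. This is the
  independence of choices behind the \<open>the_elem\<close> in the action of germs on the
  stalk.\<close>

lemma stalk_class_smult_cong:
  assumes "f \<in> Cc M" "g \<in> Cc M" "germ M x f = germ M x g" "a \<in> carrier A" "b \<in> cl a"
  shows "cl (f \<odot>\<^bsub>A\<^esub> b) = cl (g \<odot>\<^bsub>A\<^esub> a)"
proof -
  note b = stalk_class_memD[OF assms(4,5)]
  have ab: "b = (b \<ominus>\<^bsub>A\<^esub> a) \<oplus>\<^bsub>A\<^esub> a" using assms(4) b(1) by (simp add: A.minus_eq A.a_assoc A.l_neg)
  have c: "b \<ominus>\<^bsub>A\<^esub> a \<in> carrier A" using b(2) by (simp add: null_iff)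
  have "f \<odot>\<^bsub>A\<^esub> b = f \<odot>\<^bsub>A\<^esub> (b \<ominus>\<^bsub>A\<^esub> a) \<oplus>\<^bsub>A\<^esub> f \<odot>\<^bsub>A\<^esub> a"
    using smult_add[OF assms(1) c assms(4)] ab by simp
  then have "f \<odot>\<^bsub>A\<^esub> b \<ominus>\<^bsub>A\<^esub> g \<odot>\<^bsub>A\<^esub> a = f \<odot>\<^bsub>A\<^esub> (b \<ominus>\<^bsub>A\<^esub> a) \<oplus>\<^bsub>A\<^esub> (\<lambda>z. f z - g z) \<odot>\<^bsub>A\<^esub> a"
    using smult_closed assms(1,2,4) c by (simp add: A.minus_eq A.a_assoc diff_smult)
  moreover have "germ M x (\<lambda>z. f z - g z) = germ M x (\<lambda>_. 0)"
    using germ_add_germ[of M x f "\<lambda>z. - g z"] germ_add_germ[of M x g "\<lambda>z. - g z"] assms(3) by simp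
  then have "(\<lambda>z. f z - g z) \<odot>\<^bsub>A\<^esub> a \<in> N"
    using null_of_zero_germ[OF Cc_diff[OF assms(1,2)] _ assms(4)] by simp
  ultimately have "f \<odot>\<^bsub>A\<^esub> b \<ominus>\<^bsub>A\<^esub> g \<odot>\<^bsub>A\<^esub> a \<in> N"
    using null_add[OF null_smult[OF assms(1) b(2)]] by simp
  then show ?thesis using stalk_class_eqI smult_closed assms(1,2,4) b(1) by simp
qed

lemma stalk_smult:
  assumes "f \<in> Cc M" "a \<in> carrier A"
  shows "germ M x f \<odot>\<^bsub>S\<^esub> cl a = cl (f \<odot>\<^bsub>A\<^esub> a)"
proof -
  have "{cl (g \<odot>\<^bsub>A\<^esub> b) | g b. g \<in> Cc M \<and> germ M x g = germ M x f \<and> b \<in> cl a} = {cl (f \<odot>\<^bsub>A\<^esub> a)}"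
  proof (intro equalityI subsetI)
    fix z assume "z \<in> {cl (g \<odot>\<^bsub>A\<^esub> b) | g b. g \<in> Cc M \<and> germ M x g = germ M x f \<and> b \<in> cl a}"
    then show "z \<in> {cl (f \<odot>\<^bsub>A\<^esub> a)}" using stalk_class_smult_cong[OF _ assms(1) _ assms(2)] by blast
  next
    fix z assume "z \<in> {cl (f \<odot>\<^bsub>A\<^esub> a)}"
    then show "z \<in> {cl (g \<odot>\<^bsub>A\<^esub> b) | g b. g \<in> Cc M \<and> germ M x g = germ M x f \<and> b \<in> cl a}"
      using assms stalk_class_self by blast
  qed
  then show ?thesis by (simp add: stalk_def)
qed

text \<open>A function that is smooth only near \<open>x\<close> becomes an element of
  \<open>Cc M\<close> after multiplication by a bump function with germ 1 at \<open>x\<close>, which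
  does not change its germ.\<close>

lemma germ_ring_representative:
  assumes "g \<in> carrier (germ_ring M x)"
  obtains f where "f \<in> Cc M" "germ M x f = (g :: ('m \<Rightarrow> 'k) set)"
proof -
  obtain h W where h: "g = germ M x h" "openin (mtop M) W" "x \<in> W" "smooth_fun_on M W h"
    using assms by (auto simp: germ_ring_def smooth_fun_submanifold[OF M])
  obtain \<rho> where \<rho>: "\<rho> \<in> Cc M" "supp M \<rho> \<subseteq> W" "germ M x \<rho> = germ M x (\<lambda>_. 1 :: 'k)"
    using unit_germ_exists[OF h(2,3)] .
  have "smooth_fun_on M W (\<lambda>z. \<rho> z * h z)"
    by (rule smooth_fun_on_mult[OF smooth_fun_on_subset[OF CcD(1)[OF \<rho>(1)] open_subset_points[OF h(2)]] h(4)])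
  then have "(\<lambda>z. \<rho> z * h z) \<in> Cc M"
    by (rule CcI(1)[OF CcD(3)[OF \<rho>(1)] \<rho>(2) h(2)]) (use Cc_nonzero_in_supp[OF M \<rho>(1)] in auto)
  moreover have "germ M x (\<lambda>z. \<rho> z * h z) = g"
    using germ_mult_germ[of M x \<rho> h] germ_mult_germ[of M x "\<lambda>_. 1" h] \<rho>(3) h(1) by simp
  ultimately show ?thesis using that by blast
qed

lemma germ_in_germ_ring: "f \<in> Cc M \<Longrightarrow> germ M x f \<in> carrier (germ_ring M x)"
  using openin_points x CcD(1)[of f] by (auto simp: germ_ring_def smooth_fun_submanifold[OF M])

lemma stalk_tensor_pair: "tensor_pair (germ_ring M x) S S"
proof -
  have "g \<odot>\<^bsub>S\<^esub> \<zeta> \<in> carrier S" if g: "g \<in> carrier (germ_ring M x)" and \<zeta>: "\<zeta> \<in> carrier S" for g \<zeta>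
  proof -
    obtain f where "f \<in> Cc M" "germ M x f = g" using germ_ring_representative[OF g] .
    then show ?thesis using \<zeta> stalk_smult smult_closed by (auto simp: carrier_stalk)
  qed
  then show ?thesis by (simp add: tensor_pair_def tensor_pair_axioms_def stalk_abelian_group)
qed

lemma tensor_pair: "tensor_pair (Cc_ring M) A A"
  by (rule tensor_pairI[OF A A])

text \<open>The class map is semilinear along the passage from functions to germs, with
  \<open>germ M x r\<close> matching \<open>r\<close>. It therefore induces the map of tensor
  squares from which \<open>stalk_comult\<close> is formed.\<close>

lemma stalk_tensor_hom: "tensor_hom (Cc_ring M) A A (germ_ring M x) S S cl cl"
proof -
  have "\<exists>s\<in>carrier (germ_ring M x). (\<forall>a\<in>carrier A. cl (r \<odot>\<^bsub>A\<^esub> a) = s \<odot>\<^bsub>S\<^esub> cl a) \<and> (\<forall>a\<in>carrier A. cl (r \<odot>\<^bsub>A\<^esub> a) = s \<odot>\<^bsub>S\<^esub> cl a)"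
    if "r \<in> Cc M" for r
    using stalk_smult that germ_in_germ_ring by (intro bexI[of _ "germ M x r"]) auto
  then show ?thesis
    by (simp add: tensor_hom_def tensor_pair stalk_tensor_pair tensor_hom_axioms_def carrier_stalk stalk_class_add)
qed

abbreviation Tx where "Tx \<equiv> tensor_map (germ_ring M x) S S cl cl"

lemma nonunital_tensor:
  "nonunital_module (Cc_ring M) (tensor (Cc_ring M) A A)"
  "r \<in> Cc M \<Longrightarrow> a \<in> carrier A \<Longrightarrow> b \<in> carrier A \<Longrightarrow>
    r \<odot>\<^bsub>tensor (Cc_ring M) A A\<^esub> pure_tensor (Cc_ring M) A A a b = pure_tensor (Cc_ring M) A A (r \<odot>\<^bsub>A\<^esub> a) b"
  using tensor_nonunital_module[OF A A] by (auto simp: mult.commute Cc_mult Cc_add)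

text \<open>A bump function \<rho> supported where \<open>r\<close> is 1 satisfies \<rho> r =
  \<rho>, so it annihilates \<open>r a - a\<close>.\<close>

lemma stalk_class_smult_one:
  assumes "r \<in> Cc M" "germ M x r = germ M x (\<lambda>_. 1)" "a \<in> carrier A"
  shows "cl (r \<odot>\<^bsub>A\<^esub> a) = cl a"
proof -
  obtain W where W: "openin (mtop M) W" "x \<in> W" "\<And>z. z \<in> W \<Longrightarrow> r z = 1"
    using germ_eqD[OF assms(2) xT] by blast
  obtain \<rho> where \<rho>: "\<rho> \<in> Cc M" "supp M \<rho> \<subseteq> W" "germ M x \<rho> = germ M x (\<lambda>_. 1 :: 'k)"
    using unit_germ_exists[OF W(1,2)] .
  have "(\<lambda>z. \<rho> z * r z) = \<rho>"
    using W(3) Cc_nonzero_in_supp[OF M \<rho>(1)] \<rho>(2) by (intro HOL.ext) fastforce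
  then have "\<rho> \<odot>\<^bsub>A\<^esub> (r \<odot>\<^bsub>A\<^esub> a) = \<rho> \<odot>\<^bsub>A\<^esub> a"
    using mult_smult[OF \<rho>(1) assms(1,3)] by simp
  then have "\<rho> \<odot>\<^bsub>A\<^esub> (r \<odot>\<^bsub>A\<^esub> a \<ominus>\<^bsub>A\<^esub> a) = \<zero>\<^bsub>A\<^esub>"
    using smult_add[OF \<rho>(1) smult_closed[OF assms(1,3)] A.a_inv_closed[OF assms(3)]] smult_uminus[OF \<rho>(1) assms(3)]
      smult_closed[OF \<rho>(1) assms(3)] by (simp add: A.minus_eq A.r_neg)
  then have "r \<odot>\<^bsub>A\<^esub> a \<ominus>\<^bsub>A\<^esub> a \<in> N"
    using \<rho> smult_closed[OF assms(1,3)] assms(3) unfolding null_iff by blast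
  then show ?thesis using stalk_class_eqI[OF assms(3) smult_closed[OF assms(1,3)]] by simp
qed

text \<open>Allows a scalar with germ 1 to be inserted before passing to the tensor square of the
  stalk, as needed to see that the comultiplication descends.\<close>

lemma Tx_smult_one:
  assumes "r \<in> Cc M" "germ M x r = germ M x (\<lambda>_. 1)" "t \<in> carrier (tensor (Cc_ring M) A A)"
  shows "Tx (r \<odot>\<^bsub>tensor (Cc_ring M) A A\<^esub> t) = Tx t"
  using assms(3)
proof (induction rule: tensor_pair.tensor_induct[OF tensor_pair, consumes 1, case_names zero pure add])
  case zero
  then show ?case using nonunital_smult_zero[OF nonunital_tensor(1)] assms(1) by simp
next
  case (pure a b)
  then show ?case
    using tensor_hom.tensor_map_pure[OF stalk_tensor_hom] stalk_class_smult_one assms smult_closed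
    by (simp add: nonunital_tensor(2))
next
  case (add t u)
  then show ?case
    using tensor_hom.tensor_map_add[OF stalk_tensor_hom] nonunital_moduleD(2,3)[OF nonunital_tensor(1)] assms(1)
    by simp
qed

end

section \<open>Comultiplication, counit and grouplike elements on stalks\<close>

locale coalgebra_at = module_at M A x
  for M :: "('m, 'b::euclidean_space) manifold"
    and A :: "('m \<Rightarrow> 'k::real_normed_field, 'a, 'z) coalgebra_scheme" and x +
  assumes coalg: "is_coalgebra (Cc_ring M) A"
begin

lemma comult_linear: "linear_map (Cc_ring M) A (tensor (Cc_ring M) A A) (comult A)"
  and counit_linear: "linear_map (Cc_ring M) A (regular_module (Cc_ring M)) (counit A)"
  using coalg by (auto simp: is_coalgebra_def)

lemma counit_simps:
  assumes "a \<in> carrier A"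
  shows "counit A a \<in> Cc M" "b \<in> carrier A \<Longrightarrow> counit A (a \<oplus>\<^bsub>A\<^esub> b) = (\<lambda>z. counit A a z + counit A b z)"
    "r \<in> Cc M \<Longrightarrow> counit A (r \<odot>\<^bsub>A\<^esub> a) = (\<lambda>z. r z * counit A a z)"
  using counit_linear assms by (auto simp: linear_map_def regular_module_def Pi_iff)

text \<open>If \<open>f\<close> has germ 1 and \<open>f n = 0\<close>, then f \<Delta>(n) =
  \<Delta>(f n) = 0, while \<Delta>(n) and f \<Delta>(n) have the same image in the tensor square of
  the stalk. So \<Delta> of a null element maps to 0 there, and the set under
  \<open>the_elem\<close> is a singleton.\<close>

lemma stalk_comult:
  assumes "a \<in> carrier A"
  shows "stalk_comult M A x (cl a) = Tx (comult A a)"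
proof -
  let ?T = "tensor (Cc_ring M) A A"
  have T: "abelian_group ?T" by (rule nonunital_moduleD(1)[OF nonunital_tensor(1)])
  interpret T: abelian_group ?T by fact
  interpret TS: abelian_group "tensor (germ_ring M x) S S" by (rule tensor_pair.tensor_abelian_group[OF stalk_tensor_pair])
  have closed: "comult A a \<in> carrier ?T" if "a \<in> carrier A" for a
    using comult_linear that by (auto simp: linear_map_def)
  have null: "Tx (comult A n) = \<zero>\<^bsub>tensor (germ_ring M x) S S\<^esub>" if nN: "n \<in> N" for n
  proof -
    obtain f where f: "f \<in> Cc M" "germ M x f = germ M x (\<lambda>_. 1)" "f \<odot>\<^bsub>A\<^esub> n = \<zero>\<^bsub>A\<^esub>" "n \<in> carrier A"
      using nN by (auto simp: null_iff)
    have "f \<odot>\<^bsub>?T\<^esub> comult A n = comult A (f \<odot>\<^bsub>A\<^esub> n)"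
      using comult_linear f(1,4) by (simp add: linear_map_def)
    also have "\<dots> = \<zero>\<^bsub>?T\<^esub>" unfolding f(3) by (rule linear_map_zero[OF A.abelian_group_axioms T comult_linear])
    finally show ?thesis
      using Tx_smult_one[OF f(1,2) closed[OF f(4)]] tensor_hom.tensor_map_zero[OF stalk_tensor_hom] by simp
  qed
  have "Tx (comult A b) = Tx (comult A a)" if "b \<in> cl a" for b
  proof -
    obtain n where n: "n \<in> N" "b = n \<oplus>\<^bsub>A\<^esub> a" using \<open>b \<in> cl a\<close> by (auto simp: stalk_class_iff)
    have nA: "n \<in> carrier A" using n(1) by (simp add: null_iff)
    have "comult A b = comult A n \<oplus>\<^bsub>?T\<^esub> comult A a"
      using comult_linear nA assms by (simp add: n(2) linear_map_def)
    then show ?thesis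
      using tensor_hom.tensor_map_add[OF stalk_tensor_hom closed[OF nA] closed[OF assms]] null[OF n(1)]
        tensor_hom.tensor_map_closed[OF stalk_tensor_hom closed[OF assms]] by simp
  qed
  then have "the_elem ((\<lambda>c. Tx (comult A c)) ` cl a) = Tx (comult A a)"
    using stalk_class_self[OF assms] by (intro the_elem_image_unique) blast+
  then show ?thesis by (simp add: stalk_comult_def)
qed

text \<open>For null \<open>n\<close>, multiplication by some \<open>f\<close> with germ 1 at
  \<open>x\<close> kills the function \<epsilon>(n), so \<epsilon>(n) has germ 0 at
  \<open>x\<close>.\<close>

lemma stalk_counit:
  assumes "a \<in> carrier A"
  shows "stalk_counit M A x (cl a) = germ M x (counit A a)"
proof -
  have "germ M x (counit A b) = germ M x (counit A a)" if b: "b \<in> cl a" for b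
  proof -
    obtain n where n: "n \<in> N" "b = n \<oplus>\<^bsub>A\<^esub> a" using b by (auto simp: stalk_class_iff)
    obtain f where f: "f \<in> Cc M" "germ M x f = germ M x (\<lambda>_. 1)" "f \<odot>\<^bsub>A\<^esub> n = \<zero>\<^bsub>A\<^esub>" "n \<in> carrier A"
      using n(1) by (auto simp: null_iff)
    have "(\<lambda>z. f z * counit A n z) = counit A \<zero>\<^bsub>A\<^esub>" using counit_simps(3)[OF f(4,1)] f(3) by simp
    also have "counit A \<zero>\<^bsub>A\<^esub> = (\<lambda>z. 0)"
      using counit_simps(3)[OF A.zero_closed Cc_zero] smult_zero[OF Cc_zero] by simp
    finally have "germ M x (counit A n) = germ M x (\<lambda>_. 0)"
      using germ_mult_germ[of M x f "counit A n"] germ_mult_germ[of M x "\<lambda>_. 1" "counit A n"] f(2) by simp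
    then show ?thesis
      using germ_add_germ[of M x "counit A n" "counit A a"] germ_add_germ[of M x "\<lambda>_. 0" "counit A a"]
        counit_simps(2)[OF f(4) assms] by (simp add: n(2))
  qed
  then have "the_elem ((\<lambda>c. germ M x (counit A c)) ` cl a) = germ M x (counit A a)"
    using stalk_class_self[OF assms] by (intro the_elem_image_unique) blast+
  then show ?thesis by (simp add: stalk_counit_def)
qed

text \<open>If \<open>\<Delta> c = c \<otimes> c'\<close>, the counit laws give \<open>c = \<epsilon>(c) c'\<close>, hence \<open>c\<^sub>x = c'\<^sub>x\<close> where \<open>c\<close> is normalized.\<close>

lemma weakly_grouplike_imp_grouplike:
  assumes c: "weakly_grouplike (Cc_ring M) A c" and norm: "germ M x (counit A c) = germ M x (\<lambda>_. 1)"
  shows "cl c \<in> grouplikes M A x"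
proof -
  obtain c' where cc: "c \<in> carrier A" "c' \<in> carrier A" "comult A c = pure_tensor (Cc_ring M) A A c c'"
    using c by (auto simp: weakly_grouplike_def)
  interpret P: tensor_pair "Cc_ring M" A A by (rule tensor_pair)
  have "tensor_lift A (\<lambda>a b. counit A a \<odot>\<^bsub>A\<^esub> b) (P.pure c c') = counit A c \<odot>\<^bsub>A\<^esub> c'"
  proof (rule P.tensor_lift_pure[OF A.abelian_group_axioms _ _ _ _ cc(1,2)])
    fix r :: "'m \<Rightarrow> 'k" and a b assume "r \<in> carrier (Cc_ring M)" "a \<in> carrier A" "b \<in> carrier A"
    then show "counit A (r \<odot>\<^bsub>A\<^esub> a) \<odot>\<^bsub>A\<^esub> b = counit A a \<odot>\<^bsub>A\<^esub> (r \<odot>\<^bsub>A\<^esub> b)"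
      using mult_smult[of "counit A a" r b] counit_simps by (simp add: mult.commute)
  qed (use counit_simps smult_closed smult_add add_smult in auto)
  moreover have "tensor_lift A (\<lambda>a b. counit A a \<odot>\<^bsub>A\<^esub> b) (comult A c) = c"
    using coalg cc(1) by (simp add: is_coalgebra_def)
  ultimately have "c = counit A c \<odot>\<^bsub>A\<^esub> c'" using cc(3) by simp
  then have eq: "cl c = cl c'"
    using stalk_class_smult_one[OF counit_simps(1)[OF cc(1)] norm cc(2)] by simp
  have "stalk_comult M A x (cl c) = pure_tensor (germ_ring M x) S S (cl c) (cl c)"
    using stalk_comult[OF cc(1)] tensor_hom.tensor_map_pure[OF stalk_tensor_hom cc(1,2)] cc(3) eq by simp
  then show ?thesis
    using stalk_counit[OF cc(1)] norm cc(1) by (simp add: grouplikes_def carrier_stalk germ_ring_def)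
qed

end

section \<open>The coalgebra of compactly supported functions on a sheaf\<close>

lemma nonunital_module_cong:
  assumes "nonunital_module R C" "carrier C' = carrier C" "zero C' = zero C" "add C' = add C" "smult C' = smult C"
  shows "nonunital_module R C'"
proof -
  interpret C: abelian_group C by (rule nonunital_moduleD(1)[OF assms(1)])
  have "abelian_group C'"
  proof (rule abelian_groupI; unfold assms(2-4))
    fix a assume "a \<in> carrier C"
    then show "\<exists>b\<in>carrier C. b \<oplus>\<^bsub>C\<^esub> a = \<zero>\<^bsub>C\<^esub>" using C.l_neg C.a_inv_closed by blast
  qed (assumption | rule C.a_closed C.a_assoc C.a_comm C.l_zero C.zero_closed)+
  then show ?thesis using assms by (simp add: nonunital_module_def)
qed

lemma Cc_coalgebra_simps [simp]:
  "carrier (Cc_coalgebra M E \<pi>) = Cc_sections E" "zero (Cc_coalgebra M E \<pi>) = (\<lambda>y. germ E y (\<lambda>_. 0))"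
  "add (Cc_coalgebra M E \<pi>) = (\<lambda>s t y. germ_add (s y) (t y))"
  "smult (Cc_coalgebra M E \<pi>) = (\<lambda>p s y. germ_mult (germ E y (p \<circ> \<pi>)) (s y))"
  "comult (Cc_coalgebra M E \<pi>) = Cc_comult M E \<pi>" "counit (Cc_coalgebra M E \<pi>) = Cc_counit M E \<pi>"
  by (simp_all add: Cc_coalgebra_def module.extend_def coalgebra.fields_def Cc_module_def)

text \<open>The tensor product is built from carrier, addition and scalar multiplication, hence does
  not see the fields for \<Delta> and \<epsilon>. This permits constructing \<Delta> over
  \<open>Cc_module\<close>, before the coalgebra record is formed.\<close>

lemma tensor_Cc_coalgebra:
  "tensor R (Cc_coalgebra M E \<pi>) (Cc_coalgebra M E \<pi>) = tensor R (Cc_module E \<pi>) (Cc_module E \<pi>)"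
  "pure_tensor R (Cc_coalgebra M E \<pi>) (Cc_coalgebra M E \<pi>) = pure_tensor R (Cc_module E \<pi>) (Cc_module E \<pi>)"
  by (simp_all add: fun_eq_iff tensor_def tensor_gens_def tensor_null_def tensor_map_def pure_tensor_def tensor_class_def)

lemma (in hausdorff_manifold) regular_module_nonunital:
  "nonunital_module (Cc_ring M) (regular_module (Cc_ring M :: ('m \<Rightarrow> 'k::real_normed_field) ring))"
proof -
  have "abelian_group (regular_module (Cc_ring M :: ('m \<Rightarrow> 'k) ring))"
  proof (rule abelian_groupI; simp add: regular_module_def)
    fix f :: "'m \<Rightarrow> 'k" assume "f \<in> Cc M"
    then show "\<exists>g\<in>Cc M. (\<lambda>x. g x + f x) = (\<lambda>_. 0)" by (intro bexI[OF _ Cc_uminus[of f]]) auto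
  qed (auto simp: Cc_add Cc_zero add.assoc add.commute)
  then show ?thesis
    by (auto simp: nonunital_module_def regular_module_def Cc_mult algebra_simps)
qed

context sheaf_over
begin

abbreviation RR :: "('m \<Rightarrow> 'k::real_normed_field) ring" where "RR \<equiv> Cc_ring M"
abbreviation CC :: "('m \<Rightarrow> 'k::real_normed_field, ('e, 'k) germ_section) module" where "CC \<equiv> Cc_module E \<pi>"
abbreviation CA :: "('m \<Rightarrow> 'k::real_normed_field, ('e, 'k) germ_section) coalgebra" where "CA \<equiv> Cc_coalgebra M E \<pi>"

lemma hausdorff_image: "elementary E \<pi> U \<Longrightarrow> hausdorff_manifold (submanifold M (\<pi> ` U))"
  by (rule submanifold[OF elementary_image_open])

section \<open>Existence and uniqueness of comultiplication and counit\<close>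

lemma gens_unit:
  fixes f g :: "'m \<Rightarrow> 'k::real_normed_field"
  assumes "(U, f) \<in> gens" "(U, g) \<in> gens"
  obtains \<eta> where "(U, \<eta>) \<in> gens" "\<And>x. \<eta> x * f x = f x" "\<And>x. \<eta> x * g x = g x"
proof -
  have U: "elementary E \<pi> U" using gensD(1)[OF assms(1)] .
  interpret S: hausdorff_manifold "submanifold M (\<pi> ` U)" by (rule hausdorff_image[OF U])
  obtain \<eta> where "\<eta> \<in> Cc (submanifold M (\<pi> ` U))" "\<And>x. \<eta> x * f x = f x" "\<And>x. \<eta> x * g x = g x"
    using S.Cc_common_unit[of f g] assms by (auto simp: gens_iff)
  then show ?thesis using that U by (simp add: gens_iff)
qed

lemma gens_unit1:
  assumes "(U, f) \<in> gens"
  shows "\<exists>\<eta>. (U, \<eta>) \<in> gens \<and> (\<forall>x. \<eta> x * f x = f x)"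
  using gens_unit[OF assms assms] by metis

lemma tensor_module:
  "nonunital_module RR (tensor RR CC CC)"
  "r \<in> Cc M \<Longrightarrow> s \<in> Cc_sections E \<Longrightarrow> t \<in> Cc_sections E \<Longrightarrow>
    r \<odot>\<^bsub>tensor RR CC CC\<^esub> pure_tensor RR CC CC s t = pure_tensor RR CC CC (r \<odot>\<^bsub>CC\<^esub> s) t"
  by (rule tensor_nonunital_module[OF Cc_module_nonunital Cc_module_nonunital]; auto simp: mult.commute Cc_mult Cc_add)+

lemma tensor_pair_CC: "tensor_pair RR CC CC"
  by (rule tensor_pairI[OF Cc_module_nonunital Cc_module_nonunital])

lemma tensor_unitary:
  assumes "t \<in> carrier (tensor RR CC CC)"
  shows "\<exists>r\<in>Cc M. r \<odot>\<^bsub>tensor RR CC CC\<^esub> t = t"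
  using assms
proof (induction rule: tensor_pair.tensor_induct[OF tensor_pair_CC, consumes 1, case_names zero pure add])
  case zero
  show ?case using nonunital_smult_zero[OF tensor_module(1)] Cc_zero by (intro bexI[of _ "\<lambda>_. 0"]) auto
next
  case (pure s t)
  then have st: "s \<in> Cc_sections E" "t \<in> Cc_sections E" by auto
  obtain r where "r \<in> Cc M" "r \<odot>\<^bsub>CC\<^esub> s = s" using Cc_module_unitary[OF st(1)] by blast
  then show ?case using tensor_module(2)[OF _ st] by (intro bexI[of _ r]) auto
next
  case (add t u)
  then show ?case using unitary_add[OF tensor_module(1)] by blast
qed

text \<open>The prescribed value of \<Delta> on a generator, with some unit \<eta> selected so that
  it becomes a function of the pair; \<open>diag_eq\<close> shows that every unit gives the same
  value.\<close>

definition diag :: "'e set \<times> ('m \<Rightarrow> 'k::real_normed_field) \<Rightarrow> (('e, 'k) germ_section \<times> ('e, 'k) germ_section \<Rightarrow>\<^sub>0 int) set" where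
  "diag p = pure_tensor RR CC CC (pe p)
     (pe (fst p, SOME \<eta>. (fst p, \<eta>) \<in> gens \<and> (\<forall>x. \<eta> x * snd p x = snd p x)))"

text \<open>Write \<open>f\<close> also for its pullback. If \<theta> f = f, balancing gives f
  \<otimes> \<eta> = \<theta> f \<otimes> \<eta> = f \<otimes> \<theta> \<eta>. The last expression
  is symmetric in the two units.\<close>

lemma pure_tensor_unit_independent:
  assumes "(U, f) \<in> gens" "(U, \<eta>) \<in> gens" "(U, \<theta>) \<in> gens" "\<And>x. \<eta> x * f x = f x" "\<And>x. \<theta> x * f x = f x"
  shows "pure_tensor RR CC CC (pe (U, f)) (pe (U, \<eta>)) = pure_tensor RR CC CC (pe (U, f)) (pe (U, \<theta>))"
proof -
  have *: "pure_tensor RR CC CC (pe (U, f)) (pe (U, \<eta>)) = pure_tensor RR CC CC (pe (U, f)) (pe (U, \<lambda>x. \<theta> x * \<eta> x))"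
    if "(U, \<eta>) \<in> gens" "(U, \<theta>) \<in> gens" "\<And>x. \<theta> x * f x = f x" for \<eta> \<theta>
  proof -
    have "pe (U, f) = \<theta> \<odot>\<^bsub>CC\<^esub> pe (U, f)" using smult_pe[of \<theta> U f] that(3) by simp
    then have "pure_tensor RR CC CC (pe (U, f)) (pe (U, \<eta>)) = pure_tensor RR CC CC (\<theta> \<odot>\<^bsub>CC\<^esub> pe (U, f)) (pe (U, \<eta>))" by simp
    also have "\<dots> = pure_tensor RR CC CC (pe (U, f)) (\<theta> \<odot>\<^bsub>CC\<^esub> pe (U, \<eta>))"
      using pe_closed[of "[(U, f), (U, \<eta>)]"] that assms(1) gensD(2)
      by (intro tensor_pair.pure_balanced[OF tensor_pair_CC]) auto
    finally show ?thesis using smult_pe[of \<theta> U \<eta>] by simp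
  qed
  show ?thesis using *[OF assms(2,3,5)] *[OF assms(3,2,4)] by (simp add: mult.commute)
qed

lemma diag_eq:
  assumes "(U, f) \<in> gens" "(U, \<eta>) \<in> gens" "\<And>x. \<eta> x * f x = f x"
  shows "diag (U, f) = pure_tensor RR CC CC (pullback_ext E \<pi> U f) (pullback_ext E \<pi> U \<eta>)"
proof -
  have "\<exists>\<eta>. (U, \<eta>) \<in> gens \<and> (\<forall>x. \<eta> x * f x = f x)" using assms by blast
  from someI_ex[OF this] show ?thesis
    using pure_tensor_unit_independent[OF assms(1) _ assms(2) _ assms(3)] by (simp add: diag_def)
qed

text \<open>Every relation is checked with a unit that serves all the functions involved: a common
  unit of \<open>f\<close> and \<open>g\<close> is one for their sum, a unit of \<open>f\<close> is
  one for \<open>r f\<close>, and a unit on \<open>V\<close> remains one on the larger set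
  \<open>U\<close>.\<close>

lemma compatible_family_diag:
  "compatible_family M E \<pi> (tensor (RR :: ('m \<Rightarrow> 'k::real_normed_field) ring) CC CC) diag"
proof
  interpret TP: tensor_pair "RR :: ('m \<Rightarrow> 'k) ring" CC CC by (rule tensor_pair_CC)
  interpret F: compatible_family M E \<pi> "CC :: ('m \<Rightarrow> 'k, ('e, 'k) germ_section) module" pe
    by (rule compatible_family_self)
  show "nonunital_module RR (tensor RR CC CC)" by (rule tensor_module)
  show "\<exists>r\<in>Cc M. r \<odot>\<^bsub>tensor RR CC CC\<^esub> t = t" if "t \<in> carrier (tensor RR CC CC)" for t
    by (rule tensor_unitary[OF that])
  show "diag p \<in> carrier TP.T" if p: "p \<in> gens" for p :: "'e set \<times> ('m \<Rightarrow> 'k)"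
  proof -
    obtain U f where [simp]: "p = (U, f)" by force
    obtain \<eta> where \<eta>: "(U, \<eta>) \<in> gens" "\<And>x. \<eta> x * f x = f x" using gens_unit[of U f f] p by auto
    show ?thesis
      using p \<eta> by (simp add: diag_eq TP.pure_closed pullback_ext_in_Cc_sections)
  qed
  show "diag (U, \<lambda>x. f x + g x) = diag (U, f) \<oplus>\<^bsub>TP.T\<^esub> diag (U, g)"
    if f: "(U, f) \<in> gens" and g: "(U, g) \<in> gens" for U and f g :: "'m \<Rightarrow> 'k"
  proof -
    obtain \<eta> where \<eta>: "(U, \<eta>) \<in> gens" "\<And>x. \<eta> x * f x = f x" "\<And>x. \<eta> x * g x = g x" using gens_unit[OF f g] by blast
    have "pullback_ext E \<pi> U (\<lambda>x. f x + g x) = pullback_ext E \<pi> U f \<oplus>\<^bsub>CC\<^esub> pullback_ext E \<pi> U g"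
      using F.additive[OF f g] by simp
    moreover have "\<eta> x * (f x + g x) = f x + g x" for x by (simp only: distrib_left \<eta>(2,3))
    ultimately show ?thesis
      using f g \<eta> gens_add[OF f g] pullback_ext_in_Cc_sections[OF f] pullback_ext_in_Cc_sections[OF g]
        pullback_ext_in_Cc_sections[OF \<eta>(1)]
        TP.pure_add_left[of "pullback_ext E \<pi> U f" "pullback_ext E \<pi> U g" "pullback_ext E \<pi> U \<eta>"]
      by (simp add: diag_eq)
  qed
  show "diag (U, \<lambda>x. r x * f x) = r \<odot>\<^bsub>TP.T\<^esub> diag (U, f)"
    if r: "r \<in> Cc M" and f: "(U, f) \<in> gens" for r U and f :: "'m \<Rightarrow> 'k"
  proof -
    obtain \<eta> where \<eta>: "(U, \<eta>) \<in> gens" "\<And>x. \<eta> x * f x = f x" using gens_unit1[OF f] by blast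
    have "\<eta> x * (r x * f x) = r x * f x" for x using \<eta>(2)[of x] by (metis mult.left_commute)
    then show ?thesis
      using diag_eq[OF gens_mult[OF f r] \<eta>(1)] diag_eq[OF f \<eta>(1)] \<eta>(2)
        tensor_module(2)[OF r pullback_ext_in_Cc_sections[OF f] pullback_ext_in_Cc_sections[OF \<eta>(1)]] smult_pe[of r U f]
      by simp
  qed
  show "diag (V, f) = diag (U, f)"
    if f: "(V, f) \<in> gens" and VU: "V \<subseteq> U" "elementary E \<pi> U" for U V and f :: "'m \<Rightarrow> 'k"
  proof -
    obtain \<eta> where \<eta>: "(V, \<eta>) \<in> gens" "\<And>x. \<eta> x * f x = f x" using gens_unit1[OF f] by blast
    show ?thesis
      using diag_eq[OF f \<eta>] diag_eq[OF gens_mono[OF f VU] gens_mono[OF \<eta>(1) VU] \<eta>(2)] F.mono[OF f VU] F.mono[OF \<eta>(1) VU]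
      by simp
  qed
qed

text \<open>The definite description has a unique solution: the extension of \<open>diag\<close>
  satisfies it, and any solution agrees with \<open>diag\<close> on generators, because each of them
  admits a unit.\<close>

lemma Cc_comult:
  "linear_map (RR :: ('m \<Rightarrow> 'k::real_normed_field) ring) CC (tensor RR CC CC) (Cc_comult M E \<pi>)"
  "(U, f) \<in> gens \<Longrightarrow> (U, \<eta>) \<in> gens \<Longrightarrow> (\<And>x. \<eta> x * f x = (f x :: 'k)) \<Longrightarrow>
    Cc_comult M E \<pi> (pullback_ext E \<pi> U f) = pure_tensor RR CC CC (pullback_ext E \<pi> U f) (pullback_ext E \<pi> U \<eta>)"
proof -
  let ?P = "\<lambda>\<Delta> :: ('e, 'k) germ_section \<Rightarrow> _. \<Delta> \<in> extensional (Cc_sections E) \<and> linear_map RR CC (tensor RR CC CC) \<Delta> \<and>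
     (\<forall>U. elementary E \<pi> U \<longrightarrow>
        (\<forall>f\<in>Cc (submanifold M (\<pi> ` U)). \<forall>\<eta>\<in>Cc (submanifold M (\<pi> ` U)).
           (\<forall>x. \<eta> x * f x = f x) \<longrightarrow>
           \<Delta> (pullback_ext E \<pi> U f) = pure_tensor RR CC CC (pullback_ext E \<pi> U f) (pullback_ext E \<pi> U \<eta>)))"
  interpret F: compatible_family M E \<pi> "tensor RR CC CC :: ('m \<Rightarrow> 'k, _) module" diag by (rule compatible_family_diag)
  have P_diag: "\<Delta> (pullback_ext E \<pi> U f) = diag (U, f)" if P: "?P \<Delta>" and f: "(U, f) \<in> gens" for \<Delta> U f
  proof -
    obtain \<eta> where \<eta>: "(U, \<eta>) \<in> gens" "\<And>x. \<eta> x * f x = f x" using gens_unit1[OF f] by blast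
    then show ?thesis using P f diag_eq[OF f \<eta>] by (simp add: gens_iff)
  qed
  obtain \<Delta> :: "('e, 'k) germ_section \<Rightarrow> _" where \<Delta>: "\<Delta> \<in> extensional (Cc_sections E)" "linear_map RR CC (tensor RR CC CC) \<Delta>"
    "\<And>U f. (U, f) \<in> gens \<Longrightarrow> \<Delta> (pullback_ext E \<pi> U f) = diag (U, f)"
    using F.extension_exists by blast
  have "?P \<Delta>"
  proof (intro conjI allI impI ballI \<Delta>(1,2))
    fix U and f \<eta> :: "'m \<Rightarrow> 'k"
    assume "elementary E \<pi> U" "f \<in> Cc (submanifold M (\<pi> ` U))" "\<eta> \<in> Cc (submanifold M (\<pi> ` U))" "\<forall>x. \<eta> x * f x = f x"
    then show "\<Delta> (pullback_ext E \<pi> U f) = pure_tensor RR CC CC (pullback_ext E \<pi> U f) (pullback_ext E \<pi> U \<eta>)"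
      using \<Delta>(3)[of U f] diag_eq[of U f \<eta>] by (simp add: gens_iff)
  qed
  moreover have "\<Delta>' = \<Delta>" if "?P \<Delta>'" for \<Delta>'
    by (rule linear_map_unique[OF F.A.abelian_group_axioms]) (use that \<Delta> P_diag[OF that] in auto)
  ultimately have "?P (Cc_comult M E \<pi>)" unfolding Cc_comult_def by (rule theI)
  then show "linear_map (RR :: ('m \<Rightarrow> 'k) ring) CC (tensor RR CC CC) (Cc_comult M E \<pi>)"
    "(U, f) \<in> gens \<Longrightarrow> (U, \<eta>) \<in> gens \<Longrightarrow> (\<And>x. \<eta> x * f x = f x) \<Longrightarrow>
    Cc_comult M E \<pi> (pullback_ext E \<pi> U f) = pure_tensor RR CC CC (pullback_ext E \<pi> U f) (pullback_ext E \<pi> U \<eta>)"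
    by (auto simp: gens_iff)
qed

text \<open>The same scheme with the ring as target and the family \<open>snd\<close>, for which the
  compatibility conditions are immediate.\<close>

lemma Cc_counit:
  "linear_map (RR :: ('m \<Rightarrow> 'k::real_normed_field) ring) CC (regular_module RR) (Cc_counit M E \<pi>)"
  "(U, f) \<in> gens \<Longrightarrow> Cc_counit M E \<pi> (pullback_ext E \<pi> U f) = (f :: 'm \<Rightarrow> 'k)"
proof -
  let ?P = "\<lambda>\<epsilon> :: ('e, 'k) germ_section \<Rightarrow> _. \<epsilon> \<in> extensional (Cc_sections E) \<and> linear_map RR CC (regular_module RR) \<epsilon> \<and>
     (\<forall>U. elementary E \<pi> U \<longrightarrow> (\<forall>f\<in>Cc (submanifold M (\<pi> ` U)). \<epsilon> (pullback_ext E \<pi> U f) = f))"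
  interpret F: compatible_family M E \<pi> "regular_module RR :: ('m \<Rightarrow> 'k, 'm \<Rightarrow> 'k) module" snd
  proof
    show "nonunital_module RR (regular_module RR)" by (rule regular_module_nonunital)
    show "\<exists>r\<in>Cc M. r \<odot>\<^bsub>regular_module RR\<^esub> f = f" if "f \<in> carrier (regular_module RR)" for f :: "'m \<Rightarrow> 'k"
    proof -
      have "f \<in> Cc M" using that by (simp add: regular_module_def)
      then obtain \<eta> :: "'m \<Rightarrow> 'k" where \<eta>: "\<eta> \<in> Cc M" "\<And>x. \<eta> x * f x = f x" using Cc_unit by metis
      show ?thesis by (rule bexI[OF _ \<eta>(1)]) (simp only: regular_module_def Cc_ring_simps \<eta>(2) module.simps)
    qed
  qed (auto simp: regular_module_def gensD(2))
  obtain \<epsilon> :: "('e, 'k) germ_section \<Rightarrow> _" where \<epsilon>: "\<epsilon> \<in> extensional (Cc_sections E)" "linear_map RR CC (regular_module RR) \<epsilon>"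
    "\<And>U f. (U, f) \<in> gens \<Longrightarrow> \<epsilon> (pullback_ext E \<pi> U f) = snd (U, f)"
    using F.extension_exists by blast
  have "?P \<epsilon>" using \<epsilon> by (simp add: gens_iff)
  moreover have "\<epsilon>' = \<epsilon>" if "?P \<epsilon>'" for \<epsilon>'
    by (rule linear_map_unique[OF F.A.abelian_group_axioms]) (use that \<epsilon> in \<open>auto simp: gens_iff\<close>)
  ultimately have "?P (Cc_counit M E \<pi>)" unfolding Cc_counit_def by (rule theI)
  then show "linear_map (RR :: ('m \<Rightarrow> 'k) ring) CC (regular_module RR) (Cc_counit M E \<pi>)"
    "(U, f) \<in> gens \<Longrightarrow> Cc_counit M E \<pi> (pullback_ext E \<pi> U f) = f"
    by (auto simp: gens_iff)
qed

lemma Cc_counit_simps: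
  fixes s t :: "('e, 'k::real_normed_field) germ_section"
  assumes "s \<in> Cc_sections E"
  shows "Cc_counit M E \<pi> s \<in> Cc M"
    "t \<in> Cc_sections E \<Longrightarrow> Cc_counit M E \<pi> (\<lambda>y. germ_add (s y) (t y)) = (\<lambda>x. Cc_counit M E \<pi> s x + Cc_counit M E \<pi> t x)"
    "r \<in> Cc M \<Longrightarrow> Cc_counit M E \<pi> (\<lambda>y. germ_mult (germ E y (r \<circ> \<pi>)) (s y)) = (\<lambda>x. r x * Cc_counit M E \<pi> s x)"
  using Cc_counit(1) assms by (auto simp: linear_map_def regular_module_def Pi_iff)

section \<open>The counit laws\<close>

lemma Cc_coalgebra_nonunital: "nonunital_module RR CA"
  by (rule nonunital_module_cong[OF Cc_module_nonunital]) simp_all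

lemma tensor_pair_CA: "tensor_pair RR CA CA"
  by (rule tensor_pairI[OF Cc_coalgebra_nonunital Cc_coalgebra_nonunital])

text \<open>Both laws are handled at once, \<open>b\<close> being either of the two contractions. On
  a generator they give the same result, the pullback of \<eta> f, which is the pullback of
  \<open>f\<close>; additivity does the rest.\<close>

lemma counit_law:
  fixes b :: "('e, 'k::real_normed_field) germ_section \<Rightarrow> ('e, 'k) germ_section \<Rightarrow> ('e, 'k) germ_section"
  assumes b: "(\<forall>s t. b s t = Cc_counit M E \<pi> t \<odot>\<^bsub>CA\<^esub> s) \<or> (\<forall>s t. b s t = Cc_counit M E \<pi> s \<odot>\<^bsub>CA\<^esub> t)"
    and s: "s \<in> Cc_sections E"
  shows "tensor_lift CA b (Cc_comult M E \<pi> s) = s"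
proof -
  interpret TP: tensor_pair "RR :: ('m \<Rightarrow> 'k) ring" CA CA by (rule tensor_pair_CA)
  have "nonunital_module (RR :: ('m \<Rightarrow> 'k) ring) CA" by (rule Cc_coalgebra_nonunital)
  note m = nonunital_moduleD[OF this]
  have CAc: "carrier (CA :: ('m \<Rightarrow> 'k, ('e, 'k) germ_section) coalgebra) = Cc_sections E" by simp
  have RRc: "carrier (RR :: ('m \<Rightarrow> 'k) ring) = Cc M" by simp
  \<comment> \<open>The product in the third equation is turned round so that balancedness of
    \<open>b\<close> becomes an instance of the associativity of the action.\<close>
  have eps: "Cc_counit M E \<pi> s \<in> Cc M" 
    "t \<in> Cc_sections E \<Longrightarrow> Cc_counit M E \<pi> (s \<oplus>\<^bsub>CA\<^esub> t) = Cc_counit M E \<pi> s \<oplus>\<^bsub>RR\<^esub> Cc_counit M E \<pi> t"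
    "r \<in> Cc M \<Longrightarrow> Cc_counit M E \<pi> (r \<odot>\<^bsub>CA\<^esub> s) = Cc_counit M E \<pi> s \<otimes>\<^bsub>RR\<^esub> r"
    if "s \<in> Cc_sections E" for s t :: "('e, 'k) germ_section" and r
    using Cc_counit_simps[OF that] by (simp_all add: mult.commute)
  note closed = m(2)[unfolded CAc RRc] and left = m(3)[unfolded CAc RRc] and right = m(4)[unfolded CAc RRc]
    and assoc = m(5)[unfolded CAc RRc] and add_closed = TP.C.a_closed[unfolded CAc]
  have b_closed: "b s t \<in> Cc_sections E" if "s \<in> Cc_sections E" "t \<in> Cc_sections E" for s t
    using b by (elim disjE) (simp_all only: closed eps(1) that)
  have b_left: "b (s \<oplus>\<^bsub>CA\<^esub> s') t = b s t \<oplus>\<^bsub>CA\<^esub> b s' t"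
    if "s \<in> Cc_sections E" "s' \<in> Cc_sections E" "t \<in> Cc_sections E" for s s' t
    using b by (elim disjE) (simp_all only: left right eps(1,2) that)
  have b_right: "b s (t \<oplus>\<^bsub>CA\<^esub> t') = b s t \<oplus>\<^bsub>CA\<^esub> b s t'"
    if "s \<in> Cc_sections E" "t \<in> Cc_sections E" "t' \<in> Cc_sections E" for s t t'
    using b by (elim disjE) (simp_all only: left right eps(1,2) that)
  have b_bal: "b (r \<odot>\<^bsub>CA\<^esub> s) t = b s (r \<odot>\<^bsub>CA\<^esub> t)"
    if "r \<in> Cc M" "s \<in> Cc_sections E" "t \<in> Cc_sections E" for r s t
    using b by (elim disjE) (simp_all only: assoc eps(1,3) that)
  have lift_pure: "tensor_lift CA b (TP.pure s t) = b s t" if "s \<in> Cc_sections E" "t \<in> Cc_sections E" for s t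
    by (rule TP.tensor_lift_pure[OF TP.C.abelian_group_axioms, unfolded CAc RRc])
      (assumption | rule that b_closed b_left b_right b_bal)+
  have lift_add: "tensor_lift CA b (t \<oplus>\<^bsub>TP.T\<^esub> u) = tensor_lift CA b t \<oplus>\<^bsub>CA\<^esub> tensor_lift CA b u"
    if "t \<in> carrier TP.T" "u \<in> carrier TP.T" for t u
    by (rule TP.tensor_lift_add[OF TP.C.abelian_group_axioms, unfolded CAc RRc])
      (assumption | rule that b_closed b_left b_right b_bal)+
  have lift_zero: "tensor_lift CA b \<zero>\<^bsub>TP.T\<^esub> = \<zero>\<^bsub>CA\<^esub>"
    by (rule TP.tensor_lift_zero[OF TP.C.abelian_group_axioms, unfolded CAc RRc])
      (assumption | rule b_closed b_left b_right b_bal)+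
  show ?thesis using s
  proof (induction rule: Cc_sections_induct)
    case zero
    have "Cc_comult M E \<pi> (\<lambda>y. germ E y (\<lambda>_. 0 :: 'k)) = \<zero>\<^bsub>tensor RR CA CA\<^esub>"
      using linear_map_zero[OF Cc_module_abelian_group nonunital_moduleD(1)[OF tensor_module(1)] Cc_comult(1)]
      by (simp add: tensor_Cc_coalgebra)
    then show ?case using lift_zero by simp
  next
    case (gen U f)
    obtain \<eta> where \<eta>: "(U, \<eta>) \<in> gens" "\<And>x. \<eta> x * f x = f x" using gens_unit1[OF gen] by blast
    have "b (pullback_ext E \<pi> U f) (pullback_ext E \<pi> U \<eta>) = pullback_ext E \<pi> U (\<lambda>x. \<eta> x * f x)"
      using b smult_pe[of \<eta> U f] smult_pe[of f U \<eta>] Cc_counit(2)[OF gen] Cc_counit(2)[OF \<eta>(1)] by (auto simp: mult.commute)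
    then show ?case
      using lift_pure[OF pullback_ext_in_Cc_sections[OF gen] pullback_ext_in_Cc_sections[OF \<eta>(1)]] Cc_comult(2)[OF gen \<eta>] \<eta>(2)
      by (simp add: tensor_Cc_coalgebra)
  next
    case (add s t)
    have "Cc_comult M E \<pi> (s \<oplus>\<^bsub>CC\<^esub> t) = Cc_comult M E \<pi> s \<oplus>\<^bsub>tensor RR CC CC\<^esub> Cc_comult M E \<pi> t"
      "Cc_comult M E \<pi> s \<in> carrier (tensor RR CC CC)" "Cc_comult M E \<pi> t \<in> carrier (tensor RR CC CC)"
      using Cc_comult(1) add by (auto simp: linear_map_def)
    then show ?case using lift_add[of "Cc_comult M E \<pi> s" "Cc_comult M E \<pi> t"] add by (simp add: tensor_Cc_coalgebra)
  qed
qed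

lemma Cc_coalgebra_is_coalgebra: "is_coalgebra RR CA"
  unfolding is_coalgebra_def
proof (intro conjI Cc_coalgebra_nonunital ballI)
  show "locally_unitary RR CA"
    using Cc_module_locally_unitary by (simp add: locally_unitary_def)
  show "linear_map RR CA (tensor RR CA CA) (comult CA)"
    using Cc_comult(1) by (simp add: linear_map_def tensor_Cc_coalgebra)
  show "linear_map RR CA (regular_module RR) (counit CA)"
    using Cc_counit(1) by (simp add: linear_map_def)
  fix s :: "('e, 'k::real_normed_field) germ_section" assume "s \<in> carrier CA"
  then have s: "s \<in> Cc_sections E" by simp
  show "tensor_lift CA (\<lambda>c1 c2. counit CA c2 \<odot>\<^bsub>CA\<^esub> c1) (comult CA s) = s"
    "tensor_lift CA (\<lambda>c1 c2. counit CA c1 \<odot>\<^bsub>CA\<^esub> c2) (comult CA s) = s"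
    using counit_law[OF _ s] by auto
qed

lemma coalgebra_at: "x \<in> points M \<Longrightarrow> coalgebra_at M CA x"
  by (simp add: coalgebra_at_def module_at_def module_at_axioms_def coalgebra_at_axioms_def
      hausdorff_manifold_axioms Cc_coalgebra_nonunital Cc_coalgebra_is_coalgebra)

subsection \<open>Grouplike elements of the stalks\<close>

text \<open>At a single point only one germ matters, and each generator contributes there either the
  pullback of its function or 0. So germs on \<open>E\<close> can be handled through global
  functions on \<open>M\<close>, whose continuity is used for idempotents.\<close>

lemma section_representative:
  fixes s :: "('e, 'k::real_normed_field) germ_section"
  assumes "s \<in> Cc_sections E"
  shows "\<exists>g\<in>Cc M. s y = germ E y (g \<circ> \<pi>)"
  using assms
proof (induction rule: Cc_sections_induct)
  case zero
  show ?case using Cc_zero by (intro bexI[of _ "\<lambda>_. 0"]) (auto simp: o_def)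
next
  case (gen U f)
  then show ?case using gensD(2)[OF gen] Cc_zero
    by (intro bexI[of _ "if y \<in> U then f else (\<lambda>_. 0)"]) (auto simp: pullback_ext_at o_def)
next
  case (add s t)
  then obtain g h where "g \<in> Cc M" "s y = germ E y (g \<circ> \<pi>)" "h \<in> Cc M" "t y = germ E y (h \<circ> \<pi>)" by blast
  then show ?case by (intro bexI[of _ "\<lambda>x. g x + h x"]) (auto simp: germ_add_germ o_def Cc_add)
qed

text \<open>Equality of classes says that the difference is null at \<open>x\<close>, and by
  \<open>null_at_iff\<close> this is visible on the germs along the fibre.\<close>

lemma stalk_class_eq_iff:
  fixes s t :: "('e, 'k::real_normed_field) germ_section"
  assumes x: "x \<in> points M" and s: "s \<in> Cc_sections E" and t: "t \<in> Cc_sections E"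
  shows "stalk_class M CA x s = stalk_class M CA x t \<longleftrightarrow> (\<forall>y\<in>points E. \<pi> y = x \<longrightarrow> s y = t y)"
proof -
  interpret L: coalgebra_at M "CA :: ('m \<Rightarrow> 'k, ('e, 'k) germ_section) coalgebra" x by (rule coalgebra_at[OF x])
  have null: "n \<in> null_at M CA x \<longleftrightarrow> n \<in> Cc_sections E \<and> (\<forall>y\<in>points E. \<pi> y = x \<longrightarrow> n y = germ E y (\<lambda>_. 0))"
    for n :: "('e, 'k) germ_section"
    using null_at_iff[OF x] by (simp add: null_at_def)
  let ?n = "s \<ominus>\<^bsub>CA\<^esub> t"
  have n: "?n \<in> Cc_sections E" using L.A.minus_closed[of s t] s t by simp
  have "?n \<oplus>\<^bsub>CA\<^esub> t = s" using L.A.a_assoc[of s "\<ominus>\<^bsub>CA\<^esub> t" t] L.A.l_neg[of t] L.A.r_zero[of s] L.A.a_inv_closed[of t] s t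
    unfolding a_minus_def by (simp del: Cc_coalgebra_simps(2-))
  then have sy: "s y = germ_add (?n y) (t y)" for y by (simp add: fun_eq_iff)
  have "?n y = germ E y (\<lambda>_. 0) \<longleftrightarrow> s y = t y" for y
  proof -
    obtain H K where HK: "?n y = germ E y H" "t y = germ E y K"
      using section_representative[OF n] section_representative[OF t] by blast
    show ?thesis
    proof
      assume "s y = t y"
      then have "germ_add (germ_add (?n y) (t y)) (germ E y (\<lambda>z. - K z)) = germ_add (t y) (germ E y (\<lambda>z. - K z))"
        using sy by simp
      then show "?n y = germ E y (\<lambda>_. 0)" unfolding HK germ_add_germ by simp
    next
      assume "?n y = germ E y (\<lambda>_. 0)"
      then show "s y = t y" using sy[of y] unfolding HK by (simp add: germ_add_germ)
    qed
  qed
  then show ?thesis using L.stalk_class_eq_iff[of t s] s t n null[of ?n] by auto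
qed

text \<open>\<open>tensor_lift\<close> takes its target as a module record, so the additive group of
  germs is packaged as one. Its scalar type is left free because it is the target both for the
  tensor square of the stalk, over germs, and for that of the sections, over functions.\<close>

definition germ_group :: "'e \<Rightarrow> ('s, ('e \<Rightarrow> 'k::real_normed_field) set) module" where
  "germ_group y = \<lparr>carrier = range (germ E y), monoid.mult = undefined, one = undefined,
     zero = germ E y (\<lambda>_. 0), add = germ_add, smult = undefined\<rparr>"

lemma germ_group_simps [simp]:
  "carrier (germ_group y) = range (germ E y)" "zero (germ_group y) = germ E y (\<lambda>_. 0)" "add (germ_group y) = germ_add"
  by (simp_all add: germ_group_def)

lemma germ_group: "abelian_group (germ_group y)"
proof (rule abelian_groupI, unfold germ_group_simps)
  fix g :: "('e \<Rightarrow> 'k::real_normed_field) set" assume "g \<in> range (germ E y)"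
  then obtain h where "g = germ E y h" by auto
  then show "\<exists>f\<in>range (germ E y). germ_add f g = germ E y (\<lambda>_. 0)"
    by (intro bexI[of _ "germ E y (\<lambda>z. - h z)"]) (auto simp: germ_add_germ)
qed (auto simp: germ_add_germ add_ac)

lemma germ_mult_range:
  assumes "a \<in> range (germ E y)" "b \<in> range (germ E y)" "c \<in> range (germ E y)"
  shows "germ_mult a b \<in> range (germ E y)"
    "germ_mult (germ_add a b) c = germ_add (germ_mult a c) (germ_mult b c)"
    "germ_mult a (germ_add b c) = germ_add (germ_mult a b) (germ_mult a c)"
    "germ_mult (germ_mult a b) c = germ_mult b (germ_mult a c)"
proof -
  obtain f g h where [simp]: "a = germ E y f" "b = germ E y g" "c = germ E y h" using assms by auto
  show "germ_mult a b \<in> range (germ E y)"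
    "germ_mult (germ_add a b) c = germ_add (germ_mult a c) (germ_mult b c)"
    "germ_mult a (germ_add b c) = germ_add (germ_mult a b) (germ_mult a c)"
    "germ_mult (germ_mult a b) c = germ_mult b (germ_mult a c)"
    by (simp_all add: germ_mult_germ germ_add_germ algebra_simps)
qed

text \<open>
  The functional \<open>c\<^sub>x \<otimes> d\<^sub>x \<mapsto> c(y) d(y)\<close> sends \<open>\<Delta>\<^sub>x c\<^sub>x\<close> to \<open>c(y)\<close>; hence the coefficients of a grouplike
  element are idempotent germs.
\<close>

lemma grouplike_idempotent:
  fixes c :: "('e, 'k::real_normed_field) germ_section"
  assumes y: "y \<in> points E" "\<pi> y = x" and c: "c \<in> Cc_sections E" "stalk_class M CA x c \<in> grouplikes M CA x"
  shows "germ_mult (c y) (c y) = c y"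
proof -
  have x: "x \<in> points M" using y proj_points by auto
  interpret L: coalgebra_at M "CA :: ('m \<Rightarrow> 'k, ('e, 'k) germ_section) coalgebra" x by (rule coalgebra_at[OF x])
  have CAc: "carrier (CA :: ('m \<Rightarrow> 'k, ('e, 'k) germ_section) coalgebra) = Cc_sections E" by simp
  define ev :: "('e, 'k) germ_section set \<Rightarrow> ('e \<Rightarrow> 'k) set" where "ev \<zeta> = the_elem ((\<lambda>s. s y) ` \<zeta>)" for \<zeta>
  have ev: "ev (L.cl s) = s y" if s: "s \<in> Cc_sections E" for s
  proof -
    have "s' y = s y" if s': "s' \<in> L.cl s" for s'
    proof -
      have "s' \<in> Cc_sections E" "L.cl s' = L.cl s"
        using L.stalk_class_memD[of s s'] L.stalk_class_eqI[of s s'] s s' by auto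
      then show ?thesis using stalk_class_eq_iff[OF x _ s] y by blast
    qed
    note eq = this
    show ?thesis unfolding ev_def
      by (rule the_elem_image_unique[OF _ eq]) (use L.stalk_class_self[of s] s in auto)
  qed
  have rng: "s y \<in> range (germ E y)" if "s \<in> Cc_sections E" for s :: "('e, 'k) germ_section"
    using section_representative[OF that, of y] by blast
  \<comment> \<open>The same functional in two guises, on the stalk and on sections. The grouplike
    identity lives in the tensor square of the stalk, whereas \<Delta> is known on sections;
    \<open>L12\<close> connects the two.\<close>
  define b1 where "b1 \<zeta> \<xi> = germ_mult (ev \<zeta>) (ev \<xi>)" for \<zeta> \<xi>
  define b2 :: "('e, 'k) germ_section \<Rightarrow> ('e, 'k) germ_section \<Rightarrow> ('e \<Rightarrow> 'k) set" where "b2 s t = germ_mult (s y) (t y)" for s t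
  interpret TS: tensor_pair "germ_ring M x :: ('m \<Rightarrow> 'k) set ring" L.S L.S by (rule L.stalk_tensor_pair)
  interpret TP: tensor_pair "RR :: ('m \<Rightarrow> 'k) ring" CA CA by (rule tensor_pair_CA)
  have add: "L.cl s \<oplus>\<^bsub>L.S\<^esub> L.cl t = L.cl (s \<oplus>\<^bsub>CA\<^esub> t)" "s \<oplus>\<^bsub>CA\<^esub> t \<in> Cc_sections E"
    if "s \<in> Cc_sections E" "t \<in> Cc_sections E" for s t
    using L.stalk_class_add[of s t] L.A.a_closed[of s t] that unfolding CAc by auto
  have "\<exists>s\<in>Cc_sections E. \<zeta> = L.cl s" if "\<zeta> \<in> carrier L.S" for \<zeta> using that by (auto simp: L.carrier_stalk)
  note rep = this
  have b1: "b1 \<zeta> \<xi> \<in> carrier (germ_group y)"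
    "b1 (\<zeta> \<oplus>\<^bsub>L.S\<^esub> \<zeta>') \<xi> = b1 \<zeta> \<xi> \<oplus>\<^bsub>germ_group y\<^esub> b1 \<zeta>' \<xi>"
    "b1 \<xi> (\<zeta> \<oplus>\<^bsub>L.S\<^esub> \<zeta>') = b1 \<xi> \<zeta> \<oplus>\<^bsub>germ_group y\<^esub> b1 \<xi> \<zeta>'"
    "g \<in> carrier (germ_ring M x) \<Longrightarrow> b1 (g \<odot>\<^bsub>L.S\<^esub> \<zeta>) \<xi> = b1 \<zeta> (g \<odot>\<^bsub>L.S\<^esub> \<xi>)"
    if z: "\<zeta> \<in> carrier L.S" "\<zeta>' \<in> carrier L.S" "\<xi> \<in> carrier L.S" for \<zeta> \<zeta>' \<xi> g
  proof -
    obtain s s' t where s: "s \<in> Cc_sections E" "s' \<in> Cc_sections E" "t \<in> Cc_sections E"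
      "\<zeta> = L.cl s" "\<zeta>' = L.cl s'" "\<xi> = L.cl t" using rep z by metis
    note r = rng[OF s(1)] rng[OF s(2)] rng[OF s(3)]
    show "b1 \<zeta> \<xi> \<in> carrier (germ_group y)"
      using germ_mult_range(1)[OF r(1,3,3)] ev s by (simp add: b1_def)
    show "b1 (\<zeta> \<oplus>\<^bsub>L.S\<^esub> \<zeta>') \<xi> = b1 \<zeta> \<xi> \<oplus>\<^bsub>germ_group y\<^esub> b1 \<zeta>' \<xi>"
      using germ_mult_range(2)[OF r(1,2,3)] ev s add[OF s(1,2)] by (simp add: b1_def)
    show "b1 \<xi> (\<zeta> \<oplus>\<^bsub>L.S\<^esub> \<zeta>') = b1 \<xi> \<zeta> \<oplus>\<^bsub>germ_group y\<^esub> b1 \<xi> \<zeta>'"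
      using germ_mult_range(3)[OF r(3,1,2)] ev s add[OF s(1,2)] by (simp add: b1_def)
    assume "g \<in> carrier (germ_ring M x)"
    then obtain f where f: "f \<in> Cc M" "germ M x f = g" using L.germ_ring_representative by blast
    have "g \<odot>\<^bsub>L.S\<^esub> L.cl u = L.cl (f \<odot>\<^bsub>CA\<^esub> u)" "f \<odot>\<^bsub>CA\<^esub> u \<in> Cc_sections E" if "u \<in> Cc_sections E" for u
      using L.stalk_smult[OF f(1), of u] L.smult_closed[OF f(1), of u] f(2) that unfolding CAc by auto
    then show "b1 (g \<odot>\<^bsub>L.S\<^esub> \<zeta>) \<xi> = b1 \<zeta> (g \<odot>\<^bsub>L.S\<^esub> \<xi>)"
      using germ_mult_range(4)[of "germ E y (f \<circ> \<pi>)" y "s y" "t y"] r ev s by (simp add: b1_def)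
  qed
  have b2: "b2 s t \<in> carrier (germ_group y)"
    "b2 (s \<oplus>\<^bsub>CA\<^esub> s') t = b2 s t \<oplus>\<^bsub>germ_group y\<^esub> b2 s' t"
    "b2 t (s \<oplus>\<^bsub>CA\<^esub> s') = b2 t s \<oplus>\<^bsub>germ_group y\<^esub> b2 t s'"
    "b2 (f \<odot>\<^bsub>CA\<^esub> s) t = b2 s (f \<odot>\<^bsub>CA\<^esub> t)"
    if "s \<in> carrier CA" "s' \<in> carrier CA" "t \<in> carrier CA" for s s' t f
    using germ_mult_range(1,2)[OF rng rng rng, of s s' t] germ_mult_range(1)[OF rng rng rng, of s t t]
      germ_mult_range(3)[OF rng rng rng, of t s s']
      germ_mult_range(4)[of "germ E y (f \<circ> \<pi>)" y "s y" "t y"] rng that by (simp_all add: b2_def)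
  let ?L1 = "tensor_lift (germ_group y :: (('m \<Rightarrow> 'k) set, _) module) b1"
  let ?L2 = "tensor_lift (germ_group y :: ('m \<Rightarrow> 'k, _) module) b2"
  have b1': "\<And>\<zeta> \<xi>. \<zeta> \<in> carrier L.S \<Longrightarrow> \<xi> \<in> carrier L.S \<Longrightarrow> b1 \<zeta> \<xi> \<in> carrier (germ_group y :: (('m \<Rightarrow> 'k) set, _) module)"
    "\<And>\<zeta> \<zeta>' \<xi>. \<zeta> \<in> carrier L.S \<Longrightarrow> \<zeta>' \<in> carrier L.S \<Longrightarrow> \<xi> \<in> carrier L.S \<Longrightarrow>
      b1 (\<zeta> \<oplus>\<^bsub>L.S\<^esub> \<zeta>') \<xi> = b1 \<zeta> \<xi> \<oplus>\<^bsub>germ_group y :: (('m \<Rightarrow> 'k) set, _) module\<^esub> b1 \<zeta>' \<xi>"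
    "\<And>\<xi> \<zeta> \<zeta>'. \<xi> \<in> carrier L.S \<Longrightarrow> \<zeta> \<in> carrier L.S \<Longrightarrow> \<zeta>' \<in> carrier L.S \<Longrightarrow>
      b1 \<xi> (\<zeta> \<oplus>\<^bsub>L.S\<^esub> \<zeta>') = b1 \<xi> \<zeta> \<oplus>\<^bsub>germ_group y :: (('m \<Rightarrow> 'k) set, _) module\<^esub> b1 \<xi> \<zeta>'"
    "\<And>g \<zeta> \<xi>. g \<in> carrier (germ_ring M x) \<Longrightarrow> \<zeta> \<in> carrier L.S \<Longrightarrow> \<xi> \<in> carrier L.S \<Longrightarrow>
      b1 (g \<odot>\<^bsub>L.S\<^esub> \<zeta>) \<xi> = b1 \<zeta> (g \<odot>\<^bsub>L.S\<^esub> \<xi>)"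
    using b1 by simp_all
  have b2': "\<And>s t. s \<in> carrier CA \<Longrightarrow> t \<in> carrier CA \<Longrightarrow> b2 s t \<in> carrier (germ_group y :: ('m \<Rightarrow> 'k, _) module)"
    "\<And>s s' t. s \<in> carrier CA \<Longrightarrow> s' \<in> carrier CA \<Longrightarrow> t \<in> carrier CA \<Longrightarrow>
      b2 (s \<oplus>\<^bsub>CA\<^esub> s') t = b2 s t \<oplus>\<^bsub>germ_group y :: ('m \<Rightarrow> 'k, _) module\<^esub> b2 s' t"
    "\<And>t s s'. t \<in> carrier CA \<Longrightarrow> s \<in> carrier CA \<Longrightarrow> s' \<in> carrier CA \<Longrightarrow>
      b2 t (s \<oplus>\<^bsub>CA\<^esub> s') = b2 t s \<oplus>\<^bsub>germ_group y :: ('m \<Rightarrow> 'k, _) module\<^esub> b2 t s'"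
    "\<And>f s t. f \<in> carrier RR \<Longrightarrow> s \<in> carrier CA \<Longrightarrow> t \<in> carrier CA \<Longrightarrow>
      b2 (f \<odot>\<^bsub>CA\<^esub> s) t = b2 s (f \<odot>\<^bsub>CA\<^esub> t)"
    using b2 by simp_all
  have L1_pure: "?L1 (TS.pure s t) = b1 s t" if "s \<in> carrier L.S" "t \<in> carrier L.S" for s t
    by (rule TS.tensor_lift_pure[OF germ_group]) (assumption | rule that b1')+
  have L1_add: "?L1 (t \<oplus>\<^bsub>TS.T\<^esub> u) = ?L1 t \<oplus>\<^bsub>germ_group y :: (('m \<Rightarrow> 'k) set, _) module\<^esub> ?L1 u"
    if "t \<in> carrier TS.T" "u \<in> carrier TS.T" for t u
    by (rule TS.tensor_lift_add[OF germ_group]) (assumption | rule that b1')+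
  have L1_zero: "?L1 \<zero>\<^bsub>TS.T\<^esub> = germ E y (\<lambda>_. 0)"
    by (subst TS.tensor_lift_zero[OF germ_group]) (assumption | rule b1' germ_group_simps)+
  have L2_pure: "?L2 (TP.pure s t) = b2 s t" if "s \<in> carrier CA" "t \<in> carrier CA" for s t
    by (rule TP.tensor_lift_pure[OF germ_group]) (assumption | rule that b2')+
  have L2_add: "?L2 (t \<oplus>\<^bsub>TP.T\<^esub> u) = ?L2 t \<oplus>\<^bsub>germ_group y :: ('m \<Rightarrow> 'k, _) module\<^esub> ?L2 u"
    if "t \<in> carrier TP.T" "u \<in> carrier TP.T" for t u
    by (rule TP.tensor_lift_add[OF germ_group]) (assumption | rule that b2')+
  have L2_zero: "?L2 \<zero>\<^bsub>TP.T\<^esub> = germ E y (\<lambda>_. 0)"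
    by (subst TP.tensor_lift_zero[OF germ_group]) (assumption | rule b2' germ_group_simps)+
  have L12: "?L1 (L.Tx t) = ?L2 t" if "t \<in> carrier TP.T" for t
    using that
  proof (induction rule: TP.tensor_induct)
    case zero
    then show ?case using L1_zero L2_zero tensor_hom.tensor_map_zero[OF L.stalk_tensor_hom] by simp
  next
    case (pure s t)
    then have cs: "L.cl s \<in> carrier L.S" "L.cl t \<in> carrier L.S" by (auto simp: L.carrier_stalk)
    have "?L1 (L.Tx (TP.pure s t)) = b1 (L.cl s) (L.cl t)"
      using tensor_hom.tensor_map_pure[OF L.stalk_tensor_hom pure] L1_pure[OF cs] by simp
    moreover have "?L2 (TP.pure s t) = b2 s t" using L2_pure pure by simp
    moreover have "b1 (L.cl s) (L.cl t) = b2 s t" using ev pure by (simp add: b1_def b2_def)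
    ultimately show ?case by simp
  next
    case (add t u)
    then show ?case
      using L1_add L2_add tensor_hom.tensor_map_add[OF L.stalk_tensor_hom] tensor_hom.tensor_map_closed[OF L.stalk_tensor_hom]
      by simp
  qed
  \<comment> \<open>On a generator \<Delta> gives f \<otimes> \<eta>, and the product of the two
    germs at \<open>y\<close> is that of \<eta> f = f.\<close>
  have L2_comult: "?L2 (Cc_comult M E \<pi> s) = s y" if "s \<in> Cc_sections E" for s
    using that
  proof (induction rule: Cc_sections_induct)
    case zero
    have "Cc_comult M E \<pi> (\<lambda>y. germ E y (\<lambda>_. 0 :: 'k)) = \<zero>\<^bsub>tensor RR CA CA\<^esub>"
      using linear_map_zero[OF Cc_module_abelian_group nonunital_moduleD(1)[OF tensor_module(1)] Cc_comult(1)]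
      by (simp add: tensor_Cc_coalgebra)
    then show ?case using L2_zero by simp
  next
    case (gen U f)
    obtain \<eta> where \<eta>: "(U, \<eta>) \<in> gens" "\<And>x. \<eta> x * f x = f x" using gens_unit1[OF gen] by blast
    have "b2 (pullback_ext E \<pi> U f) (pullback_ext E \<pi> U \<eta>) = pullback_ext E \<pi> U f y"
      unfolding b2_def pullback_ext_at germ_mult_germ
      by (rule arg_cong[of _ _ "germ E y"]) (use \<eta>(2) in \<open>auto simp: fun_eq_iff mult.commute\<close>)
    then show ?case
      using L2_pure pullback_ext_in_Cc_sections[OF gen] pullback_ext_in_Cc_sections[OF \<eta>(1)] Cc_comult(2)[OF gen \<eta>]
      by (simp add: tensor_Cc_coalgebra)
  next
    case (add s t)
    have "Cc_comult M E \<pi> (s \<oplus>\<^bsub>CC\<^esub> t) = Cc_comult M E \<pi> s \<oplus>\<^bsub>tensor RR CC CC\<^esub> Cc_comult M E \<pi> t"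
      "Cc_comult M E \<pi> s \<in> carrier (tensor RR CC CC)" "Cc_comult M E \<pi> t \<in> carrier (tensor RR CC CC)"
      using Cc_comult(1) add by (auto simp: linear_map_def)
    then show ?case using L2_add[of "Cc_comult M E \<pi> s" "Cc_comult M E \<pi> t"] add by (simp add: tensor_Cc_coalgebra)
  qed
  have cc: "Cc_comult M E \<pi> c \<in> carrier TP.T"
    using Cc_comult(1) c(1) by (auto simp: linear_map_def tensor_Cc_coalgebra)
  have cS: "L.cl c \<in> carrier L.S" using c(1) by (auto simp: L.carrier_stalk)
  have "L.Tx (Cc_comult M E \<pi> c) = TS.pure (L.cl c) (L.cl c)"
    using c L.stalk_comult[of c] by (simp add: grouplikes_def)
  then have "?L1 (TS.pure (L.cl c) (L.cl c)) = c y" using L12[OF cc] L2_comult[OF c(1)] by simp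
  then show ?thesis using L1_pure[OF cS cS] ev[OF c(1)] by (simp add: b1_def)
qed

section \<open>The map \<open>Phi\<close> on points\<close>

lemma admissible_iff:
  "admissible M E \<pi> y U f \<longleftrightarrow> y \<in> U \<and> (U, f) \<in> gens \<and> germ M (\<pi> y) f = germ M (\<pi> y) (\<lambda>_. 1)"
  by (auto simp: admissible_def gens_iff)

lemma unit_section_exists:
  assumes y: "y \<in> N" and N: "openin (mtop E) N"
  obtains U W and f :: "'m \<Rightarrow> 'k::real_normed_field" where "(U, f) \<in> gens" "y \<in> U" "U \<subseteq> N"
    "openin (mtop M) W" "\<pi> y \<in> W" "W \<subseteq> \<pi> ` U" "\<And>x. x \<in> W \<Longrightarrow> f x = 1"
proof -
  have "y \<in> points E" using y open_subset_pointsE[OF N] by auto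
  then obtain U0 where U0: "elementary E \<pi> U0" "y \<in> U0" using sheaf_elementary_nbhd[OF E] by metis
  let ?U = "U0 \<inter> N"
  have U: "elementary E \<pi> ?U" by (rule elementary_subset[OF U0(1)]) (use U0 N in \<open>auto simp: elementary_def\<close>)
  obtain f :: "'m \<Rightarrow> 'k" and W where f: "f \<in> Cc M" "supp M f \<subseteq> \<pi> ` ?U" "openin (mtop M) W" "\<pi> y \<in> W"
    "W \<subseteq> \<pi> ` ?U" "\<And>x. x \<in> W \<Longrightarrow> f x = 1"
    using Cc_bump[OF _ elementary_image_open[OF U], of "\<pi> y"] y U0(2) by blast
  show ?thesis by (rule that[of ?U f W]) (use f U y U0(2) in \<open>simp_all add: gens_def\<close>)
qed

lemma admissible_unit:
  assumes "(U, f) \<in> gens" "openin (mtop M) W" "\<And>x. x \<in> W \<Longrightarrow> f x = 1" "y \<in> U" "\<pi> y \<in> W"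
  shows "admissible M E \<pi> y U f"
  unfolding admissible_iff using assms germ_eqI[OF assms(2,5), of f "\<lambda>_. 1"] by auto

lemma admissible_exists:
  assumes "y \<in> points E"
  shows "\<exists>U f. admissible M E \<pi> y U (f :: 'm \<Rightarrow> 'k::real_normed_field)"
proof -
  have "openin (mtop E) (points E)" using TE by (metis openin_topspace)
  then obtain U W and f :: "'m \<Rightarrow> 'k" where "(U, f) \<in> gens" "y \<in> U" "openin (mtop M) W" "\<pi> y \<in> W" "\<And>x. x \<in> W \<Longrightarrow> f x = 1"
    using unit_section_exists[OF assms] by metis
  then show ?thesis using admissible_unit by blast
qed

text \<open>\<open>U\<close> contains no other point of the fibre than \<open>y\<close>, and
  \<open>f\<close> has germ 1 at \<pi>(y). Hence along the fibre the section is the delta function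
  at \<open>y\<close>, whichever admissible pair is used.\<close>

lemma admissible_at:
  assumes a: "admissible M E \<pi> y U f" and z: "z \<in> points E" "\<pi> z = \<pi> y"
  shows "pullback_ext E \<pi> U f z = germ E z (\<lambda>_. if z = y then 1 else 0)"
proof (cases "z = y")
  case True
  have "\<pi> y \<in> topspace (mtop M)" using proj_points[OF z(1)] z(2) TM by simp
  then obtain W where W: "openin (mtop M) W" "\<pi> y \<in> W" "\<And>x. x \<in> W \<Longrightarrow> f x = 1"
    using germ_eqD[of M "\<pi> y" f "\<lambda>_. 1"] a unfolding admissible_iff by blast
  have "germ E y (\<lambda>z. f (\<pi> z)) = germ E y (\<lambda>_. 1)"
    by (rule germ_eqI[OF openin_proj_vimage[OF W(1)]]) (use True z W in auto)
  then show ?thesis using True a by (simp add: pullback_ext_at admissible_iff)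
next
  case False
  then have "z \<notin> U" using a z(2) by (auto simp: admissible_def elementary_def inj_on_def)
  then show ?thesis using False by (simp add: pullback_ext_at)
qed

lemma stalk_class_eq_admissible_iff:
  assumes a: "admissible M E \<pi> y U f" and c: "c \<in> Cc_sections E"
  shows "stalk_class M CA (\<pi> y) c = stalk_class M CA (\<pi> y) (pullback_ext E \<pi> U f) \<longleftrightarrow>
    (\<forall>z\<in>points E. \<pi> z = \<pi> y \<longrightarrow> c z = germ E z (\<lambda>_. if z = y then 1 else 0))"
proof -
  have g: "(U, f) \<in> gens" and y: "y \<in> points E" using a elementary_points gensD(1) by (auto simp: admissible_iff)
  show ?thesis
    using stalk_class_eq_iff[OF proj_points[OF y] c pullback_ext_in_Cc_sections[OF g]] admissible_at[OF a] by auto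
qed

text \<open>Any two admissible pairs have the same germs along the fibre, hence define the same
  class; so the definite description is unambiguous.\<close>

lemma Phi_eq:
  fixes f :: "'m \<Rightarrow> 'k::real_normed_field"
  assumes a: "admissible M E \<pi> y U f"
  shows "Phi M E \<pi> y = (\<pi> y, stalk_class M CA (\<pi> y) (pullback_ext E \<pi> U f))"
  unfolding Phi_def
proof (rule the_equality)
  show "\<exists>U' f'. admissible M E \<pi> y U' f' \<and> (\<pi> y, stalk_class M CA (\<pi> y) (pullback_ext E \<pi> U f)) =
      (\<pi> y, stalk_class M CA (\<pi> y) (pullback_ext E \<pi> U' (f' :: 'm \<Rightarrow> 'k)))" using a by blast
  fix p assume "\<exists>U' f'. admissible M E \<pi> y U' f' \<and> p = (\<pi> y, stalk_class M CA (\<pi> y) (pullback_ext E \<pi> U' (f' :: 'm \<Rightarrow> 'k)))"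
  then obtain V and g :: "'m \<Rightarrow> 'k" where g: "admissible M E \<pi> y V g" "p = (\<pi> y, stalk_class M CA (\<pi> y) (pullback_ext E \<pi> V g))"
    by blast
  then show "p = (\<pi> y, stalk_class M CA (\<pi> y) (pullback_ext E \<pi> U f))"
    using stalk_class_eq_admissible_iff[OF a, of "pullback_ext E \<pi> V g"] admissible_at[OF g(1)]
      pullback_ext_in_Cc_sections[of V g] by (auto simp: admissible_iff)
qed

lemma fst_Phi: "y \<in> points E \<Longrightarrow> fst (Phi M E \<pi> y :: 'm \<times> ('e, 'k::real_normed_field) germ_section set) = \<pi> y"
proof -
  assume "y \<in> points E"
  then obtain U and f :: "'m \<Rightarrow> 'k" where "admissible M E \<pi> y U f" using admissible_exists by blast
  from Phi_eq[OF this] show ?thesis by simp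
qed

lemma Phi_eq_iff:
  fixes c :: "('e, 'k::real_normed_field) germ_section"
  assumes y: "y \<in> points E" and c: "c \<in> Cc_sections E"
  shows "Phi M E \<pi> y = (\<pi> y, stalk_class M CA (\<pi> y) c) \<longleftrightarrow>
    (\<forall>z\<in>points E. \<pi> z = \<pi> y \<longrightarrow> c z = germ E z (\<lambda>_. if z = y then 1 else 0))"
proof -
  obtain U and f :: "'m \<Rightarrow> 'k" where a: "admissible M E \<pi> y U f" using admissible_exists[OF y] by blast
  have "Phi M E \<pi> y = (\<pi> y, stalk_class M CA (\<pi> y) c) \<longleftrightarrow>
      stalk_class M CA (\<pi> y) c = stalk_class M CA (\<pi> y) (pullback_ext E \<pi> U f)"
    unfolding Phi_eq[OF a] prod.inject by (simp only: simp_thms eq_commute)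
  then show ?thesis unfolding stalk_class_eq_admissible_iff[OF a c] .
qed

text \<open>The class remembers the delta function along the fibre, and the germs of 1 and 0 differ
  at points of \<open>E\<close>.\<close>

lemma Phi_inj:
  assumes y: "y \<in> points E" "z \<in> points E"
    and eq: "Phi M E \<pi> y = (Phi M E \<pi> z :: 'm \<times> ('e, 'k::real_normed_field) germ_section set)"
  shows "y = z"
proof (rule ccontr)
  assume ne: "y \<noteq> z"
  obtain U and f :: "'m \<Rightarrow> 'k" where a: "admissible M E \<pi> y U f" using admissible_exists[OF y(1)] by blast
  then have g: "(U, f) \<in> gens" by (simp add: admissible_iff)
  have fs: "\<pi> z = \<pi> y" using fst_Phi[OF y(1)] fst_Phi[OF y(2)] eq by metis
  have "Phi M E \<pi> z = (\<pi> z, stalk_class M CA (\<pi> z) (pullback_ext E \<pi> U f))" using Phi_eq[OF a] eq fs by simp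
  then have "pullback_ext E \<pi> U f y = germ E y (\<lambda>_. if y = z then 1 else 0)"
    using Phi_eq_iff[OF y(2) pullback_ext_in_Cc_sections[OF g]] y(1) fs by simp
  then have "germ E y (\<lambda>_. 1 :: 'k) = germ E y (\<lambda>_. 0)" using admissible_at[OF a y(1) refl] ne by simp
  from germ_value[OF this] show False using y(1) TE by simp
qed

text \<open>The choice is harmless, since all representatives of a germ at a point of
  \<open>E\<close> have the same value at that point.\<close>

definition germ_val :: "('e, 'k) germ_section \<Rightarrow> 'e \<Rightarrow> 'k" where
  "germ_val s y = (SOME h. s y = germ E y h) y"

lemma germ_val_eq:
  assumes "y \<in> points E" "s y = germ E y h"
  shows "germ_val s y = h y"
proof -
  have "germ E y (SOME h. s y = germ E y h) = germ E y h"
    using someI[of "\<lambda>h. s y = germ E y h", OF assms(2)] assms(2) by metis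
  from germ_value[OF this] show ?thesis unfolding germ_val_def using assms(1) TE by blast
qed

text \<open>The counit is summation over the fibre. The fibre may be infinite, so the sum is taken
  over a finite set \<open>K\<close> outside which the germs vanish; for a sum of sections the two
  sets are united, and the added points contribute 0.\<close>

lemma counit_fibre_sum:
  fixes s :: "('e, 'k::real_normed_field) germ_section"
  assumes x: "x \<in> points M" and s: "s \<in> Cc_sections E"
  shows "\<exists>K. finite K \<and> K \<subseteq> {y \<in> points E. \<pi> y = x} \<and>
    (\<forall>y\<in>points E. \<pi> y = x \<longrightarrow> y \<notin> K \<longrightarrow> s y = germ E y (\<lambda>_. 0)) \<and>
    Cc_counit M E \<pi> s x = (\<Sum>y\<in>K. germ_val s y)"
  using s
proof (induction rule: Cc_sections_induct)
  case zero
  have "Cc_counit M E \<pi> (\<lambda>y. germ E y (\<lambda>_. 0 :: 'k)) = (\<lambda>_. 0)"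
    using linear_map_zero[OF Cc_module_abelian_group nonunital_moduleD(1)[OF regular_module_nonunital] Cc_counit(1)]
    by (simp add: regular_module_def)
  then show ?case by (intro exI[of _ "{}"]) simp
next
  case (gen U f)
  show ?case
  proof (cases "x \<in> \<pi> ` U")
    case True
    then obtain y where y: "y \<in> U" "x = \<pi> y" by auto
    have yE: "y \<in> points E" using y(1) elementary_points[OF gensD(1)[OF gen]] by auto
    have "germ_val (pullback_ext E \<pi> U f) y = f x"
      using germ_val_eq[of y "pullback_ext E \<pi> U f", OF yE pullback_ext_at[of U f y]] y by simp
    moreover have "pullback_ext E \<pi> U f z = germ E z (\<lambda>_. 0)" if "\<pi> z = x" "z \<noteq> y" for z
    proof -
      have "z \<notin> U" using gensD(1)[OF gen] that y by (auto simp: elementary_def inj_on_def)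
      then show ?thesis by (simp add: pullback_ext_at)
    qed
    ultimately show ?thesis using yE y(2) Cc_counit(2)[OF gen] by (intro exI[of _ "{y}"]) auto
  next
    case False
    then have "f x = 0" using gensD(4)[OF gen] by blast
    moreover have "pullback_ext E \<pi> U f z = germ E z (\<lambda>_. 0)" if "\<pi> z = x" for z
    proof -
      have "z \<notin> U" using False that by auto
      then show ?thesis by (simp add: pullback_ext_at)
    qed
    ultimately show ?thesis using Cc_counit(2)[OF gen] by (intro exI[of _ "{}"]) auto
  qed
next
  case (add s t)
  from add(3) obtain K where K: "finite K" "K \<subseteq> {y \<in> points E. \<pi> y = x}"
      "\<forall>y\<in>points E. \<pi> y = x \<longrightarrow> y \<notin> K \<longrightarrow> s y = germ E y (\<lambda>_. 0)" "Cc_counit M E \<pi> s x = (\<Sum>y\<in>K. germ_val s y)"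
    by (elim exE conjE) (rule that)
  from add(4) obtain L where L: "finite L" "L \<subseteq> {y \<in> points E. \<pi> y = x}"
      "\<forall>y\<in>points E. \<pi> y = x \<longrightarrow> y \<notin> L \<longrightarrow> t y = germ E y (\<lambda>_. 0)" "Cc_counit M E \<pi> t x = (\<Sum>y\<in>L. germ_val t y)"
    by (elim exE conjE) (rule that)
  have KL: "K \<union> L \<subseteq> {y \<in> points E. \<pi> y = x}" using K(2) L(2) by blast
  have "(\<Sum>y\<in>K. germ_val s y) = (\<Sum>y\<in>K \<union> L. germ_val s y)"
  proof (rule sum.mono_neutral_left)
    show "\<forall>y\<in>K \<union> L - K. germ_val s y = 0"
    proof
      fix y assume "y \<in> K \<union> L - K"
      then show "germ_val s y = 0" using K(3) KL germ_val_eq[of y s "\<lambda>_. 0"] by auto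
    qed
  qed (use K L in auto)
  moreover have "(\<Sum>y\<in>L. germ_val t y) = (\<Sum>y\<in>K \<union> L. germ_val t y)"
  proof (rule sum.mono_neutral_left)
    show "\<forall>y\<in>K \<union> L - L. germ_val t y = 0"
    proof
      fix y assume "y \<in> K \<union> L - L"
      then show "germ_val t y = 0" using L(3) KL germ_val_eq[of y t "\<lambda>_. 0"] by auto
    qed
  qed (use K L in auto)
  moreover have "germ_val (\<lambda>y. germ_add (s y) (t y)) y = germ_val s y + germ_val t y" if "y \<in> K \<union> L" for y
  proof -
    have yE: "y \<in> points E" using that KL by auto
    obtain g h where gh: "s y = germ E y g" "t y = germ E y h"
      using section_representative[OF add(1)] section_representative[OF add(2)] by metis
    then have "germ_add (s y) (t y) = germ E y (\<lambda>z. g z + h z)" by (simp add: germ_add_germ)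
    from germ_val_eq[of y "\<lambda>y. germ_add (s y) (t y)", OF yE this] germ_val_eq[of y s, OF yE gh(1)] germ_val_eq[of y t, OF yE gh(2)]
    show ?thesis by simp
  qed
  ultimately have "Cc_counit M E \<pi> (\<lambda>y. germ_add (s y) (t y)) x = (\<Sum>y\<in>K \<union> L. germ_val (\<lambda>y. germ_add (s y) (t y)) y)"
    using Cc_counit_simps(2)[OF add(1,2)] K(4) L(4) by (simp add: sum.distrib)
  moreover have "germ_add (s y) (t y) = germ E y (\<lambda>_. 0)" if "y \<in> points E" "\<pi> y = x" "y \<notin> K \<union> L" for y
    using K(3) L(3) that by (simp add: germ_add_germ)
  ultimately show ?case using K(1) L(1) KL by (intro exI[of _ "K \<union> L"]) auto
qed

text \<open>Idempotency forces the values 0 and 1 near \<open>y\<close>, and continuity prevents a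
  jump between them. Continuity is available because the germ is represented by the pullback of a
  smooth function on \<open>M\<close>.\<close>

lemma idempotent_germ:
  fixes g :: "'m \<Rightarrow> 'k::real_normed_field"
  assumes y: "y \<in> points E" and g: "g \<in> Cc M" and idem: "germ_mult (germ E y (g \<circ> \<pi>)) (germ E y (g \<circ> \<pi>)) = germ E y (g \<circ> \<pi>)"
  shows "germ E y (g \<circ> \<pi>) = germ E y (\<lambda>_. 0) \<or> germ E y (g \<circ> \<pi>) = germ E y (\<lambda>_. 1)"
proof -
  have yT: "y \<in> topspace (mtop E)" using y TE by simp
  obtain N where N: "openin (mtop E) N" "y \<in> N" "\<And>z. z \<in> N \<Longrightarrow> g (\<pi> z) * g (\<pi> z) = g (\<pi> z)"
    using germ_eqD[OF idem[unfolded germ_mult_germ] yT] by auto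
  have 01: "g (\<pi> z) = 0 \<or> g (\<pi> z) = 1" if "z \<in> N" for z using N(3)[OF that] by auto
  \<comment> \<open>Radius 1 with strict inequality separates the two possible values 0 and
    1.\<close>
  have "openin (mtop M) {x \<in> points M. g x \<in> ball (g (\<pi> y)) 1}"
    by (rule smooth_fun_on_continuous[OF M CcD(1)[OF g] openin_points]) auto
  from openin_proj_vimage[OF this]
  have "openin (mtop E) (N \<inter> {z \<in> points E. \<pi> z \<in> {x \<in> points M. g x \<in> ball (g (\<pi> y)) 1}})" using N(1) by blast
  moreover have "y \<in> N \<inter> {z \<in> points E. \<pi> z \<in> {x \<in> points M. g x \<in> ball (g (\<pi> y)) 1}}"
    using N(2) y proj_points by auto
  ultimately have "germ E y (g \<circ> \<pi>) = germ E y (\<lambda>_. g (\<pi> y))"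
  proof (rule germ_eqI)
    fix z assume z: "z \<in> N \<inter> {z \<in> points E. \<pi> z \<in> {x \<in> points M. g x \<in> ball (g (\<pi> y)) 1}}"
    then have "dist (g (\<pi> y)) (g (\<pi> z)) < 1" by simp
    then show "(g \<circ> \<pi>) z = g (\<pi> y)" using 01[of z] 01[OF N(2)] z by (auto simp: dist_norm)
  qed
  then show ?thesis using 01[OF N(2)] by metis
qed

text \<open>
  Since the coefficients of a grouplike element are \<open>0\<close> or \<open>1\<close> and their sum is \<open>\<epsilon>(c)(x) = 1\<close> in a field of
  characteristic zero, exactly one of them is \<open>1\<close>.
\<close>

lemma grouplike_is_Phi:
  fixes \<zeta> :: "('e, 'k::real_normed_field) germ_section set"
  assumes x: "x \<in> points M" and z: "\<zeta> \<in> grouplikes M CA x"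
  shows "\<exists>y\<in>points E. \<pi> y = x \<and> Phi M E \<pi> y = (x, \<zeta>)"
proof -
  interpret L: coalgebra_at M "CA :: ('m \<Rightarrow> 'k, ('e, 'k) germ_section) coalgebra" x by (rule coalgebra_at[OF x])
  obtain c where c: "c \<in> Cc_sections E" "\<zeta> = L.cl c" using z by (auto simp: grouplikes_def L.carrier_stalk)
  have 01: "c y = germ E y (\<lambda>_. 0) \<or> c y = germ E y (\<lambda>_. 1)" if y: "y \<in> points E" "\<pi> y = x" for y
  proof -
    obtain g where g: "g \<in> Cc M" "c y = germ E y (g \<circ> \<pi>)" using section_representative[OF c(1)] by blast
    show ?thesis using idempotent_germ[OF y(1) g(1)] grouplike_idempotent[OF y c(1)] z c(2) g(2) by simp
  qed
  obtain K where K: "finite K" "K \<subseteq> {y \<in> points E. \<pi> y = x}"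
    "\<And>y. y \<in> points E \<Longrightarrow> \<pi> y = x \<Longrightarrow> y \<notin> K \<Longrightarrow> c y = germ E y (\<lambda>_. 0)" "Cc_counit M E \<pi> c x = (\<Sum>y\<in>K. germ_val c y)"
    using counit_fibre_sum[OF x c(1)] by blast
  have "germ M x (Cc_counit M E \<pi> c) = germ M x (\<lambda>_. 1)"
    using z L.stalk_counit[of c] c by (simp add: grouplikes_def germ_ring_def)
  from germ_value[OF this L.xT] have one: "(\<Sum>y\<in>K. germ_val c y) = 1" using K(4) by simp
  define K1 where "K1 = {y \<in> K. c y = germ E y (\<lambda>_. 1)}"
  have val: "germ_val c y = (if y \<in> K1 then 1 else 0)" if "y \<in> K" for y
    using 01[of y] germ_val_eq[of y c "\<lambda>_. 0"] germ_val_eq[of y c "\<lambda>_. 1"] that K(2) by (auto simp: K1_def)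
  have "(\<Sum>y\<in>K. germ_val c y) = (\<Sum>y\<in>K. if y \<in> K1 then 1 else 0)" by (rule sum.cong) (use val in auto)
  also have "\<dots> = of_nat (card K1)" using K(1) by (simp add: sum.If_cases K1_def Int_def)
  finally have "of_nat (card K1) = (1 :: 'k)" using one by simp
  then have "card K1 = 1" using of_nat_eq_1_iff by blast
  then obtain y where y: "K1 = {y}" using card_1_singletonE by metis
  then have yK: "y \<in> K1" by simp
  then have yE: "y \<in> points E" "\<pi> y = x" using K(2) by (auto simp: K1_def)
  have "c z = germ E z (\<lambda>_. if z = y then 1 else 0)" if z: "z \<in> points E" "\<pi> z = x" for z
  proof (cases "z = y")
    case True
    then show ?thesis using yK by (simp add: K1_def)
  next
    case False
    then have "z \<notin> K1" using y by simp
    then have "c z = germ E z (\<lambda>_. 0)" using 01[OF z] K(3)[OF z] by (auto simp: K1_def)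
    then show ?thesis using False by simp
  qed
  then show ?thesis using Phi_eq_iff[OF yE(1) c(1)] yE c(2) by auto
qed

subsection \<open>The spectral sheaf\<close>

abbreviation bsec :: "('e, 'k::real_normed_field) germ_section \<Rightarrow> 'm set \<Rightarrow> ('m \<times> ('e, 'k) germ_section set) set" where
  "bsec \<equiv> basic_section M CA"

abbreviation bpair :: "('e, 'k::real_normed_field) germ_section \<Rightarrow> 'm set \<Rightarrow> bool" where
  "bpair \<equiv> basic_pair M CA"

text \<open>The \<open>itself\<close> argument records the scalar type, so that statements about the
  space alone can name it.\<close>

abbreviation SS :: "'k::real_normed_field itself \<Rightarrow> ('m \<times> ('e, 'k) germ_section set, 'b) manifold" where
  "SS k \<equiv> spectral_sheaf M CA"

lemma bpairD:
  assumes "bpair c W"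
  shows "openin (mtop M) W" "c \<in> Cc_sections E" "W \<subseteq> points M"
  using assms open_subset_points by (auto simp: basic_pair_def weakly_grouplike_def)

lemma bpair_subset: "bpair c W \<Longrightarrow> openin (mtop M) W' \<Longrightarrow> W' \<subseteq> W \<Longrightarrow> bpair c W'"
  by (auto simp: basic_pair_def normalized_on_def)

lemma bpair_grouplike:
  fixes c :: "('e, 'k::real_normed_field) germ_section"
  assumes c: "bpair c W" and x: "x \<in> W"
  shows "stalk_class M CA x c \<in> grouplikes M CA x"
proof -
  have xM: "x \<in> points M" using bpairD(3)[OF c] x by auto
  interpret L: coalgebra_at M "CA :: ('m \<Rightarrow> 'k, ('e, 'k) germ_section) coalgebra" x by (rule coalgebra_at[OF xM])
  show ?thesis
    by (rule L.weakly_grouplike_imp_grouplike) (use c x in \<open>auto simp: basic_pair_def normalized_on_def\<close>)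
qed

text \<open>The second tensor factor required for a weakly grouplike element is the pullback of a
  unit of \<open>f\<close>, and the counit returns \<open>f\<close>, which is 1 on
  \<open>W\<close>.\<close>

lemma bpair_unit:
  fixes f :: "'m \<Rightarrow> 'k::real_normed_field"
  assumes g: "(U, f) \<in> gens" and W: "openin (mtop M) W" "\<And>x. x \<in> W \<Longrightarrow> f x = 1"
  shows "bpair (pullback_ext E \<pi> U f) W"
proof -
  obtain \<eta> where \<eta>: "(U, \<eta>) \<in> gens" "\<And>x. \<eta> x * f x = f x" using gens_unit1[OF g] by blast
  have "weakly_grouplike RR CA (pullback_ext E \<pi> U f)"
    using pullback_ext_in_Cc_sections[OF g] pullback_ext_in_Cc_sections[OF \<eta>(1)] Cc_comult(2)[OF g \<eta>]
    by (auto simp: weakly_grouplike_def tensor_Cc_coalgebra)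
  then show ?thesis
    using W Cc_counit(2)[OF g] germ_eqI[OF W(1), of _ f "\<lambda>_. 1"] by (auto simp: basic_pair_def normalized_on_def)
qed

lemma Phi_image_unit:
  fixes f :: "'m \<Rightarrow> 'k::real_normed_field"
  assumes g: "(U, f) \<in> gens" and W: "openin (mtop M) W" "\<And>x. x \<in> W \<Longrightarrow> f x = 1" and z: "z \<in> U" "\<pi> z \<in> W"
  shows "Phi M E \<pi> z = (\<pi> z, stalk_class M CA (\<pi> z) (pullback_ext E \<pi> U f))"
  by (rule Phi_eq[OF admissible_unit[OF g W z]])

text \<open>Equality of classes at \<open>x\<close> is witnessed by a function with germ 1 at
  \<open>x\<close> that annihilates \<open>c - d\<close>. It is 1 on a neighbourhood of
  \<open>x\<close>, so it is a witness at all points of that neighbourhood too.\<close>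

lemma stalk_class_locally_equal:
  fixes c d :: "('e, 'k::real_normed_field) germ_section"
  assumes x: "x \<in> points M" and c: "c \<in> Cc_sections E" and d: "d \<in> Cc_sections E"
    and eq: "stalk_class M CA x c = stalk_class M CA x d"
  obtains W where "openin (mtop M) W" "x \<in> W" "\<And>z. z \<in> W \<Longrightarrow> stalk_class M CA z c = stalk_class M CA z d"
proof -
  interpret L: coalgebra_at M "CA :: ('m \<Rightarrow> 'k, ('e, 'k) germ_section) coalgebra" x by (rule coalgebra_at[OF x])
  have "c \<ominus>\<^bsub>CA\<^esub> d \<in> L.N" using L.stalk_class_eq_iff[of d c] c d eq by simp
  then obtain g where g: "g \<in> Cc M" "germ M x g = germ M x (\<lambda>_. 1)" "g \<odot>\<^bsub>CA\<^esub> (c \<ominus>\<^bsub>CA\<^esub> d) = \<zero>\<^bsub>CA\<^esub>"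
    "c \<ominus>\<^bsub>CA\<^esub> d \<in> carrier CA" unfolding L.null_iff by blast
  obtain W where W: "openin (mtop M) W" "x \<in> W" "\<And>z. z \<in> W \<Longrightarrow> g z = 1" using germ_eqD[OF g(2) L.xT] by blast
  have "stalk_class M CA z c = stalk_class M CA z d" if z: "z \<in> W" for z
  proof -
    have "z \<in> points M" using z open_subset_points[OF W(1)] by auto
    then interpret Z: coalgebra_at M "CA :: ('m \<Rightarrow> 'k, ('e, 'k) germ_section) coalgebra" z by (rule coalgebra_at)
    have "germ M z g = germ M z (\<lambda>_. 1)" by (rule germ_eqI[OF W(1) z W(3)])
    then have "c \<ominus>\<^bsub>CA\<^esub> d \<in> Z.N" unfolding Z.null_iff using g by blast
    then show ?thesis using Z.stalk_class_eq_iff[of d c] c d by simp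
  qed
  then show ?thesis using that W(1,2) by blast
qed

text \<open>The set where \<open>c\<close> and \<open>d\<close> have the same class is open by
  \<open>stalk_class_locally_equal\<close>; over it the two basic sets coincide, and elsewhere they
  are disjoint.\<close>

lemma basic_section_Int:
  fixes c d :: "('e, 'k::real_normed_field) germ_section"
  assumes c: "bpair c W" and d: "bpair d W'"
  shows "\<exists>W''. bpair c W'' \<and> W'' \<subseteq> W \<inter> W' \<and> bsec c W \<inter> bsec d W' = bsec c W''"
proof -
  let ?W = "{x \<in> W \<inter> W'. stalk_class M CA x c = stalk_class M CA x d}"
  have "openin (mtop M) ?W"
  proof (subst openin_subopen, clarify)
    fix x assume x: "x \<in> W" "x \<in> W'" "stalk_class M CA x c = stalk_class M CA x d"
    have xM: "x \<in> points M" using x bpairD(3)[OF c] by auto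
    obtain Q where Q: "openin (mtop M) Q" "x \<in> Q" "\<And>z. z \<in> Q \<Longrightarrow> stalk_class M CA z c = stalk_class M CA z d"
      using stalk_class_locally_equal[OF xM bpairD(2)[OF c] bpairD(2)[OF d] x(3)] by blast
    then show "\<exists>T. openin (mtop M) T \<and> x \<in> T \<and> T \<subseteq> ?W"
      using x bpairD(1)[OF c] bpairD(1)[OF d] by (intro exI[of _ "Q \<inter> (W \<inter> W')"]) auto
  qed
  then have "bpair c ?W" using bpair_subset[OF c] by auto
  moreover have "bsec c W \<inter> bsec d W' = bsec c ?W" by (auto simp: basic_section_def)
  ultimately show ?thesis by blast
qed

text \<open>\<open>topology\<close> returns the given family only if that family is a topology.
  Basic sets are closed under intersection of two, so their unions form one, and openness gets the
  usual pointwise description.\<close>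

lemma openin_spectral:
  fixes Q :: "('m \<times> ('e, 'k::real_normed_field) germ_section set) set"
  shows "openin (mtop (SS TYPE('k))) Q \<longleftrightarrow> (\<forall>p\<in>Q. \<exists>c W. bpair c W \<and> p \<in> bsec c W \<and> bsec c W \<subseteq> Q)"
proof -
  let ?P = "\<lambda>S. \<exists>(c :: ('e, 'k) germ_section) W. bpair c W \<and> S = bsec c W"
  have "istopology (arbitrary union_of ?P)"
  proof (rule istopology_base)
    fix S T assume "?P S" "?P T"
    then show "?P (S \<inter> T)" using basic_section_Int by blast
  qed
  then have "openin (mtop (SS TYPE('k))) = (arbitrary union_of ?P)"
    by (simp add: spectral_sheaf_def topology_inverse')
  then have "openin (mtop (SS TYPE('k))) Q \<longleftrightarrow> (\<forall>p\<in>Q. \<exists>U. ?P U \<and> p \<in> U \<and> U \<subseteq> Q)"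
    by (simp only: arbitrary_union_of_alt)
  then show ?thesis by blast
qed

lemma openin_basic_section: "bpair c W \<Longrightarrow> openin (mtop (SS TYPE('k::real_normed_field))) (bsec (c :: ('e, 'k) germ_section) W)"
  unfolding openin_spectral by blast

lemma spectral_simps:
  "points (SS TYPE('k::real_normed_field)) = (SIGMA x:points M. grouplikes M CA x)" "model (SS TYPE('k::real_normed_field)) = model M"
  "atlas (SS TYPE('k::real_normed_field)) = {(bsec c W, \<phi> \<circ> fst) | c W U \<phi>. bpair c W \<and> (U, \<phi>) \<in> atlas M \<and> W \<subseteq> U}"
  by (simp_all add: spectral_sheaf_def)

lemma basic_section_subset: "bpair c W \<Longrightarrow> bsec c W \<subseteq> points (SS TYPE('k::real_normed_field))"
  using bpair_grouplike bpairD(3) by (fastforce simp: spectral_simps basic_section_def)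

text \<open>The elementary set is cut down to its part over \<open>W\<close>, so that \<pi>(U) = W
  and \<open>Phi\<close> maps \<open>U\<close> onto the basic set of \<open>c\<close> over
  \<open>W\<close>. Both continuity and openness of \<open>Phi\<close> are read off from this local
  form.\<close>

lemma Phi_in_basic_section:
  fixes N :: "'e set"
  assumes y: "y \<in> N" and N: "openin (mtop E) N"
  obtains c :: "('e, 'k::real_normed_field) germ_section" and U W where "bpair c W" "Phi M E \<pi> y \<in> bsec c W"
    "openin (mtop E) U" "y \<in> U" "U \<subseteq> N" "\<And>z. z \<in> U \<Longrightarrow> Phi M E \<pi> z = (\<pi> z, stalk_class M CA (\<pi> z) c)"
    "W = \<pi> ` U"
proof -
  obtain U W and f :: "'m \<Rightarrow> 'k" where *: "(U, f) \<in> gens" "y \<in> U" "U \<subseteq> N" "openin (mtop M) W" "\<pi> y \<in> W" "W \<subseteq> \<pi> ` U"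
    "\<And>x. x \<in> W \<Longrightarrow> f x = 1" using unit_section_exists[OF y N] by metis
  let ?U = "U \<inter> {z \<in> points E. \<pi> z \<in> W}"
  have UE: "U \<subseteq> points E" using elementary_points[OF gensD(1)[OF *(1)]] .
  have oU: "openin (mtop E) ?U" using openin_proj_vimage[OF *(4)] gensD(1)[OF *(1)] by (auto simp: elementary_def)
  have Ph: "Phi M E \<pi> z = (\<pi> z, stalk_class M CA (\<pi> z) (pullback_ext E \<pi> U f))" if "z \<in> ?U" for z
    using Phi_image_unit[OF *(1,4,7)] that by blast
  have W: "W = \<pi> ` ?U" using *(6) UE by auto
  show ?thesis
  proof (rule that[OF bpair_unit[OF *(1,4,7)] _ oU _ _ Ph W])
    show "Phi M E \<pi> y \<in> bsec (pullback_ext E \<pi> U f) W"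
      using Ph[of y] *(2,5) UE by (auto simp: basic_section_def)
  qed (use * UE in auto)
qed

lemma Phi_points: "y \<in> points E \<Longrightarrow> Phi M E \<pi> y \<in> points (SS TYPE('k::real_normed_field))"
proof -
  assume y: "y \<in> points E"
  have "openin (mtop E) (points E)" using TE by (metis openin_topspace)
  then obtain c :: "('e, 'k) germ_section" and W where "bpair c W" "Phi M E \<pi> y \<in> bsec c W"
    using Phi_in_basic_section[OF y] by metis
  then show ?thesis using basic_section_subset by blast
qed

lemma Phi_surj:
  assumes "p \<in> points (SS TYPE('k::real_normed_field))"
  obtains y where "y \<in> points E" "p = Phi M E \<pi> y"
  using assms grouplike_is_Phi by (cases p) (fastforce simp: spectral_simps)

text \<open>That the basic sets cover all grouplike elements is not evident from the definition. It
  follows from surjectivity of \<open>Phi\<close>, whose values all lie in basic sets.\<close>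

lemma TS: "topspace (mtop (SS TYPE('k::real_normed_field))) = points (SS TYPE('k))"
proof
  show "topspace (mtop (SS TYPE('k))) \<subseteq> points (SS TYPE('k))"
  proof
    fix p assume "p \<in> topspace (mtop (SS TYPE('k)))"
    then obtain c :: "('e, 'k) germ_section" and W where "bpair c W" "p \<in> bsec c W"
      using openin_spectral[of "topspace (mtop (SS TYPE('k)))"] by (metis openin_topspace)
    then show "p \<in> points (SS TYPE('k))" using basic_section_subset by blast
  qed
  show "points (SS TYPE('k)) \<subseteq> topspace (mtop (SS TYPE('k)))"
  proof
    fix p assume "p \<in> points (SS TYPE('k))"
    then obtain y where y: "y \<in> points E" "p = Phi M E \<pi> y" using Phi_surj by metis
    have "openin (mtop E) (points E)" using TE by (metis openin_topspace)
    then obtain c :: "('e, 'k) germ_section" and W where "bpair c W" "p \<in> bsec c W"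
      using Phi_in_basic_section[OF y(1)] y(2) by metis
    then show "p \<in> topspace (mtop (SS TYPE('k)))" using openin_subset[OF openin_basic_section] by blast
  qed
qed

lemma spectral_basic_nbhd:
  fixes p :: "'m \<times> ('e, 'k::real_normed_field) germ_section set"
  assumes "p \<in> points (SS TYPE('k))"
  obtains c :: "('e, 'k) germ_section" and W where "bpair c W" "p \<in> bsec c W"
  using openin_spectral[of "topspace (mtop (SS TYPE('k)))"] assms TS by (metis openin_topspace)

lemma fst_basic_section: "fst ` bsec c W = W" "inj_on fst (bsec c W)"
  by (auto simp: basic_section_def image_image inj_on_def)

section \<open>The projection of the spectral sheaf and its charts\<close>

lemma fst_continuous: "continuous_map (mtop (SS TYPE('k::real_normed_field))) (mtop M) fst"
proof -
  have "openin (mtop (SS TYPE('k))) {p \<in> points (SS TYPE('k)). fst p \<in> N}" if N: "openin (mtop M) N" for N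
    unfolding openin_spectral
  proof
    fix p assume p: "p \<in> {p \<in> points (SS TYPE('k)). fst p \<in> N}"
    then obtain c :: "('e, 'k) germ_section" and W where c: "bpair c W" "p \<in> bsec c W"
      using spectral_basic_nbhd by blast
    have b: "bpair c (W \<inter> N)" using bpair_subset[OF c(1)] bpairD(1)[OF c(1)] N by auto
    have "p \<in> bsec c (W \<inter> N)" using c(2) p by (auto simp: basic_section_def)
    moreover have "bsec c (W \<inter> N) \<subseteq> {p \<in> points (SS TYPE('k)). fst p \<in> N}"
      using basic_section_subset[OF b] by (auto simp: basic_section_def)
    ultimately show "\<exists>c W. bpair c W \<and> p \<in> bsec c W \<and> bsec c W \<subseteq> {p \<in> points (SS TYPE('k)). fst p \<in> N}"
      using b by blast
  qed
  moreover have "fst p \<in> points M" if "p \<in> points (SS TYPE('k))" for p using that by (auto simp: spectral_simps)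
  ultimately show ?thesis using TS TM by (auto simp: continuous_map_def)
qed

lemma fst_open:
  assumes Q: "openin (mtop (SS TYPE('k::real_normed_field))) Q"
  shows "openin (mtop M) (fst ` Q)"
proof (subst openin_subopen, clarify)
  fix x \<zeta> assume p: "(x, \<zeta>) \<in> Q"
  then obtain c :: "('e, 'k) germ_section" and W where c: "bpair c W" "(x, \<zeta>) \<in> bsec c W" "bsec c W \<subseteq> Q"
    using Q unfolding openin_spectral by blast
  then show "\<exists>T. openin (mtop M) T \<and> fst (x, \<zeta>) \<in> T \<and> T \<subseteq> fst ` Q"
    using bpairD(1)[OF c(1)] fst_basic_section(1)[of c W] by (intro exI[of _ W]) (metis image_eqI image_mono)
qed

lemma fst_homeomorphic:
  fixes c :: "('e, 'k::real_normed_field) germ_section"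
  assumes c: "bpair c W"
  shows "homeomorphic_map (subtopology (mtop (SS TYPE('k))) (bsec c W)) (subtopology (mtop M) W) fst"
proof (rule bijective_open_imp_homeomorphic_map)
  show "continuous_map (subtopology (mtop (SS TYPE('k))) (bsec c W)) (subtopology (mtop M) W) fst"
    by (rule continuous_map_into_subtopology)
      (use fst_continuous continuous_map_from_subtopology fst_basic_section(1)[of c W] in auto)
  show "open_map (subtopology (mtop (SS TYPE('k))) (bsec c W)) (subtopology (mtop M) W) fst"
    unfolding open_map_def
  proof (intro allI impI)
    fix Q assume "openin (subtopology (mtop (SS TYPE('k))) (bsec c W)) Q"
    then have Q: "openin (mtop (SS TYPE('k))) Q" "Q \<subseteq> bsec c W"
      by (simp_all add: openin_open_subtopology[OF openin_basic_section[OF c]])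
    then show "openin (subtopology (mtop M) W) (fst ` Q)"
      using fst_open[OF Q(1)] image_mono[OF Q(2), of fst] fst_basic_section(1)[of c W]
      by (simp add: openin_open_subtopology[OF bpairD(1)[OF c]])
  qed
  have "topspace (subtopology (mtop (SS TYPE('k))) (bsec c W)) = bsec c W"
    using basic_section_subset[OF c] TS by auto
  then show "fst ` topspace (subtopology (mtop (SS TYPE('k))) (bsec c W)) = topspace (subtopology (mtop M) W)"
    "inj_on fst (topspace (subtopology (mtop (SS TYPE('k))) (bsec c W)))"
    using fst_basic_section[of c W] bpairD(3)[OF c] TM by auto
qed

text \<open>Every chart is a chart of \<open>M\<close> after \<open>fst\<close>, and
  \<open>fst\<close> is a homeomorphism from each basic set onto its base. Changes of charts are
  therefore restrictions of those of \<open>M\<close>.\<close>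

lemma spectral_manifold: "is_manifold (SS TYPE('k::real_normed_field))"
  unfolding is_manifold_def
proof (intro conjI)
  show "topspace (mtop (SS TYPE('k))) = points (SS TYPE('k))" by (rule TS)
  show "subspace (model (SS TYPE('k)))" using manifoldD(2)[OF M] by (simp add: spectral_simps)
  have chart: "openin (mtop (SS TYPE('k))) (bsec c W)"
      "openin (top_of_set (model M)) ((\<phi> \<circ> fst) ` bsec c W)"
      "homeomorphic_map (subtopology (mtop (SS TYPE('k))) (bsec c W)) (top_of_set ((\<phi> \<circ> fst) ` bsec c W)) (\<phi> \<circ> fst)"
    if c: "bpair c W" and u: "(U, \<phi>) \<in> atlas M" "W \<subseteq> U" for c :: "('e, 'k) germ_section" and W U \<phi>
  proof -
    have im: "(\<phi> \<circ> fst) ` bsec c W = \<phi> ` W" using fst_basic_section(1)[of c W] by (metis image_comp)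
    show "openin (mtop (SS TYPE('k))) (bsec c W)" by (rule openin_basic_section[OF c])
    show "openin (top_of_set (model M)) ((\<phi> \<circ> fst) ` bsec c W)"
      unfolding im by (rule chart_open_image[OF M u(1) bpairD(1)[OF c] u(2)])
    \<comment> \<open>The chart of \<open>M\<close> is replaced by its restriction to the open
      submanifold \<open>W\<close>, for which the homeomorphism property is already known.\<close>
    have "(U \<inter> W, \<phi>) \<in> atlas (submanifold M W)" using u(1) by auto
    from manifold_chartD(4)[OF is_manifold_submanifold[OF M bpairD(1)[OF c]] this]
    have "homeomorphic_map (subtopology (mtop M) W) (top_of_set (\<phi> ` W)) \<phi>"
      using u(2) by (simp add: subtopology_subtopology Int_absorb1)
    then show "homeomorphic_map (subtopology (mtop (SS TYPE('k))) (bsec c W)) (top_of_set ((\<phi> \<circ> fst) ` bsec c W)) (\<phi> \<circ> fst)"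
      unfolding im by (rule homeomorphic_map_compose[OF fst_homeomorphic[OF c]])
  qed
  then show "\<forall>(U, \<phi>)\<in>atlas (SS TYPE('k)). openin (mtop (SS TYPE('k))) U \<and>
      openin (top_of_set (model (SS TYPE('k)))) (\<phi> ` U) \<and>
      homeomorphic_map (subtopology (mtop (SS TYPE('k))) U) (top_of_set (\<phi> ` U)) \<phi>"
    unfolding spectral_simps by blast
  show "(\<Union>(U, \<phi>)\<in>atlas (SS TYPE('k)). U) = points (SS TYPE('k))"
  proof
    show "(\<Union>(U, \<phi>)\<in>atlas (SS TYPE('k)). U) \<subseteq> points (SS TYPE('k))"
      using basic_section_subset unfolding spectral_simps(3) by blast
    show "points (SS TYPE('k)) \<subseteq> (\<Union>(U, \<phi>)\<in>atlas (SS TYPE('k)). U)"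
    proof
      fix p assume "p \<in> points (SS TYPE('k))"
      then obtain c :: "('e, 'k) germ_section" and W where c: "bpair c W" "p \<in> bsec c W"
        using spectral_basic_nbhd by blast
      have "fst p \<in> points M" using c bpairD(3)[OF c(1)] by (auto simp: basic_section_def)
      then obtain U \<phi> where u: "(U, \<phi>) \<in> atlas M" "fst p \<in> U" using manifold_chart_exists[OF M] by metis
      have "bpair c (W \<inter> U)" using bpair_subset[OF c(1)] bpairD(1)[OF c(1)] manifold_chartD(1)[OF M u(1)] by auto
      then have "(bsec c (W \<inter> U), \<phi> \<circ> fst) \<in> atlas (SS TYPE('k))" unfolding spectral_simps using u(1) by blast
      moreover have "p \<in> bsec c (W \<inter> U)" using c(2) u(2) by (auto simp: basic_section_def)
      ultimately show "p \<in> (\<Union>(U, \<phi>)\<in>atlas (SS TYPE('k)). U)" by blast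
    qed
  qed
  have "smooth_on (model M) ((\<phi> \<circ> fst) ` (bsec c W \<inter> bsec d W')) ((\<psi> \<circ> fst) \<circ> inv_into (bsec c W) (\<phi> \<circ> fst))"
    if c: "bpair c W" and u: "(U, \<phi>) \<in> atlas M" "W \<subseteq> U" and d: "bpair d W'" and v: "(U', \<psi>) \<in> atlas M" "W' \<subseteq> U'"
    for c d :: "('e, 'k) germ_section" and W W' U U' \<phi> \<psi>
  proof -
    note inj = manifold_chartD(5)[OF M u(1)]
    have injf: "inj_on (\<phi> \<circ> fst) (bsec c W)"
      by (rule comp_inj_on[OF fst_basic_section(2)]) (use fst_basic_section(1)[of c W] inj u(2) in \<open>auto simp: inj_on_def\<close>)
    have sub: "(\<phi> \<circ> fst) ` (bsec c W \<inter> bsec d W') \<subseteq> \<phi> ` (U \<inter> U')"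
      using u(2) v(2) by (auto simp: basic_section_def)
    have "smooth_on (model M) ((\<phi> \<circ> fst) ` (bsec c W \<inter> bsec d W')) (\<psi> \<circ> inv_into U \<phi>)"
      by (rule smooth_on_subset[OF manifold_transition_smooth[OF M u(1) v(1)] sub])
    then show ?thesis
    proof (rule smooth_on_cong[THEN iffD1, rotated])
      fix w assume "w \<in> (\<phi> \<circ> fst) ` (bsec c W \<inter> bsec d W')"
      then obtain p where p: "p \<in> bsec c W" "w = (\<phi> \<circ> fst) p" by blast
      have "fst p \<in> U" using p(1) u(2) by (auto simp: basic_section_def)
      then show "(\<psi> \<circ> inv_into U \<phi>) w = ((\<psi> \<circ> fst) \<circ> inv_into (bsec c W) (\<phi> \<circ> fst)) w"
        using inv_into_f_f[OF injf p(1)] inv_into_f_f[OF inj] p(2) by simp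
    qed
  qed
  then show "\<forall>(U, \<phi>)\<in>atlas (SS TYPE('k)). \<forall>(W, \<psi>)\<in>atlas (SS TYPE('k)).
      smooth_on (model (SS TYPE('k))) (\<phi> ` (U \<inter> W)) (\<psi> \<circ> inv_into U \<phi>)"
    unfolding spectral_simps by blast
qed

text \<open>Over a basic set the inverse of the projection is the section \<open>?g\<close> that
  sends a point to its class of \<open>c\<close>. In the charts of the spectral sheaf both maps
  become charts of \<open>M\<close>.\<close>

lemma spectral_sheaf_sheaf: "sheaf M (SS TYPE('k::real_normed_field)) fst"
  unfolding sheaf_def local_diffeo_def
proof (intro conjI spectral_manifold ballI)
  note MS = spectral_manifold[where ?'k = 'k]
  fix p assume "p \<in> points (SS TYPE('k))"
  then obtain c :: "('e, 'k) germ_section" and W where c: "bpair c W" "p \<in> bsec c W"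
    using spectral_basic_nbhd by blast
  let ?B = "bsec c W" let ?g = "\<lambda>x. (x, stalk_class M CA x c)"
  note oB = openin_basic_section[OF c(1)] and oW = bpairD(1)[OF c(1)] and fB = fst_basic_section[of c W]
  have gB: "?g x \<in> ?B" if "x \<in> W" for x using that by (auto simp: basic_section_def)
  have "smooth_map (submanifold (SS TYPE('k)) ?B) (submanifold M W) fst"
    unfolding smooth_map_iff
  proof (rule conjI)
    show "continuous_map (mtop (submanifold (SS TYPE('k)) ?B)) (mtop (submanifold M W)) fst"
      using homeomorphic_imp_continuous_map[OF fst_homeomorphic[OF c(1)]] by simp
    show "\<forall>(U', \<psi>)\<in>atlas (submanifold M W). smooth_fun_on (submanifold (SS TYPE('k)) ?B) (fst -` U') (\<psi> \<circ> fst)"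
    proof clarify
      fix U' \<psi> assume "(U', \<psi>) \<in> atlas (submanifold M W)"
      then obtain U where U: "(U, \<psi>) \<in> atlas M" "U' = U \<inter> W" by auto
      have b: "bpair c (W \<inter> U)" using bpair_subset[OF c(1)] oW manifold_chartD(1)[OF M U(1)] by auto
      have "(bsec c (W \<inter> U), \<psi> \<circ> fst) \<in> atlas (SS TYPE('k))" unfolding spectral_simps using b U(1) by blast
      from smooth_fun_on_chart[OF MS this]
      have "smooth_fun_on (SS TYPE('k)) (bsec c (W \<inter> U)) (\<psi> \<circ> fst)" .
      then have "smooth_fun_on (SS TYPE('k)) (?B \<inter> fst -` U') (\<psi> \<circ> fst)"
        by (rule smooth_fun_on_subset) (auto simp: basic_section_def U(2))
      then show "smooth_fun_on (submanifold (SS TYPE('k)) ?B) (fst -` U') (\<psi> \<circ> fst)"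
        by (simp add: smooth_fun_on_submanifold[OF MS])
    qed
  qed
  moreover have "smooth_map (submanifold M W) (submanifold (SS TYPE('k)) ?B) ?g"
    unfolding smooth_map_iff
  proof (rule conjI)
    have "openin (mtop M) {x \<in> W. ?g x \<in> Q}" if Q: "openin (mtop (SS TYPE('k))) Q" "Q \<subseteq> ?B" for Q
    proof -
      have "{x \<in> W. ?g x \<in> Q} = fst ` Q"
      proof (intro equalityI subsetI)
        fix x assume "x \<in> {x \<in> W. ?g x \<in> Q}"
        then show "x \<in> fst ` Q" by (auto intro: image_eqI[of _ fst "?g x"])
      next
        fix x assume "x \<in> fst ` Q"
        then obtain p where p: "p \<in> Q" "x = fst p" by auto
        then obtain z where "z \<in> W" "p = ?g z" using Q(2) by (auto simp: basic_section_def)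
        then show "x \<in> {x \<in> W. ?g x \<in> Q}" using p by simp
      qed
      then show ?thesis using fst_open[OF Q(1)] by simp
    qed
    then show "continuous_map (mtop (submanifold M W)) (mtop (submanifold (SS TYPE('k)) ?B)) ?g"
      using gB TM basic_section_subset[OF c(1)] bpairD(3)[OF c(1)]
      by (auto simp: TS continuous_map_def openin_open_subtopology[OF oB] openin_open_subtopology[OF oW] Int_absorb1)
    show "\<forall>(B', \<psi>)\<in>atlas (submanifold (SS TYPE('k)) ?B). smooth_fun_on (submanifold M W) (?g -` B') (\<psi> \<circ> ?g)"
    proof clarify
      fix B' \<psi> assume "(B', \<psi>) \<in> atlas (submanifold (SS TYPE('k)) ?B)"
      then obtain d W' U \<phi> where U: "(U, \<phi>) \<in> atlas M" "W' \<subseteq> U" "B' = bsec d W' \<inter> ?B" "\<psi> = \<phi> \<circ> fst"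
        by (auto simp: spectral_simps)
      have "\<psi> \<circ> ?g = \<phi>" by (auto simp: U(4))
      moreover have "smooth_fun_on M (W \<inter> ?g -` B') \<phi>"
        by (rule smooth_fun_on_subset[OF smooth_fun_on_chart[OF M U(1)]]) (use U(2,3) in \<open>auto simp: basic_section_def\<close>)
      ultimately show "smooth_fun_on (submanifold M W) (?g -` B') (\<psi> \<circ> ?g)"
        by (simp add: smooth_fun_on_submanifold[OF M])
    qed
  qed
  ultimately have "diffeo (submanifold (SS TYPE('k)) ?B) (submanifold M (fst ` ?B)) fst"
    unfolding diffeo_def fB(1)
    by (intro conjI exI[of _ ?g]) (auto simp: basic_section_def)
  then show "\<exists>U. p \<in> U \<and> openin (mtop (SS TYPE('k))) U \<and> openin (mtop M) (fst ` U) \<and>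
      diffeo (submanifold (SS TYPE('k)) U) (submanifold M (fst ` U)) fst"
    using c(2) oB oW fB(1) by (intro exI[of _ ?B]) auto
qed

text \<open>Two sections are in play at \<open>y\<close>: \<open>c\<close>, whose basic set lies in
  \<open>Q\<close>, and \<open>d\<close>, which describes \<open>Phi\<close> near \<open>y\<close>.
  Their classes agree at \<pi>(y), hence at nearby points, so \<open>Phi\<close> stays in the basic
  set of \<open>c\<close>.\<close>

lemma Phi_continuous: "continuous_map (mtop E) (mtop (SS TYPE('k::real_normed_field))) (Phi M E \<pi>)"
proof -
  have oE: "openin (mtop E) (points E)" using TE by (metis openin_topspace)
  have "openin (mtop E) {y \<in> points E. Phi M E \<pi> y \<in> Q}" if Q: "openin (mtop (SS TYPE('k))) Q" for Q
  proof (subst openin_subopen, clarify)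
    fix y assume y: "y \<in> points E" "Phi M E \<pi> y \<in> Q"
    then obtain c :: "('e, 'k) germ_section" and W where c: "bpair c W" "Phi M E \<pi> y \<in> bsec c W" "bsec c W \<subseteq> Q"
      using Q unfolding openin_spectral by blast
    obtain d :: "('e, 'k) germ_section" and U W' where d: "bpair d W'" "openin (mtop E) U" "y \<in> U" "U \<subseteq> points E"
      "\<And>z. z \<in> U \<Longrightarrow> Phi M E \<pi> z = (\<pi> z, stalk_class M CA (\<pi> z) d)"
      using Phi_in_basic_section[OF y(1) oE] by metis
    have yW: "\<pi> y \<in> W" and eq: "stalk_class M CA (\<pi> y) c = stalk_class M CA (\<pi> y) d"
      using c(2) d(5)[OF d(3)] by (auto simp: basic_section_def)
    obtain W2 where W2: "openin (mtop M) W2" "\<pi> y \<in> W2" "\<And>z. z \<in> W2 \<Longrightarrow> stalk_class M CA z c = stalk_class M CA z d"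
      using stalk_class_locally_equal[OF proj_points[OF y(1)] bpairD(2)[OF c(1)] bpairD(2)[OF d(1)] eq] by blast
    let ?T = "U \<inter> {z \<in> points E. \<pi> z \<in> W \<inter> W2}"
    have "openin (mtop E) ?T" using d(2) openin_proj_vimage[of "W \<inter> W2"] bpairD(1)[OF c(1)] W2(1) by blast
    moreover have "Phi M E \<pi> z \<in> Q" if "z \<in> ?T" for z
    proof -
      have "Phi M E \<pi> z = (\<pi> z, stalk_class M CA (\<pi> z) c)" using d(5)[of z] W2(3)[of "\<pi> z"] that by simp
      then have "Phi M E \<pi> z \<in> bsec c W" using that by (auto simp: basic_section_def)
      then show ?thesis using c(3) by blast
    qed
    ultimately show "\<exists>T. openin (mtop E) T \<and> y \<in> T \<and> T \<subseteq> {y \<in> points E. Phi M E \<pi> y \<in> Q}"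
      using y(1) d(3) yW W2(2) by (intro exI[of _ ?T]) auto
  qed
  then show ?thesis using Phi_points TE TS by (auto simp: continuous_map_def)
qed

lemma Phi_open:
  assumes N: "openin (mtop E) N"
  shows "openin (mtop (SS TYPE('k::real_normed_field))) (Phi M E \<pi> ` N)"
  unfolding openin_spectral
proof
  fix p :: "'m \<times> ('e, 'k) germ_section set" assume "p \<in> Phi M E \<pi> ` N"
  then obtain y where y: "y \<in> N" and p: "p = Phi M E \<pi> y" by blast
  obtain c :: "('e, 'k) germ_section" and U W where c: "bpair c W" "Phi M E \<pi> y \<in> bsec c W" "U \<subseteq> N"
    "\<And>z. z \<in> U \<Longrightarrow> Phi M E \<pi> z = (\<pi> z, stalk_class M CA (\<pi> z) c)" "W = \<pi> ` U"
    using Phi_in_basic_section[OF y N] by metis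
  have "bsec c W \<subseteq> Phi M E \<pi> ` N"
  proof
    fix p assume "p \<in> bsec c W"
    then obtain z where "z \<in> U" "p = (\<pi> z, stalk_class M CA (\<pi> z) c)" by (auto simp: basic_section_def c(5))
    then show "p \<in> Phi M E \<pi> ` N" using c(3,4) by (metis image_eqI subsetD)
  qed
  then show "\<exists>(c :: ('e, 'k) germ_section) W. bpair c W \<and> p \<in> bsec c W \<and> bsec c W \<subseteq> Phi M E \<pi> ` N"
    using c(1,2) p by blast
qed

text \<open>\<open>Phi\<close> is a continuous open bijection compatible with the projections, so
  its inverse is continuous over \<open>M\<close> as well, and
  \<open>continuous_map_over_smooth\<close> makes both directions smooth.\<close>

lemma Phi_isomorphism:
  "sheaf_isomorphism E \<pi> (SS TYPE('k::real_normed_field)) fst (Phi M E \<pi>)"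
proof -
  let ?\<Phi> = "Phi M E \<pi> :: 'e \<Rightarrow> 'm \<times> ('e, 'k) germ_section set"
  let ?\<Psi> = "inv_into (points E) ?\<Phi>"
  have inj: "inj_on ?\<Phi> (points E)" using Phi_inj by (auto simp: inj_on_def)
  have im: "?\<Phi> ` points E = points (SS TYPE('k))"
  proof
    show "?\<Phi> ` points E \<subseteq> points (SS TYPE('k))" using Phi_points by blast
    show "points (SS TYPE('k)) \<subseteq> ?\<Phi> ` points E" using Phi_surj by (metis image_eqI subsetI)
  qed
  have \<Psi>\<Phi>: "?\<Psi> (?\<Phi> y) = y" if "y \<in> points E" for y using inv_into_f_f[OF inj that] .
  have \<Phi>\<Psi>: "?\<Phi> (?\<Psi> p) = p" "?\<Psi> p \<in> points E" if "p \<in> points (SS TYPE('k))" for p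
    using f_inv_into_f[of p ?\<Phi> "points E"] inv_into_into[of p ?\<Phi> "points E"] im that by auto
  have "openin (mtop (SS TYPE('k))) {p \<in> points (SS TYPE('k)). ?\<Psi> p \<in> N}" if N: "openin (mtop E) N" for N
  proof -
    have NE: "N \<subseteq> points E" using open_subset_pointsE[OF N] .
    have "{p \<in> points (SS TYPE('k)). ?\<Psi> p \<in> N} = ?\<Phi> ` N"
    proof (intro equalityI subsetI)
      fix p assume "p \<in> {p \<in> points (SS TYPE('k)). ?\<Psi> p \<in> N}"
      then show "p \<in> ?\<Phi> ` N" using \<Phi>\<Psi>(1)[of p] by (metis (mono_tags, lifting) image_eqI mem_Collect_eq)
    next
      fix p assume "p \<in> ?\<Phi> ` N"
      then show "p \<in> {p \<in> points (SS TYPE('k)). ?\<Psi> p \<in> N}" using \<Psi>\<Phi> NE im by auto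
    qed
    then show ?thesis using Phi_open[OF N] by simp
  qed
  then have cont: "continuous_map (mtop (SS TYPE('k))) (mtop E) ?\<Psi>"
    using \<Phi>\<Psi>(2) by (auto simp: continuous_map_def TE TS)
  have "\<pi> (?\<Psi> p) = fst p" if "p \<in> points (SS TYPE('k))" for p
    using fst_Phi[OF \<Phi>\<Psi>(2)[OF that], where ?'k = 'k] \<Phi>\<Psi>(1)[OF that] by simp
  then have "sheaf_morphism (SS TYPE('k)) fst E \<pi> ?\<Psi>"
    unfolding sheaf_morphism_def using continuous_map_over_smooth[OF M spectral_sheaf_sheaf E cont] by blast
  moreover have "sheaf_morphism E \<pi> (SS TYPE('k)) fst ?\<Phi>"
    unfolding sheaf_morphism_def
    using continuous_map_over_smooth[OF M E spectral_sheaf_sheaf Phi_continuous] fst_Phi by blast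
  ultimately show ?thesis unfolding sheaf_isomorphism_def using \<Psi>\<Phi> \<Phi>\<Psi>(1) by blast
qed

end

subsection \<open>Naturality\<close>

locale sheaf_over_morphism = sheaf_over M E \<pi>
  for M :: "('m, 'b::euclidean_space) manifold" and E :: "('e, 'c::euclidean_space) manifold" and \<pi> +
  fixes F :: "('f, 'd::euclidean_space) manifold" and \<xi> :: "'f \<Rightarrow> 'm" and \<phi> :: "'e \<Rightarrow> 'f"
  assumes F: "sheaf M F \<xi>" and \<phi>: "sheaf_morphism E \<pi> F \<xi> \<phi>"
begin

sublocale F: sheaf_over M F \<xi>
  by unfold_locales (rule F)

lemma \<phi>_continuous: "continuous_map (mtop E) (mtop F) \<phi>"
  and \<phi>_over: "y \<in> points E \<Longrightarrow> \<xi> (\<phi> y) = \<pi> y"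
  using \<phi> by (auto simp: sheaf_morphism_def smooth_map_iff)

lemma \<phi>_points: "y \<in> points E \<Longrightarrow> \<phi> y \<in> points F"
  using \<phi>_continuous TE F.TE by (auto simp: continuous_map_def)

text \<open>In an elementary neighbourhood \<open>V\<close> of the image point, a point lying over
  \<pi>(z), with \<open>z\<close> in \<open>N\<close> and \<phi>(z) in \<open>V\<close>, can only be
  \<phi>(z). So the part of \<open>V\<close> over an open set of \<open>M\<close> is contained in
  the image of \<open>N\<close>.\<close>

lemma \<phi>_open:
  assumes N: "openin (mtop E) N"
  shows "openin (mtop F) (\<phi> ` N)"
proof (subst openin_subopen, clarify)
  note NE = open_subset_pointsE[OF N]
  fix y assume y: "y \<in> N"
  then obtain V where V: "elementary F \<xi> V" "\<phi> y \<in> V" using sheaf_elementary_nbhd[OF F] \<phi>_points NE by (metis subsetD)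
  have oV: "openin (mtop F) V" using V(1) by (simp add: elementary_def)
  let ?N = "N \<inter> {z \<in> topspace (mtop E). \<phi> z \<in> V}"
  have oN: "openin (mtop E) ?N" using N openin_continuous_map_preimage[OF \<phi>_continuous oV] by blast
  let ?T = "V \<inter> {z \<in> points F. \<xi> z \<in> \<pi> ` ?N}"
  have "openin (mtop F) ?T" using oV F.openin_proj_vimage[OF proj_open[OF oN]] by blast
  moreover have "\<phi> y \<in> ?T" using V(2) y NE TE \<phi>_over \<phi>_points by (auto intro!: image_eqI[of _ \<pi> y])
  moreover have "?T \<subseteq> \<phi> ` N"
  proof clarify
    fix v z assume v: "v \<in> V" "\<xi> v = \<pi> z" "z \<in> N" "z \<in> topspace (mtop E)" "\<phi> z \<in> V"
    then have "\<xi> v = \<xi> (\<phi> z)" using \<phi>_over NE by auto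
    then have "v = \<phi> z" using V(1) v(1,5) by (auto simp: elementary_def inj_on_def)
    then show "v \<in> \<phi> ` N" using v(3) by blast
  qed
  ultimately show "\<exists>T. openin (mtop F) T \<and> \<phi> y \<in> T \<and> T \<subseteq> \<phi> ` N" by blast
qed

lemma proj_image: "U \<subseteq> points E \<Longrightarrow> \<xi> ` \<phi> ` U = \<pi> ` U"
  using \<phi>_over by (auto simp: image_image image_iff) (metis subsetD)+

text \<open>Injectivity of \<open>\<xi>\<close> on the image comes from injectivity of
  \<open>\<pi>\<close> on \<open>U\<close>, since \<open>\<xi>\<close> after \<open>\<phi>\<close>
  is \<open>\<pi>\<close>.\<close>

lemma elementary_\<phi>:
  assumes U: "elementary E \<pi> U"
  shows "elementary F \<xi> (\<phi> ` U)"
proof -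
  have "inj_on \<xi> (\<phi> ` U)"
    using U \<phi>_over elementary_points[OF U] by (auto simp: inj_on_def elementary_def) (metis subsetD)
  then show ?thesis using \<phi>_open U by (simp add: elementary_def)
qed

lemma gens_\<phi>: "(U, f) \<in> gens \<Longrightarrow> (\<phi> ` U, f) \<in> F.gens"
  using elementary_\<phi> proj_image[OF elementary_points] by (auto simp: gens_def F.gens_def)

text \<open>Replacing \<open>U\<close> by \<phi>(U) maps generators for \<open>E\<close> to
  generators for \<open>F\<close> and preserves inclusions, so the relations are those already
  verified for the standard family of \<open>F\<close>.\<close>

lemma compatible_family_push:
  "compatible_family M E \<pi> (Cc_module F \<xi> :: ('m \<Rightarrow> 'k::real_normed_field, ('f, 'k) germ_section) module)
    (\<lambda>(U, f). pullback_ext F \<xi> (\<phi> ` U) f)"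
proof -
  interpret P: compatible_family M F \<xi> "Cc_module F \<xi> :: ('m \<Rightarrow> 'k, ('f, 'k) germ_section) module" F.pe
    by (rule F.compatible_family_self)
  show ?thesis
  proof (unfold_locales, goal_cases)
    case 1 show ?case by (rule P.A)
  next
    case (2 a) then show ?case by (rule P.unitary)
  next
    case (3 p) then show ?case using P.closed[OF gens_\<phi>] by (cases p) auto
  next
    case (4 U f g) then show ?case using P.additive[OF gens_\<phi> gens_\<phi>] by simp
  next
    case (5 r U f) then show ?case using P.linear[OF _ gens_\<phi>] by simp
  next
    case (6 V f U) then show ?case using P.mono[OF gens_\<phi> image_mono elementary_\<phi>] by simp
  qed
qed

lemma Cc_push:
  "linear_map (F.RR :: ('m \<Rightarrow> 'k::real_normed_field) ring) CC F.CC (Cc_push M E \<pi> F \<xi> \<phi>)"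
  "(U, f :: 'm \<Rightarrow> 'k) \<in> gens \<Longrightarrow> Cc_push M E \<pi> F \<xi> \<phi> (pullback_ext E \<pi> U f) = pullback_ext F \<xi> (\<phi> ` U) f"
proof -
  interpret P: compatible_family M E \<pi> "F.CC :: ('m \<Rightarrow> 'k, ('f, 'k) germ_section) module" "\<lambda>(U, f). pullback_ext F \<xi> (\<phi> ` U) f"
    by (rule compatible_family_push)
  let ?P = "\<lambda>\<alpha> :: ('e, 'k) germ_section \<Rightarrow> ('f, 'k) germ_section. \<alpha> \<in> extensional (Cc_sections E) \<and> linear_map F.RR CC F.CC \<alpha> \<and>
     (\<forall>U. elementary E \<pi> U \<longrightarrow> (\<forall>f\<in>Cc (submanifold M (\<pi> ` U)). \<alpha> (pullback_ext E \<pi> U f) = pullback_ext F \<xi> (\<phi> ` U) f))"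
  obtain \<alpha> :: "('e, 'k) germ_section \<Rightarrow> ('f, 'k) germ_section" where \<alpha>: "\<alpha> \<in> extensional (Cc_sections E)" "linear_map F.RR CC F.CC \<alpha>"
    "\<And>U f. (U, f) \<in> gens \<Longrightarrow> \<alpha> (pullback_ext E \<pi> U f) = (case (U, f) of (U, f) \<Rightarrow> pullback_ext F \<xi> (\<phi> ` U) f)"
    using P.extension_exists by blast
  have "?P \<alpha>" using \<alpha> by (simp add: gens_iff)
  moreover have "\<alpha>' = \<alpha>" if "?P \<alpha>'" for \<alpha>'
    by (rule linear_map_unique[OF Cc_module_abelian_group]) (use that \<alpha> in \<open>auto simp: gens_iff\<close>)
  ultimately have "?P (Cc_push M E \<pi> F \<xi> \<phi>)" unfolding Cc_push_def by (rule theI)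
  then show "linear_map (F.RR :: ('m \<Rightarrow> 'k) ring) CC F.CC (Cc_push M E \<pi> F \<xi> \<phi>)"
    "(U, f) \<in> gens \<Longrightarrow> Cc_push M E \<pi> F \<xi> \<phi> (pullback_ext E \<pi> U f) = pullback_ext F \<xi> (\<phi> ` U) f"
    by (auto simp: gens_iff)
qed

text \<open>If \<open>U\<close> and \<open>f\<close> are admissible for \<open>y\<close>, then
  \<phi>(U) and \<open>f\<close> are admissible for \<phi>(y), and pushing forward takes one
  generator to the other. What remains is that the push-forward descends to stalks: by linearity, a
  function that annihilates a section also annihilates its image.\<close>

lemma spectral_map_Phi:
  assumes y: "y \<in> points E"
  shows "spectral_map M (Cc_coalgebra M F \<xi>) (Cc_push M E \<pi> F \<xi> \<phi>)
      (Phi M E \<pi> y :: 'm \<times> ('e, 'k::real_normed_field) germ_section set) = Phi M F \<xi> (\<phi> y)"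
proof -
  obtain U and f :: "'m \<Rightarrow> 'k" where a: "admissible M E \<pi> y U f" using admissible_exists[OF y] by blast
  then have g: "(U, f) \<in> gens" by (simp add: admissible_iff)
  have aF: "admissible M F \<xi> (\<phi> y) (\<phi> ` U) f"
    using a gens_\<phi>[OF g] \<phi>_over[OF y] by (auto simp: admissible_iff F.admissible_iff)
  let ?x = "\<pi> y" let ?push = "Cc_push M E \<pi> F \<xi> \<phi> :: ('e, 'k) germ_section \<Rightarrow> ('f, 'k) germ_section"
  interpret L: coalgebra_at M "CA :: ('m \<Rightarrow> 'k, ('e, 'k) germ_section) coalgebra" ?x by (rule coalgebra_at[OF proj_points[OF y]])
  interpret K: coalgebra_at M "F.CA :: ('m \<Rightarrow> 'k, ('f, 'k) germ_section) coalgebra" ?x by (rule F.coalgebra_at[OF proj_points[OF y]])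
  note lin = Cc_push(1)[where ?'k = 'k, unfolded linear_map_def]
  let ?c = "pullback_ext E \<pi> U f"
  have c: "?c \<in> Cc_sections E" by (rule pullback_ext_in_Cc_sections[OF g])
  have pc: "?push s \<in> Cc_sections F" if "s \<in> Cc_sections E" for s using lin that by auto
  have "K.cl (?push s) = K.cl (?push ?c)" if s: "s \<in> L.cl ?c" for s
  proof -
    obtain n where n: "n \<in> L.N" "s = n \<oplus>\<^bsub>CA\<^esub> ?c" using s by (auto simp: L.stalk_class_iff)
    then obtain r where r: "r \<in> Cc M" "germ M ?x r = germ M ?x (\<lambda>_. 1)" "r \<odot>\<^bsub>CA\<^esub> n = \<zero>\<^bsub>CA\<^esub>" "n \<in> Cc_sections E"
      by (auto simp: L.null_iff)
    have "r \<odot>\<^bsub>F.CA\<^esub> ?push n = ?push (r \<odot>\<^bsub>CA\<^esub> n)" using lin r(1,4) by simp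
    also have "\<dots> = \<zero>\<^bsub>F.CA\<^esub>" unfolding r(3)
      using linear_map_zero[OF Cc_module_abelian_group Cc_module_abelian_group Cc_push(1)[where ?'k = 'k]] by simp
    finally have "?push n \<in> K.N" unfolding K.null_iff using r(1,2) pc[OF r(4)] by auto
    moreover have "?push s = ?push n \<oplus>\<^bsub>F.CA\<^esub> ?push ?c" using lin r(4) c n(2) by simp
    ultimately have "?push s \<in> K.cl (?push ?c)" unfolding K.stalk_class_iff by blast
    then show ?thesis
      using K.stalk_class_memD[of "?push ?c" "?push s"] K.stalk_class_eqI[of "?push ?c" "?push s"] pc[OF c] by simp
  qed
  note eq = this
  have "the_elem ((\<lambda>s. K.cl (?push s)) ` L.cl ?c) = K.cl (?push ?c)"
    by (rule the_elem_image_unique[OF _ eq]) (use L.stalk_class_self[of ?c] c in auto)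
  then show ?thesis
    using Phi_eq[OF a] F.Phi_eq[OF aF] Cc_push(2)[OF g] \<phi>_over[OF y] by (simp add: spectral_map_def)
qed

end

theorem theorem2p4:
  fixes M :: "('m, 'b::euclidean_space) manifold"
    and E :: "('e, 'c::euclidean_space) manifold"
    and \<pi> :: "'e \<Rightarrow> 'm"
  assumes "is_manifold M" and "Hausdorff_space (mtop M)"
    and "sheaf M E \<pi>"
  shows "let C = (Cc_coalgebra M E \<pi> ::
               ('m \<Rightarrow> 'k::real_normed_field, ('e, 'k) germ_section) coalgebra);
             \<Phi> = (Phi M E \<pi> :: 'e \<Rightarrow> 'm \<times> ('e, 'k) germ_section set)
         in is_coalgebra (Cc_ring M) C \<and>
            sheaf M (spectral_sheaf M C) fst \<and>
            (\<forall>y\<in>points E.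
               (\<exists>U f. admissible M E \<pi> y U (f :: 'm \<Rightarrow> 'k)) \<and>
               (\<forall>U f. admissible M E \<pi> y U (f :: 'm \<Rightarrow> 'k) \<longrightarrow>
                  \<Phi> y = (\<pi> y, stalk_class M C (\<pi> y) (pullback_ext E \<pi> U f)))) \<and>
            sheaf_isomorphism E \<pi> (spectral_sheaf M C) fst \<Phi> \<and>
            (\<forall>(F :: ('f, 'd::euclidean_space) manifold) \<xi> \<phi>.
               sheaf M F \<xi> \<and> sheaf_morphism E \<pi> F \<xi> \<phi> \<longrightarrow>
               (\<forall>y\<in>points E.
                  spectral_map M (Cc_coalgebra M F \<xi>) (Cc_push M E \<pi> F \<xi> \<phi>) (\<Phi> y) =
                    Phi M F \<xi> (\<phi> y)))"
proof -
  interpret sheaf_over M E \<pi>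
    by unfold_locales (use assms in auto)
  show ?thesis
    unfolding Let_def
  proof (intro conjI ballI allI impI)
    show "is_coalgebra (Cc_ring M) (CA :: ('m \<Rightarrow> 'k, ('e, 'k) germ_section) coalgebra)"
      by (rule Cc_coalgebra_is_coalgebra)
    show "sheaf M (spectral_sheaf M (CA :: ('m \<Rightarrow> 'k, ('e, 'k) germ_section) coalgebra)) fst"
      by (rule spectral_sheaf_sheaf)
    show "sheaf_isomorphism E \<pi> (spectral_sheaf M (CA :: ('m \<Rightarrow> 'k, ('e, 'k) germ_section) coalgebra)) fst (Phi M E \<pi>)"
      by (rule Phi_isomorphism)
  next
    fix y assume "y \<in> points E"
    then show "\<exists>U f. admissible M E \<pi> y U (f :: 'm \<Rightarrow> 'k)" by (rule admissible_exists)
  next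
    fix y U and f :: "'m \<Rightarrow> 'k" assume "admissible M E \<pi> y U f"
    then show "Phi M E \<pi> y = (\<pi> y, stalk_class M CA (\<pi> y) (pullback_ext E \<pi> U f))" by (rule Phi_eq)
  next
    fix F :: "('f, 'd) manifold" and \<xi> :: "'f \<Rightarrow> 'm" and \<phi> y
    assume "sheaf M F \<xi> \<and> sheaf_morphism E \<pi> F \<xi> \<phi>" and y: "y \<in> points E"
    then interpret N: sheaf_over_morphism M E \<pi> F \<xi> \<phi> by unfold_locales auto
    show "spectral_map M (Cc_coalgebra M F \<xi>) (Cc_push M E \<pi> F \<xi> \<phi>)
        (Phi M E \<pi> y :: 'm \<times> ('e, 'k) germ_section set) = Phi M F \<xi> (\<phi> y)"
      by (rule N.spectral_map_Phi[OF y])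
  qed
qed

end
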